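(* For every system of trees $(T_i)_{1\le i\le k}$ and every $S\subseteq\prod_{i=1}^kV(T_i)$, let $N=\sum_{i=1}^k|V(T_i)|$. Then \textsc{$\min$-Eccentricities} (resp., \textsc{$+$-Eccentricities}) can be solved with $\mathcal{O}(2^{\mathcal{O}(k\log k)}(N+|S|)^{1+o(1)})$ pre-processing time and $\mathcal{O}(2^{\mathcal{O}(k\log k)}(N+|S|)^{o(1)})$ query time.
   Context: Trees are finite and unweighted, with shortest-path distances $d_{T_i}$. For $\odot\in\{\min,+\}$, the problem \textsc{$\odot$-Eccentricities} is: global input a system of trees $(T_i)_{1\le i\le k}$ and a set $S\subseteq\prod_{i=1}^kV(T_i)$; query input $v=(v_1,\ldots,v_k)\in\prod_iV(T_i)$; query output $e_\odot(v,S)=\max\{d_{T_1}(s_1,v_1)\odot d_{T_2}(s_2,v_2)\odot\cdots\odot d_{T_k}(s_k,v_k)\mid(s_1,\ldots,s_k)\in S\}$ (so for $\odot=\min$ the inner expression is $\min_i d_{T_i}(s_i,v_i)$ and for $\odot=+$ it is $\sum_i d_{T_i}(s_i,v_i)$). Solving it with given pre-processing time and query time means building, from the global input within the pre-processing time, a data structure that answers each query within the query time. *)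

theory Defs
  imports
    Complex_Main
    "HOL-Library.Landau_Symbols"
    "HOL-Library.Log_Nat"
begin

section \<open>Finite trees and their distances\<close>

text \<open>
  A simple undirected graph is a pair of a vertex set and a set of two-element edges.
  The notion of a tree in AFP's Graph\_Theory forbids only \<^emph>\<open>directed\<close> cycles of a digraph,
  so it is not the undirected notion needed here.
\<close>

type_synonym 'a graph = "'a set \<times> 'a set set"

abbreviation verts :: "'a graph \<Rightarrow> 'a set" where
  "verts \<equiv> fst"

abbreviation edges :: "'a graph \<Rightarrow> 'a set set" where
  "edges \<equiv> snd"

definition simple_graph :: "'a graph \<Rightarrow> bool" where
  "simple_graph G \<longleftrightarrow> finite (verts G) \<and> (\<forall>e\<in>edges G. e \<subseteq> verts G \<and> card e = 2)"

definition walk :: "'a graph \<Rightarrow> 'a list \<Rightarrow> bool" where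
  "walk G p \<longleftrightarrow> p \<noteq> [] \<and> set p \<subseteq> verts G \<and> successively (\<lambda>u v. {u, v} \<in> edges G) p"

definition connected_graph :: "'a graph \<Rightarrow> bool" where
  "connected_graph G \<longleftrightarrow> verts G \<noteq> {} \<and>
     (\<forall>u\<in>verts G. \<forall>v\<in>verts G. \<exists>p. walk G p \<and> hd p = u \<and> last p = v)"

definition graph_cycle :: "'a graph \<Rightarrow> 'a list \<Rightarrow> bool" where
  "graph_cycle G p \<longleftrightarrow> walk G p \<and> distinct p \<and> length p \<ge> 3 \<and> {last p, hd p} \<in> edges G"

definition tree :: "'a graph \<Rightarrow> bool" where
  "tree G \<longleftrightarrow> simple_graph G \<and> connected_graph G \<and> (\<nexists>p. graph_cycle G p)"

definition graph_dist :: "'a graph \<Rightarrow> 'a \<Rightarrow> 'a \<Rightarrow> nat" where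
  "graph_dist G u v = (LEAST l. \<exists>p. walk G p \<and> hd p = u \<and> last p = v \<and> length p = Suc l)"

section \<open>Eccentricities in a system of trees\<close>

text \<open>\<open>bigop f [x\<^sub>1, \<dots>, x\<^sub>k]\<close> is \<open>f x\<^sub>1 (f x\<^sub>2 (\<dots> x\<^sub>k))\<close>; it is only meant for nonempty lists.\<close>

fun bigop :: "('a \<Rightarrow> 'a \<Rightarrow> 'a) \<Rightarrow> 'a list \<Rightarrow> 'a" where
  "bigop f [x] = x"
| "bigop f (x # y # zs) = f x (bigop f (y # zs))"
| "bigop f [] = undefined"

text \<open>The product of the vertex sets; tuples are lists.\<close>

definition tuples :: "'a graph list \<Rightarrow> 'a list set" where
  "tuples Ts = listset (map verts Ts)"

definition eccentricity ::
    "(nat \<Rightarrow> nat \<Rightarrow> nat) \<Rightarrow> 'a graph list \<Rightarrow> 'a list set \<Rightarrow> 'a list \<Rightarrow> nat" where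
  "eccentricity f Ts S v =
     Max {bigop f (map (\<lambda>i. graph_dist (Ts ! i) (s ! i) (v ! i)) [0..<length Ts]) | s. s \<in> S}"

section \<open>Random access machines with logarithmic cost\<close>

text \<open>
  Programs work on natural numbers held in registers and in arrays that are unbounded and
  initially zero, and they have random access to a read-only input word. Register and array
  names are literals of the program, so a program uses only finitely many of them; interleaving
  these in one memory gives the usual single-memory machine at the price of a constant factor.

  Time is measured by the logarithmic cost criterion: each operation is charged the number of
  bits of all the numbers involved, addresses included. Hence no computing power can be gained
  from large numbers. A computation all of whose numbers have at most \<open>w\<close> bits has unit-cost time (on a
  word RAM) at most its logarithmic cost, which is at most \<open>O(w)\<close> times the unit-cost time.
\<close>

datatype expr =
    Num nat
  | Reg nat
  | Arr nat expr
  | Inp expr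
  | Add expr expr
  | Sub expr expr
  | Mul expr expr
  | Div expr expr

text \<open>Conditions are expressions, true if nonzero; comparisons arise from truncated subtraction.\<close>

datatype com =
    Skip
  | Assign nat expr
  | Store nat expr expr
  | Seq com com
  | Cond expr com com
  | While expr com

text \<open>Contents of the registers, and of the arrays by name and index.\<close>

type_synonym state = "(nat \<Rightarrow> nat) \<times> (nat \<Rightarrow> nat \<Rightarrow> nat)"

definition init_state :: state where
  "init_state = ((\<lambda>_. 0), (\<lambda>_ _. 0))"

definition result :: "state \<Rightarrow> nat" where
  "result \<sigma> = fst \<sigma> 0"

definition bits :: "nat \<Rightarrow> nat" where
  "bits n = Suc (floorlog 2 n)"

fun val :: "nat list \<Rightarrow> state \<Rightarrow> expr \<Rightarrow> nat" where
  "val xs \<sigma> (Num n) = n"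
| "val xs \<sigma> (Reg r) = fst \<sigma> r"
| "val xs \<sigma> (Arr a e) = snd \<sigma> a (val xs \<sigma> e)"
| "val xs \<sigma> (Inp e) = (if val xs \<sigma> e < length xs then xs ! val xs \<sigma> e else 0)"
| "val xs \<sigma> (Add e1 e2) = val xs \<sigma> e1 + val xs \<sigma> e2"
| "val xs \<sigma> (Sub e1 e2) = val xs \<sigma> e1 - val xs \<sigma> e2"
| "val xs \<sigma> (Mul e1 e2) = val xs \<sigma> e1 * val xs \<sigma> e2"
| "val xs \<sigma> (Div e1 e2) = val xs \<sigma> e1 div val xs \<sigma> e2"

text \<open>An operation is charged for its result and, through the subexpressions, for its arguments.\<close>

fun cost :: "nat list \<Rightarrow> state \<Rightarrow> expr \<Rightarrow> nat" where
  "cost xs \<sigma> (Num n) = bits n"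
| "cost xs \<sigma> (Reg r) = bits (val xs \<sigma> (Reg r))"
| "cost xs \<sigma> (Arr a e) = cost xs \<sigma> e + bits (val xs \<sigma> (Arr a e))"
| "cost xs \<sigma> (Inp e) = cost xs \<sigma> e + bits (val xs \<sigma> (Inp e))"
| "cost xs \<sigma> (Add e1 e2) = cost xs \<sigma> e1 + cost xs \<sigma> e2 + bits (val xs \<sigma> (Add e1 e2))"
| "cost xs \<sigma> (Sub e1 e2) = cost xs \<sigma> e1 + cost xs \<sigma> e2 + bits (val xs \<sigma> (Sub e1 e2))"
| "cost xs \<sigma> (Mul e1 e2) = cost xs \<sigma> e1 + cost xs \<sigma> e2 + bits (val xs \<sigma> (Mul e1 e2))"
| "cost xs \<sigma> (Div e1 e2) = cost xs \<sigma> e1 + cost xs \<sigma> e2 + bits (val xs \<sigma> (Div e1 e2))"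

text \<open>
  \<open>exec xs c \<sigma> t \<sigma>'\<close>: on input \<open>xs\<close>, the program \<open>c\<close> started in \<open>\<sigma>\<close> halts in \<open>\<sigma>'\<close> after time \<open>t\<close>.
\<close>

inductive exec :: "nat list \<Rightarrow> com \<Rightarrow> state \<Rightarrow> nat \<Rightarrow> state \<Rightarrow> bool" for xs where
  Skip: "exec xs Skip \<sigma> 1 \<sigma>"
| Assign: "exec xs (Assign r e) \<sigma> (1 + cost xs \<sigma> e) ((fst \<sigma>)(r := val xs \<sigma> e), snd \<sigma>)"
| Store: "exec xs (Store a e1 e2) \<sigma> (1 + cost xs \<sigma> e1 + cost xs \<sigma> e2)
            (fst \<sigma>, (snd \<sigma>)(a := (snd \<sigma> a)(val xs \<sigma> e1 := val xs \<sigma> e2)))"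
| Seq: "exec xs c1 \<sigma> t1 \<sigma>' \<Longrightarrow> exec xs c2 \<sigma>' t2 \<sigma>'' \<Longrightarrow> exec xs (Seq c1 c2) \<sigma> (t1 + t2) \<sigma>''"
| CondTrue: "val xs \<sigma> e \<noteq> 0 \<Longrightarrow> exec xs c1 \<sigma> t \<sigma>' \<Longrightarrow>
             exec xs (Cond e c1 c2) \<sigma> (1 + cost xs \<sigma> e + t) \<sigma>'"
| CondFalse: "val xs \<sigma> e = 0 \<Longrightarrow> exec xs c2 \<sigma> t \<sigma>' \<Longrightarrow>
             exec xs (Cond e c1 c2) \<sigma> (1 + cost xs \<sigma> e + t) \<sigma>'"
| WhileFalse: "val xs \<sigma> e = 0 \<Longrightarrow> exec xs (While e c) \<sigma> (1 + cost xs \<sigma> e) \<sigma>"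
| WhileTrue: "val xs \<sigma> e \<noteq> 0 \<Longrightarrow> exec xs c \<sigma> t1 \<sigma>' \<Longrightarrow> exec xs (While e c) \<sigma>' t2 \<sigma>'' \<Longrightarrow>
             exec xs (While e c) \<sigma> (1 + cost xs \<sigma> e + t1 + t2) \<sigma>''"

inductive_cases SkipE: "exec xs Skip \<sigma> t \<sigma>'"
inductive_cases AssignE: "exec xs (Assign r e) \<sigma> t \<sigma>'"
inductive_cases StoreE: "exec xs (Store a e1 e2) \<sigma> t \<sigma>'"
inductive_cases SeqE: "exec xs (Seq c1 c2) \<sigma> t \<sigma>'"
inductive_cases CondE: "exec xs (Cond e c1 c2) \<sigma> t \<sigma>'"
inductive_cases WhileE: "exec xs (While e c) \<sigma> t \<sigma>'"

lemma exec_deterministic: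
  "exec xs c \<sigma> t \<sigma>' \<Longrightarrow> exec xs c \<sigma> u \<sigma>'' \<Longrightarrow> t = u \<and> \<sigma>' = \<sigma>''"
proof (induction arbitrary: u \<sigma>'' rule: exec.induct)
  case (Skip \<sigma>)
  then show ?case by (elim SkipE) simp
next
  case (Assign r e \<sigma>)
  then show ?case by (elim AssignE) simp
next
  case (Store a e1 e2 \<sigma>)
  then show ?case by (elim StoreE) simp
next
  case (Seq c1 \<sigma> t1 \<sigma>1 c2 t2 \<sigma>2)
  from Seq.prems obtain u1 u2 \<rho> where
    "exec xs c1 \<sigma> u1 \<rho>" "exec xs c2 \<rho> u2 \<sigma>''" "u = u1 + u2"
    by (elim SeqE)
  with Seq.IH(1)[of u1 \<rho>] Seq.IH(2)[of u2 \<sigma>''] show ?case by simp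
next
  case (CondTrue \<sigma> e c1 t \<sigma>' c2)
  from CondTrue.prems CondTrue.hyps obtain u1 where
    "exec xs c1 \<sigma> u1 \<sigma>''" "u = 1 + cost xs \<sigma> e + u1"
    by (elim CondE) simp_all
  with CondTrue.IH[of u1 \<sigma>''] show ?case by simp
next
  case (CondFalse \<sigma> e c2 t \<sigma>' c1)
  from CondFalse.prems CondFalse.hyps obtain u1 where
    "exec xs c2 \<sigma> u1 \<sigma>''" "u = 1 + cost xs \<sigma> e + u1"
    by (elim CondE) simp_all
  with CondFalse.IH[of u1 \<sigma>''] show ?case by simp
next
  case (WhileFalse \<sigma> e c)
  from WhileFalse.prems show ?case by (rule WhileE) (simp_all add: WhileFalse.hyps)
next
  case (WhileTrue \<sigma> e c t1 \<sigma>1 t2 \<sigma>2)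
  from WhileTrue.prems obtain u1 u2 \<rho> where
    "exec xs c \<sigma> u1 \<rho>" "exec xs (While e c) \<rho> u2 \<sigma>''" "u = 1 + cost xs \<sigma> e + u1 + u2"
    by (rule WhileE) (simp_all add: WhileTrue.hyps)
  with WhileTrue.IH(1)[of u1 \<rho>] WhileTrue.IH(2)[of u2 \<sigma>''] show ?case by simp
qed

section \<open>Data structures\<close>

text \<open>
  The states of a data structure that is built by \<open>P\<close> from the global input \<open>xs\<close> and then used
  for arbitrarily many queries by \<open>Q\<close>. A query program may change the memory, and what it
  leaves behind is what the next query finds.
\<close>

inductive ds_state :: "com \<Rightarrow> com \<Rightarrow> nat list \<Rightarrow> nat list set \<Rightarrow> state \<Rightarrow> bool"
  for P Q xs V where
  built: "exec xs P init_state t \<sigma> \<Longrightarrow> ds_state P Q xs V \<sigma>"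
| queried: "ds_state P Q xs V \<sigma> \<Longrightarrow> v \<in> V \<Longrightarrow> exec v Q \<sigma> t \<sigma>' \<Longrightarrow> ds_state P Q xs V \<sigma>'"

text \<open>
  \<open>V\<close> is the set of admissible queries and \<open>ok v a\<close> says that \<open>a\<close> is a correct answer to \<open>v\<close>.
\<close>

definition ds_solves ::
    "com \<Rightarrow> com \<Rightarrow> nat list \<Rightarrow> nat list set \<Rightarrow> (nat list \<Rightarrow> nat \<Rightarrow> bool) \<Rightarrow> real \<Rightarrow> real \<Rightarrow> bool" where
  "ds_solves P Q xs V ok pre_time query_time \<longleftrightarrow>
     (\<exists>t \<sigma>. exec xs P init_state t \<sigma> \<and> real t \<le> pre_time) \<and>
     (\<forall>\<sigma> v. ds_state P Q xs V \<sigma> \<longrightarrow> v \<in> V \<longrightarrow>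
        (\<exists>t \<sigma>'. exec v Q \<sigma> t \<sigma>' \<and> real t \<le> query_time \<and> ok v (result \<sigma>')))"

section \<open>Encoding of the global input\<close>

text \<open>
  The vertices are \<open>0, \<dots>, n - 1\<close>. A graph is given by its numbers of vertices and edges
  followed by its edges, in arbitrary order and each with an arbitrary orientation.
\<close>

definition encodes_graph :: "nat list \<Rightarrow> nat graph \<Rightarrow> bool" where
  "encodes_graph xs G \<longleftrightarrow> (\<exists>es :: (nat \<times> nat) list.
     verts G = {..<card (verts G)} \<and>
     distinct (map (\<lambda>(u, v). {u, v}) es) \<and> set (map (\<lambda>(u, v). {u, v}) es) = edges G \<and>
     xs = card (verts G) # length es # concat (map (\<lambda>(u, v). [u, v]) es))"

text \<open>The elements of \<open>S\<close> are listed in arbitrary order, without repetitions.\<close>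

definition encodes_input :: "nat list \<Rightarrow> nat graph list \<Rightarrow> nat list set \<Rightarrow> bool" where
  "encodes_input xs Ts S \<longleftrightarrow> (\<exists>gs ss.
     list_all2 encodes_graph gs Ts \<and> distinct ss \<and> set ss = S \<and>
     xs = length Ts # concat gs @ length ss # concat ss)"

end

theory Submission imports Defs "HOL-Real_Asymp.Real_Asymp" begin

text \<open>
  On a circular Euler tour with heights \<open>H\<close>, the distance of two vertices at positions \<open>p\<close> and \<open>q\<close> is
  \<open>H p + H q\<close> minus twice the least height between \<open>p\<close> and \<open>q\<close>. Two distinct positions lie in
  adjacent dyadic blocks of some common size, so the minimum is the lesser of a
  suffix minimum of the left block and a prefix minimum of the right block. Hence a distance is the
  maximum of two sums, each of a number that depends only on the data vertex and a number that
  depends only on the query vertex, subject to a matching of block names. For \<open>k\<close> trees, every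
  combination of sides, sizes and summands, of which there are at most \<open>G\<close> to the power \<open>2 * k\<close>
  for some \<open>G = O(log N)\<close>, turns a tuple of \<open>S\<close> into one dictionary key, under which the
  greatest sum is stored; a query asks for the complementary keys. For \<open>min\<close>, the test \<open>d \<ge> t\<close>
  for each coordinate is put into the key, because \<open>a > b\<close> also means that \<open>a\<close> and \<open>b\<close> lie in
  adjacent dyadic blocks of some size, \<open>a\<close> in the right one. The answer is found bit by bit. The
  unbounded arrays, zero at the start, serve as dictionaries: keys have \<open>O(k log (N + |S|))\<close> bits,
  so the logarithmic cost of an access is harmless.

  Finally, a power of \<open>log n\<close> with exponent \<open>O(k)\<close> is at most 2 to the power \<open>O(k log k)\<close> if
  \<open>k\<^sup>2 \<ge> log n\<close>, and \<open>n\<close> to the power \<open>o(1)\<close> otherwise.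
\<close>

section \<open>Programs of bounded word size\<close>

text \<open>The edges arrive in arbitrary order and orientation, without adjacency lists, so the
  tour is not found by a search. It is kept as a cyclic linked list: a new edge joins two cycles by
  changing four successors. To splice at any end point, the proof keeps, for every vertex, the list
  obtained by cutting the cycle open there; only the successors exist in memory. Every tour element
  takes two consecutive positions of equal height. Vertices of \<open>S\<close> use the first and
  queries the second, so the two positions compared are always distinct, as the lemma on adjacent
  blocks demands. Which of the two block minima is the lesser one need not be known: subtracting the
  other one underestimates the distance, and such wrong combinations do no harm under a maximum.
  Each summand is shifted by the number of positions, which keeps it a natural number. For the time
  bound, one word size is fixed that bounds all numbers between loop-free blocks; each block then
  costs a constant times the word length, and only blocks have to be counted. Queries write
  registers but no arrays, so the next query finds the dictionary intact.\<close>

lemma bits_less_power: "n < 2 ^ m \<Longrightarrow> bits n \<le> Suc m"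
  by (simp add: bits_def floorlog_le_iff)

lemma less_power_floorlog: "n < 2 ^ floorlog 2 n"
proof (cases "n = 0")
  case False
  then show ?thesis using floorlog_bounds[of n 2] by simp
qed (simp add: floorlog_def)

lemma bits_mono: "m \<le> n \<Longrightarrow> bits m \<le> bits n"
  by (simp add: bits_def floorlog_mono)

lemma bits_le_power:
  assumes "n < W ^ s" "s \<ge> 1"
  shows "bits n \<le> s * bits W"
proof -
  have "n < (2 ^ floorlog 2 W) ^ s"
    using assms less_power_floorlog[of W] by (meson less_imp_le less_le_trans power_mono zero_le)
  then have "bits n \<le> Suc (floorlog 2 W * s)"
    by (intro bits_less_power) (simp add: power_mult)
  also have "\<dots> \<le> s * bits W"
    using assms(2) by (simp add: bits_def)
  finally show ?thesis .
qed

definition bounded_state :: "nat list \<Rightarrow> nat \<Rightarrow> state \<Rightarrow> bool" where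
  "bounded_state xs V \<sigma> \<longleftrightarrow>
     (\<forall>x\<in>set xs. x \<le> V) \<and> (\<forall>r. fst \<sigma> r \<le> V) \<and> (\<forall>a i. snd \<sigma> a i \<le> V)"

text \<open>An exponent to the base \<open>V + 2\<close>, where \<open>V\<close> bounds memory and
  input. The base is at least 2 even for \<open>V = 0\<close>, which lets a literal \<open>n\<close>
  be charged through \<open>n + 1 \<le> 2 ^ (n + 1)\<close>.\<close>

fun expr_size :: "expr \<Rightarrow> nat" where
  "expr_size (Num n) = Suc n"
| "expr_size (Reg r) = 1"
| "expr_size (Arr a e) = Suc (expr_size e)"
| "expr_size (Inp e) = Suc (expr_size e)"
| "expr_size (Add e1 e2) = expr_size e1 + expr_size e2"
| "expr_size (Sub e1 e2) = expr_size e1 + expr_size e2"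
| "expr_size (Mul e1 e2) = expr_size e1 + expr_size e2"
| "expr_size (Div e1 e2) = expr_size e1 + expr_size e2"

text \<open>Mirrors the recursion of \<open>cost\<close>: the sizes of all subexpressions are added
  up, because each operation is charged for its own result on top of its arguments.\<close>

fun expr_weight :: "expr \<Rightarrow> nat" where
  "expr_weight (Num n) = expr_size (Num n)"
| "expr_weight (Reg r) = expr_size (Reg r)"
| "expr_weight (Arr a e) = expr_weight e + expr_size (Arr a e)"
| "expr_weight (Inp e) = expr_weight e + expr_size (Inp e)"
| "expr_weight (Add e1 e2) = expr_weight e1 + expr_weight e2 + expr_size (Add e1 e2)"
| "expr_weight (Sub e1 e2) = expr_weight e1 + expr_weight e2 + expr_size (Sub e1 e2)"
| "expr_weight (Mul e1 e2) = expr_weight e1 + expr_weight e2 + expr_size (Mul e1 e2)"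
| "expr_weight (Div e1 e2) = expr_weight e1 + expr_weight e2 + expr_size (Div e1 e2)"

lemma expr_size_pos: "expr_size e \<ge> 1"
  by (induction e) auto

lemma mult_le_powers:
  fixes W :: nat
  assumes "W \<ge> 1" "a \<le> W ^ s" "b \<le> W ^ t"
  shows "a * b \<le> W ^ (s + t)"
  using assms mult_le_mono by (simp add: power_add)

text \<open>For each of the four operations the successor of the result is at most the product of
  the successors of the arguments, so exponents add. Counting successors rather than values is what
  makes addition of a zero harmless.\<close>

lemma val_less_power:
  assumes "bounded_state xs V \<sigma>"
  shows "Suc (val xs \<sigma> e) \<le> (V + 2) ^ expr_size e"
proof (induction e)
  case (Num n)
  have "Suc n \<le> 2 ^ Suc n"
    by (metis Suc_leI less_exp lessI less_trans)
  also have "\<dots> \<le> (V + 2) ^ Suc n"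
    by (rule power_mono) auto
  finally show ?case by simp
next
  case (Reg r)
  then show ?case using assms by (simp add: bounded_state_def le_SucI)
next
  case (Arr a e)
  have "Suc (val xs \<sigma> (Arr a e)) \<le> (V + 2) ^ 1"
    using assms by (simp add: bounded_state_def le_SucI)
  also have "\<dots> \<le> (V + 2) ^ expr_size (Arr a e)"
    by (rule power_increasing) auto
  finally show ?case .
next
  case (Inp e)
  have "Suc (val xs \<sigma> (Inp e)) \<le> (V + 2) ^ 1"
    using assms by (auto simp: bounded_state_def le_SucI)
  also have "\<dots> \<le> (V + 2) ^ expr_size (Inp e)"
    by (rule power_increasing) auto
  finally show ?case .
next
  case (Add e1 e2)
  have "Suc (val xs \<sigma> (Add e1 e2)) \<le> Suc (val xs \<sigma> e1) * Suc (val xs \<sigma> e2)" by simp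
  also have "\<dots> \<le> (V + 2) ^ expr_size (Add e1 e2)"
    unfolding expr_size.simps by (rule mult_le_powers[OF _ Add]) simp
  finally show ?case .
next
  case (Sub e1 e2)
  have "Suc (val xs \<sigma> (Sub e1 e2)) \<le> Suc (val xs \<sigma> e1) * Suc (val xs \<sigma> e2)" by simp
  also have "\<dots> \<le> (V + 2) ^ expr_size (Sub e1 e2)"
    unfolding expr_size.simps by (rule mult_le_powers[OF _ Sub]) simp
  finally show ?case .
next
  case (Mul e1 e2)
  have "Suc (val xs \<sigma> (Mul e1 e2)) \<le> Suc (val xs \<sigma> e1) * Suc (val xs \<sigma> e2)" by simp
  also have "\<dots> \<le> (V + 2) ^ expr_size (Mul e1 e2)"
    unfolding expr_size.simps by (rule mult_le_powers[OF _ Mul]) simp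
  finally show ?case .
next
  case (Div e1 e2)
  have "Suc (val xs \<sigma> (Div e1 e2)) \<le> Suc (val xs \<sigma> e1) * Suc (val xs \<sigma> e2)"
    by (simp add: div_le_dividend trans_le_add1)
  also have "\<dots> \<le> (V + 2) ^ expr_size (Div e1 e2)"
    unfolding expr_size.simps by (rule mult_le_powers[OF _ Div]) simp
  finally show ?case .
qed

lemma bits_val_le:
  assumes "bounded_state xs V \<sigma>"
  shows "bits (val xs \<sigma> e) \<le> expr_size e * bits (V + 2)"
  using bits_le_power[OF _ expr_size_pos] val_less_power[OF assms, of e]
  by (metis Suc_le_lessD)

lemma cost_le:
  assumes "bounded_state xs V \<sigma>"
  shows "cost xs \<sigma> e \<le> expr_weight e * bits (V + 2)"
proof (induction e)
  case (Num n)
  then show ?case using bits_val_le[OF assms, of "Num n"] by simp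
next
  case (Reg r)
  then show ?case using bits_val_le[OF assms, of "Reg r"] by simp
next
  case (Arr a e)
  then show ?case using bits_val_le[OF assms, of "Arr a e"] by (simp add: algebra_simps)
next
  case (Inp e)
  then show ?case
    using bits_val_le[OF assms, of "Inp e"] unfolding cost.simps expr_weight.simps add_mult_distrib
    by (rule add_mono)
next
  case (Add e1 e2)
  then show ?case
    using bits_val_le[OF assms, of "Add e1 e2"] unfolding cost.simps expr_weight.simps add_mult_distrib
    by (intro add_mono)
next
  case (Sub e1 e2)
  then show ?case
    using bits_val_le[OF assms, of "Sub e1 e2"] unfolding cost.simps expr_weight.simps add_mult_distrib
    by (intro add_mono)
next
  case (Mul e1 e2)
  then show ?case
    using bits_val_le[OF assms, of "Mul e1 e2"] unfolding cost.simps expr_weight.simps add_mult_distrib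
    by (intro add_mono)
next
  case (Div e1 e2)
  then show ?case
    using bits_val_le[OF assms, of "Div e1 e2"] unfolding cost.simps expr_weight.simps add_mult_distrib
    by (intro add_mono)
qed

fun loop_free :: "com \<Rightarrow> bool" where
  "loop_free (Seq c1 c2) \<longleftrightarrow> loop_free c1 \<and> loop_free c2"
| "loop_free (Cond e c1 c2) \<longleftrightarrow> loop_free c1 \<and> loop_free c2"
| "loop_free (While e c) \<longleftrightarrow> False"
| "loop_free _ \<longleftrightarrow> True"

text \<open>A functional semantics that simplification can evaluate. The clause for
  \<open>While\<close> is a placeholder; \<open>sem\<close> is linked to \<open>exec\<close> for
  loop-free programs only.\<close>

fun sem :: "nat list \<Rightarrow> com \<Rightarrow> state \<Rightarrow> state" where
  "sem xs Skip \<sigma> = \<sigma>"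
| "sem xs (Assign r e) \<sigma> = ((fst \<sigma>)(r := val xs \<sigma> e), snd \<sigma>)"
| "sem xs (Store a e1 e2) \<sigma> =
     (fst \<sigma>, (snd \<sigma>)(a := (snd \<sigma> a)(val xs \<sigma> e1 := val xs \<sigma> e2)))"
| "sem xs (Seq c1 c2) \<sigma> = sem xs c2 (sem xs c1 \<sigma>)"
| "sem xs (Cond e c1 c2) \<sigma> = (if val xs \<sigma> e \<noteq> 0 then sem xs c1 \<sigma> else sem xs c2 \<sigma>)"
| "sem xs (While e c) \<sigma> = \<sigma>"

text \<open>
  A block maps states bounded by \<open>V\<close> to states bounded by \<open>(V + 2) ^ growth c\<close>, so its running
  time is a constant times the number of bits of \<open>V\<close>, whatever it computes.
\<close>

fun growth :: "com \<Rightarrow> nat" where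
  "growth (Assign r e) = expr_size e"
| "growth (Store a e1 e2) = expr_size e2"
| "growth (Seq c1 c2) = Suc (growth c1) * growth c2"
| "growth (Cond e c1 c2) = growth c1 + growth c2"
| "growth _ = 1"

text \<open>In a sequence the second part starts from numbers up to
  \<open>(V + 2) ^ growth c1\<close>. Their bit length exceeds that of \<open>V + 2\<close> by a
  factor of at most \<open>Suc (growth c1)\<close>, the extra one paying for the 2 that is added to
  the new bound.\<close>

fun com_weight :: "com \<Rightarrow> nat" where
  "com_weight (Assign r e) = 1 + expr_weight e"
| "com_weight (Store a e1 e2) = 1 + expr_weight e1 + expr_weight e2"
| "com_weight (Seq c1 c2) = com_weight c1 + com_weight c2 * Suc (growth c1)"
| "com_weight (Cond e c1 c2) = 1 + expr_weight e + com_weight c1 + com_weight c2"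
| "com_weight _ = 1"

lemma growth_pos: "growth c \<ge> 1"
  by (induction c) (use expr_size_pos in \<open>auto simp: Suc_le_eq\<close>)

lemma bits_pos: "bits n \<ge> 1"
  by (simp add: bits_def)

lemma bounded_state_mono:
  "bounded_state xs V \<sigma> \<Longrightarrow> V \<le> V' \<Longrightarrow> bounded_state xs V' \<sigma>"
  by (meson bounded_state_def order_trans)

lemma power_ge_self: "s \<ge> 1 \<Longrightarrow> V \<le> ((V::nat) + 2) ^ s"
  by (metis le_add1 order_trans power_increasing power_one_right one_le_numeral add_leE le_add2)

lemma bounded_state_reg:
  "bounded_state xs V (f, A) \<Longrightarrow> x \<le> V \<Longrightarrow> bounded_state xs V (f(r := x), A)"
  by (simp add: bounded_state_def)

lemma bounded_state_arr:
  "bounded_state xs V (f, A) \<Longrightarrow> x \<le> V \<Longrightarrow> bounded_state xs V (f, A(a := (A a)(i := x)))"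
  by (simp add: bounded_state_def)

text \<open>The bound on the final state is part of the claim because the second half of a sequence
  inherits it as its own hypothesis.\<close>

lemma loop_free_exec:
  assumes "loop_free c" "bounded_state xs V \<sigma>"
  shows "\<exists>t. exec xs c \<sigma> t (sem xs c \<sigma>) \<and> t \<le> com_weight c * bits (V + 2) \<and>
    bounded_state xs ((V + 2) ^ growth c) (sem xs c \<sigma>)"
  using assms
proof (induction c arbitrary: \<sigma> V)
  case Skip
  then show ?case
    using bounded_state_mono[OF Skip(2), of "V + 2"] bits_pos[of "V + 2"]
    by (auto intro!: exI[of _ 1] exec.Skip)
next
  case (Assign r e)
  have "bounded_state xs ((V + 2) ^ expr_size e) (sem xs (Assign r e) \<sigma>)"
    using bounded_state_mono[OF Assign(2) power_ge_self[OF expr_size_pos[of e]]]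
      val_less_power[OF Assign(2), of e]
    by (auto intro!: bounded_state_reg)
  moreover have "1 + cost xs \<sigma> e \<le> com_weight (Assign r e) * bits (V + 2)"
    using cost_le[OF Assign(2), of e] bits_pos[of "V + 2"] by simp
  ultimately show ?case by (auto intro!: exec.Assign)
next
  case (Store a e1 e2)
  have "bounded_state xs ((V + 2) ^ expr_size e2) (sem xs (Store a e1 e2) \<sigma>)"
    using bounded_state_mono[OF Store(2) power_ge_self[OF expr_size_pos[of e2]]]
      val_less_power[OF Store(2), of e2]
    by (auto intro!: bounded_state_arr)
  moreover have "1 + cost xs \<sigma> e1 + cost xs \<sigma> e2 \<le> com_weight (Store a e1 e2) * bits (V + 2)"
    using cost_le[OF Store(2), of e1] cost_le[OF Store(2), of e2] bits_pos[of "V + 2"]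
    by (simp add: algebra_simps)
  ultimately show ?case by (auto intro!: exec.Store)
next
  case (Seq c1 c2)
  define W where "W = (V + 2) ^ growth c1"
  from Seq obtain t1 where t1: "exec xs c1 \<sigma> t1 (sem xs c1 \<sigma>)" "t1 \<le> com_weight c1 * bits (V + 2)"
    "bounded_state xs W (sem xs c1 \<sigma>)"
    unfolding W_def by (metis loop_free.simps(1))
  from Seq(2)[OF _ t1(3)] Seq.prems(1) obtain t2 where t2:
    "exec xs c2 (sem xs c1 \<sigma>) t2 (sem xs c2 (sem xs c1 \<sigma>))" "t2 \<le> com_weight c2 * bits (W + 2)"
    "bounded_state xs ((W + 2) ^ growth c2) (sem xs c2 (sem xs c1 \<sigma>))"
    by auto
  \<comment> \<open>As \<open>W \<ge> 2\<close>, the added 2 is absorbed by one more factor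
    \<open>V + 2\<close>.\<close>
  have W2: "W + 2 \<le> (V + 2) ^ Suc (growth c1)"
  proof -
    have "V + 2 \<le> (V + 2) ^ growth c1"
      using power_increasing[OF growth_pos[of c1], of "V + 2"] by simp
    then have "2 \<le> W" unfolding W_def by linarith
    then have "W + 2 \<le> 2 * W" by simp
    also have "\<dots> \<le> (V + 2) * W" by simp
    finally show ?thesis by (simp add: W_def)
  qed
  have "bits (W + 2) \<le> Suc (growth c1) * bits (V + 2)"
  proof -
    have "W + 2 < ((V + 2) ^ Suc (growth c1)) + 1" using W2 by simp
    have "bits (W + 2) \<le> bits ((V + 2) ^ Suc (growth c1))" using W2 by (rule bits_mono)
    also have "\<dots> \<le> Suc (Suc (growth c1) * floorlog 2 (V + 2))"
    proof (rule bits_less_power)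
      have "(V + 2) ^ Suc (growth c1) < (2 ^ floorlog 2 (V + 2)) ^ Suc (growth c1)"
        by (rule power_strict_mono[OF less_power_floorlog]) auto
      then show "(V + 2) ^ Suc (growth c1) < 2 ^ (Suc (growth c1) * floorlog 2 (V + 2))"
        by (metis mult.commute power_mult)
    qed
    also have "\<dots> \<le> Suc (growth c1) * bits (V + 2)" by (simp add: bits_def)
    finally show ?thesis .
  qed
  then have "com_weight c2 * bits (W + 2) \<le> com_weight c2 * (Suc (growth c1) * bits (V + 2))"
    by (rule mult_le_mono2)
  with t1(2) t2(2) have "t1 + t2 \<le> com_weight (Seq c1 c2) * bits (V + 2)"
    by (simp only: com_weight.simps add_mult_distrib mult.assoc)
  moreover have "(W + 2) ^ growth c2 \<le> (V + 2) ^ growth (Seq c1 c2)"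
    using power_mono[OF W2, of "growth c2"] by (simp only: growth.simps power_mult)
  ultimately show ?case
    using exec.Seq[OF t1(1) t2(1)] bounded_state_mono[OF t2(3)] by auto
next
  case (Cond e c1 c2)
  note cost = cost_le[OF Cond.prems(2), of e]
  have mono: "(V + 2) ^ growth c \<le> (V + 2) ^ growth (Cond e c1 c2)" if "c \<in> {c1, c2}" for c
    using that by (intro power_increasing) auto
  show ?case
  proof (cases "val xs \<sigma> e = 0")
    case True
    from Cond obtain t where "exec xs c2 \<sigma> t (sem xs c2 \<sigma>)" "t \<le> com_weight c2 * bits (V + 2)"
      "bounded_state xs ((V + 2) ^ growth c2) (sem xs c2 \<sigma>)" by (metis loop_free.simps(2))
    with True mono[of c2] cost bits_pos[of "V + 2"] show ?thesis
      by (auto intro!: exI[of _ "1 + cost xs \<sigma> e + t"] exec.CondFalse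
          elim: bounded_state_mono simp: algebra_simps)
  next
    case False
    from Cond obtain t where "exec xs c1 \<sigma> t (sem xs c1 \<sigma>)" "t \<le> com_weight c1 * bits (V + 2)"
      "bounded_state xs ((V + 2) ^ growth c1) (sem xs c1 \<sigma>)" by (metis loop_free.simps(2))
    with False mono[of c1] cost bits_pos[of "V + 2"] show ?thesis
      by (auto intro!: exI[of _ "1 + cost xs \<sigma> e + t"] exec.CondTrue
          elim: bounded_state_mono simp: algebra_simps)
  qed
qed simp

text \<open>A triple for total correctness from one given start state. Time is counted in units of
  \<open>bits (V + 2)\<close>, so that \<open>T\<close> behaves like a unit-cost time, and the same
  bound \<open>V\<close> is handed on from triple to triple.\<close>

definition runs :: "nat list \<Rightarrow> nat \<Rightarrow> com \<Rightarrow> state \<Rightarrow> nat \<Rightarrow> (state \<Rightarrow> bool) \<Rightarrow> bool" where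
  "runs xs V c \<sigma> T Q \<longleftrightarrow>
     (\<exists>t \<sigma>'. exec xs c \<sigma> t \<sigma>' \<and> t \<le> T * bits (V + 2) \<and> bounded_state xs V \<sigma>' \<and> Q \<sigma>')"

text \<open>Only the end of a block has to respect \<open>V\<close>; in between numbers may grow to
  a power of it, which \<open>com_weight\<close> has paid for. The bound at the end is proved afresh
  for each block, since the one from \<open>loop_free_exec\<close> would deteriorate with every
  round of a loop.\<close>

lemma runs_block:
  assumes "loop_free c" "bounded_state xs V \<sigma>"
    and "bounded_state xs V (sem xs c \<sigma>)" "Q (sem xs c \<sigma>)"
  shows "runs xs V c \<sigma> (com_weight c) Q"
  using loop_free_exec[OF assms(1,2)] assms(3,4) unfolding runs_def by blast

lemma runs_Seq:
  assumes "runs xs V c1 \<sigma> T1 R"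
    and "\<And>\<tau>. bounded_state xs V \<tau> \<Longrightarrow> R \<tau> \<Longrightarrow> runs xs V c2 \<tau> T2 Q"
  shows "runs xs V (Seq c1 c2) \<sigma> (T1 + T2) Q"
proof -
  obtain t1 \<tau> where 1: "exec xs c1 \<sigma> t1 \<tau>" "t1 \<le> T1 * bits (V + 2)" "bounded_state xs V \<tau>" "R \<tau>"
    using assms(1) unfolding runs_def by blast
  obtain t2 \<rho> where 2: "exec xs c2 \<tau> t2 \<rho>" "t2 \<le> T2 * bits (V + 2)" "bounded_state xs V \<rho>" "Q \<rho>"
    using assms(2)[OF 1(3,4)] unfolding runs_def by blast
  have "t1 + t2 \<le> (T1 + T2) * bits (V + 2)"
    using 1(2) 2(2) by (simp only: add_mult_distrib)
  then show ?thesis unfolding runs_def using exec.Seq[OF 1(1) 2(1)] 2(3,4) by blast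
qed

lemma runs_mono:
  assumes "runs xs V c \<sigma> T Q" "T \<le> T'"
    and "\<And>\<tau>. bounded_state xs V \<tau> \<Longrightarrow> Q \<tau> \<Longrightarrow> Q' \<tau>"
  shows "runs xs V c \<sigma> T' Q'"
proof -
  have "T * bits (V + 2) \<le> T' * bits (V + 2)" using assms(2) by simp
  then show ?thesis using assms(1,3) unfolding runs_def by (meson order_trans)
qed

definition For :: "nat \<Rightarrow> nat \<Rightarrow> com \<Rightarrow> com" where
  "For i m c = Seq (Assign i (Num 0))
     (While (Sub (Reg m) (Reg i)) (Seq c (Assign i (Add (Reg i) (Num 1)))))"

text \<open>The factor \<open>T + 10\<close> pays for one iteration with body time \<open>T\<close>, counter included.\<close>

lemma runs_While_counter:
  assumes "fst \<sigma> i = a" "a \<le> n" "n \<le> V" "fst \<sigma> m = n" "m \<noteq> i" "bounded_state xs V \<sigma>" "I a \<sigma>"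
    and step: "\<And>j \<tau>. j < n \<Longrightarrow> fst \<tau> i = j \<Longrightarrow> fst \<tau> m = n \<Longrightarrow> bounded_state xs V \<tau> \<Longrightarrow> I j \<tau> \<Longrightarrow>
      runs xs V c \<tau> T (\<lambda>\<rho>. fst \<rho> i = j \<and> fst \<rho> m = n \<and> I (Suc j) ((fst \<rho>)(i := Suc j), snd \<rho>))"
  shows "runs xs V (While (Sub (Reg m) (Reg i)) (Seq c (Assign i (Add (Reg i) (Num 1))))) \<sigma>
     ((n - a) * (T + 10) + 5) (\<lambda>\<rho>. fst \<rho> m = n \<and> I n \<rho>)"
  using assms(1,2,4,6,7)
proof (induction "n - a" arbitrary: a \<sigma>)
  case 0
  have cost: "1 + cost xs \<sigma> (Sub (Reg m) (Reg i)) \<le> 5 * bits (V + 2)"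
    using cost_le[OF 0(5), of "Sub (Reg m) (Reg i)"] bits_pos[of "V + 2"] by simp
  have "exec xs (While (Sub (Reg m) (Reg i)) (Seq c (Assign i (Add (Reg i) (Num 1))))) \<sigma>
    (1 + cost xs \<sigma> (Sub (Reg m) (Reg i))) \<sigma>"
    using 0 by (intro exec.WhileFalse) simp
  moreover have "a = n" using 0 by simp
  ultimately show ?case unfolding runs_def
    using cost 0 by (intro exI conjI) (assumption | simp only: diff_self_eq_0 mult_0 add_0)+
next
  case (Suc d)
  from Suc.prems Suc.hyps have "a < n" by simp
  from step[OF \<open>a < n\<close> Suc.prems(1,3-5)] obtain t1 \<rho> where 1:
    "exec xs c \<sigma> t1 \<rho>" "t1 \<le> T * bits (V + 2)" "bounded_state xs V \<rho>"
    "fst \<rho> i = a" "fst \<rho> m = n" "I (Suc a) ((fst \<rho>)(i := Suc a), snd \<rho>)"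
    unfolding runs_def by blast
  define \<rho>' where "\<rho>' = ((fst \<rho>)(i := Suc a), snd \<rho>)"
  have b': "bounded_state xs V \<rho>'"
    unfolding \<rho>'_def using bounded_state_reg[of xs V "fst \<rho>" "snd \<rho>" "Suc a" i] 1(3) \<open>a < n\<close> assms(3)
    by simp
  have "runs xs V (While (Sub (Reg m) (Reg i)) (Seq c (Assign i (Add (Reg i) (Num 1))))) \<rho>'
     ((n - Suc a) * (T + 10) + 5) (\<lambda>\<rho>. fst \<rho> m = n \<and> I n \<rho>)"
    using Suc.hyps 1 b' \<open>a < n\<close> \<open>m \<noteq> i\<close> by (intro Suc.hyps(1)) (auto simp: \<rho>'_def)
  then obtain t2 \<pi> where 2:
    "exec xs (While (Sub (Reg m) (Reg i)) (Seq c (Assign i (Add (Reg i) (Num 1))))) \<rho>' t2 \<pi>"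
    "t2 \<le> ((n - Suc a) * (T + 10) + 5) * bits (V + 2)" "bounded_state xs V \<pi>" "fst \<pi> m = n" "I n \<pi>"
    unfolding runs_def by blast
  have inc: "exec xs (Assign i (Add (Reg i) (Num 1))) \<rho> (1 + cost xs \<rho> (Add (Reg i) (Num 1))) \<rho>'"
    using exec.Assign[of xs i "Add (Reg i) (Num 1)" \<rho>] 1(4) by (simp add: \<rho>'_def)
  have cost1: "1 + cost xs \<sigma> (Sub (Reg m) (Reg i)) \<le> 5 * bits (V + 2)"
    using cost_le[OF Suc.prems(4), of "Sub (Reg m) (Reg i)"] bits_pos[of "V + 2"] by simp
  \<comment> \<open>The general estimate \<open>cost_le\<close> would charge 6 here and exceed the
    announced 10. The sum is at most \<open>n\<close>, and the literal 1 costs 2; with the test this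
    gives 5 + 5.\<close>
  have cost2: "cost xs \<rho> (Add (Reg i) (Num 1)) \<le> 3 * bits (V + 2) + bits n"
  proof -
    have "bits a \<le> bits (V + 2)" "bits (Suc a) \<le> bits n" "bits (Suc 0) \<le> 2"
      using \<open>a < n\<close> assms(3) bits_less_power[of 1 1] by (auto intro!: bits_mono)
    moreover have "1 \<le> bits (V + 2)" by (rule bits_pos)
    ultimately show ?thesis using 1(4) by simp
  qed
  have "bits n \<le> bits (V + 2)" using assms(3) by (intro bits_mono) simp
  have "exec xs (While (Sub (Reg m) (Reg i)) (Seq c (Assign i (Add (Reg i) (Num 1))))) \<sigma>
     (1 + cost xs \<sigma> (Sub (Reg m) (Reg i)) + (t1 + (1 + cost xs \<rho> (Add (Reg i) (Num 1)))) + t2) \<pi>"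
    using Suc.prems \<open>a < n\<close> by (intro exec.WhileTrue[OF _ exec.Seq[OF 1(1) inc] 2(1)]) simp
  moreover have "1 + cost xs \<sigma> (Sub (Reg m) (Reg i)) + (t1 + (1 + cost xs \<rho> (Add (Reg i) (Num 1)))) + t2
     \<le> ((n - a) * (T + 10) + 5) * bits (V + 2)"
  proof -
    have "n - a = Suc (n - Suc a)" using \<open>a < n\<close> by simp
    then have "((n - a) * (T + 10) + 5) * bits (V + 2) =
      (T + 10) * bits (V + 2) + ((n - Suc a) * (T + 10) + 5) * bits (V + 2)"
      by (simp add: add_mult_distrib)
    then show ?thesis
      using cost1 cost2 1(2) 2(2) \<open>bits n \<le> bits (V + 2)\<close> bits_pos[of "V + 2"]
      by (simp add: add_mult_distrib)
  qed
  ultimately show ?case using 2 unfolding runs_def by blast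
qed

text \<open>The increment belongs to the loop and not to \<open>c\<close>, so the body has to
  establish the invariant for the state in which the counter is already advanced. The limit respects
  \<open>V\<close> because it is the content of a register.\<close>

lemma runs_For:
  assumes "fst \<sigma> m = n" "m \<noteq> i" "bounded_state xs V \<sigma>" "I 0 ((fst \<sigma>)(i := 0), snd \<sigma>)"
    and step: "\<And>j \<tau>. j < n \<Longrightarrow> fst \<tau> i = j \<Longrightarrow> fst \<tau> m = n \<Longrightarrow> bounded_state xs V \<tau> \<Longrightarrow> I j \<tau> \<Longrightarrow>
      runs xs V c \<tau> T (\<lambda>\<rho>. fst \<rho> i = j \<and> fst \<rho> m = n \<and> I (Suc j) ((fst \<rho>)(i := Suc j), snd \<rho>))"
  shows "runs xs V (For i m c) \<sigma> (n * (T + 10) + 10) (\<lambda>\<rho>. fst \<rho> m = n \<and> I n \<rho>)"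
proof -
  have assign: "runs xs V (Assign i (Num 0)) \<sigma> (com_weight (Assign i (Num 0)))
    (\<lambda>\<rho>. \<rho> = ((fst \<sigma>)(i := 0), snd \<sigma>))"
    using assms bounded_state_reg[of xs V "fst \<sigma>" "snd \<sigma>" 0 i] by (intro runs_block) auto
  have "n \<le> V" using assms(1,3) by (auto simp: bounded_state_def)
  have "runs xs V (For i m c) \<sigma> (com_weight (Assign i (Num 0)) + ((n - 0) * (T + 10) + 5))
    (\<lambda>\<rho>. fst \<rho> m = n \<and> I n \<rho>)"
    unfolding For_def
  proof (rule runs_Seq[OF assign])
    fix \<tau> assume "bounded_state xs V \<tau>" "\<tau> = ((fst \<sigma>)(i := 0), snd \<sigma>)"
    then show "runs xs V (While (Sub (Reg m) (Reg i)) (Seq c (Assign i (Add (Reg i) (Num 1))))) \<tau>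
     ((n - 0) * (T + 10) + 5) (\<lambda>\<rho>. fst \<rho> m = n \<and> I n \<rho>)"
      using assms \<open>n \<le> V\<close> by (intro runs_While_counter step) auto
  qed
  then show ?thesis by (rule runs_mono) auto
qed

lemma bounded_stateD:
  assumes "bounded_state xs V (f, A)"
  shows "f r \<le> V" "A a i \<le> V" "x \<in> set xs \<Longrightarrow> x \<le> V"
  using assms by (auto simp: bounded_state_def)

section \<open>Euler tours of forests\<close>

text \<open>Numbers divisible by 3 are vertices, the other two residues the two directions of an
  edge; thus one successor array holds the whole tour. For the set of elements passed so far, these
  are the edges traversed exactly once, that is, the edges on the path from the root to the current
  place.\<close>

definition half_open :: "nat set \<Rightarrow> nat set" where
  "half_open X = {e. (3 * e + 1 \<in> X) \<noteq> (3 * e + 2 \<in> X)}"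

definition darts_of :: "nat \<Rightarrow> nat set" where
  "darts_of e = {3 * e + 1, 3 * e + 2}"

lemma half_open_empty [simp]: "half_open {} = {}"
  by (simp add: half_open_def)

lemma takeWhile_neq_append: "z \<notin> set X \<Longrightarrow> takeWhile (\<lambda>w. w \<noteq> z) (X @ z # A) = X"
  by (induction X) auto

lemma dropWhile_neq_append: "z \<notin> set X \<Longrightarrow> dropWhile (\<lambda>w. w \<noteq> z) (X @ z # A) = z # A"
  by (induction X) auto

lemma half_open_closed:
  assumes "\<And>f. darts_of f \<subseteq> S \<or> darts_of f \<inter> S = {}"
  shows "half_open S = {}"
  using assms by (auto simp: half_open_def darts_of_def)

lemma finite_half_open: "finite X \<Longrightarrow> finite (half_open X)"
proof -
  assume "finite X"
  moreover have "half_open X \<subseteq> (\<lambda>z. z div 3) ` X"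
  proof
    fix e assume "e \<in> half_open X"
    then consider "3 * e + 1 \<in> X" | "3 * e + 2 \<in> X" by (auto simp: half_open_def)
    then show "e \<in> (\<lambda>z. z div 3) ` X"
    proof cases
      case 1
      then show ?thesis by (intro image_eqI[of _ _ "3 * e + 1"]) auto
    next
      case 2
      then show ?thesis by (intro image_eqI[of _ _ "3 * e + 2"]) auto
    qed
  qed
  ultimately show ?thesis by (rule finite_surj)
qed

lemma half_open_insert_vertex [simp]: "half_open (insert (3 * g) X) = half_open X"
proof -
  have "3 * e + 1 \<noteq> 3 * g" "3 * e + 2 \<noteq> 3 * g" for e by presburger+
  then show ?thesis by (auto simp: half_open_def)
qed

lemma half_open_insert_dart:
  assumes "z mod 3 \<noteq> 0" "z \<notin> X"
  shows "half_open (insert z X) =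
    (if darts_of (z div 3) \<inter> X = {} then insert (z div 3) (half_open X) else half_open X - {z div 3})"
proof -
  have "3 * e + 1 = z \<longleftrightarrow> z mod 3 = 1 \<and> e = z div 3" for e by presburger
  moreover have "3 * e + 2 = z \<longleftrightarrow> z mod 3 = 2 \<and> e = z div 3" for e by presburger
  moreover have "z mod 3 = 1 \<or> z mod 3 = 2" using assms(1) by presburger
  moreover have "3 * (z div 3) + 1 = z" if "z mod 3 = 1" using that by presburger
  moreover have "3 * (z div 3) + 2 = z" if "z mod 3 = 2" using that by presburger
  ultimately show ?thesis using assms(2)
    by (auto simp: half_open_def darts_of_def) metis+
qed

lemma half_open_Un_closed:
  assumes "half_open Y = {}" "X \<inter> Y = {}"
  shows "half_open (X \<union> Y) = half_open X \<union> half_open Y"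
  using assms by (auto simp: half_open_def)

lemma half_open_Un_separated:
  assumes "\<And>e. darts_of e \<inter> X = {} \<or> darts_of e \<inter> Y = {}"
  shows "half_open (X \<union> Y) = half_open X \<union> half_open Y"
proof -
  have "(3 * e + 1 \<notin> X \<and> 3 * e + 2 \<notin> X) \<or> (3 * e + 1 \<notin> Y \<and> 3 * e + 2 \<notin> Y)" for e
    using assms[of e] by (auto simp: darts_of_def)
  then show ?thesis unfolding half_open_def by (simp add: set_eq_iff) metis
qed

text \<open>The number of darts of an edge that have been passed only grows, so if it is one at both
  times, it is one in between. This will bound all heights between two places from below.\<close>

lemma half_open_Int_between:
  assumes "X \<subseteq> Y" "Y \<subseteq> Z"
  shows "half_open X \<inter> half_open Z \<subseteq> half_open Y"
  using assms by (auto simp: half_open_def)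

definition open_at :: "nat list \<Rightarrow> nat \<Rightarrow> nat set" where
  "open_at L z = half_open (set (takeWhile (\<lambda>w. w \<noteq> z) L))"

definition open_prefix :: "nat list \<Rightarrow> nat \<Rightarrow> nat set" where
  "open_prefix L i = half_open (set (take i L))"

text \<open>The place \<open>l\<close> acts as the lowest common ancestor. This form of
  well-nestedness says exactly that the least height in an interval counts the edges shared by the
  root paths of its two ends.\<close>

definition noncrossing :: "nat list \<Rightarrow> bool" where
  "noncrossing L \<longleftrightarrow> (\<forall>i j. i \<le> j \<longrightarrow> j \<le> length L \<longrightarrow>
     (\<exists>l. i \<le> l \<and> l \<le> j \<and> open_prefix L l \<subseteq> open_prefix L i \<inter> open_prefix L j))"

section \<open>Cyclic tours and their splicing\<close>

definition cyclic_for :: "(nat \<Rightarrow> nat) \<Rightarrow> nat list \<Rightarrow> bool" where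
  "cyclic_for nxt L \<longleftrightarrow> successively (\<lambda>a b. nxt a = b) (L @ [hd L])"

text \<open>Although \<open>K\<close> starts with \<open>v\<close>, the vertex \<open>v\<close>
  comes last in the insertion: the cycle of \<open>K\<close> is cut behind \<open>v\<close>. In
  terms of successors only those of \<open>u\<close>, \<open>v\<close>, \<open>x\<close> and
  \<open>y\<close> change, and no predecessor has to be known. Each vertex occurs exactly once, so
  \<open>n\<close> vertices give a tour of \<open>n + 2 * (n - 1)\<close> elements.\<close>

definition splice :: "nat \<Rightarrow> nat \<Rightarrow> nat \<Rightarrow> nat \<Rightarrow> nat list \<Rightarrow> nat list \<Rightarrow> nat list" where
  "splice u x v y L K =
     takeWhile (\<lambda>w. w \<noteq> u) L @ [u, x] @ tl K @ [v, y] @ tl (dropWhile (\<lambda>w. w \<noteq> u) L)"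

lemma splice_append:
  assumes "u \<notin> set X"
  shows "splice u x v y (X @ u # A) (v # B) = X @ [u, x] @ B @ [v, y] @ A"
  using assms by (simp add: splice_def takeWhile_neq_append dropWhile_neq_append)

lemma open_prefix_eq_open_at:
  assumes "distinct L" "i < length L"
  shows "open_at L (L ! i) = open_prefix L i"
proof -
  have "takeWhile (\<lambda>w. w \<noteq> L ! i) L = take i L"
    using assms by (intro takeWhile_eq_take_P_nth) (auto simp: nth_eq_iff_index_eq)
  then show ?thesis by (simp add: open_at_def open_prefix_def)
qed

lemma successively_cong_butlast:
  assumes "\<And>a b. a \<in> set (butlast M) \<Longrightarrow> P a b \<longleftrightarrow> Q a b"
  shows "successively P M \<longleftrightarrow> successively Q M"
  using assms by (induction M rule: induct_list012) auto

text \<open>The open sets of the outer tour, the inserted tour and the result are \<open>h\<close>,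
  \<open>g\<close> and \<open>h'\<close>; \<open>b\<close> elements are inserted behind the first
  \<open>a\<close>. All inner sets contain \<open>h a\<close>. Hence a pair with one end outside is
  settled by a witness of \<open>h\<close>, with \<open>a\<close> in place of the inner end, and a
  pair inside by a witness of \<open>g\<close>.\<close>

lemma nested_sequences:
  fixes h g h' :: "nat \<Rightarrow> nat set"
  assumes "a \<le> n" "b \<ge> 2" and g_end: "g (Suc m) = {}"
    and h: "\<And>i j. i \<le> j \<Longrightarrow> j \<le> n \<Longrightarrow> \<exists>l. i \<le> l \<and> l \<le> j \<and> h l \<subseteq> h i \<inter> h j"
    and g: "\<And>i j. i \<le> j \<Longrightarrow> j \<le> m \<Longrightarrow> \<exists>l. i \<le> l \<and> l \<le> j \<and> g l \<subseteq> g i \<inter> g j"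
    and before: "\<And>i. i \<le> a \<Longrightarrow> h' i = h i"
    and inner: "\<And>i. a < i \<Longrightarrow> i < a + b \<Longrightarrow> h' i = h a \<union> {e} \<union> g (i - a)"
    and after: "\<And>i. a + b \<le> i \<Longrightarrow> h' i = h (i - b)"
    and "b = m + 2" "i \<le> j" "j \<le> n + b"
  shows "\<exists>l. i \<le> l \<and> l \<le> j \<and> h' l \<subseteq> h' i \<inter> h' j"
proof -
  consider "j \<le> a" | "i \<le> a" "a < j" "j < a + b" | "i \<le> a" "a + b \<le> j"
    | "a < i" "j < a + b - 1" | "a < i" "i < a + b" "j = a + b - 1" | "a < i" "i < a + b" "a + b \<le> j"
    | "a + b \<le> i"
    by linarith
  then show ?thesis
  proof cases
    case 1
    then obtain l where "i \<le> l" "l \<le> j" "h l \<subseteq> h i \<inter> h j" using h[of i j] \<open>i \<le> j\<close> \<open>a \<le> n\<close> le_trans by blast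
    then show ?thesis using 1 \<open>i \<le> j\<close> before[of l] before[of i] before[of j] by (intro exI[of _ l]) auto
  next
    case 2
    then obtain l where "i \<le> l" "l \<le> a" "h l \<subseteq> h i \<inter> h a" using h[of i a] \<open>a \<le> n\<close> by blast
    then show ?thesis using 2 before[of l] before[of i] inner[of j] by (intro exI[of _ l]) auto
  next
    case 3
    then obtain l where l: "i \<le> l" "l \<le> j - b" "h l \<subseteq> h i \<inter> h (j - b)"
      using h[of i "j - b"] \<open>j \<le> n + b\<close> by (metis add_le_imp_le_diff le_diff_conv le_trans)
    show ?thesis
    proof (cases "l \<le> a")
      case True
      then show ?thesis using l 3 before[of l] before[of i] after[of j] by (intro exI[of _ l]) auto
    next
      case False
      then show ?thesis using l 3 after[of "l + b"] before[of i] after[of j]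
        by (intro exI[of _ "l + b"]) auto
    qed
  next
    case 4
    then obtain l where l: "i - a \<le> l" "l \<le> j - a" "g l \<subseteq> g (i - a) \<inter> g (j - a)"
      using g[of "i - a" "j - a"] \<open>b = m + 2\<close> \<open>i \<le> j\<close> by (metis diff_le_mono le_diff_conv less_diff_conv2 nle_le add.commute add_diff_cancel_right' group_cancel.add1 less_eq_Suc_le one_add_one plus_1_eq_Suc Suc_le_mono diff_Suc_1 diff_add_inverse)
    then show ?thesis using inner[of "a + l"] inner[of i] inner[of j] 4 \<open>i \<le> j\<close>
      by (intro exI[of _ "a + l"]) auto
  next
    \<comment> \<open>At the last inner place the inserted tour is complete; only \<open>h a\<close>
      and \<open>e\<close> are open there, so \<open>j\<close> itself is the witness.\<close>
    case 5
    then show ?thesis using inner[of i] inner[of j] g_end \<open>b = m + 2\<close> by (intro exI[of _ j]) auto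
  next
    case 6
    then obtain l where l: "a \<le> l" "l \<le> j - b" "h l \<subseteq> h a \<inter> h (j - b)"
      using h[of a "j - b"] \<open>j \<le> n + b\<close> by (metis add_le_imp_le_diff le_diff_conv)
    then show ?thesis using 6 after[of "l + b"] after[of j] inner[of i] by (intro exI[of _ "l + b"]) auto
  next
    case 7
    then obtain l where l: "i - b \<le> l" "l \<le> j - b" "h l \<subseteq> h (i - b) \<inter> h (j - b)"
      using h[of "i - b" "j - b"] \<open>j \<le> n + b\<close> \<open>i \<le> j\<close> by (metis diff_le_mono le_diff_conv)
    then show ?thesis using 7 \<open>i \<le> j\<close> after[of "l + b"] after[of j] after[of i] by (intro exI[of _ "l + b"]) auto
  qed
qed

text \<open>Which dart of the new edge \<open>e\<close> leads from \<open>u\<close> to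
  \<open>v\<close> is left open: \<open>x\<close> and \<open>y\<close> are its darts in either
  order. The same locale therefore serves tours rooted on either side of the new edge.\<close>

locale splicing =
  fixes nxt :: "nat \<Rightarrow> nat" and X A B :: "nat list" and u v e x y :: nat
  assumes distinct_L: "distinct (X @ [3 * u] @ A)"
    and distinct_K: "distinct (3 * v # B)"
    and disjoint: "set (X @ [3 * u] @ A) \<inter> set (3 * v # B) = {}"
    and new: "darts_of e \<inter> set (X @ [3 * u] @ A) = {}" "darts_of e \<inter> set (3 * v # B) = {}"
    and xy: "darts_of e = {x, y}"
    and closed: "\<And>f. darts_of f \<subseteq> set (X @ [3 * u] @ A) \<or> darts_of f \<inter> set (X @ [3 * u] @ A) = {}"
      "\<And>f. darts_of f \<subseteq> set (3 * v # B) \<or> darts_of f \<inter> set (3 * v # B) = {}"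
    and nc: "noncrossing (X @ [3 * u] @ A)" "noncrossing (3 * v # B)"
begin

abbreviation L :: "nat list" where "L \<equiv> X @ [3 * u] @ A"
abbreviation K :: "nat list" where "K \<equiv> 3 * v # B"
abbreviation J :: "nat list" where "J \<equiv> X @ [3 * u, x] @ B @ [3 * v, y] @ A"

lemma x_neq_y: "x \<noteq> y"
proof
  assume "x = y"
  then have "3 * e + 1 = 3 * e + 2" using xy by (auto simp: darts_of_def doubleton_eq_iff)
  then show False by simp
qed

lemma distinct_J: "distinct J"
  using distinct_L distinct_K disjoint new x_neq_y unfolding xy by auto

lemma set_J: "set J = set L \<union> set K \<union> {x, y}"
  by auto

lemma not_vertex: "x \<noteq> 3 * g" "y \<noteq> 3 * g"
proof -
  have "x \<in> darts_of e" "y \<in> darts_of e" using xy by auto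
  moreover have "3 * e + 1 \<noteq> 3 * g" "3 * e + 2 \<noteq> 3 * g" by presburger+
  ultimately show "x \<noteq> 3 * g" "y \<noteq> 3 * g" unfolding darts_of_def by auto
qed

lemma half_open_K: "half_open (set K) = {}"
  by (rule half_open_closed[OF closed(2)])

lemma half_open_x: "half_open {x} = {e}"
proof -
  have "x = 3 * e + 1 \<or> x = 3 * e + 2" using xy unfolding darts_of_def by auto
  then have "x mod 3 \<noteq> 0 \<and> x div 3 = e" by presburger
  then show ?thesis using half_open_insert_dart[of x "{}"] by (simp add: half_open_def)
qed

lemma half_open_inner:
  assumes "set B1 \<subseteq> set K"
  shows "half_open (set (X @ [3 * u, x] @ B1)) =
    half_open (set X) \<union> {e} \<union> half_open (set B1)"
proof -
  have 1: "half_open (set X \<union> set B1) = half_open (set X) \<union> half_open (set B1)"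
    using assms disjoint closed(2) by (intro half_open_Un_separated) fastforce
  have 2: "half_open ((set X \<union> set B1) \<union> {x}) = half_open (set X \<union> set B1) \<union> half_open {x}"
  proof (rule half_open_Un_separated)
    fix f
    show "darts_of f \<inter> (set X \<union> set B1) = {} \<or> darts_of f \<inter> {x} = {}"
    proof (cases "f = e")
      case True
      then show ?thesis using new assms by auto
    next
      case False
      then have "darts_of f \<inter> darts_of e = {}" by (auto simp: darts_of_def; presburger)
      then show ?thesis using xy by auto
    qed
  qed
  have "set (X @ [3 * u, x] @ B1) = insert (3 * u) ((set X \<union> set B1) \<union> {x})" by auto
  then show ?thesis using 1 2 half_open_x by auto
qed

text \<open>Behind the insertion both darts of \<open>e\<close> and all darts of \<open>K\<close>
  have been passed, and an edge passed twice is no longer open.\<close>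

lemma half_open_outer:
  assumes "set A1 \<subseteq> set A"
  shows "half_open (set (X @ [3 * u, x] @ B @ [3 * v, y] @ A1)) = half_open (set (X @ [3 * u] @ A1))"
proof -
  have eq: "set (X @ [3 * u, x] @ B @ [3 * v, y] @ A1) = set (X @ [3 * u] @ A1) \<union> (set K \<union> darts_of e)"
    unfolding xy by auto
  have sub: "set (X @ [3 * u] @ A1) \<subseteq> set L" using assms by auto
  have "half_open (set K \<union> darts_of e) = {}"
  proof -
    have "darts_of f \<subseteq> set K \<union> darts_of e \<or> darts_of f \<inter> (set K \<union> darts_of e) = {}" for f
    proof (cases "f = e")
      case False
      then have "darts_of f \<inter> darts_of e = {}" by (auto simp: darts_of_def; presburger)
      then show ?thesis using closed(2)[of f] by auto
    qed auto
    then show ?thesis by (rule half_open_closed)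
  qed
  moreover have "set (X @ [3 * u] @ A1) \<inter> (set K \<union> darts_of e) = {}"
    using sub disjoint new by auto
  ultimately show ?thesis unfolding eq by (simp add: half_open_Un_closed)
qed

lemma open_at_L:
  assumes "z \<in> set L"
  shows "open_at J z = open_at L z"
proof -
  consider "z \<in> set (X @ [3 * u])" | "z \<in> set A" "z \<notin> set (X @ [3 * u])"
    using assms by auto
  then show ?thesis
  proof cases
    case 1
    then have "takeWhile (\<lambda>w. w \<noteq> z) ((X @ [3 * u]) @ C) = takeWhile (\<lambda>w. w \<noteq> z) (X @ [3 * u])" for C
      by (intro takeWhile_append1) auto
    from this[of A] this[of "[x] @ B @ [3 * v, y] @ A"] show ?thesis by (simp add: open_at_def)
  next
    case 2
    have tw: "takeWhile (\<lambda>w. w \<noteq> z) (C @ A) = C @ takeWhile (\<lambda>w. w \<noteq> z) A" if "z \<notin> set C" for C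
      using that by (intro takeWhile_append2) auto
    have "z \<notin> set (X @ [3 * u, x] @ B @ [3 * v, y])"
      using 2 disjoint new(1) unfolding xy by auto
    from tw[OF this] tw[OF 2(2)] show ?thesis
      using half_open_outer[of "takeWhile (\<lambda>w. w \<noteq> z) A"] set_takeWhileD[of _ "\<lambda>w. w \<noteq> z" A]
      by (simp add: open_at_def subset_iff)
  qed
qed

text \<open>The root path of an element of the inserted tour goes to \<open>u\<close>, crosses
  \<open>e\<close>, and continues inside \<open>K\<close> from \<open>v\<close>.\<close>

lemma open_at_K:
  assumes "z \<in> set K"
  shows "open_at J z = open_at L (3 * u) \<union> {e} \<union> open_at K z"
proof -
  have z: "z \<notin> set (X @ [3 * u, x])" using assms disjoint new(2) unfolding xy by auto
  have "3 * u \<notin> set X" using distinct_L by auto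
  then have ou: "open_at L (3 * u) = half_open (set X)"
    by (simp add: open_at_def takeWhile_neq_append)
  have tw: "takeWhile (\<lambda>w. w \<noteq> z) J =
    (X @ [3 * u, x]) @ takeWhile (\<lambda>w. w \<noteq> z) (B @ [3 * v, y] @ A)"
  proof -
    have "takeWhile (\<lambda>w. w \<noteq> z) ((X @ [3 * u, x]) @ M) = (X @ [3 * u, x]) @ takeWhile (\<lambda>w. w \<noteq> z) M" for M
      using z by (intro takeWhile_append2) auto
    then show ?thesis by (metis append.assoc append_Cons append_Nil)
  qed
  show ?thesis
  proof (cases "z = 3 * v")
    case True
    then have "z \<notin> set B" using distinct_K by auto
    then have "takeWhile (\<lambda>w. w \<noteq> z) J = X @ [3 * u, x] @ B"
      using tw True by (simp add: takeWhile_neq_append)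
    moreover have "half_open (set B) = {}" using half_open_K by simp
    moreover have "open_at K z = {}" using True by (simp add: open_at_def half_open_def)
    ultimately show ?thesis using half_open_inner[of B] ou by (auto simp: open_at_def)
  next
    case False
    then have "z \<in> set B" using assms by auto
    then have "takeWhile (\<lambda>w. w \<noteq> z) J = X @ [3 * u, x] @ takeWhile (\<lambda>w. w \<noteq> z) B"
      using tw takeWhile_append1[of z B "\<lambda>w. w \<noteq> z"] by auto
    moreover have "open_at K z = half_open (set (takeWhile (\<lambda>w. w \<noteq> z) B))"
      using False by (simp add: open_at_def)
    moreover have "set (takeWhile (\<lambda>w. w \<noteq> z) B) \<subseteq> set K" by (auto dest: set_takeWhileD)
    ultimately show ?thesis using half_open_inner ou by (simp add: open_at_def)
  qed
qed

lemma open_at_subset: "open_at M z \<subseteq> {f. darts_of f \<inter> set M \<noteq> {}}"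
proof -
  have "half_open Y \<subseteq> {f. darts_of f \<inter> Y \<noteq> {}}" for Y
    by (auto simp: half_open_def darts_of_def)
  moreover have "set (takeWhile (\<lambda>w. w \<noteq> z) M) \<subseteq> set M"
    by (meson set_takeWhileD subsetI)
  ultimately show ?thesis unfolding open_at_def by blast
qed

lemma new_not_open_K: "e \<notin> open_at K z" "e \<notin> open_at L z"
  using open_at_subset[of K z] open_at_subset[of L z] new by blast+

lemma open_disjoint: "open_at K z \<inter> open_at L w = {}"
proof -
  have "{f. darts_of f \<inter> set K \<noteq> {}} \<inter> {f. darts_of f \<inter> set L \<noteq> {}} = {}"
    using closed(2) disjoint by blast
  then show ?thesis using open_at_subset[of K z] open_at_subset[of L w] by blast
qed

lemma finite_open_at [simp]: "finite (open_at M z)"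
  by (simp add: open_at_def finite_half_open)

abbreviation gap_card :: "nat list \<Rightarrow> nat \<Rightarrow> nat \<Rightarrow> nat" where
  "gap_card M z w \<equiv> card ((open_at M z - open_at M w) \<union> (open_at M w - open_at M z))"

lemma gap_L: "z \<in> set L \<Longrightarrow> w \<in> set L \<Longrightarrow> gap_card J z w = gap_card L z w"
  by (simp only: open_at_L)

lemma gap_K: "z \<in> set K \<Longrightarrow> w \<in> set K \<Longrightarrow> gap_card J z w = gap_card K z w"
proof -
  assume zw: "z \<in> set K" "w \<in> set K"
  have "open_at J z - open_at J w \<union> (open_at J w - open_at J z) =
    open_at K z - open_at K w \<union> (open_at K w - open_at K z)"
    unfolding open_at_K[OF zw(1)] open_at_K[OF zw(2)]
    using open_disjoint[of z "3 * u"] open_disjoint[of w "3 * u"] new_not_open_K(1)[of z] new_not_open_K(1)[of w]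
    by blast
  then show ?thesis by simp
qed

text \<open>Nothing is open in \<open>K\<close> at its root \<open>v\<close>. The edges of
  \<open>L\<close>, the edge \<open>e\<close> and the edges of \<open>K\<close> are disjoint, so the
  symmetric difference falls into the path from \<open>z\<close> to \<open>u\<close>, the new edge,
  and the path from \<open>v\<close> to \<open>w\<close>.\<close>

lemma gap_LK:
  assumes "z \<in> set L" "w \<in> set K"
  shows "gap_card J z w = gap_card L z (3 * u) + 1 + gap_card K (3 * v) w" "gap_card J w z = gap_card L z (3 * u) + 1 + gap_card K (3 * v) w"
proof -
  let ?P = "open_at L z - open_at L (3 * u) \<union> (open_at L (3 * u) - open_at L z)"
  have Kv: "open_at K (3 * v) = {}" by (simp add: open_at_def half_open_def)
  have "open_at J z - open_at J w \<union> (open_at J w - open_at J z) = ?P \<union> ({e} \<union> open_at K w)"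
    unfolding open_at_K[OF assms(2)] open_at_L[OF assms(1)]
    using open_disjoint[of w "3 * u"] open_disjoint[of w z] new_not_open_K(2)[of z] new_not_open_K(2)[of "3 * u"]
    by blast
  moreover have "card (?P \<union> ({e} \<union> open_at K w)) = card ?P + card ({e} \<union> open_at K w)"
    using open_disjoint[of w "3 * u"] open_disjoint[of w z] new_not_open_K
    by (intro card_Un_disjoint) (simp_all, blast)
  moreover have "card ({e} \<union> open_at K w) = 1 + gap_card K (3 * v) w"
    using new_not_open_K(1)[of w] Kv by simp
  ultimately show 1: "gap_card J z w = gap_card L z (3 * u) + 1 + gap_card K (3 * v) w" by simp
  then show "gap_card J w z = gap_card L z (3 * u) + 1 + gap_card K (3 * v) w" by (simp add: Un_commute)
qed

lemma open_prefix_J: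
  shows open_prefix_J_before: "i \<le> Suc (length X) \<Longrightarrow> open_prefix J i = open_prefix L i"
    and open_prefix_J_inner: "c \<le> length B \<Longrightarrow>
      open_prefix J (length X + 2 + c) = open_prefix L (Suc (length X)) \<union> {e} \<union> open_prefix K (Suc c)"
    and open_prefix_J_inner_end:
      "open_prefix J (length X + 3 + length B) = open_prefix L (Suc (length X)) \<union> {e} \<union> open_prefix K 0"
    and open_prefix_J_after:
      "open_prefix J (length X + 4 + length B + c) = open_prefix L (Suc (length X) + c)"
proof -
  have LX: "open_prefix L (Suc (length X)) = half_open (set X)"
    by (simp add: open_prefix_def)
  show "open_prefix J i = open_prefix L i" if "i \<le> Suc (length X)"
    using that by (cases "i = Suc (length X)") (simp_all add: open_prefix_def)
  show "open_prefix J (length X + 2 + c) = open_prefix L (Suc (length X)) \<union> {e} \<union> open_prefix K (Suc c)"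
    if "c \<le> length B"
  proof -
    have "take (length X + 2 + c) J = X @ [3 * u, x] @ take c B" using that by simp
    moreover have "set (take c B) \<subseteq> set K" using set_take_subset by fastforce
    ultimately show ?thesis using half_open_inner[of "take c B"] LX by (simp add: open_prefix_def)
  qed
  show "open_prefix J (length X + 3 + length B) = open_prefix L (Suc (length X)) \<union> {e} \<union> open_prefix K 0"
  proof -
    have "take (length X + 3 + length B) J = X @ [3 * u, x] @ (B @ [3 * v])"
      by (simp add: numeral_eq_Suc)
    then show ?thesis using half_open_inner[of "B @ [3 * v]"] LX half_open_K
      by (simp add: open_prefix_def)
  qed
  show "open_prefix J (length X + 4 + length B + c) = open_prefix L (Suc (length X) + c)"
  proof -
    have "take (length X + 4 + length B + c) J = X @ [3 * u, x] @ B @ [3 * v, y] @ take c A"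
      by (simp add: numeral_eq_Suc)
    moreover have "take (Suc (length X) + c) L = X @ [3 * u] @ take c A" by simp
    ultimately show ?thesis
      using half_open_outer[of "take c A"] set_take_subset[of c A] by (simp add: open_prefix_def)
  qed
qed

lemma noncrossing_J: "noncrossing J"
proof -
  define a where "a = Suc (length X)"
  define b where "b = length B + 3"
  have before: "open_prefix J i = open_prefix L i" if "i \<le> a" for i
    using that unfolding a_def by (rule open_prefix_J_before)
  have after: "open_prefix J i = open_prefix L (i - b)" if "a + b \<le> i" for i
  proof -
    have "i = length X + 4 + length B + (i - (a + b))" "i - b = Suc (length X) + (i - (a + b))"
      using that by (auto simp: a_def b_def)
    then show ?thesis using open_prefix_J_after[of "i - (a + b)"] by metis
  qed
  \<comment> \<open>The index \<open>Suc (length K)\<close> lies beyond the list and stands for the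
    place between \<open>3 * v\<close> and \<open>y\<close>, which has no counterpart in
    \<open>K\<close>; \<open>take\<close> still returns all of \<open>K\<close> there.\<close>
  have K_end: "open_prefix K (length K) = {}" "open_prefix K 0 = {}" "open_prefix K (Suc (length K)) = {}"
    using half_open_K by (simp_all add: open_prefix_def)
  have inner: "open_prefix J i = open_prefix L a \<union> {e} \<union> open_prefix K (i - a)"
    if "a < i" "i < a + b" for i
  proof (cases "i = length X + 3 + length B")
    case True
    then have "i - a = Suc (length K)" by (simp add: a_def)
    then show ?thesis using open_prefix_J_inner_end True K_end unfolding a_def by metis
  next
    case False
    then have "i = length X + 2 + (i - a - 1)" "i - a = Suc (i - a - 1)" "i - a - 1 \<le> length B"
      using that by (auto simp: a_def b_def)
    then show ?thesis using open_prefix_J_inner[of "i - a - 1"] unfolding a_def by metis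
  qed
  have len: "a \<le> length L" "length J = length L + b" "b = length K + 2" "b \<ge> 2"
    by (simp_all add: a_def b_def)
  have ncL: "\<And>i j. i \<le> j \<Longrightarrow> j \<le> length L \<Longrightarrow>
      \<exists>l\<ge>i. l \<le> j \<and> open_prefix L l \<subseteq> open_prefix L i \<inter> open_prefix L j"
    and ncK: "\<And>i j. i \<le> j \<Longrightarrow> j \<le> length K \<Longrightarrow>
      \<exists>l\<ge>i. l \<le> j \<and> open_prefix K l \<subseteq> open_prefix K i \<inter> open_prefix K j"
    using nc unfolding noncrossing_def by blast+
  show ?thesis unfolding noncrossing_def len(2)
  proof (intro allI impI)
    fix i j assume ij: "i \<le> j" "j \<le> length L + b"
    show "\<exists>l\<ge>i. l \<le> j \<and> open_prefix J l \<subseteq> open_prefix J i \<inter> open_prefix J j"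
      by (rule nested_sequences[where h = "open_prefix L" and g = "open_prefix K" and e = e,
            OF len(1,4) K_end(3)]) (fact ncL ncK before inner after len(3) ij)+
  qed
qed

lemma cyclic_J:
  assumes "cyclic_for nxt L" "cyclic_for nxt K"
  shows "cyclic_for (nxt(3 * u := x, 3 * v := y, x := nxt (3 * v), y := nxt (3 * u))) J"
proof -
  define n where "n = nxt(3 * u := x, 3 * v := y, x := nxt (3 * v), y := nxt (3 * u))"
  let ?S = "successively (\<lambda>a b. nxt a = b)"
  let ?S' = "successively (\<lambda>a b. n a = b)"
  define h where "h = hd L"
  have hJ: "hd J = h" by (cases X) (auto simp: h_def)
  have S: "?S (X @ [3 * u] @ (A @ [h]))" "?S (3 * v # (B @ [3 * v]))"
    using assms by (auto simp: cyclic_for_def h_def)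
  have uv: "3 * u \<noteq> 3 * v" "x \<noteq> 3 * u" "x \<noteq> 3 * v" "y \<noteq> 3 * u" "y \<noteq> 3 * v"
    using disjoint not_vertex by auto
  have keep: "n z = nxt z" if "z \<in> set X \<union> set A \<union> set B" for z
    using that distinct_L distinct_K disjoint new x_neq_y unfolding xy n_def by auto
  have keepS: "?S' M \<longleftrightarrow> ?S M" if "set (butlast M) \<subseteq> set X \<union> set A \<union> set B" for M
  proof (rule successively_cong_butlast)
    fix a b assume "a \<in> set (butlast M)"
    then have "n a = nxt a" using that by (intro keep) blast
    then show "n a = b \<longleftrightarrow> nxt a = b" by simp
  qed
  have keepS': "?S' (C @ [w])" if "?S (C @ [w])" "set C \<subseteq> set X \<union> set A \<union> set B" for C w
    using that keepS[of "C @ [w]"] unfolding butlast_snoc by blast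
  have "?S (X @ [3 * u])" using S(1) by (auto simp: successively_append_iff)
  then have 1: "?S' (X @ [3 * u])" by (rule keepS') auto
  have "?S (B @ [3 * v])" using S(2) by (cases B) auto
  then have 2: "?S' (B @ [3 * v])" by (rule keepS') auto
  have "?S (A @ [h])" using S(1) by (cases A) (auto simp: successively_append_iff)
  then have 3: "?S' (A @ [h])" by (rule keepS') auto
  \<comment> \<open>If \<open>B\<close> is empty, then \<open>nxt (3 * v)\<close> is
    \<open>3 * v\<close> itself and the new dart leads straight to \<open>v\<close>.\<close>
  have nx: "n x = hd (B @ [3 * v])"
    using S(2) x_neq_y by (cases B) (auto simp: n_def)
  have ny: "n y = hd (A @ [h])"
    using S(1) x_neq_y by (cases A) (auto simp: successively_append_iff n_def)
  have "?S' ((X @ [3 * u]) @ ((x # (B @ [3 * v])) @ (y # (A @ [h]))))"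
  proof -
    have "?S' (x # (B @ [3 * v]))" "?S' (y # (A @ [h]))"
      using 2 3 nx ny by (auto simp: successively_Cons)
    moreover have "n (3 * u) = x" "n (3 * v) = y" using uv by (simp_all add: n_def)
    ultimately show ?thesis using 1 by (simp add: successively_append_iff successively_Cons hd_append)
  qed
  then show ?thesis unfolding cyclic_for_def hJ n_def by simp
qed

end

section \<open>Tours of all components of a growing forest\<close>

definition edge_path :: "(nat \<times> nat) list \<Rightarrow> nat list \<Rightarrow> bool" where
  "edge_path F \<pi> \<longleftrightarrow> \<pi> \<noteq> [] \<and> distinct \<pi> \<and> successively (\<lambda>a b. (a, b) \<in> set F \<or> (b, a) \<in> set F) \<pi>"

text \<open>In a tree the symmetric difference of two root paths is the path between their
  ends.\<close>

definition gap :: "nat list \<Rightarrow> nat \<Rightarrow> nat \<Rightarrow> nat" where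
  "gap M z w = card ((open_at M z - open_at M w) \<union> (open_at M w - open_at M z))"

text \<open>
  \<open>M\<close> is the cyclic Euler tour, cut open at \<open>r\<close>, of the component of \<open>r\<close> in the forest with
  edges \<open>F\<close>: vertex \<open>g\<close> is the list element \<open>3 * g\<close> and the two directions of the \<open>j\<close>-th edge are
  the darts of \<open>e0 + j\<close>. The set \<open>open_at M (3 * g)\<close> consists of the edges on the path from \<open>r\<close>
  to \<open>g\<close>, and \<open>D\<close> is the distance.
\<close>

locale root_tour =
  fixes V :: "nat set" and e0 :: nat and F :: "(nat \<times> nat) list" and nxt :: "nat \<Rightarrow> nat"
    and D :: "nat \<Rightarrow> nat \<Rightarrow> nat" and r :: nat and M :: "nat list"
  assumes nonempty: "M \<noteq> []" and hd: "hd M = 3 * r" and dist: "distinct M"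
    and cyclic: "cyclic_for nxt M" and noncross: "noncrossing M"
    and subset: "set M \<subseteq> (\<lambda>g. 3 * g) ` V \<union> (\<Union>j<length F. darts_of (e0 + j))"
    and edge: "\<And>j. j < length F \<Longrightarrow>
        darts_of (e0 + j) \<subseteq> set M \<and> 3 * fst (F ! j) \<in> set M \<and> 3 * snd (F ! j) \<in> set M \<or>
        darts_of (e0 + j) \<inter> set M = {} \<and> 3 * fst (F ! j) \<notin> set M \<and> 3 * snd (F ! j) \<notin> set M"
    and len: "length M + 2 = 3 * card {g. 3 * g \<in> set M}"
    and gap: "\<And>p q. 3 * p \<in> set M \<Longrightarrow> 3 * q \<in> set M \<Longrightarrow> D p q = gap M (3 * p) (3 * q)"
    and path: "\<And>q. 3 * q \<in> set M \<Longrightarrow> \<exists>\<pi>. edge_path F \<pi> \<and> hd \<pi> = r \<and> last \<pi> = q \<and>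
        length \<pi> = Suc (D r q) \<and> set \<pi> \<subseteq> {g. 3 * g \<in> set M}"
    and lip: "\<And>a b. (a, b) \<in> set F \<Longrightarrow> 3 * a \<in> set M \<Longrightarrow> D r a \<le> Suc (D r b) \<and> D r b \<le> Suc (D r a)"

text \<open>Every vertex owns a list, because an edge insertion needs the tour of one component cut
  open at an arbitrary vertex. All lists are cuts of cycles of the single function
  \<open>nxt\<close>; the second condition says that vertices of one component cut the same
  cycle.\<close>

definition tours ::
    "nat set \<Rightarrow> nat \<Rightarrow> (nat \<times> nat) list \<Rightarrow> (nat \<Rightarrow> nat) \<Rightarrow> (nat \<Rightarrow> nat list) \<Rightarrow> (nat \<Rightarrow> nat \<Rightarrow> nat) \<Rightarrow> bool" where
  "tours V e0 F nxt L D \<longleftrightarrow> (\<forall>r\<in>V. root_tour V e0 F nxt D r (L r)) \<and>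
     (\<forall>r\<in>V. \<forall>q\<in>V. 3 * q \<in> set (L r) \<longrightarrow> set (L q) = set (L r))"

lemma gap_commute: "gap M z w = gap M w z"
  by (simp add: gap_def Un_commute)

lemma gap_self [simp]: "gap M z z = 0"
  by (simp add: gap_def)

lemma vertex_not_dart: "3 * g \<notin> darts_of e"
proof -
  have "3 * g \<noteq> 3 * e + 1" "3 * g \<noteq> 3 * e + 2" by presburger+
  then show ?thesis by (simp add: darts_of_def)
qed

lemma darts_of_disjoint: "e \<noteq> f \<Longrightarrow> darts_of e \<inter> darts_of f = {}"
proof -
  assume "e \<noteq> f"
  then have "3 * e + 1 \<noteq> 3 * f + 2" "3 * e + 2 \<noteq> 3 * f + 1" by presburger+
  with \<open>e \<noteq> f\<close> show ?thesis by (auto simp: darts_of_def)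
qed

lemma root_tour_cases:
  assumes "root_tour V e0 F nxt D r M" "z \<in> set M"
  obtains g where "g \<in> V" "z = 3 * g" | j where "j < length F" "z \<in> darts_of (e0 + j)"
  using root_tour.subset[OF assms(1)] assms(2) by auto

lemma root_tour_dart:
  assumes "root_tour V e0 F nxt D r M" "z \<in> set M" "z \<in> darts_of f"
  obtains j where "j < length F" "f = e0 + j"
  using assms(1,2)
proof (cases rule: root_tour_cases)
  case (1 g)
  then show thesis using assms(3) vertex_not_dart by simp
next
  case (2 j)
  then have "f = e0 + j" using assms(3) darts_of_disjoint[of f "e0 + j"] by auto
  then show thesis using that 2 by blast
qed

lemma root_tour_closed:
  assumes "root_tour V e0 F nxt D r M"
  shows "darts_of f \<subseteq> set M \<or> darts_of f \<inter> set M = {}"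
proof (cases "\<exists>j<length F. f = e0 + j")
  case True
  then show ?thesis using root_tour.edge[OF assms] by auto
next
  case False
  then show ?thesis using root_tour_dart[OF assms] by (metis disjoint_iff)
qed

lemma root_tour_fresh:
  assumes "root_tour V e0 F nxt D r M"
  shows "darts_of (e0 + length F) \<inter> set M = {}"
  using root_tour_dart[OF assms] by (metis add_left_cancel disjoint_iff less_irrefl)

lemma root_tour_vertex:
  assumes "root_tour V e0 F nxt D r M" "3 * g \<in> set M"
  shows "g \<in> V"
  using assms by (cases rule: root_tour_cases) (use vertex_not_dart in auto)

lemma root_tour_self: "root_tour V e0 F nxt D r M \<Longrightarrow> 3 * r \<in> set M"
  by (metis hd_in_set root_tour.hd root_tour.nonempty)

lemma edge_path_mono:
  assumes "edge_path F \<pi>" "set F \<subseteq> set F'"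
  shows "edge_path F' \<pi>"
proof -
  have "successively (\<lambda>a b. (a, b) \<in> set F' \<or> (b, a) \<in> set F') \<pi>"
    by (rule successively_mono[of "\<lambda>a b. (a, b) \<in> set F \<or> (b, a) \<in> set F"])
      (use assms in \<open>auto simp: edge_path_def\<close>)
  then show ?thesis using assms(1) by (simp add: edge_path_def)
qed

text \<open>The new distances are given by equations rather than by a definition, and the
  orientation of the new edge is left open. In this way the statement applies a second time with
  \<open>u\<close>, \<open>x\<close> and \<open>v\<close>, \<open>y\<close> exchanged.\<close>

lemma root_tour_splice:
  assumes T: "tours V e0 F nxt L D" and uv: "u \<in> V" "v \<in> V" "3 * v \<notin> set (L u)"
    and r: "r \<in> V" "3 * u \<in> set (L r)"
    and xy: "darts_of (e0 + length F) = {x, y}"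
    and ab: "(a, b) = (u, v) \<or> (a, b) = (v, u)"
    and D'_same: "\<And>p q. 3 * q \<in> set (L p) \<Longrightarrow> D' p q = D p q"
    and D'_cross: "\<And>p q. p \<in> V \<Longrightarrow> 3 * p \<in> set (L u) \<Longrightarrow> 3 * q \<in> set (L v) \<Longrightarrow> D' p q = D p u + 1 + D v q"
      "\<And>p q. p \<in> V \<Longrightarrow> 3 * p \<in> set (L v) \<Longrightarrow> 3 * q \<in> set (L u) \<Longrightarrow> D' p q = D p v + 1 + D u q"
  defines "M \<equiv> splice (3 * u) x (3 * v) y (L r) (L v)"
  shows "root_tour V e0 (F @ [(a, b)])
      (nxt(3 * u := x, 3 * v := y, x := nxt (3 * v), y := nxt (3 * u))) D' r M"
    and "set M = set (L u) \<union> set (L v) \<union> {x, y}"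
proof -
  let ?e = "e0 + length F"
  have R: "root_tour V e0 F nxt D s (L s)" if "s \<in> V" for s
    using T that by (simp add: tours_def)
  have same: "set (L q) = set (L s)" if "s \<in> V" "q \<in> V" "3 * q \<in> set (L s)" for s q
    using T that unfolding tours_def by blast
  have Lru: "set (L r) = set (L u)" using same[OF r(1) uv(1) r(2)] by simp
  \<comment> \<open>A common dart would bring its end points along, so two tours that meet share a
    vertex; then they belong to the same component, against \<open>uv(3)\<close>.\<close>
  have disj: "set (L r) \<inter> set (L v) = {}"
  proof (rule ccontr)
    assume "set (L r) \<inter> set (L v) \<noteq> {}"
    then obtain z where z: "z \<in> set (L r)" "z \<in> set (L v)" by blast
    have "\<exists>g. 3 * g \<in> set (L r) \<and> 3 * g \<in> set (L v)"
      using R[OF r(1)] z(1)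
    proof (cases rule: root_tour_cases)
      case (1 g)
      then show ?thesis using z by blast
    next
      case (2 j)
      then have "3 * fst (F ! j) \<in> set (L r)" "3 * fst (F ! j) \<in> set (L v)"
        using z root_tour.edge[OF R[OF r(1)] 2(1)] root_tour.edge[OF R[OF uv(2)] 2(1)] by auto
      then show ?thesis by blast
    qed
    then obtain g where g: "3 * g \<in> set (L r)" "3 * g \<in> set (L v)" by blast
    then have "g \<in> V" using root_tour_vertex[OF R[OF r(1)]] by blast
    then have "set (L r) = set (L v)" using same[OF r(1) _ g(1)] same[OF uv(2) _ g(2)] by simp
    moreover have "3 * v \<in> set (L v)" using root_tour_self[OF R[OF uv(2)]] .
    ultimately show False using uv(3) Lru by simp
  qed
  obtain X A where XA: "L r = X @ [3 * u] @ A" "3 * u \<notin> set X"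
    using split_list_first[OF r(2)] by auto
  obtain B where B: "L v = 3 * v # B"
    using root_tour.nonempty[OF R[OF uv(2)]] root_tour.hd[OF R[OF uv(2)]] by (metis list.collapse)
  have M: "M = X @ [3 * u, x] @ B @ [3 * v, y] @ A"
    unfolding M_def XA(1) B using splice_append[OF XA(2)] by simp
  interpret splicing nxt X A B u v ?e x y
  proof
    show "distinct (X @ [3 * u] @ A)" "noncrossing (X @ [3 * u] @ A)"
      using root_tour.dist[OF R[OF r(1)]] root_tour.noncross[OF R[OF r(1)]] unfolding XA(1) .
    show "distinct (3 * v # B)" "noncrossing (3 * v # B)"
      using root_tour.dist[OF R[OF uv(2)]] root_tour.noncross[OF R[OF uv(2)]] unfolding B .
    show "set (X @ [3 * u] @ A) \<inter> set (3 * v # B) = {}"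
      using disj unfolding XA(1)[symmetric] B[symmetric] .
    show "darts_of ?e \<inter> set (X @ [3 * u] @ A) = {}" "darts_of ?e \<inter> set (3 * v # B) = {}"
      using root_tour_fresh[OF R[OF r(1)]] root_tour_fresh[OF R[OF uv(2)]] unfolding XA(1) B .
    show "darts_of f \<subseteq> set (X @ [3 * u] @ A) \<or> darts_of f \<inter> set (X @ [3 * u] @ A) = {}"
      "darts_of f \<subseteq> set (3 * v # B) \<or> darts_of f \<inter> set (3 * v # B) = {}" for f
      using root_tour_closed[OF R[OF r(1)]] root_tour_closed[OF R[OF uv(2)]] unfolding XA(1) B .
  qed (rule xy)
  have setM: "set M = set (L r) \<union> set (L v) \<union> {x, y}"
    unfolding M XA(1) B by (rule set_J)
  then show "set M = set (L u) \<union> set (L v) \<union> {x, y}" using Lru by simp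
  have vertM: "3 * g \<in> set M \<longleftrightarrow> 3 * g \<in> set (L r) \<or> 3 * g \<in> set (L v)" for g
    using setM not_vertex[of g] by auto
  have gL: "D p q = gap (L r) (3 * p) (3 * q)" if "3 * p \<in> set (L r)" "3 * q \<in> set (L r)" for p q
    using root_tour.gap[OF R[OF r(1)] that] .
  have gK: "D p q = gap (L v) (3 * p) (3 * q)" if "3 * p \<in> set (L v)" "3 * q \<in> set (L v)" for p q
    using root_tour.gap[OF R[OF uv(2)] that] .
  have inV: "p \<in> V" if "3 * p \<in> set M" for p
    using that vertM[of p] root_tour_vertex[OF R[OF r(1)]] root_tour_vertex[OF R[OF uv(2)]] by auto
  have vv: "3 * v \<in> set (L v)" "3 * r \<in> set (L r)" using root_tour_self[OF R[OF uv(2)]] root_tour_self[OF R[OF r(1)]] .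
  have D'rr: "D' p q = D p q" if "3 * p \<in> set (L r)" "3 * q \<in> set (L r)" for p q
    using that D'_same same[OF r(1) inV, of p] vertM by auto
  have D'vv: "D' p q = D p q" if "3 * p \<in> set (L v)" "3 * q \<in> set (L v)" for p q
    using that D'_same same[OF uv(2) inV, of p] vertM by auto
  have D'rv: "D' p q = D p u + 1 + D v q" if "3 * p \<in> set (L r)" "3 * q \<in> set (L v)" for p q
    using that D'_cross(1)[of p q] Lru inV[of p] vertM[of p] by simp
  have D'vr: "D' p q = D p v + 1 + D u q" if "3 * p \<in> set (L v)" "3 * q \<in> set (L r)" for p q
    using that D'_cross(2)[of p q] Lru inV[of p] vertM[of p] by simp
  have gapM: "D' p q = gap M (3 * p) (3 * q)" if pq: "3 * p \<in> set M" "3 * q \<in> set M" for p q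
  proof -
    consider "3 * p \<in> set (L r)" "3 * q \<in> set (L r)" | "3 * p \<in> set (L v)" "3 * q \<in> set (L v)"
      | "3 * p \<in> set (L r)" "3 * q \<in> set (L v)" | "3 * p \<in> set (L v)" "3 * q \<in> set (L r)"
      using pq vertM[of p] vertM[of q] by blast
    then show ?thesis
    proof cases
      case 1
      then show ?thesis using D'rr gL[of p q] gap_L[of "3 * p" "3 * q"] unfolding M gap_def XA(1) by simp
    next
      case 2
      then show ?thesis using D'vv gK[of p q] gap_K[of "3 * p" "3 * q"] unfolding M gap_def B by simp
    next
      case 3
      then have "D' p q = gap (L r) (3 * p) (3 * u) + 1 + gap (L v) (3 * v) (3 * q)"
        using D'rv gL[OF _ r(2)] gK[OF vv(1)] by simp
      then show ?thesis using 3 gap_LK(1)[of "3 * p" "3 * q"] unfolding M gap_def XA(1) B by simp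
    next
      case 4
      then have "D' p q = gap (L r) (3 * q) (3 * u) + 1 + gap (L v) (3 * v) (3 * p)"
        using D'vr gL[OF r(2)] gK[OF _ vv(1)] gap_commute by simp
      then show ?thesis using 4 gap_LK(2)[of "3 * q" "3 * p"] unfolding M gap_def XA(1) B by simp
    qed
  qed
  have lenM: "length M + 2 = 3 * card {g. 3 * g \<in> set M}"
  proof -
    have fin: "finite {g. 3 * g \<in> set N}" for N :: "nat list"
      by (rule finite_imageD[of "\<lambda>g. 3 * g"]) (auto intro: finite_subset[of _ "set N"] inj_onI)
    have "{g. 3 * g \<in> set M} = {g. 3 * g \<in> set (L r)} \<union> {g. 3 * g \<in> set (L v)}"
      using vertM by blast
    then have "card {g. 3 * g \<in> set M} = card {g. 3 * g \<in> set (L r)} + card {g. 3 * g \<in> set (L v)}"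
      using disj by (simp add: card_Un_disjoint fin disjoint_iff)
    moreover have "length M = length (L r) + length (L v) + 2" unfolding M XA(1) B by simp
    ultimately show ?thesis
      using root_tour.len[OF R[OF r(1)]] root_tour.len[OF R[OF uv(2)]] by linarith
  qed
  have edges: "darts_of (e0 + j) \<subseteq> set M \<and> 3 * fst ((F @ [(a, b)]) ! j) \<in> set M \<and> 3 * snd ((F @ [(a, b)]) ! j) \<in> set M \<or>
        darts_of (e0 + j) \<inter> set M = {} \<and> 3 * fst ((F @ [(a, b)]) ! j) \<notin> set M \<and> 3 * snd ((F @ [(a, b)]) ! j) \<notin> set M"
    if "j < length (F @ [(a, b)])" for j
  proof (cases "j = length F")
    case True
    then show ?thesis using ab setM xy vertM r(2) vv by auto
  next
    case False
    then have j: "j < length F" using that by simp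
    then have "darts_of (e0 + j) \<inter> {x, y} = {}" unfolding xy[symmetric] by (intro darts_of_disjoint) simp
    moreover have "darts_of (e0 + j) \<subseteq> set (L s) \<and> 3 * fst (F ! j) \<in> set (L s) \<and> 3 * snd (F ! j) \<in> set (L s) \<or>
        darts_of (e0 + j) \<inter> set (L s) = {} \<and> 3 * fst (F ! j) \<notin> set (L s) \<and> 3 * snd (F ! j) \<notin> set (L s)"
      if "s \<in> V" for s
      using root_tour.edge[OF R[OF that] j] .
    from this[OF r(1)] this[OF uv(2)] calculation show ?thesis
      using j vertM[of "fst (F ! j)"] vertM[of "snd (F ! j)"] setM by (simp add: nth_append) blast
  qed
  have path: "\<exists>\<pi>. edge_path (F @ [(a, b)]) \<pi> \<and> hd \<pi> = r \<and> last \<pi> = q \<and> length \<pi> = Suc (D' r q) \<and>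
        set \<pi> \<subseteq> {g. 3 * g \<in> set M}" if "3 * q \<in> set M" for q
  proof -
    have old: "\<exists>\<pi>. edge_path F \<pi> \<and> hd \<pi> = s \<and> last \<pi> = w \<and> length \<pi> = Suc (D s w) \<and>
        set \<pi> \<subseteq> {g. 3 * g \<in> set (L s)}" if "3 * w \<in> set (L s)" "s \<in> V" for s w
      using root_tour.path[OF R[OF that(2)] that(1)] .
    show ?thesis
    proof (cases "3 * q \<in> set (L r)")
      case True
      then obtain \<pi> where "edge_path F \<pi>" "hd \<pi> = r" "last \<pi> = q" "length \<pi> = Suc (D r q)"
        "set \<pi> \<subseteq> {g. 3 * g \<in> set (L r)}" using old r(1) by blast
      then show ?thesis using D'rr[OF vv(2) True] setM edge_path_mono[of F \<pi> "F @ [(a, b)]"]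
        by (intro exI[of _ \<pi>]) auto
    next
      case False
      then have q: "3 * q \<in> set (L v)" using that vertM[of q] by blast
      obtain \<pi> where \<pi>: "edge_path F \<pi>" "hd \<pi> = r" "last \<pi> = u" "length \<pi> = Suc (D r u)"
        "set \<pi> \<subseteq> {g. 3 * g \<in> set (L r)}" using old r by blast
      obtain \<rho> where \<rho>: "edge_path F \<rho>" "hd \<rho> = v" "last \<rho> = q" "length \<rho> = Suc (D v q)"
        "set \<rho> \<subseteq> {g. 3 * g \<in> set (L v)}" using old q uv(2) by blast
      have "set \<pi> \<inter> set \<rho> = {}" using \<pi>(5) \<rho>(5) disj by blast
      moreover have "edge_path (F @ [(a, b)]) \<pi>" "edge_path (F @ [(a, b)]) \<rho>"
        using edge_path_mono \<pi>(1) \<rho>(1) by (metis Un_upper1 set_append)+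
      moreover have "(u, v) \<in> set (F @ [(a, b)]) \<or> (v, u) \<in> set (F @ [(a, b)])" using ab by auto
      ultimately have "edge_path (F @ [(a, b)]) (\<pi> @ \<rho>)"
        unfolding edge_path_def successively_append_iff \<pi>(3) \<rho>(2) by simp
      moreover have "hd (\<pi> @ \<rho>) = r" "last (\<pi> @ \<rho>) = q"
        using \<pi>(1,2) \<rho>(1,3) by (simp_all add: edge_path_def)
      moreover have "length (\<pi> @ \<rho>) = Suc (D' r q)"
        using D'rv[OF vv(2) q] \<pi>(4) \<rho>(4) by simp
      moreover have "set (\<pi> @ \<rho>) \<subseteq> {g. 3 * g \<in> set M}" using \<pi>(5) \<rho>(5) setM by auto
      ultimately show ?thesis by blast
    qed
  qed
  have lip: "D' r c \<le> Suc (D' r d) \<and> D' r d \<le> Suc (D' r c)"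
    if cd: "(c, d) \<in> set (F @ [(a, b)])" "3 * c \<in> set M" for c d
  proof (cases "(c, d) \<in> set F")
    case True
    then obtain j where "j < length F" "F ! j = (c, d)" by (metis in_set_conv_nth)
    then have iff: "3 * c \<in> set (L s) \<longleftrightarrow> 3 * d \<in> set (L s)" if "s \<in> V" for s
      using root_tour.edge[OF R[OF that]] by (metis fst_conv snd_conv)
    have old: "D s c \<le> Suc (D s d) \<and> D s d \<le> Suc (D s c)" if "s \<in> V" "3 * c \<in> set (L s)" for s
      using root_tour.lip[OF R[OF that(1)] True that(2)] .
    show ?thesis
    proof (cases "3 * c \<in> set (L r)")
      case True
      then show ?thesis using D'rr[OF vv(2)] iff[OF r(1)] old[OF r(1)] by simp
    next
      case False
      then have "3 * c \<in> set (L v)" using cd(2) vertM[of c] by blast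
      then show ?thesis using D'rv[OF vv(2)] iff[OF uv(2)] old[OF uv(2)] by simp
    qed
  next
    case False
    have "D v v = 0" using gK[OF vv(1) vv(1)] by simp
    then have "D' r v = Suc (D' r u)" using D'rv[OF vv(2) vv(1)] D'rr[OF vv(2) r(2)] by simp
    moreover have "(c, d) = (u, v) \<or> (c, d) = (v, u)" using False cd(1) ab by auto
    ultimately show ?thesis by auto
  qed
  have "cyclic_for nxt (X @ [3 * u] @ A)" "cyclic_for nxt (3 * v # B)"
    using root_tour.cyclic[OF R[OF r(1)]] root_tour.cyclic[OF R[OF uv(2)]] unfolding XA(1) B .
  then have cyc: "cyclic_for (nxt(3 * u := x, 3 * v := y, x := nxt (3 * v), y := nxt (3 * u))) M"
    unfolding M by (rule cyclic_J)
  have hdM: "hd M = 3 * r"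
  proof -
    have "hd M = hd (L r)" unfolding M XA(1) by (cases X) auto
    then show ?thesis using root_tour.hd[OF R[OF r(1)]] by simp
  qed
  have subM: "set M \<subseteq> (\<lambda>g. 3 * g) ` V \<union> (\<Union>j<length (F @ [(a, b)]). darts_of (e0 + j))"
  proof -
    have "set (L s) \<subseteq> (\<lambda>g. 3 * g) ` V \<union> (\<Union>j<length F. darts_of (e0 + j))" if "s \<in> V" for s
      using root_tour.subset[OF R[OF that]] .
    from this[OF r(1)] this[OF uv(2)] show ?thesis
      unfolding setM xy[symmetric] by (auto simp: lessThan_Suc)
  qed
  show "root_tour V e0 (F @ [(a, b)])
      (nxt(3 * u := x, 3 * v := y, x := nxt (3 * v), y := nxt (3 * u))) D' r M"
  proof
    show "M \<noteq> []" "distinct M" "noncrossing M" using distinct_J noncrossing_J unfolding M by simp_all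
  qed (fact cyc hdM subM lenM gapM path lip edges)+
qed

lemma root_tour_unaffected:
  assumes R: "root_tour V e0 F nxt D r M"
    and "3 * a \<notin> set M" "3 * b \<notin> set M"
    and D': "\<And>p q. 3 * p \<in> set M \<Longrightarrow> 3 * q \<in> set M \<Longrightarrow> D' p q = D p q"
    and nxt': "\<And>z. z \<in> set M \<Longrightarrow> nxt' z = nxt z"
  shows "root_tour V e0 (F @ [(a, b)]) nxt' D' r M"
proof -
  note fresh = root_tour_fresh[OF R]
  have r: "3 * r \<in> set M" by (rule root_tour_self[OF R])
  have cyc: "cyclic_for nxt' M"
  proof -
    have "successively (\<lambda>a b. nxt' a = b) (M @ [hd M]) \<longleftrightarrow> successively (\<lambda>a b. nxt a = b) (M @ [hd M])"
      by (rule successively_cong_butlast) (use nxt' in simp)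
    then show ?thesis using root_tour.cyclic[OF R] unfolding cyclic_for_def by blast
  qed
  have edges: "darts_of (e0 + j) \<subseteq> set M \<and> 3 * fst ((F @ [(a, b)]) ! j) \<in> set M \<and> 3 * snd ((F @ [(a, b)]) ! j) \<in> set M \<or>
        darts_of (e0 + j) \<inter> set M = {} \<and> 3 * fst ((F @ [(a, b)]) ! j) \<notin> set M \<and> 3 * snd ((F @ [(a, b)]) ! j) \<notin> set M"
    if "j < length (F @ [(a, b)])" for j
  proof (cases "j = length F")
    case False
    then show ?thesis using root_tour.edge[OF R, of j] that by (simp add: nth_append)
  qed (use fresh assms(2,3) in simp)
  have path: "\<exists>\<pi>. edge_path (F @ [(a, b)]) \<pi> \<and> hd \<pi> = r \<and> last \<pi> = q \<and> length \<pi> = Suc (D' r q) \<and>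
        set \<pi> \<subseteq> {g. 3 * g \<in> set M}" if q: "3 * q \<in> set M" for q
  proof -
    obtain \<pi> where "edge_path F \<pi>" "hd \<pi> = r" "last \<pi> = q" "length \<pi> = Suc (D r q)"
      "set \<pi> \<subseteq> {g. 3 * g \<in> set M}" using root_tour.path[OF R q] by blast
    then show ?thesis using D'[OF r q] edge_path_mono[of F \<pi> "F @ [(a, b)]"]
      by (intro exI[of _ \<pi>]) auto
  qed
  have lip: "D' r c \<le> Suc (D' r d) \<and> D' r d \<le> Suc (D' r c)"
    if cd: "(c, d) \<in> set (F @ [(a, b)])" "3 * c \<in> set M" for c d
  proof -
    have "(c, d) \<in> set F" using that assms(2) by auto
    then obtain j where "j < length F" "F ! j = (c, d)" by (metis in_set_conv_nth)
    then have "3 * d \<in> set M" using root_tour.edge[OF R] cd(2) by (metis fst_conv snd_conv)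
    then show ?thesis using D'[OF r] cd(2) root_tour.lip[OF R \<open>(c, d) \<in> set F\<close>] by simp
  qed
  have sub: "set M \<subseteq> (\<lambda>g. 3 * g) ` V \<union> (\<Union>j<length (F @ [(a, b)]). darts_of (e0 + j))"
    using root_tour.subset[OF R] by (auto simp: lessThan_Suc)
  have gapM: "D' p q = gap M (3 * p) (3 * q)" if "3 * p \<in> set M" "3 * q \<in> set M" for p q
    using that D' root_tour.gap[OF R] by metis
  show ?thesis
    by unfold_locales (fact root_tour.nonempty[OF R] root_tour.hd[OF R] root_tour.dist[OF R] cyc
        root_tour.noncross[OF R] sub edges root_tour.len[OF R] gapM path lip)+
qed

text \<open>A root in the component of \<open>u\<close> gets the tour of \<open>v\<close> inserted
  at \<open>u\<close>, a root in the component of \<open>v\<close> gets the tour of \<open>u\<close>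
  inserted at \<open>v\<close>; all other lists stay. One and the same change of four successors
  accounts for every one of these lists.\<close>

lemma tours_insert_edge:
  assumes T: "tours V e0 F nxt L D" and uv: "u \<in> V" "v \<in> V" "3 * v \<notin> set (L u)"
    and x: "x = 3 * (e0 + length F) + 1" and y: "y = 3 * (e0 + length F) + 2"
  shows "\<exists>L' D'. tours V e0 (F @ [(u, v)])
    (nxt(3 * u := x, 3 * v := y, x := nxt (3 * v), y := nxt (3 * u))) L' D'"
proof -
  define nxt' where "nxt' = nxt(3 * u := x, 3 * v := y, x := nxt (3 * v), y := nxt (3 * u))"
  define L' where "L' r = (if 3 * u \<in> set (L r) then splice (3 * u) x (3 * v) y (L r) (L v)
    else if 3 * v \<in> set (L r) then splice (3 * v) y (3 * u) x (L r) (L u) else L r)" for r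
  define D' where "D' p q = (if 3 * q \<in> set (L p) then D p q
    else if 3 * p \<in> set (L u) then D p u + 1 + D v q else D p v + 1 + D u q)" for p q
  have R: "root_tour V e0 F nxt D s (L s)" if "s \<in> V" for s
    using T that by (simp add: tours_def)
  have same: "set (L q) = set (L s)" if "s \<in> V" "q \<in> V" "3 * q \<in> set (L s)" for s q
    using T that unfolding tours_def by blast
  have self: "3 * s \<in> set (L s)" if "s \<in> V" for s
    using root_tour_self[OF R[OF that]] .
  have xy: "darts_of (e0 + length F) = {x, y}" "darts_of (e0 + length F) = {y, x}"
    unfolding darts_of_def x y by auto
  have uv': "3 * u \<notin> set (L v)" using same[OF uv(2,1)] self[OF uv(2)] uv(3) by auto
  have excl: "\<not> (3 * p \<in> set (L u) \<and> 3 * p \<in> set (L v))" for p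
    using same uv self uv' root_tour_vertex[OF R] by metis
  have D'_same: "D' p q = D p q" if "3 * q \<in> set (L p)" for p q using that by (simp add: D'_def)
  have D'_cross: "D' p q = D p u + 1 + D v q" if "p \<in> V" "3 * p \<in> set (L u)" "3 * q \<in> set (L v)" for p q
    using that same[OF uv(1) that(1,2)] excl[of q] by (simp add: D'_def)
  have D'_cross': "D' p q = D p v + 1 + D u q" if "p \<in> V" "3 * p \<in> set (L v)" "3 * q \<in> set (L u)" for p q
    using that same[OF uv(2) that(1,2)] excl[of q] excl[of p] by (auto simp: D'_def)
  have x_ne: "x \<noteq> 3 * g" "y \<noteq> 3 * g" for g using x y by presburger+
  have "u \<noteq> v" using uv self by auto
  \<comment> \<open>The update is invariant under exchanging \<open>u\<close> with \<open>v\<close>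
    and \<open>x\<close> with \<open>y\<close>, which reduces the roots on the side of
    \<open>v\<close> to those on the side of \<open>u\<close>.\<close>
  then have nxt'_sym: "nxt' = nxt(3 * v := y, 3 * u := x, y := nxt (3 * u), x := nxt (3 * v))"
    using x_ne unfolding nxt'_def x y by (auto simp: fun_eq_iff)
  have main: "root_tour V e0 (F @ [(u, v)]) nxt' D' r (L' r) \<and>
      set (L' r) = (if 3 * u \<in> set (L r) \<or> 3 * v \<in> set (L r) then set (L u) \<union> set (L v) \<union> {x, y} else set (L r))"
    if r: "r \<in> V" for r
  proof -
    consider "3 * u \<in> set (L r)" | "3 * u \<notin> set (L r)" "3 * v \<in> set (L r)"
      | "3 * u \<notin> set (L r)" "3 * v \<notin> set (L r)" by blast
    then show ?thesis
    proof cases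
      case 1
      then have "L' r = splice (3 * u) x (3 * v) y (L r) (L v)" by (simp add: L'_def)
      then show ?thesis unfolding nxt'_def
        using root_tour_splice[OF T uv r 1 xy(1) _ D'_same D'_cross D'_cross', of u v] 1 by simp
    next
      case 2
      then have "L' r = splice (3 * v) y (3 * u) x (L r) (L u)" by (simp add: L'_def)
      then show ?thesis unfolding nxt'_sym
        using root_tour_splice[OF T uv(2,1) uv' r 2(2) xy(2) _ D'_same D'_cross' D'_cross, of u v] 2
        by auto
    next
      case 3
      then have L': "L' r = L r" by (simp add: L'_def)
      have "root_tour V e0 (F @ [(u, v)]) nxt' D' r (L r)"
      proof (rule root_tour_unaffected[OF R[OF r] 3])
        show "D' p q = D p q" if "3 * p \<in> set (L r)" "3 * q \<in> set (L r)" for p q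
          using D'_same that same[OF r root_tour_vertex[OF R[OF r] that(1)] that(1)] by simp
        show "nxt' z = nxt z" if "z \<in> set (L r)" for z
          using that 3 root_tour_fresh[OF R[OF r]] xy(1) unfolding nxt'_def by auto
      qed
      then show ?thesis using L' 3 by simp
    qed
  qed
  have "set (L' q) = set (L' r)" if rq: "r \<in> V" "q \<in> V" "3 * q \<in> set (L' r)" for r q
  proof (cases "3 * u \<in> set (L r) \<or> 3 * v \<in> set (L r)")
    case True
    then have "3 * q \<in> set (L u) \<or> 3 * q \<in> set (L v)"
      using rq(3) main[OF rq(1)] x_ne[of q] by auto
    then have "3 * u \<in> set (L q) \<or> 3 * v \<in> set (L q)" using same rq(2) uv self by metis
    then show ?thesis using main[OF rq(1)] main[OF rq(2)] True by simp
  next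
    case False
    then have "set (L q) = set (L r)" using same[OF rq(1,2)] rq(3) main[OF rq(1)] by simp
    then show ?thesis using main[OF rq(1)] main[OF rq(2)] False by simp
  qed
  then have "tours V e0 (F @ [(u, v)]) nxt' L' D'" unfolding tours_def using main by blast
  then show ?thesis unfolding nxt'_def by blast
qed

lemma tours_singletons:
  assumes "\<And>g. g \<in> V \<Longrightarrow> nxt (3 * g) = 3 * g"
  shows "\<exists>L D. tours V e0 [] nxt L D"
proof -
  have "noncrossing [3 * g]" for g
    unfolding noncrossing_def
  proof (intro allI impI)
    fix i j :: nat assume "i \<le> j"
    have "half_open {3 * g} = {}" using half_open_insert_vertex[of g "{}"] by simp
    then have "open_prefix [3 * g] j = {}" for j by (cases j) (simp_all add: open_prefix_def)
    with \<open>i \<le> j\<close> show "\<exists>l\<ge>i. l \<le> j \<and> open_prefix [3 * g] l \<subseteq> open_prefix [3 * g] i \<inter> open_prefix [3 * g] j"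
      by blast
  qed
  moreover have "{h. h = g} = {g}" for g :: nat by auto
  ultimately have "tours V e0 [] nxt (\<lambda>g. [3 * g]) (\<lambda>_ _. 0)"
    using assms unfolding tours_def root_tour_def cyclic_for_def edge_path_def
    by (auto intro!: exI[of _ "[_]"])
  then show ?thesis by blast
qed

section \<open>Heights and distances in one tree\<close>

locale listed_tree =
  fixes T :: "nat graph" and n off :: nat and es :: "(nat \<times> nat) list"
  assumes tree: "tree T" and verts: "verts T = {..<n}"
    and distinct_es: "distinct (map (\<lambda>(u, v). {u, v}) es)"
    and set_es: "set (map (\<lambda>(u, v). {u, v}) es) = edges T"
begin

text \<open>The vertices of all trees share one range of numbers, in which this tree starts at
  \<open>off\<close>.\<close>

definition F :: "(nat \<times> nat) list" where "F = map (\<lambda>(u, v). (off + u, off + v)) es"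

abbreviation V :: "nat set" where "V \<equiv> {off..<off + n}"

lemma n_pos: "n > 0"
proof -
  have "verts T \<noteq> {}" using tree by (simp add: tree_def connected_graph_def)
  then show ?thesis using verts by auto
qed

lemma es_edge: "(u, v) \<in> set es \<Longrightarrow> {u, v} \<in> edges T"
  using set_es by force

lemma es_vertex:
  assumes "(u, v) \<in> set es"
  shows "u < n" "v < n" "u \<noteq> v"
proof -
  have "{u, v} \<subseteq> verts T \<and> card {u, v} = 2"
    using es_edge[OF assms] tree by (auto simp: tree_def simple_graph_def)
  then have "{u, v} \<subseteq> {..<n}" "card {u, v} = 2" unfolding verts by blast+
  then show "u < n" "v < n" by simp_all
  show "u \<noteq> v" using \<open>card {u, v} = 2\<close> by (cases "u = v") simp_all
qed

lemma length_F: "length F = length es"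
  by (simp add: F_def)

lemma take_F_mem:
  assumes "(a, b) \<in> set (take m F)"
  shows "a \<ge> off" "b \<ge> off" "(a - off, b - off) \<in> set (take m es)"
  using assms by (auto simp: F_def take_map)

lemma edge_path_walk:
  assumes "edge_path (take m F) \<pi>" "set \<pi> \<subseteq> V"
  shows "walk T (map (\<lambda>g. g - off) \<pi>)" "distinct (map (\<lambda>g. g - off) \<pi>)"
proof -
  have "successively (\<lambda>a b. {a - off, b - off} \<in> edges T) \<pi>"
  proof (rule successively_mono)
    show "successively (\<lambda>a b. (a, b) \<in> set (take m F) \<or> (b, a) \<in> set (take m F)) \<pi>"
      using assms(1) by (simp add: edge_path_def)
    show "{a - off, b - off} \<in> edges T" if "(a, b) \<in> set (take m F) \<or> (b, a) \<in> set (take m F)" for a b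
    proof -
      have "(a - off, b - off) \<in> set es \<or> (b - off, a - off) \<in> set es"
        using that take_F_mem(3) set_take_subset[of m es] by blast
      then show ?thesis using es_edge[of "a - off" "b - off"] es_edge[of "b - off" "a - off"]
        by (auto simp: insert_commute)
    qed
  qed
  moreover have "set (map (\<lambda>g. g - off) \<pi>) \<subseteq> verts T"
    using assms(2) verts by fastforce
  ultimately show "walk T (map (\<lambda>g. g - off) \<pi>)"
    using assms(1) by (simp add: walk_def edge_path_def successively_map)
  have "inj_on (\<lambda>g. g - off) (set \<pi>)"
    by (rule inj_on_subset[OF _ assms(2)]) (auto simp: inj_on_def)
  then show "distinct (map (\<lambda>g. g - off) \<pi>)"
    using assms(1) by (simp add: distinct_map edge_path_def)
qed

lemma tours_vertex:
  assumes "tours V e0 F' nxt L D" "p \<in> V"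
  shows "root_tour V e0 F' nxt D p (L p)" "{g. 3 * g \<in> set (L p)} \<subseteq> V"
proof -
  show R: "root_tour V e0 F' nxt D p (L p)" using assms by (simp add: tours_def)
  show "{g. 3 * g \<in> set (L p)} \<subseteq> V" using root_tour_vertex[OF R] by blast
qed

text \<open>Otherwise the earlier edges contain a simple path from \<open>u\<close> to
  \<open>v\<close>. It does not have one vertex because \<open>u \<noteq> v\<close>, nor two because
  no edge is listed twice, and with three or more the new edge closes it to a cycle.\<close>

lemma next_edge_separates:
  assumes m: "m < length es" "es ! m = (u, v)" and T: "tours V e0 (take m F) nxt L D"
  shows "3 * (off + v) \<notin> set (L (off + u))"
proof
  assume *: "3 * (off + v) \<in> set (L (off + u))"
  have uv: "(u, v) \<in> set es" using m nth_mem by fastforce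
  have "off + u \<in> V" using es_vertex[OF uv] by simp
  note R = tours_vertex[OF T this]
  obtain \<pi> where \<pi>: "edge_path (take m F) \<pi>" "hd \<pi> = off + u" "last \<pi> = off + v" "set \<pi> \<subseteq> V"
    using root_tour.path[OF R(1) *] R(2) by blast
  let ?p = "map (\<lambda>g. g - off) \<pi>"
  have ne: "\<pi> \<noteq> []" using \<pi>(1) by (simp add: edge_path_def)
  have ends: "hd ?p = u" "last ?p = v" using \<pi>(2,3) ne by (simp_all add: hd_map last_map)
  have nin: "{u, v} \<notin> set (take m (map (\<lambda>(u, v). {u, v}) es))"
  proof
    assume "{u, v} \<in> set (take m (map (\<lambda>(u, v). {u, v}) es))"
    then obtain i where "i < m" "map (\<lambda>(u, v). {u, v}) es ! i = {u, v}"
      using m(1) by (auto simp: in_set_conv_nth)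
    then show False using distinct_es m
      by (metis (mono_tags, lifting) case_prod_conv length_map less_trans nat_neq_iff nth_eq_iff_index_eq nth_map)
  qed
  have "length \<pi> \<noteq> 1" using ends es_vertex(3)[OF uv] by (cases \<pi>) auto
  moreover have "length \<pi> \<noteq> 2"
  proof
    assume "length \<pi> = 2"
    then have "\<pi> = [off + u, off + v]" using \<pi>(2,3) by (cases \<pi>; cases "tl \<pi>") auto
    then have "(off + u, off + v) \<in> set (take m F) \<or> (off + v, off + u) \<in> set (take m F)"
      using \<pi>(1) by (simp add: edge_path_def)
    then have "(u, v) \<in> set (take m es) \<or> (v, u) \<in> set (take m es)"
      using take_F_mem(3) by fastforce
    then have "{u, v} \<in> (\<lambda>(u, v). {u, v}) ` set (take m es)" by force
    then show False using nin by (simp add: take_map)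
  qed
  moreover have "length \<pi> \<noteq> 0" using ne by simp
  ultimately have "length ?p \<ge> 3" by (simp; presburger)
  then have "graph_cycle T ?p"
    using edge_path_walk[OF \<pi>(1,4)] ends es_edge[OF uv] by (simp add: graph_cycle_def insert_commute)
  then show False using tree by (auto simp: tree_def)
qed

context
  fixes e0 nxt L D
  assumes T: "tours V e0 F nxt L D"
begin

text \<open>A tour contains both ends of an edge or neither, and by \<open>lip\<close> one step
  along an edge raises the distance from a fixed root by at most one. Adding this up along the walk
  shows that no walk is shorter than \<open>D\<close>; the paths stored in \<open>root_tour\<close>
  attain \<open>D\<close>.\<close>

lemma walk_reaches:
  assumes "walk T p"
  shows "3 * (off + last p) \<in> set (L (off + hd p))"
    and "r < n \<Longrightarrow> 3 * (off + hd p) \<in> set (L (off + r)) \<Longrightarrow> 3 * (off + last p) \<in> set (L (off + r)) \<and>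
      D (off + r) (off + last p) \<le> D (off + r) (off + hd p) + (length p - 1)"
proof -
  show main: "3 * (off + last p) \<in> set (L (off + r)) \<and>
      D (off + r) (off + last p) \<le> D (off + r) (off + hd p) + (length p - 1)"
    if "r < n" "3 * (off + hd p) \<in> set (L (off + r))" for r
    using assms that(2)
  proof (induction p rule: induct_list012)
    case 1
    then show ?case by (simp add: walk_def)
  next
    case (2 a)
    then show ?case by simp
  next
    case (3 a b zs)
    have R: "root_tour V e0 F nxt D (off + r) (L (off + r))"
      using tours_vertex(1)[OF T] that(1) by simp
    have "{a, b} \<in> edges T" using 3(3) by (simp add: walk_def)
    then have "{a, b} \<in> (\<lambda>(u, v). {u, v}) ` set es" using set_es by simp
    then obtain w where w: "{a, b} = (\<lambda>(u, v). {u, v}) w" "w \<in> set es" by (rule imageE)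
    obtain c d where "w = (c, d)" by fastforce
    with w have cd: "(c, d) \<in> set es" "{a, b} = {c, d}" by simp_all
    then have F: "(off + c, off + d) \<in> set F" by (force simp: F_def)
    then obtain j where "j < length F" "F ! j = (off + c, off + d)" by (metis in_set_conv_nth)
    then have iff: "3 * (off + c) \<in> set (L (off + r)) \<longleftrightarrow> 3 * (off + d) \<in> set (L (off + r))"
      using root_tour.edge[OF R, of j] by auto
    have ab: "(a = c \<and> b = d) \<or> (a = d \<and> b = c)" using cd(2) by (auto simp: doubleton_eq_iff)
    then have b: "3 * (off + b) \<in> set (L (off + r))" using iff 3(4) by auto
    have "D (off + r) (off + b) \<le> Suc (D (off + r) (off + a))"
      using root_tour.lip[OF R F] ab iff 3(4) by auto
    moreover have "walk T (b # zs)" using 3(3) by (simp add: walk_def)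
    ultimately show ?case using 3(2) b by fastforce
  qed
  have "hd p < n" using assms verts unfolding walk_def by (metis hd_in_set lessThan_iff subsetD)
  then have "off + hd p \<in> V" by simp
  from root_tour_self[OF tours_vertex(1)[OF T this]]
  have "3 * (off + hd p) \<in> set (L (off + hd p))" .
  then show "3 * (off + last p) \<in> set (L (off + hd p))" using main \<open>hd p < n\<close> by blast
qed

lemma tour_reaches_all:
  assumes "u < n" "v < n"
  shows "3 * (off + v) \<in> set (L (off + u))"
proof -
  obtain p where "walk T p" "hd p = u" "last p = v"
    using assms tree verts unfolding tree_def connected_graph_def by (metis lessThan_iff)
  then show ?thesis using walk_reaches(1) by blast
qed

lemma graph_dist_eq:
  assumes "u < n" "v < n"
  shows "graph_dist T u v = D (off + u) (off + v)"
proof -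
  have R: "root_tour V e0 F nxt D (off + u) (L (off + u))" using tours_vertex(1)[OF T] assms(1) by simp
  have "D (off + u) (off + u) = 0"
    using root_tour.gap[OF R root_tour_self[OF R] root_tour_self[OF R]] by simp
  then have lower: "D (off + u) (off + v) \<le> l" if "walk T p" "hd p = u" "last p = v" "length p = Suc l" for p l
    using walk_reaches(2)[OF that(1) assms(1)] root_tour_self[OF R] that by simp
  obtain \<pi> where \<pi>: "edge_path F \<pi>" "hd \<pi> = off + u" "last \<pi> = off + v"
    "length \<pi> = Suc (D (off + u) (off + v))" "set \<pi> \<subseteq> V"
    using root_tour.path[OF R tour_reaches_all[OF assms]] tours_vertex(2)[OF T, of "off + u"] assms(1)
    by (auto; blast)
  have "walk T (map (\<lambda>g. g - off) \<pi>)" using edge_path_walk(1)[of "length F"] \<pi>(1,5) by simp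
  moreover have "hd (map (\<lambda>g. g - off) \<pi>) = u" "last (map (\<lambda>g. g - off) \<pi>) = v"
    using \<pi> by (simp_all add: edge_path_def hd_map last_map)
  ultimately show ?thesis unfolding graph_dist_def
    by (intro Least_equality) (use \<pi>(4) lower in \<open>auto intro!: exI[of _ "map (\<lambda>g. g - off) \<pi>"]\<close>)
qed

definition M :: "nat list" where "M = L off"

text \<open>Measured when the element at index \<open>i\<close> has been passed. For a vertex this
  makes no difference; for a dart it is the depth of the vertex to which the dart leads.\<close>

definition height :: "nat \<Rightarrow> nat" where "height i = card (open_prefix M (Suc i))"

lemma root_tour_M: "root_tour V e0 F nxt D off M"
  unfolding M_def using tours_vertex(1)[OF T, of off] n_pos by simp

lemma M_vertices: "{g. 3 * g \<in> set M} = V"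
proof
  show "{g. 3 * g \<in> set M} \<subseteq> V" unfolding M_def using tours_vertex(2)[OF T, of off] n_pos by simp
  show "V \<subseteq> {g. 3 * g \<in> set M}"
  proof
    fix g assume "g \<in> V"
    then have "g = off + (g - off)" "g - off < n" by auto
    then show "g \<in> {g. 3 * g \<in> set M}"
      using tour_reaches_all[OF n_pos, of "g - off"] by (simp only: M_def mem_Collect_eq add_0_right)
  qed
qed

lemma length_M: "length M = 3 * n - 2"
  using root_tour.len[OF root_tour_M] M_vertices by simp

lemma M_darts: "(\<Union>j<length es. darts_of (e0 + j)) \<subseteq> set M"
proof -
  have "darts_of (e0 + j) \<subseteq> set M" if "j < length es" for j
  proof -
    obtain u v where "es ! j = (u, v)" by fastforce
    then have "u < n" using es_vertex(1) that by (metis nth_mem)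
    then have "off + u \<in> {g. 3 * g \<in> set M}" unfolding M_vertices by simp
    then have "3 * (off + u) \<in> set M" by simp
    moreover have "fst (F ! j) = off + u" using that \<open>es ! j = (u, v)\<close> by (simp add: F_def)
    ultimately show ?thesis using root_tour.edge[OF root_tour_M, of j] that length_F by auto
  qed
  then show ?thesis by blast
qed

text \<open>The tour contains two darts for each edge and all \<open>n\<close> vertices, and its
  length is \<open>3 * n - 2\<close>.\<close>

lemma length_es_le: "length es < n"
proof -
  let ?A = "(\<lambda>j. 3 * (e0 + j) + 1) ` {..<length es}" and ?B = "(\<lambda>j. 3 * (e0 + j) + 2) ` {..<length es}"
  let ?C = "(\<lambda>g. 3 * g) ` V"
  have sub: "?A \<union> ?B \<union> ?C \<subseteq> set M" using M_darts M_vertices by (auto simp: darts_of_def)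
  have ne: "?A \<inter> ?B = {}" "(?A \<union> ?B) \<inter> ?C = {}"
  proof -
    have sep: "X \<inter> Y = {}" if "\<And>z. z \<in> X \<Longrightarrow> f z \<in> N" "\<And>z. z \<in> Y \<Longrightarrow> f z \<notin> N"
      for X Y N :: "nat set" and f using that by blast
    have A: "z mod 3 = 1" if "z \<in> ?A" for z using that by (elim imageE) presburger
    have B: "z mod 3 = 2" if "z \<in> ?B" for z using that by (elim imageE) presburger
    have C: "z mod 3 = 0" if "z \<in> ?C" for z using that by (elim imageE) presburger
    show "?A \<inter> ?B = {}" by (rule sep[of _ "\<lambda>z. z mod 3" "{1}"]) (simp_all only: A B, simp_all)
    show "(?A \<union> ?B) \<inter> ?C = {}"
      by (rule sep[of _ "\<lambda>z. z mod 3" "{1, 2}"]) (use A B in blast, simp only: C, simp)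
  qed
  have "card (?A \<union> ?B \<union> ?C) = card ?A + card ?B + card ?C"
  proof -
    have "card (?A \<union> ?B \<union> ?C) = card (?A \<union> ?B) + card ?C"
      using ne(2) by (intro card_Un_disjoint) auto
    also have "card (?A \<union> ?B) = card ?A + card ?B"
      using ne(1) by (intro card_Un_disjoint) auto
    finally show ?thesis .
  qed
  also have "\<dots> = length es + length es + n"
    by (simp add: card_image inj_on_def)
  finally have "length es + length es + n \<le> card (set M)" using sub by (metis List.finite_set card_mono)
  also have "\<dots> \<le> 3 * n - 2" using length_M card_length[of M] by simp
  finally show ?thesis using n_pos by simp
qed

lemma M_nth_next: "Suc i < length M \<Longrightarrow> nxt (M ! i) = M ! Suc i"
proof -
  assume i: "Suc i < length M"
  have "successively (\<lambda>a b. nxt a = b) (M @ [hd M])"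
    using root_tour.cyclic[OF root_tour_M] by (simp add: cyclic_for_def)
  then have "nxt ((M @ [hd M]) ! i) = (M @ [hd M]) ! Suc i"
    using i successively_nth[of _ "M @ [hd M]" i] by auto
  then show ?thesis using i by (simp add: nth_append)
qed

lemma M_first: "M ! 0 = 3 * off"
  using root_tour.hd[OF root_tour_M] root_tour.nonempty[OF root_tour_M] by (simp add: hd_conv_nth)

lemma distinct_M: "distinct M"
  using root_tour.dist[OF root_tour_M] .

lemma open_prefix_Suc:
  assumes "i < length M"
  shows "open_prefix M (Suc i) = half_open (insert (M ! i) (set (take i M)))"
  using assms by (simp add: open_prefix_def take_Suc_conv_app_nth)

lemma M_nth_fresh: "i < length M \<Longrightarrow> M ! i \<notin> set (take i M)"
  using distinct_M by (auto simp: in_set_conv_nth nth_eq_iff_index_eq)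

lemma card_open_prefix_vertex:
  assumes "i < length M" "M ! i mod 3 = 0"
  shows "open_prefix M (Suc i) = open_prefix M i"
proof -
  have "M ! i = 3 * (M ! i div 3)" using div_mult_mod_eq[of "M ! i" 3] assms(2) by simp
  then have "half_open (insert (M ! i) (set (take i M))) = half_open (set (take i M))"
    using half_open_insert_vertex[of "M ! i div 3" "set (take i M)"] by (simp only:)
  then show ?thesis using open_prefix_Suc[OF assms(1)] by (simp only: open_prefix_def)
qed

text \<open>The program decides between going down and coming back by a mark on the edge, which is
  set exactly if one of the darts has been passed.\<close>

lemma card_open_prefix_dart:
  assumes "i < length M" "M ! i mod 3 \<noteq> 0"
  shows "height i = (if darts_of (M ! i div 3) \<inter> set (take i M) = {}
    then card (open_prefix M i) + 1 else card (open_prefix M i) - 1)"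
proof (cases "darts_of (M ! i div 3) \<inter> set (take i M) = {}")
  case True
  then have "M ! i div 3 \<notin> half_open (set (take i M))" by (auto simp: half_open_def darts_of_def)
  then show ?thesis using True half_open_insert_dart[OF assms(2) M_nth_fresh[OF assms(1)]]
      open_prefix_Suc[OF assms(1)]
    by (simp add: height_def open_prefix_def finite_half_open)
next
  case False
  have "M ! i \<in> darts_of (M ! i div 3)" using assms(2) unfolding darts_of_def by (simp; presburger)
  then have "M ! i div 3 \<in> half_open (set (take i M))"
    using False M_nth_fresh[OF assms(1)] by (auto simp: half_open_def darts_of_def)
  then show ?thesis using False half_open_insert_dart[OF assms(2) M_nth_fresh[OF assms(1)]]
      open_prefix_Suc[OF assms(1)]
    by (simp add: height_def open_prefix_def finite_half_open)
qed

lemma height_le: "height i \<le> i"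
proof (induction i)
  case 0
  then show ?case using card_open_prefix_vertex[of 0] M_first root_tour.nonempty[OF root_tour_M]
    by (simp add: height_def open_prefix_def)
next
  case (Suc i)
  show ?case
  proof (cases "Suc i < length M")
    case True
    then show ?thesis using Suc card_open_prefix_vertex[OF True] card_open_prefix_dart[OF True]
      by (cases "M ! Suc i mod 3 = 0") (auto simp: height_def split: if_splits)
  next
    case False
    then show ?thesis using Suc by (simp add: height_def open_prefix_def)
  qed
qed

text \<open>The distance is the size of a symmetric difference of two root paths, hence the sum of
  their lengths minus twice the number of shared edges. Shared edges stay open throughout the
  interval, and noncrossing provides a place where nothing else is open.\<close>

lemma graph_dist_height:
  assumes uv: "u < n" "v < n" and ij: "i \<le> j" "j < length M"
    and M: "M ! i = 3 * (off + u) \<and> M ! j = 3 * (off + v) \<or> M ! i = 3 * (off + v) \<and> M ! j = 3 * (off + u)"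
  shows "graph_dist T u v = height i + height j - 2 * Min (height ` {i..j})"
proof -
  let ?O = "open_prefix M"
  have fin: "finite (?O l)" for l by (simp add: open_prefix_def finite_half_open)
  have vertex: "M ! i mod 3 = 0" "M ! j mod 3 = 0" using M by auto
  have h: "height i = card (?O i)" "height j = card (?O j)"
    using card_open_prefix_vertex vertex ij by (simp_all add: height_def)
  have "off + u \<in> {g. 3 * g \<in> set M}" "off + v \<in> {g. 3 * g \<in> set M}"
    unfolding M_vertices using uv by simp_all
  then have mem: "3 * (off + u) \<in> set M" "3 * (off + v) \<in> set M" by simp_all
  have "graph_dist T u v = gap M (3 * (off + u)) (3 * (off + v))"
    using graph_dist_eq[OF uv] root_tour.gap[OF root_tour_M mem] by simp
  also have "\<dots> = gap M (M ! i) (M ! j)" using M gap_commute by auto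
  also have "\<dots> = card ((?O i - ?O j) \<union> (?O j - ?O i))"
    using open_prefix_eq_open_at[OF distinct_M] ij by (simp add: gap_def)
  also have "\<dots> = card (?O i - ?O j) + card (?O j - ?O i)"
    by (intro card_Un_disjoint) (auto simp: fin)
  also have "\<dots> = height i + height j - 2 * card (?O i \<inter> ?O j)"
  proof -
    have "card (?O i - ?O j) + card (?O i \<inter> ?O j) = card (?O i)"
      by (metis add.commute card_Diff_subset_Int card_mono fin finite_Int inf_le1 le_add_diff_inverse)
    moreover have "card (?O j - ?O i) + card (?O i \<inter> ?O j) = card (?O j)"
      by (metis add.commute card_Diff_subset_Int card_mono fin finite_Int inf_le1 inf_commute le_add_diff_inverse)
    ultimately show ?thesis using h by simp
  qed
  also have "card (?O i \<inter> ?O j) = Min (height ` {i..j})"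
  proof (rule antisym)
    have "card (?O i \<inter> ?O j) \<le> height l" if "i \<le> l" "l \<le> j" for l
    proof (cases "l = j")
      case True
      then show ?thesis using h fin by (simp add: card_mono)
    next
      case False
      have "?O i \<inter> ?O j \<subseteq> ?O (Suc l)" unfolding open_prefix_def
        using that False by (intro half_open_Int_between set_take_subset_set_take) auto
      then show ?thesis using fin by (simp add: height_def card_mono)
    qed
    then show "card (?O i \<inter> ?O j) \<le> Min (height ` {i..j})" using ij by simp
    obtain l where l: "i \<le> l" "l \<le> j" "?O l \<subseteq> ?O i \<inter> ?O j"
      using root_tour.noncross[OF root_tour_M] ij unfolding noncrossing_def by (meson less_imp_le)
    \<comment> \<open>\<open>height\<close> is indexed one lower than \<open>open_prefix\<close>, so
      \<open>l\<close> corresponds to \<open>l - 1\<close>. For \<open>l = i\<close> that would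
      leave the interval, but a vertex stands at \<open>i\<close> and passing it changes
      nothing.\<close>
    have "\<exists>k\<in>{i..j}. height k = card (?O l)"
    proof (cases "l = i")
      case True
      then show ?thesis using h ij by auto
    next
      case False
      then show ?thesis using l by (intro bexI[of _ "l - 1"]) (auto simp: height_def)
    qed
    then have "Min (height ` {i..j}) \<le> card (?O l)" by (metis Min_le finite_atLeastAtMost finite_imageI imageI)
    also have "\<dots> \<le> card (?O i \<inter> ?O j)" using l(3) fin by (intro card_mono) auto
    finally show "Min (height ` {i..j}) \<le> card (?O i \<inter> ?O j)" .
  qed
  finally show ?thesis .
qed

end

text \<open>The insertions are carried out abstractly, with the identity as initial successor
  function. This yields facts about the tree alone, such as the number of edges and a bound on
  distances, independently of any program run.\<close>

lemma tours_exist: "\<exists>nxt L D. tours V 0 F nxt L D"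
proof -
  have "\<exists>nxt L D. tours V 0 (take m F) nxt L D" if "m \<le> length es" for m
    using that
  proof (induction m)
    case 0
    then show ?case using tours_singletons[of V "\<lambda>z. z" 0] by auto
  next
    case (Suc m)
    then obtain nxt L D where T: "tours V 0 (take m F) nxt L D" by auto
    obtain u v where uv: "es ! m = (u, v)" by fastforce
    have m: "m < length es" using Suc.prems by simp
    have "(u, v) \<in> set es" using m uv nth_mem by metis
    from es_vertex(1,2)[OF this] have V: "off + u \<in> V" "off + v \<in> V" by simp_all
    have "take (Suc m) F = take m F @ [(off + u, off + v)]"
      using m uv by (simp add: F_def take_Suc_conv_app_nth)
    then show ?case
      using tours_insert_edge[OF T V next_edge_separates[OF m uv T] refl refl] by metis
  qed
  from this[OF order_refl] show ?thesis using length_F by (metis order_refl take_all)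
qed

lemma length_es_less: "length es < n"
  using tours_exist length_es_le by blast

lemma graph_dist_less:
  assumes "u < n" "v < n"
  shows "graph_dist T u v < n"
proof -
  obtain nxt L D where T: "tours V 0 F nxt L D" using tours_exist by blast
  have R: "root_tour V 0 F nxt D (off + u) (L (off + u))" using tours_vertex(1)[OF T] assms(1) by simp
  obtain \<pi> where \<pi>: "edge_path F \<pi>" "length \<pi> = Suc (D (off + u) (off + v))"
      "set \<pi> \<subseteq> {g. 3 * g \<in> set (L (off + u))}"
    using root_tour.path[OF R tour_reaches_all[OF T assms]] by blast
  have "set \<pi> \<subseteq> V" using \<pi>(3) tours_vertex(2)[OF T, of "off + u"] assms(1) by auto
  then have "card (set \<pi>) \<le> n" using card_mono[of V "set \<pi>"] by simp
  moreover have "card (set \<pi>) = length \<pi>" using \<pi>(1) by (simp add: edge_path_def distinct_card)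
  ultimately show ?thesis using \<pi>(2) graph_dist_eq[OF T assms] by simp
qed

end

section \<open>Constructing the tour\<close>

fun block :: "com list \<Rightarrow> com" where
  "block [] = Skip"
| "block (c # cs) = Seq c (block cs)"

definition Mod :: "expr \<Rightarrow> expr \<Rightarrow> expr" where
  "Mod e1 e2 = Sub e1 (Mul (Div e1 e2) e2)"

lemma val_Mod [simp]: "val xs \<sigma> (Mod e1 e2) = val xs \<sigma> e1 mod val xs \<sigma> e2"
  by (simp add: Mod_def minus_div_mult_eq_mod)

definition height_dist :: "(nat \<Rightarrow> nat) \<Rightarrow> nat \<Rightarrow> nat \<Rightarrow> nat" where
  "height_dist H a b = H a + H b - 2 * Min (H ` {min a b..max a b})"

text \<open>Arrays: 0 tour successors, 1 edge marks, 2 positions of vertices, 3 heights by position,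
  4 vertex offsets of the trees, 5 powers of two, 6 block minima, 7 dictionary. Registers: 0 answer,
  1 \<open>k\<close>, 2 input pointer, 3 to 5 offsets of vertices, edges and positions, 17 to 19
  \<open>B\<close>, \<open>2 ^ B\<close> and \<open>J\<close>, 20 number of tuples, 22 current
  combination, 24 to 26 key, weight and unread digits, 33 threshold, 34 step of the binary search,
  35 success flag, 36 pointer to the current tuple. Here each vertex becomes a cycle of one
  element.\<close>

definition init_code :: com where
  "init_code = Store 0 (Mul (Num 3) (Add (Reg 3) (Reg 9))) (Mul (Num 3) (Add (Reg 3) (Reg 9)))"

text \<open>The machine version of \<open>splice\<close>. The old successors of both end points are
  saved in registers 15 and 16 and then become, crosswise, the successors of the new darts.\<close>

definition edge_code :: com where
  "edge_code = block
    [Assign 13 (Mul (Num 3) (Add (Reg 3) (Inp (Reg 2)))),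
     Assign 14 (Mul (Num 3) (Add (Reg 3) (Inp (Add (Reg 2) (Num 1))))),
     Assign 15 (Arr 0 (Reg 13)),
     Assign 16 (Arr 0 (Reg 14)),
     Store 0 (Reg 13) (Add (Mul (Num 3) (Reg 4)) (Num 1)),
     Store 0 (Reg 14) (Add (Mul (Num 3) (Reg 4)) (Num 2)),
     Store 0 (Add (Mul (Num 3) (Reg 4)) (Num 1)) (Reg 16),
     Store 0 (Add (Mul (Num 3) (Reg 4)) (Num 2)) (Reg 15),
     Assign 4 (Add (Reg 4) (Num 1)),
     Assign 2 (Add (Reg 2) (Num 2))]"

text \<open>Two positions are written per tour element, with the same height. Array 2 remembers the
  first one of each vertex; its neighbour is reserved for queries.\<close>

definition walk_code :: com where
  "walk_code = block
    [Cond (Mod (Reg 10) (Num 3))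
       (Seq (Cond (Arr 1 (Div (Reg 10) (Num 3)))
              (Assign 11 (Sub (Reg 11) (Num 1)))
              (Assign 11 (Add (Reg 11) (Num 1))))
            (Store 1 (Div (Reg 10) (Num 3)) (Num 1)))
       (Store 2 (Div (Reg 10) (Num 3)) (Reg 5)),
     Store 3 (Reg 5) (Reg 11),
     Store 3 (Add (Reg 5) (Num 1)) (Reg 11),
     Assign 5 (Add (Reg 5) (Num 2)),
     Assign 10 (Arr 0 (Reg 10))]"

definition tree_head_code :: com where
  "tree_head_code = block
    [Assign 7 (Inp (Reg 2)), Assign 8 (Inp (Add (Reg 2) (Num 1))),
     Assign 2 (Add (Reg 2) (Num 2)), Store 4 (Reg 6) (Reg 3)]"

definition tree_mid_code :: com where
  "tree_mid_code = block
    [Assign 10 (Mul (Num 3) (Reg 3)), Assign 11 (Num 0),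
     Assign 12 (Sub (Mul (Num 3) (Reg 7)) (Num 2))]"

definition tree_code :: com where
  "tree_code =
     Seq tree_head_code (Seq (For 9 7 init_code) (Seq (For 9 8 edge_code)
       (Seq tree_mid_code (Seq (For 9 12 walk_code) (Assign 3 (Add (Reg 3) (Reg 7)))))))"

definition same_except :: "nat set \<Rightarrow> nat set \<Rightarrow> state \<Rightarrow> state \<Rightarrow> bool" where
  "same_except R A \<sigma> \<tau> \<longleftrightarrow> (\<forall>r. r \<notin> R \<longrightarrow> fst \<tau> r = fst \<sigma> r) \<and> (\<forall>a. a \<notin> A \<longrightarrow> snd \<tau> a = snd \<sigma> a)"

lemma tree_weight_bound:
  fixes a b c d e l m w N :: nat
  assumes "l < N" "m \<le> 3 * N"
  shows "a + ((N * (b + 10) + 10) + ((l * (c + 10) + 10) + (d + ((m * (w + 10) + 10) + e)))) \<le>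
    N * (a + (b + 20) + (c + 20) + d + (3 * w + 40) + e)"
proof -
  have le: "x \<le> N * x" for x using assms by (cases N) auto
  have "l * (c + 10) \<le> N * (c + 10)" "m * (w + 10) \<le> (3 * N) * (w + 10)"
    using assms by (intro mult_le_mono1; simp)+
  then show ?thesis using le[of a] le[of d] le[of e] le[of 10]
    by (simp only: add_mult_distrib2)
qed

definition tree_weight :: nat where
  "tree_weight = com_weight tree_head_code + (com_weight init_code + 20) + (com_weight edge_code + 20) +
     com_weight tree_mid_code + (3 * com_weight walk_code + 40) + com_weight (Assign 3 (Add (Reg 3) (Reg 7)))"

locale tree_program = listed_tree +
  fixes xs :: "nat list" and W p e0 P0 :: nat
  assumes input: "p + 2 + 2 * length es \<le> length xs" "xs ! p = n" "xs ! (p + 1) = length es"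
      "\<And>j. j < length es \<Longrightarrow> xs ! (p + 2 + 2 * j) = fst (es ! j)"
      "\<And>j. j < length es \<Longrightarrow> xs ! (p + 2 + 2 * j + 1) = snd (es ! j)"
    and W: "3 * (off + n) \<le> W" "3 * (e0 + length es) + 2 \<le> W" "P0 + 6 * n \<le> W" "p + 2 + 2 * length es \<le> W"
begin

abbreviation bnd :: "state \<Rightarrow> bool" where "bnd \<equiv> bounded_state xs W"

lemma runs_init:
  assumes "bnd \<sigma>" "fst \<sigma> 3 = off" "fst \<sigma> 7 = n"
  shows "runs xs W (For 9 7 init_code) \<sigma> (n * (com_weight init_code + 10) + 10)
    (\<lambda>\<tau>. same_except {9} {0} \<sigma> \<tau> \<and> (\<forall>g\<in>V. snd \<tau> 0 (3 * g) = 3 * g))"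
proof -
  let ?I = "\<lambda>j \<tau>. same_except {9} {0} \<sigma> \<tau> \<and> (\<forall>c<j. snd \<tau> 0 (3 * (off + c)) = 3 * (off + c))"
  have "runs xs W (For 9 7 init_code) \<sigma> (n * (com_weight init_code + 10) + 10)
    (\<lambda>\<rho>. fst \<rho> 7 = n \<and> ?I n \<rho>)"
  proof (rule runs_For[where I = ?I])
    fix j \<tau> assume j: "j < n" "fst \<tau> 9 = j" "fst \<tau> 7 = n" "bnd \<tau>" "?I j \<tau>"
    obtain f A where \<tau>: "\<tau> = (f, A)" by fastforce
    have f3: "f 3 = off" using j(5) assms \<tau> by (simp add: same_except_def)
    have sem: "sem xs init_code \<tau> = (f, A(0 := (A 0)(3 * (off + j) := 3 * (off + j))))"
      using j \<tau> f3 by (simp add: init_code_def)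
    show "runs xs W init_code \<tau> (com_weight init_code)
      (\<lambda>\<rho>. fst \<rho> 9 = j \<and> fst \<rho> 7 = n \<and> ?I (Suc j) ((fst \<rho>)(9 := Suc j), snd \<rho>))"
    proof (rule runs_block)
      show "loop_free init_code" by (simp add: init_code_def)
      show "bnd \<tau>" by (rule j)
      show "bnd (sem xs init_code \<tau>)"
        unfolding sem using j \<tau> W(1) by (intro bounded_state_arr) auto
      show "fst (sem xs init_code \<tau>) 9 = j \<and> fst (sem xs init_code \<tau>) 7 = n \<and>
        ?I (Suc j) ((fst (sem xs init_code \<tau>))(9 := Suc j), snd (sem xs init_code \<tau>))"
        unfolding sem using j \<tau> by (auto simp: same_except_def less_Suc_eq)
    qed
  qed (use assms in \<open>simp_all add: same_except_def\<close>)
  then show ?thesis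
  proof (rule runs_mono)
    fix \<tau> assume *: "fst \<tau> 7 = n \<and> ?I n \<tau>"
    have "snd \<tau> 0 (3 * g) = 3 * g" if "g \<in> V" for g
    proof -
      have "g = off + (g - off)" "g - off < n" using that by auto
      then show ?thesis using * by metis
    qed
    then show "same_except {9} {0} \<sigma> \<tau> \<and> (\<forall>g\<in>V. snd \<tau> 0 (3 * g) = 3 * g)" using * by blast
  qed simp
qed

text \<open>Memory contains the successor function only; the lists and distances live in the
  invariant, existentially quantified. That the next edge joins different components is where
  acyclicity of the tree enters.\<close>

lemma runs_edges:
  assumes "bnd \<sigma>" "fst \<sigma> 2 = p + 2" "fst \<sigma> 3 = off" "fst \<sigma> 4 = e0" "fst \<sigma> 8 = length es"
    and "\<And>g. g \<in> V \<Longrightarrow> snd \<sigma> 0 (3 * g) = 3 * g"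
  shows "runs xs W (For 9 8 edge_code) \<sigma> (length es * (com_weight edge_code + 10) + 10)
    (\<lambda>\<tau>. same_except {2, 4, 9, 13, 14, 15, 16} {0} \<sigma> \<tau> \<and> fst \<tau> 2 = p + 2 + 2 * length es \<and>
       fst \<tau> 4 = e0 + length es \<and> (\<exists>L D. tours V e0 F (snd \<tau> 0) L D))"
proof -
  let ?I = "\<lambda>j \<tau>. same_except {2, 4, 9, 13, 14, 15, 16} {0} \<sigma> \<tau> \<and> fst \<tau> 2 = p + 2 + 2 * j \<and>
       fst \<tau> 4 = e0 + j \<and> (\<exists>L D. tours V e0 (take j F) (snd \<tau> 0) L D)"
  have "runs xs W (For 9 8 edge_code) \<sigma> (length es * (com_weight edge_code + 10) + 10)
    (\<lambda>\<rho>. fst \<rho> 8 = length es \<and> ?I (length es) \<rho>)"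
  proof (rule runs_For[where I = ?I])
    show "?I 0 ((fst \<sigma>)(9 := 0), snd \<sigma>)"
      using assms tours_singletons[of V "snd \<sigma> 0" e0] by (simp add: same_except_def)
  next
    fix j \<tau> assume j: "j < length es" "fst \<tau> 9 = j" "fst \<tau> 8 = length es" "bnd \<tau>" "?I j \<tau>"
    obtain f A where \<tau>: "\<tau> = (f, A)" by fastforce
    obtain L D where T: "tours V e0 (take j F) (A 0) L D" using j(5) \<tau> by auto
    obtain u v where uv: "es ! j = (u, v)" by fastforce
    have uvn: "u < n" "v < n" "u \<noteq> v" using es_vertex[of u v] uv j(1) nth_mem by metis+
    have f: "f 2 = p + 2 + 2 * j" "f 3 = off" "f 4 = e0 + j"
      using j(5) assms \<tau> by (simp_all add: same_except_def)
    have inp: "p + 2 + 2 * j + 1 < length xs" "xs ! (p + 2 + 2 * j) = u" "xs ! (p + 2 + 2 * j + 1) = v"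
      using input j(1) uv by auto
    define a b x y where "a = 3 * (off + u)" and "b = 3 * (off + v)"
      and "x = 3 * (e0 + j) + 1" and "y = 3 * (e0 + j) + 2"
    have ne: "a \<noteq> b" using uvn by (simp add: a_def b_def)
    define A' where "A' = (A 0)(a := x, b := y, x := A 0 b, y := A 0 a)"
    define f' where "f' = f(13 := a, 14 := b, 15 := A 0 a, 16 := A 0 b, 4 := e0 + j + 1, 2 := p + 2 + 2 * j + 2)"
    have sem: "sem xs edge_code \<tau> = (f', A(0 := A'))"
      using \<tau> f inp by (simp add: edge_code_def A'_def f'_def a_def b_def x_def y_def fun_upd_twist)
    have "3 * (off + v) \<notin> set (L (off + u))" by (rule next_edge_separates[OF j(1) uv T])
    moreover have "take (Suc j) F = take j F @ [(off + u, off + v)]"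
      using j(1) uv by (simp add: F_def take_Suc_conv_app_nth)
    moreover have "length (take j F) = j" using j(1) length_F by simp
    ultimately have T': "\<exists>L D. tours V e0 (take (Suc j) F) A' L D"
      using tours_insert_edge[OF T, of "off + u" "off + v" x y] uvn
      unfolding A'_def a_def b_def x_def y_def by simp
    show "runs xs W edge_code \<tau> (com_weight edge_code)
      (\<lambda>\<rho>. fst \<rho> 9 = j \<and> fst \<rho> 8 = length es \<and> ?I (Suc j) ((fst \<rho>)(9 := Suc j), snd \<rho>))"
    proof (rule runs_block)
      show "loop_free edge_code" by (simp add: edge_code_def)
      show "bnd \<tau>" by (rule j)
      have le: "a \<le> W" "b \<le> W" "x \<le> W" "y \<le> W" "e0 + j + 1 \<le> W" "p + 2 + 2 * j + 2 \<le> W"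
        using W uvn j(1) by (auto simp: a_def b_def x_def y_def)
      have "A(0 := A') = (((A(0 := (A 0)(a := x)))(0 := ((A(0 := (A 0)(a := x))) 0)(b := y)))
        (0 := (A 0)(a := x, b := y, x := A 0 b)))(0 := A')"
        by simp
      have "bnd (f, A)" using j(4) \<tau> by simp
      then have b: "\<And>r. f r \<le> W" "\<And>a i. A a i \<le> W" "\<forall>x\<in>set xs. x \<le> W"
        by (auto simp: bounded_state_def)
      show "bnd (sem xs edge_code \<tau>)"
        unfolding sem bounded_state_def f'_def A'_def using b le by auto
      show "fst (sem xs edge_code \<tau>) 9 = j \<and> fst (sem xs edge_code \<tau>) 8 = length es \<and>
        ?I (Suc j) ((fst (sem xs edge_code \<tau>))(9 := Suc j), snd (sem xs edge_code \<tau>))"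
        unfolding sem using j \<tau> T' by (auto simp: same_except_def f'_def)
    qed
  qed (use assms in simp_all)
  then show ?thesis using length_F by (elim runs_mono) auto
qed

text \<open>Edge numbers are never reused from tree to tree, so marks need not be cleared: those
  from \<open>e0\<close> on are zero before the walk, those from \<open>e0 + length es\<close> on
  after it.\<close>

lemma runs_walk:
  assumes "bnd \<sigma>" "fst \<sigma> 5 = P0" "fst \<sigma> 10 = 3 * off" "fst \<sigma> 11 = 0" "fst \<sigma> 12 = 3 * n - 2"
    and T: "tours V e0 F (snd \<sigma> 0) L D"
    and marks: "\<And>e. e \<ge> e0 \<Longrightarrow> snd \<sigma> 1 e = 0"
  shows "runs xs W (For 9 12 walk_code) \<sigma> ((3 * n - 2) * (com_weight walk_code + 10) + 10)
    (\<lambda>\<tau>. same_except {5, 9, 10, 11} {1, 2, 3} \<sigma> \<tau> \<and> fst \<tau> 5 = P0 + 2 * (3 * n - 2) \<and>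
       (\<forall>e\<ge>e0 + length es. snd \<tau> 1 e = 0) \<and>
       (\<forall>l<3 * n - 2. M L ! l mod 3 = 0 \<longrightarrow> snd \<tau> 2 (M L ! l div 3) = P0 + 2 * l) \<and>
       (\<forall>g. g \<notin> V \<longrightarrow> snd \<tau> 2 g = snd \<sigma> 2 g) \<and>
       (\<forall>l<3 * n - 2. snd \<tau> 3 (P0 + 2 * l) = height L l \<and> snd \<tau> 3 (P0 + 2 * l + 1) = height L l) \<and>
       (\<forall>q. q < P0 \<or> P0 + 2 * (3 * n - 2) \<le> q \<longrightarrow> snd \<tau> 3 q = snd \<sigma> 3 q))"
proof -
  note R = root_tour_M[OF T]
  let ?N = "3 * n - 2"
  have lenM: "length (M L) = ?N" by (rule length_M[OF T])
  let ?I = "\<lambda>j \<tau>. same_except {5, 9, 10, 11} {1, 2, 3} \<sigma> \<tau> \<and> fst \<tau> 5 = P0 + 2 * j \<and>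
       (j < ?N \<longrightarrow> fst \<tau> 10 = M L ! j) \<and> fst \<tau> 11 = card (open_prefix (M L) j) \<and>
       (\<forall>e\<ge>e0. snd \<tau> 1 e \<noteq> 0 \<longleftrightarrow> darts_of e \<inter> set (take j (M L)) \<noteq> {}) \<and>
       (\<forall>l<j. M L ! l mod 3 = 0 \<longrightarrow> snd \<tau> 2 (M L ! l div 3) = P0 + 2 * l) \<and>
       (\<forall>g. g \<notin> V \<longrightarrow> snd \<tau> 2 g = snd \<sigma> 2 g) \<and>
       (\<forall>l<j. snd \<tau> 3 (P0 + 2 * l) = height L l \<and> snd \<tau> 3 (P0 + 2 * l + 1) = height L l) \<and>
       (\<forall>q. q < P0 \<or> P0 + 2 * j \<le> q \<longrightarrow> snd \<tau> 3 q = snd \<sigma> 3 q)"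
  have "runs xs W (For 9 12 walk_code) \<sigma> (?N * (com_weight walk_code + 10) + 10)
    (\<lambda>\<rho>. fst \<rho> 12 = ?N \<and> ?I ?N \<rho>)"
  proof (rule runs_For[where I = ?I])
    show "?I 0 ((fst \<sigma>)(9 := 0), snd \<sigma>)"
      using assms M_first[OF T] marks by (simp add: same_except_def open_prefix_def)
  next
    fix j \<tau> assume j: "j < ?N" "fst \<tau> 9 = j" "fst \<tau> 12 = ?N" "bnd \<tau>" "?I j \<tau>"
    obtain f A where \<tau>: "\<tau> = (f, A)" by fastforce
    define z where "z = M L ! j"
    define h where "h = height L j"
    have jM: "j < length (M L)" using j(1) lenM by simp
    have same: "same_except {5, 9, 10, 11} {1, 2, 3} \<sigma> (f, A)"
      and f5: "f 5 = P0 + 2 * j" and f10: "j < ?N \<longrightarrow> f 10 = M L ! j"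
      and f11: "f 11 = card (open_prefix (M L) j)"
      and marks_j': "\<forall>e\<ge>e0. A 1 e \<noteq> 0 \<longleftrightarrow> darts_of e \<inter> set (take j (M L)) \<noteq> {}"
      and pos: "\<forall>l<j. M L ! l mod 3 = 0 \<longrightarrow> A 2 (M L ! l div 3) = P0 + 2 * l"
      and pos': "\<forall>g. g \<notin> V \<longrightarrow> A 2 g = snd \<sigma> 2 g"
      and ht: "\<forall>l<j. A 3 (P0 + 2 * l) = height L l \<and> A 3 (P0 + 2 * l + 1) = height L l"
      and ht': "\<forall>q. q < P0 \<or> P0 + 2 * j \<le> q \<longrightarrow> A 3 q = snd \<sigma> 3 q"
      using j(5)[unfolded \<tau> fst_conv snd_conv] by - (elim conjE, assumption)+
    have f: "f 5 = P0 + 2 * j" "f 10 = z" "f 11 = card (open_prefix (M L) j)" "A 0 = snd \<sigma> 0"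
      using f5 f10 f11 j(1) same by (simp_all add: same_except_def z_def)
    have marks_j: "A 1 e \<noteq> 0 \<longleftrightarrow> darts_of e \<inter> set (take j (M L)) \<noteq> {}" if "e \<ge> e0" for e
      using marks_j' that by blast
    define e where "e = z div 3"
    have next_z: "A 0 z = M L ! Suc j" if "Suc j < ?N"
      using M_nth_next[OF T, of j] that lenM f(4) by (simp add: z_def)
    have take_Suc: "set (take (Suc j) (M L)) = insert z (set (take j (M L)))"
      using jM by (simp add: take_Suc_conv_app_nth z_def)
    define A1 where "A1 = (if z mod 3 = 0 then A 1 else (A 1)(e := 1))"
    define A2 where "A2 = (if z mod 3 = 0 then (A 2)(e := P0 + 2 * j) else A 2)"
    define A3 where "A3 = (A 3)(P0 + 2 * j := h, P0 + 2 * j + 1 := h)"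
    define f' where "f' = f(11 := h, 5 := P0 + 2 * j + 2, 10 := A 0 z)"
    have z_dart: "e0 \<le> e \<and> e < e0 + length es \<and> z \<in> darts_of e" if "z mod 3 \<noteq> 0"
    proof -
      have zM: "z \<in> set (M L)" using jM by (simp add: z_def)
      have ze: "z \<in> darts_of e" using that unfolding darts_of_def e_def by (simp; presburger)
      obtain l where "l < length F" "e = e0 + l" by (rule root_tour_dart[OF R zM ze])
      then show ?thesis using ze length_F by linarith
    qed
    have z_vertex: "z = 3 * e \<and> e \<in> V" if "z mod 3 = 0"
    proof -
      have "z = 3 * e" using that div_mult_mod_eq[of z 3] by (simp add: e_def)
      moreover have "z \<in> set (M L)" using jM by (simp add: z_def)
      ultimately show ?thesis using root_tour_vertex[OF R] by blast
    qed
    have h_dart: "h = (if A 1 e \<noteq> 0 then f 11 - 1 else f 11 + 1)" if "z mod 3 \<noteq> 0"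
      using card_open_prefix_dart[OF T jM] that z_dart[OF that] marks_j[of e] f(3)
      by (simp add: h_def z_def e_def)
    have h_vertex: "h = f 11" if "z mod 3 = 0"
      using card_open_prefix_vertex[OF T jM] that f(3) by (simp add: h_def height_def[OF T] z_def)
    have sem: "sem xs walk_code \<tau> = (f', A(1 := A1, 2 := A2, 3 := A3))"
    proof (cases "z mod 3 = 0")
      case True
      then show ?thesis using \<tau> f h_vertex
        by (auto simp: walk_code_def f'_def A1_def A2_def A3_def e_def fun_eq_iff)
    next
      case False
      then show ?thesis using \<tau> f h_dart
        by (auto simp: walk_code_def f'_def A1_def A2_def A3_def e_def fun_eq_iff)
    qed
    have hW: "h \<le> P0 + 6 * n" using height_le[OF T, of j] j(1) by (simp add: h_def)
    show "runs xs W walk_code \<tau> (com_weight walk_code)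
      (\<lambda>\<rho>. fst \<rho> 9 = j \<and> fst \<rho> 12 = ?N \<and> ?I (Suc j) ((fst \<rho>)(9 := Suc j), snd \<rho>))"
    proof (rule runs_block)
      show "loop_free walk_code" by (simp add: walk_code_def)
      show "bnd \<tau>" by (rule j)
      have "bnd (f, A)" using j(4) \<tau> by simp
      then have b: "\<And>r. f r \<le> W" "\<And>a i. A a i \<le> W" "\<forall>x\<in>set xs. x \<le> W"
        by (auto simp: bounded_state_def)
      have "h \<le> W" "P0 + 2 * j + 2 \<le> W" "P0 + 2 * j \<le> W" "1 \<le> W" using hW W j(1) by auto
      then show "bnd (sem xs walk_code \<tau>)"
        unfolding sem bounded_state_def f'_def A1_def A2_def A3_def using b by auto
      have 1: "same_except {5, 9, 10, 11} {1, 2, 3} \<sigma> (f'(9 := Suc j), A(1 := A1, 2 := A2, 3 := A3))"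
        using same by (simp add: same_except_def f'_def)
      have 2: "A1 e' \<noteq> 0 \<longleftrightarrow> darts_of e' \<inter> set (take (Suc j) (M L)) \<noteq> {}" if "e' \<ge> e0" for e'
      proof (cases "z mod 3 = 0")
        case True
        then have "z \<notin> darts_of e'" using z_vertex vertex_not_dart by metis
        then show ?thesis using True marks_j[OF that] unfolding take_Suc A1_def by auto
      next
        case False
        show ?thesis
        proof (cases "e' = e")
          case True
          then show ?thesis using False z_dart unfolding take_Suc A1_def by auto
        next
          case ne: False
          then have "z \<notin> darts_of e'" using z_dart[OF False] darts_of_disjoint by blast
          then show ?thesis using False ne marks_j[OF that] unfolding take_Suc A1_def by auto
        qed
      qed
      have 3: "A2 (M L ! l div 3) = P0 + 2 * l" if "l < Suc j" "M L ! l mod 3 = 0" for l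
      proof (cases "l = j")
        case True
        then show ?thesis using that by (simp add: A2_def z_def e_def)
      next
        case False
        then have "M L ! l \<noteq> z" unfolding z_def
          using that jM distinct_M[OF T] by (simp add: nth_eq_iff_index_eq)
        then have "z mod 3 = 0 \<longrightarrow> M L ! l div 3 \<noteq> e"
          using that(2) z_vertex div_mult_mod_eq[of "M L ! l" 3] by auto
        then show ?thesis using that False pos by (simp add: A2_def)
      qed
      have 4: "A2 g = snd \<sigma> 2 g" if "g \<notin> V" for g
        using that pos' z_vertex by (auto simp: A2_def)
      have 5: "A3 (P0 + 2 * l) = height L l \<and> A3 (P0 + 2 * l + 1) = height L l" if "l < Suc j" for l
      proof (cases "l = j")
        case True
        then show ?thesis by (simp add: A3_def h_def)
      next
        case False
        then have "A 3 (P0 + 2 * l) = height L l \<and> A 3 (P0 + 2 * l + 1) = height L l"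
          using that ht False by simp
        moreover have "P0 + 2 * l \<noteq> P0 + 2 * j + 1" "P0 + 2 * l + 1 \<noteq> P0 + 2 * j" by presburger+
        ultimately show ?thesis using False by (simp add: A3_def)
      qed
      have 6: "A3 q = snd \<sigma> 3 q" if "q < P0 \<or> P0 + 2 * Suc j \<le> q" for q
        using that ht' by (auto simp: A3_def)
      have 7: "f' 11 = card (open_prefix (M L) (Suc j))" by (simp add: f'_def h_def height_def[OF T])
      have 8: "Suc j < ?N \<longrightarrow> f' 10 = M L ! Suc j" "f' 5 = P0 + 2 * Suc j"
        using next_z by (simp_all add: f'_def)
      have I: "?I (Suc j) (f'(9 := Suc j), A(1 := A1, 2 := A2, 3 := A3))"
        using 1 2 3 4 5 6 7 8 by (intro conjI allI impI) simp_all
      have 9: "f' 9 = j" "f' 12 = ?N" using j(2,3) \<tau> by (simp_all add: f'_def)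
      show "fst (sem xs walk_code \<tau>) 9 = j \<and> fst (sem xs walk_code \<tau>) 12 = ?N \<and>
        ?I (Suc j) ((fst (sem xs walk_code \<tau>))(9 := Suc j), snd (sem xs walk_code \<tau>))"
        unfolding sem fst_conv snd_conv by (rule conjI[OF 9(1) conjI[OF 9(2) I[unfolded fst_conv snd_conv]]])
    qed
  qed (use assms in simp_all)
  then show ?thesis
  proof (rule runs_mono)
    fix \<tau> assume *: "fst \<tau> 12 = ?N \<and> ?I ?N \<tau>"
    then have marked: "\<forall>e\<ge>e0. snd \<tau> 1 e \<noteq> 0 \<longleftrightarrow> darts_of e \<inter> set (take ?N (M L)) \<noteq> {}"
      by - (elim conjE, assumption)
    have "snd \<tau> 1 e = 0" if "e \<ge> e0 + length es" for e
    proof -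
      have "darts_of e \<inter> set (M L) = {}"
      proof (rule equals0I)
        fix z assume "z \<in> darts_of e \<inter> set (M L)"
        then have z: "z \<in> set (M L)" "z \<in> darts_of e" by auto
        obtain l where "l < length F" "e = e0 + l" by (rule root_tour_dart[OF R z])
        then show False using that length_F by simp
      qed
      moreover have "take ?N (M L) = M L" using lenM by simp
      moreover have "e \<ge> e0" using that by simp
      ultimately show ?thesis using marked by metis
    qed
    then show "same_except {5, 9, 10, 11} {1, 2, 3} \<sigma> \<tau> \<and> fst \<tau> 5 = P0 + 2 * (3 * n - 2) \<and>
       (\<forall>e\<ge>e0 + length es. snd \<tau> 1 e = 0) \<and>
       (\<forall>l<3 * n - 2. M L ! l mod 3 = 0 \<longrightarrow> snd \<tau> 2 (M L ! l div 3) = P0 + 2 * l) \<and>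
       (\<forall>g. g \<notin> V \<longrightarrow> snd \<tau> 2 g = snd \<sigma> 2 g) \<and>
       (\<forall>l<3 * n - 2. snd \<tau> 3 (P0 + 2 * l) = height L l \<and> snd \<tau> 3 (P0 + 2 * l + 1) = height L l) \<and>
       (\<forall>q. q < P0 \<or> P0 + 2 * (3 * n - 2) \<le> q \<longrightarrow> snd \<tau> 3 q = snd \<sigma> 3 q)"
      using * by simp
  qed simp
qed

text \<open>Writing every height twice does not change the set of heights in an interval, hence not
  its minimum either.\<close>

lemma image_heights:
  assumes "\<forall>l<N. h (P0 + 2 * l) = g l \<and> h (P0 + 2 * l + 1) = g l" "P0 \<le> a" "a \<le> b" "b < P0 + 2 * N"
  shows "h ` {a..b} = g ` {(a - P0) div 2..(b - P0) div 2}"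
proof -
  have h: "h q = g ((q - P0) div 2)" if "P0 \<le> q" "q < P0 + 2 * N" for q
  proof -
    have "q = P0 + 2 * ((q - P0) div 2) \<or> q = P0 + 2 * ((q - P0) div 2) + 1" "(q - P0) div 2 < N"
      using that by presburger+
    then show ?thesis using assms(1) by metis
  qed
  show ?thesis
  proof (intro equalityI subsetI)
    fix z assume "z \<in> h ` {a..b}"
    then obtain q where "q \<in> {a..b}" "z = h q" by blast
    then show "z \<in> g ` {(a - P0) div 2..(b - P0) div 2}"
      using h[of q] assms by (intro image_eqI[of _ _ "(q - P0) div 2"]) (auto intro!: div_le_mono)
  next
    fix z assume "z \<in> g ` {(a - P0) div 2..(b - P0) div 2}"
    then obtain l where l: "(a - P0) div 2 \<le> l" "l \<le> (b - P0) div 2" "z = g l" by auto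
    \<comment> \<open>If \<open>a\<close> is the second copy of an element, then
      \<open>P0 + 2 * l\<close> may lie just in front of the interval.\<close>
    define q where "q = max a (P0 + 2 * l)"
    have "(q - P0) div 2 = l" "a \<le> q" "q \<le> b" unfolding q_def using l assms(2,3)
      by (auto simp: max_def; linarith)+
    then show "z \<in> h ` {a..b}" using h[of q] assms l(3) by (intro image_eqI[of _ _ q]) auto
  qed
qed

definition tree_table :: "(nat \<Rightarrow> nat) \<Rightarrow> (nat \<Rightarrow> nat) \<Rightarrow> bool" where
  "tree_table pos H \<longleftrightarrow> (\<forall>u<n. P0 \<le> pos (off + u) \<and> pos (off + u) + 1 < P0 + 2 * (3 * n - 2) \<and>
     (\<forall>v<n. pos (off + u) \<noteq> pos (off + v) + 1 \<and>
       height_dist H (pos (off + u)) (pos (off + v) + 1) = graph_dist T u v))"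

lemma tree_table_tour:
  assumes T: "tours V e0 F nxt L D"
    and pos: "\<forall>l<3 * n - 2. M L ! l mod 3 = 0 \<longrightarrow> pos (M L ! l div 3) = P0 + 2 * l"
    and ht: "\<forall>l<3 * n - 2. H (P0 + 2 * l) = height L l \<and> H (P0 + 2 * l + 1) = height L l"
  shows "tree_table pos H"
proof -
  let ?N = "3 * n - 2"
  have ex: "\<exists>l<?N. M L ! l = 3 * (off + u) \<and> pos (off + u) = P0 + 2 * l" if "u < n" for u
  proof -
    have "off + u \<in> {g. 3 * g \<in> set (M L)}" unfolding M_vertices[OF T] using that by simp
    then have "3 * (off + u) \<in> set (M L)" by blast
    then obtain l where l: "l < ?N" "M L ! l = 3 * (off + u)"
      using length_M[OF T] by (metis in_set_conv_nth)
    have "M L ! l mod 3 = 0" "M L ! l div 3 = off + u" unfolding l(2) by simp_all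
    then show ?thesis using l pos by metis
  qed
  have dist: "height_dist H (P0 + 2 * i) (P0 + 2 * j + 1) = graph_dist T u v"
    if uv: "u < n" "v < n" and ij: "i < ?N" "j < ?N" "M L ! i = 3 * (off + u)" "M L ! j = 3 * (off + v)"
    for u v i j
  proof (cases "i \<le> j")
    case True
    have "H ` {P0 + 2 * i..P0 + 2 * j + 1} = height L ` {i..j}"
      using image_heights[OF ht, of "P0 + 2 * i" "P0 + 2 * j + 1"] True ij by simp
    then show ?thesis
      using True ij ht graph_dist_height[OF T uv True] length_M[OF T] by (simp add: height_dist_def)
  next
    case False
    have "H ` {P0 + 2 * j + 1..P0 + 2 * i} = height L ` {j..i}"
      using image_heights[OF ht, of "P0 + 2 * j + 1" "P0 + 2 * i"] False ij by simp
    then show ?thesis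
      using False ij ht graph_dist_height[OF T uv, of j i] length_M[OF T] by (simp add: height_dist_def)
  qed
  show ?thesis unfolding tree_table_def
  proof (intro allI impI conjI)
    fix u assume "u < n"
    then obtain i where i: "i < ?N" "M L ! i = 3 * (off + u)" "pos (off + u) = P0 + 2 * i" using ex by blast
    show "P0 \<le> pos (off + u)" "pos (off + u) + 1 < P0 + 2 * ?N" using i by simp_all
    fix v assume "v < n"
    then obtain j where j: "j < ?N" "M L ! j = 3 * (off + v)" "pos (off + v) = P0 + 2 * j" using ex by blast
    show "pos (off + u) \<noteq> pos (off + v) + 1" unfolding i(3) j(3) by presburger
    show "height_dist H (pos (off + u)) (pos (off + v) + 1) = graph_dist T u v"
      unfolding i(3) j(3) by (rule dist[OF \<open>u < n\<close> \<open>v < n\<close> i(1) j(1) i(2) j(2)])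
  qed
qed

lemma runs_tree:
  assumes b: "bnd \<sigma>" and f: "fst \<sigma> 2 = p" "fst \<sigma> 3 = off" "fst \<sigma> 4 = e0" "fst \<sigma> 5 = P0"
    and marks: "\<And>e. e \<ge> e0 \<Longrightarrow> snd \<sigma> 1 e = 0"
  shows "runs xs W tree_code \<sigma> (n * tree_weight)
    (\<lambda>\<tau>. same_except ({2, 3, 4, 5} \<union> {7..16}) {0, 1, 2, 3, 4} \<sigma> \<tau> \<and>
       fst \<tau> 2 = p + 2 + 2 * length es \<and> fst \<tau> 3 = off + n \<and> fst \<tau> 4 = e0 + length es \<and>
       fst \<tau> 5 = P0 + 2 * (3 * n - 2) \<and> length es < n \<and>
       (\<forall>e\<ge>e0 + length es. snd \<tau> 1 e = 0) \<and> snd \<tau> 4 = (snd \<sigma> 4)(fst \<sigma> 6 := off) \<and>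
       (\<forall>g. g \<notin> V \<longrightarrow> snd \<tau> 2 g = snd \<sigma> 2 g) \<and>
       (\<forall>q. q < P0 \<or> P0 + 2 * (3 * n - 2) \<le> q \<longrightarrow> snd \<tau> 3 q = snd \<sigma> 3 q) \<and>
       (\<forall>q. P0 \<le> q \<and> q < P0 + 2 * (3 * n - 2) \<longrightarrow> snd \<tau> 3 q \<le> q) \<and>
       tree_table (snd \<tau> 2) (snd \<tau> 3))" (is "runs _ _ _ _ _ ?Q")
proof -
  obtain f0 A0 where \<sigma>: "\<sigma> = (f0, A0)" by fastforce
  have WW: "p + 2 \<le> W" "n \<le> W" "length es \<le> W" "off \<le> W" "3 * off \<le> W" "3 * n - 2 \<le> W" using W by auto
  have 1: "runs xs W tree_head_code \<sigma> (com_weight tree_head_code) (\<lambda>\<tau>. \<tau> =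
      (f0(7 := n, 8 := length es, 2 := p + 2), A0(4 := (A0 4)(f0 6 := off))))" (is "runs _ _ _ _ _ ?Q1")
  proof (rule runs_block)
    have sem: "sem xs tree_head_code \<sigma> = (f0(7 := n, 8 := length es, 2 := p + 2), A0(4 := (A0 4)(f0 6 := off)))"
      using \<sigma> f input by (simp add: tree_head_code_def)
    show "?Q1 (sem xs tree_head_code \<sigma>)" using sem .
    show "bnd (sem xs tree_head_code \<sigma>)" unfolding sem
      using b \<sigma> WW by (intro bounded_state_arr bounded_state_reg) auto
  qed (use b in \<open>simp_all add: tree_head_code_def\<close>)
  have "runs xs W tree_code \<sigma> (com_weight tree_head_code + ((n * (com_weight init_code + 10) + 10) +
     ((length es * (com_weight edge_code + 10) + 10) + (com_weight tree_mid_code +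
     (((3 * n - 2) * (com_weight walk_code + 10) + 10) + com_weight (Assign 3 (Add (Reg 3) (Reg 7)))))))) ?Q"
    unfolding tree_code_def
  proof (rule runs_Seq[OF 1], rule runs_Seq[OF runs_init], goal_cases)
    case (4 \<tau>1 \<tau>2)
    have s2: "same_except {2, 7, 8, 9} {0, 4} \<sigma> \<tau>2" "snd \<tau>2 4 = (A0 4)(f0 6 := off)"
      "fst \<tau>2 2 = p + 2" "fst \<tau>2 7 = n" "fst \<tau>2 8 = length es"
      using 4(2,4) \<sigma> by (auto simp: same_except_def)
    show ?case
    proof (rule runs_Seq[OF runs_edges], goal_cases)
      case (7 \<tau>3)
      then obtain L D where T: "tours V e0 F (snd \<tau>3 0) L D" by blast
      have s3: "same_except ({2, 4} \<union> {7..16}) {0, 4} \<sigma> \<tau>3" "snd \<tau>3 4 = (A0 4)(f0 6 := off)"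
        "fst \<tau>3 7 = n" "fst \<tau>3 2 = p + 2 + 2 * length es" "fst \<tau>3 4 = e0 + length es"
        using 7(2) s2 by (auto simp: same_except_def)
      obtain f3 A3 where \<tau>3: "\<tau>3 = (f3, A3)" by fastforce
      have f35: "f3 5 = P0" "\<forall>e\<ge>e0. A3 1 e = 0"
        using s3(1) f(4) marks \<tau>3 by (simp_all add: same_except_def)
      have 2: "runs xs W tree_mid_code \<tau>3 (com_weight tree_mid_code) (\<lambda>\<tau>. \<tau> =
          (f3(10 := 3 * off, 11 := 0, 12 := 3 * n - 2), A3))" (is "runs _ _ _ _ _ ?Q1")
      proof (rule runs_block)
        have sem: "sem xs tree_mid_code \<tau>3 = (f3(10 := 3 * off, 11 := 0, 12 := 3 * n - 2), A3)"
          using \<tau>3 s3 f by (simp add: tree_mid_code_def same_except_def)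
        show "?Q1 (sem xs tree_mid_code \<tau>3)" using sem .
        show "bnd (sem xs tree_mid_code \<tau>3)" unfolding sem
          using 7(1) \<tau>3 WW by (intro bounded_state_arr bounded_state_reg) auto
      qed (use 7 in \<open>simp_all add: tree_mid_code_def\<close>)
      show ?case
      proof (rule runs_Seq[OF 2], rule runs_Seq[OF runs_walk[where L = L and D = D]], goal_cases)
        case (8 \<tau>4 \<tau>5)
        have s5: "same_except ({2, 4, 5} \<union> {7..16}) {0, 1, 2, 3, 4} \<sigma> \<tau>5" "snd \<tau>5 4 = (A0 4)(f0 6 := off)"
          "fst \<tau>5 7 = n" "fst \<tau>5 2 = p + 2 + 2 * length es" "fst \<tau>5 4 = e0 + length es"
          "snd \<tau>4 2 = snd \<sigma> 2" "snd \<tau>4 3 = snd \<sigma> 3"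
          using 8(2,4) s3 \<tau>3 by (auto simp: same_except_def)
        obtain f5 A5 where \<tau>5: "\<tau>5 = (f5, A5)" by fastforce
        have f53: "f5 3 = off" using s5(1) \<tau>5 f by (simp add: same_except_def)
        have same: "same_except {5, 9, 10, 11} {1, 2, 3} \<tau>4 \<tau>5"
          and P5: "fst \<tau>5 5 = P0 + 2 * (3 * n - 2)"
          and m5: "\<forall>e\<ge>e0 + length es. snd \<tau>5 1 e = 0"
          and pos: "\<forall>l<3 * n - 2. M L ! l mod 3 = 0 \<longrightarrow> snd \<tau>5 2 (M L ! l div 3) = P0 + 2 * l"
          and pos': "\<forall>g. g \<notin> V \<longrightarrow> snd \<tau>5 2 g = snd \<tau>4 2 g"
          and ht: "\<forall>l<3 * n - 2. snd \<tau>5 3 (P0 + 2 * l) = height L l \<and> snd \<tau>5 3 (P0 + 2 * l + 1) = height L l"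
          and ht': "\<forall>q. q < P0 \<or> P0 + 2 * (3 * n - 2) \<le> q \<longrightarrow> snd \<tau>5 3 q = snd \<tau>4 3 q"
          using 8(4) by - (elim conjE, assumption)+
        have table: "tree_table (snd \<tau>5 2) (snd \<tau>5 3)" by (rule tree_table_tour[OF T pos ht])
        have small: "snd \<tau>5 3 q \<le> q" if "P0 \<le> q \<and> q < P0 + 2 * (3 * n - 2)" for q
        proof -
          have "q = P0 + 2 * ((q - P0) div 2) \<or> q = P0 + 2 * ((q - P0) div 2) + 1" "(q - P0) div 2 < 3 * n - 2"
            using that by presburger+
          then have "snd \<tau>5 3 q = height L ((q - P0) div 2)" using ht by metis
          also have "\<dots> \<le> (q - P0) div 2" by (rule height_le[OF T])
          finally show ?thesis by (simp; linarith)
        qed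
        show ?case
        proof (rule runs_block)
          have sem: "sem xs (Assign 3 (Add (Reg 3) (Reg 7))) \<tau>5 = (f5(3 := off + n), A5)"
            using \<tau>5 f53 s5(3) by simp
          show "bnd (sem xs (Assign 3 (Add (Reg 3) (Reg 7))) \<tau>5)" unfolding sem
            using 8(3) \<tau>5 W by (intro bounded_state_reg) auto
          have "same_except ({2, 3, 4, 5} \<union> {7..16}) {0, 1, 2, 3, 4} \<sigma> (f5(3 := off + n), A5)"
            using s5(1) \<tau>5 by (auto simp: same_except_def)
          moreover have "length es < n" by (rule length_es_le[OF T])
          ultimately show "?Q (sem xs (Assign 3 (Add (Reg 3) (Reg 7))) \<tau>5)" unfolding sem fst_conv snd_conv
            using s5(2,4-7) P5 m5 pos' ht' table small \<tau>5 \<sigma> by simp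
        qed (use 8 in simp_all)
      qed (use f35 T \<tau>3 in simp_all)
    qed (use 4 s2 f in \<open>auto simp: same_except_def\<close>)
  qed (use f \<sigma> in auto)
  then show ?thesis
  proof (cases "length es < n")
    case True
    assume *: "runs xs W tree_code \<sigma> (com_weight tree_head_code + ((n * (com_weight init_code + 10) + 10) +
     ((length es * (com_weight edge_code + 10) + 10) + (com_weight tree_mid_code +
     (((3 * n - 2) * (com_weight walk_code + 10) + 10) + com_weight (Assign 3 (Add (Reg 3) (Reg 7)))))))) ?Q"
    show ?thesis
      unfolding tree_weight_def using True by (intro runs_mono[OF *] tree_weight_bound) simp_all
  next
    case False
    assume "runs xs W tree_code \<sigma> (com_weight tree_head_code + ((n * (com_weight init_code + 10) + 10) +
     ((length es * (com_weight edge_code + 10) + 10) + (com_weight tree_mid_code +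
     (((3 * n - 2) * (com_weight walk_code + 10) + 10) + com_weight (Assign 3 (Add (Reg 3) (Reg 7)))))))) ?Q"
    then show ?thesis using False unfolding runs_def by blast
  qed
qed

end

lemma concat_pairs_nth:
  assumes "j < length es"
  shows "concat (map (\<lambda>(u, v). [u, v]) es) ! (2 * j) = fst (es ! j)"
    and "concat (map (\<lambda>(u, v). [u, v]) es) ! (2 * j + 1) = snd (es ! j)"
  using assms
proof (induction es arbitrary: j)
  case (Cons e es)
  {
    case 1
    then show ?case using Cons.IH(1)[of "j - 1"] by (cases j) (auto split: prod.splits)
  next
    case 2
    then show ?case using Cons.IH(2)[of "j - 1"] by (cases j) (auto split: prod.splits)
  }
qed simp_all

lemma length_concat_pairs: "length (concat (map (\<lambda>(u, v). [u, v]) es)) = 2 * length es"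
  by (induction es) auto

definition parse_code :: com where
  "parse_code = Seq (Seq (Assign 1 (Inp (Num 0))) (Assign 2 (Num 1))) (For 6 1 tree_code)"

section \<open>The system of trees in memory\<close>

locale forest =
  fixes Ts :: "nat graph list" and gs :: "nat list list" and es :: "nat \<Rightarrow> (nat \<times> nat) list"
    and xs rest :: "nat list" and W :: nat
  assumes length_gs: "length gs = length Ts"
    and tree: "\<And>i. i < length Ts \<Longrightarrow> tree (Ts ! i)"
    and verts: "\<And>i. i < length Ts \<Longrightarrow> verts (Ts ! i) = {..<card (verts (Ts ! i))}"
    and distinct_es: "\<And>i. i < length Ts \<Longrightarrow> distinct (map (\<lambda>(u, v). {u, v}) (es i))"
    and set_es: "\<And>i. i < length Ts \<Longrightarrow> set (map (\<lambda>(u, v). {u, v}) (es i)) = edges (Ts ! i)"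
    and gs_nth: "\<And>i. i < length Ts \<Longrightarrow> gs ! i =
        card (verts (Ts ! i)) # length (es i) # concat (map (\<lambda>(u, v). [u, v]) (es i))"
    and xs: "xs = length Ts # concat gs @ rest"
begin

abbreviation k :: nat where "k \<equiv> length Ts"

definition n :: "nat \<Rightarrow> nat" where "n i = card (verts (Ts ! i))"
definition off :: "nat \<Rightarrow> nat" where "off i = (\<Sum>j<i. n j)"
definition edge_off :: "nat \<Rightarrow> nat" where "edge_off i = (\<Sum>j<i. length (es j))"
definition pos_off :: "nat \<Rightarrow> nat" where "pos_off i = (\<Sum>j<i. 2 * (3 * n j - 2))"
definition ptr :: "nat \<Rightarrow> nat" where "ptr i = 1 + (\<Sum>j<i. 2 + 2 * length (es j))"

abbreviation N :: nat where "N \<equiv> off k"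

lemma listed: "i < k \<Longrightarrow> listed_tree (Ts ! i) (n i) (es i)"
  unfolding listed_tree_def n_def using tree verts distinct_es set_es by auto

lemma n_pos: "i < k \<Longrightarrow> n i > 0"
  by (rule listed_tree.n_pos[OF listed])

lemma length_es_less: "i < k \<Longrightarrow> length (es i) < n i"
  by (rule listed_tree.length_es_less[OF listed])

lemma off_mono: "i \<le> j \<Longrightarrow> off i \<le> off j"
  unfolding off_def by (intro sum_mono2) auto

lemma pos_off_mono: "i \<le> j \<Longrightarrow> pos_off i \<le> pos_off j"
  unfolding pos_off_def by (intro sum_mono2) auto

lemma edge_off_le: "i \<le> k \<Longrightarrow> edge_off i \<le> off i"
proof -
  assume "i \<le> k"
  show ?thesis unfolding edge_off_def off_def
  proof (rule sum_mono)
    fix j assume "j \<in> {..<i}"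
    then show "length (es j) \<le> n j" using length_es_less[of j] \<open>i \<le> k\<close> by simp
  qed
qed

lemma ptr_le: "i \<le> k \<Longrightarrow> ptr i \<le> 1 + 2 * off i"
proof -
  assume "i \<le> k"
  have "(\<Sum>j<i. 2 + 2 * length (es j)) \<le> (\<Sum>j<i. 2 * n j)"
  proof (rule sum_mono)
    fix j assume "j \<in> {..<i}"
    then show "2 + 2 * length (es j) \<le> 2 * n j" using length_es_less[of j] \<open>i \<le> k\<close> by simp
  qed
  then show ?thesis by (simp add: ptr_def off_def sum_distrib_left)
qed

lemma pos_off_le: "pos_off i \<le> 6 * off i"
  unfolding pos_off_def off_def sum_distrib_left by (intro sum_mono) simp

lemma pos_off_ge: "i \<le> k \<Longrightarrow> 2 * off i \<le> pos_off i"
proof -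
  assume "i \<le> k"
  show ?thesis unfolding pos_off_def off_def sum_distrib_left
  proof (rule sum_mono)
    fix j assume "j \<in> {..<i}"
    then show "2 * n j \<le> 2 * (3 * n j - 2)" using n_pos[of j] \<open>i \<le> k\<close> by simp
  qed
qed

lemma k_le_N: "k \<le> N"
proof -
  have "(\<Sum>j<k. 1) \<le> N" unfolding off_def
  proof (rule sum_mono)
    fix j assume "j \<in> {..<k}"
    then show "1 \<le> n j" using n_pos[of j] by simp
  qed
  then show ?thesis by simp
qed

lemma xs_drop:
  assumes "i \<le> k"
  shows "drop (ptr i) xs = concat (drop i gs) @ rest"
  using assms
proof (induction i)
  case 0
  then show ?case by (simp add: ptr_def xs)
next
  case (Suc i)
  have "ptr (Suc i) = length (gs ! i) + ptr i"
    using Suc.prems gs_nth[of i] by (simp add: ptr_def length_concat_pairs)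
  then have "drop (ptr (Suc i)) xs = drop (length (gs ! i)) (drop (ptr i) xs)"
    by (simp add: add.commute)
  also have "\<dots> = drop (length (gs ! i)) (concat (drop i gs) @ rest)"
    using Suc by simp
  also have "drop i gs = gs ! i # drop (Suc i) gs"
    using Suc.prems length_gs by (simp add: Cons_nth_drop_Suc)
  finally show ?case by simp
qed

lemma xs_nth:
  assumes "i < k"
  shows "xs ! (ptr i + l) = (gs ! i @ concat (drop (Suc i) gs) @ rest) ! l"
    and "ptr i + length (gs ! i) \<le> length xs"
proof -
  have "drop i gs = gs ! i # drop (Suc i) gs"
    using assms length_gs by (simp add: Cons_nth_drop_Suc)
  then have d: "drop (ptr i) xs = gs ! i @ concat (drop (Suc i) gs) @ rest"
    using xs_drop[of i] assms by simp
  have "gs ! i \<noteq> []" using gs_nth[OF assms] by simp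
  then have "drop (ptr i) xs \<noteq> []" using d by simp
  then have le: "ptr i \<le> length xs" by simp
  have "length (drop (ptr i) xs) = length (gs ! i @ concat (drop (Suc i) gs) @ rest)" by (simp only: d)
  then show "ptr i + length (gs ! i) \<le> length xs" using le by simp
  have "drop (ptr i) xs ! l = xs ! (ptr i + l)" by (rule nth_drop) (rule le)
  then show "xs ! (ptr i + l) = (gs ! i @ concat (drop (Suc i) gs) @ rest) ! l" using d by simp
qed

text \<open>The bound \<open>8 * N + 4\<close> covers all numbers that arise while a tree is read:
  vertices and darts are about three times an offset, positions reach \<open>6 * N\<close>, and the
  input pointer \<open>1 + 2 * N\<close>.\<close>

lemma program:
  assumes "i < k" "8 * N + 4 \<le> W"
  shows "tree_program (Ts ! i) (n i) (off i) (es i) xs W (ptr i) (edge_off i) (pos_off i)"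
proof -
  have g: "gs ! i = n i # length (es i) # concat (map (\<lambda>(u, v). [u, v]) (es i))"
    using gs_nth[OF assms(1)] by (simp add: n_def)
  have len: "length (gs ! i) = 2 + 2 * length (es i)" using g by (simp add: length_concat_pairs)
  have at: "xs ! (ptr i + l) = (gs ! i) ! l" if "l < 2 + 2 * length (es i)" for l
    using xs_nth(1)[OF assms(1)] len that by (simp add: nth_append)
  have off_Suc: "off (Suc i) = off i + n i" "edge_off (Suc i) = edge_off i + length (es i)"
    "pos_off i + 2 * (3 * n i - 2) = pos_off (Suc i)" "ptr (Suc i) = ptr i + 2 + 2 * length (es i)"
    by (simp_all add: off_def edge_off_def pos_off_def ptr_def)
  have le: "off (Suc i) \<le> N" using assms by (intro off_mono) simp
  have "edge_off (Suc i) \<le> off (Suc i)" "ptr (Suc i) \<le> 1 + 2 * off (Suc i)" "pos_off i \<le> 6 * off i"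
    using assms by (intro edge_off_le ptr_le pos_off_le; simp)+
  then have "3 * off (Suc i) \<le> W" "3 * edge_off (Suc i) + 2 \<le> W" "pos_off i + 6 * n i \<le> W" "ptr (Suc i) \<le> W"
    using le assms(2) off_Suc(1) by auto
  then have W: "3 * (off i + n i) \<le> W" "3 * (edge_off i + length (es i)) + 2 \<le> W" "pos_off i + 6 * n i \<le> W"
    "ptr i + 2 + 2 * length (es i) \<le> W"
    unfolding off_Suc by blast+
  show ?thesis
  proof (intro tree_program.intro tree_program_axioms.intro listed[OF assms(1)] W)
    show "ptr i + 2 + 2 * length (es i) \<le> length xs"
      using xs_nth(2)[OF assms(1)] len by simp
    show "xs ! ptr i = n i" using at[of 0] g by simp
    show "xs ! (ptr i + 1) = length (es i)" using at[of 1] g by simp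
    fix j assume j: "j < length (es i)"
    have "xs ! (ptr i + (2 + 2 * j)) = fst (es i ! j)"
      using at[of "2 + 2 * j"] j concat_pairs_nth(1)[OF j] g by simp
    then show "xs ! (ptr i + 2 + 2 * j) = fst (es i ! j)" by (simp add: add.assoc)
    have "xs ! (ptr i + (2 + 2 * j + 1)) = snd (es i ! j)"
      using at[of "2 + 2 * j + 1"] j concat_pairs_nth(2)[OF j] g by simp
    then show "xs ! (ptr i + 2 + 2 * j + 1) = snd (es i ! j)" by (simp add: add.assoc)
  qed
qed

text \<open>Distances are recorded only between the first position of one vertex and the second
  position of another one, since a data vertex is only ever compared with a query vertex.\<close>

definition placed :: "nat \<Rightarrow> (nat \<Rightarrow> nat) \<Rightarrow> (nat \<Rightarrow> nat) \<Rightarrow> bool" where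
  "placed i pos H \<longleftrightarrow> (\<forall>u<n i. pos (off i + u) + 1 < pos_off (Suc i) \<and>
     (\<forall>v<n i. pos (off i + u) \<noteq> pos (off i + v) + 1 \<and>
       height_dist H (pos (off i + u)) (pos (off i + v) + 1) = graph_dist (Ts ! i) u v))"

lemma placed_cong:
  assumes "placed i pos H" and "\<And>g. g < off (Suc i) \<Longrightarrow> pos' g = pos g"
    and "\<And>q. q < pos_off (Suc i) \<Longrightarrow> H' q = H q"
  shows "placed i pos' H'"
proof -
  have pos': "pos' (off i + u) = pos (off i + u)" if "u < n i" for u
    using assms(2) that by (simp add: off_def)
  have "height_dist H' (pos (off i + u)) (pos (off i + v) + 1) = height_dist H (pos (off i + u)) (pos (off i + v) + 1)"
    if "u < n i" "v < n i" for u v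
  proof -
    let ?a = "pos (off i + u)" and ?b = "pos (off i + v) + 1"
    have ab: "?a < pos_off (Suc i)" "?b < pos_off (Suc i)"
      using assms(1) that unfolding placed_def by auto
    then have "H' ` {min ?a ?b..max ?a ?b} = H ` {min ?a ?b..max ?a ?b}"
      using assms(3) by (intro image_cong) auto
    then show ?thesis using assms(3) ab by (simp add: height_dist_def)
  qed
  then show ?thesis using assms(1) unfolding placed_def by (simp add: pos')
qed

definition parse_inv :: "nat \<Rightarrow> state \<Rightarrow> bool" where
  "parse_inv i \<tau> \<longleftrightarrow> fst \<tau> 2 = ptr i \<and> fst \<tau> 3 = off i \<and> fst \<tau> 4 = edge_off i \<and> fst \<tau> 5 = pos_off i \<and>
     (\<forall>e\<ge>edge_off i. snd \<tau> 1 e = 0) \<and> (\<forall>j<i. snd \<tau> 4 j = off j) \<and>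
     (\<forall>j<i. placed j (snd \<tau> 2) (snd \<tau> 3)) \<and>
     (\<forall>q. snd \<tau> 3 q \<le> q) \<and> (\<forall>q\<ge>pos_off i. snd \<tau> 3 q = 0) \<and>
     (\<forall>r. r \<notin> {1..16} \<longrightarrow> fst \<tau> r = 0) \<and> (\<forall>a. a \<notin> {0..4} \<longrightarrow> snd \<tau> a = (\<lambda>_. 0))"

lemma parse_inv_step:
  assumes i: "i < k" and W: "8 * N + 4 \<le> W" and \<tau>: "bounded_state xs W \<tau>" "parse_inv i \<tau>" "fst \<tau> 6 = i"
  shows "runs xs W tree_code \<tau> (N * tree_weight)
    (\<lambda>\<rho>. fst \<rho> 6 = i \<and> fst \<rho> 1 = fst \<tau> 1 \<and> parse_inv (Suc i) ((fst \<rho>)(6 := Suc i), snd \<rho>))"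
proof -
  interpret tree_program "Ts ! i" "n i" "off i" "es i" xs W "ptr i" "edge_off i" "pos_off i"
    by (rule program[OF i W])
  have f: "fst \<tau> 2 = ptr i" "fst \<tau> 3 = off i" "fst \<tau> 4 = edge_off i" "fst \<tau> 5 = pos_off i"
    and marks: "\<forall>e\<ge>edge_off i. snd \<tau> 1 e = 0" and offs: "\<forall>j<i. snd \<tau> 4 j = off j"
    and tabs: "\<forall>j<i. placed j (snd \<tau> 2) (snd \<tau> 3)"
    and ht: "\<forall>q. snd \<tau> 3 q \<le> q" "\<forall>q\<ge>pos_off i. snd \<tau> 3 q = 0"
    and zero: "\<forall>r. r \<notin> {1..16} \<longrightarrow> fst \<tau> r = 0" "\<forall>a. a \<notin> {0..4} \<longrightarrow> snd \<tau> a = (\<lambda>_. 0)"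
    using \<tau>(2) unfolding parse_inv_def by - (elim conjE, assumption)+
  have Suc: "off (Suc i) = off i + n i" "edge_off (Suc i) = edge_off i + length (es i)"
    "pos_off (Suc i) = pos_off i + 2 * (3 * n i - 2)" "ptr (Suc i) = ptr i + 2 + 2 * length (es i)"
    by (simp_all add: off_def edge_off_def pos_off_def ptr_def)
  have "n i \<le> N" using off_mono[of "Suc i" k] i Suc(1) by simp
  then have "n i * tree_weight \<le> N * tree_weight" by (rule mult_le_mono1)
  have mk: "snd \<tau> 1 e = 0" if "e \<ge> edge_off i" for e using marks that by blast
  show ?thesis
  proof (rule runs_mono[OF runs_tree[OF \<tau>(1) f mk]])
    fix \<rho> assume *: "same_except ({2, 3, 4, 5} \<union> {7..16}) {0, 1, 2, 3, 4} \<tau> \<rho> \<and>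
       fst \<rho> 2 = ptr i + 2 + 2 * length (es i) \<and> fst \<rho> 3 = off i + n i \<and> fst \<rho> 4 = edge_off i + length (es i) \<and>
       fst \<rho> 5 = pos_off i + 2 * (3 * n i - 2) \<and> length (es i) < n i \<and>
       (\<forall>e\<ge>edge_off i + length (es i). snd \<rho> 1 e = 0) \<and> snd \<rho> 4 = (snd \<tau> 4)(fst \<tau> 6 := off i) \<and>
       (\<forall>g. g \<notin> V \<longrightarrow> snd \<rho> 2 g = snd \<tau> 2 g) \<and>
       (\<forall>q. q < pos_off i \<or> pos_off i + 2 * (3 * n i - 2) \<le> q \<longrightarrow> snd \<rho> 3 q = snd \<tau> 3 q) \<and>
       (\<forall>q. pos_off i \<le> q \<and> q < pos_off i + 2 * (3 * n i - 2) \<longrightarrow> snd \<rho> 3 q \<le> q) \<and>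
       tree_table (snd \<rho> 2) (snd \<rho> 3)"
    obtain f' A' where \<rho>: "\<rho> = (f', A')" by fastforce
    have same: "same_except ({2, 3, 4, 5} \<union> {7..16}) {0, 1, 2, 3, 4} \<tau> (f', A')"
      and f': "f' 2 = ptr i + 2 + 2 * length (es i)" "f' 3 = off i + n i" "f' 4 = edge_off i + length (es i)"
         "f' 5 = pos_off i + 2 * (3 * n i - 2)"
      and m': "\<forall>e\<ge>edge_off i + length (es i). A' 1 e = 0" and o': "A' 4 = (snd \<tau> 4)(fst \<tau> 6 := off i)"
      and p': "\<forall>g. g \<notin> V \<longrightarrow> A' 2 g = snd \<tau> 2 g"
      and h': "\<forall>q. q < pos_off i \<or> pos_off i + 2 * (3 * n i - 2) \<le> q \<longrightarrow> A' 3 q = snd \<tau> 3 q"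
         "\<forall>q. pos_off i \<le> q \<and> q < pos_off i + 2 * (3 * n i - 2) \<longrightarrow> A' 3 q \<le> q"
      and t': "tree_table (A' 2) (A' 3)"
      using *[unfolded \<rho> fst_conv snd_conv] by - (elim conjE, assumption)+
    have "placed j (A' 2) (A' 3)" if "j < Suc i" for j
    proof (cases "j = i")
      case True
      then show ?thesis using t' by (simp add: placed_def tree_table_def Suc(3))
    next
      case False
      then have "j < i" using that by simp
      then have le: "off (Suc j) \<le> off i" "pos_off (Suc j) \<le> pos_off i"
        by (auto intro: off_mono pos_off_mono)
      show ?thesis
      proof (rule placed_cong)
        show "placed j (snd \<tau> 2) (snd \<tau> 3)" using tabs \<open>j < i\<close> by blast
        show "A' 2 g = snd \<tau> 2 g" if "g < off (Suc j)" for g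
          using p' that le by simp
        show "A' 3 q = snd \<tau> 3 q" if "q < pos_off (Suc j)" for q
          using h'(1) that le by simp
      qed
    qed
    moreover have "A' 3 q \<le> q" for q
      using h'(1)[rule_format, of q] h'(2)[rule_format, of q] ht(1)[rule_format, of q]
      by (cases "q < pos_off i \<or> pos_off i + 2 * (3 * n i - 2) \<le> q") auto
    moreover have "A' 3 q = 0" if "q \<ge> pos_off (Suc i)" for q
      using h'(1)[rule_format, of q] ht(2)[rule_format, of q] that Suc(3) by simp
    moreover have "A' 4 j = off j" if "j < Suc i" for j
      using o' offs that \<tau>(3) by (auto simp: less_Suc_eq)
    moreover have "f' r = 0" if "r \<notin> {1..16}" for r
      using zero(1)[rule_format, of r] same that by (auto simp: same_except_def)
    moreover have "A' a = (\<lambda>_. 0)" if "a \<notin> {0..4}" for a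
    proof -
      have "a \<notin> {0, 1, 2, 3, 4}" using that by auto
      then have "A' a = snd \<tau> a" using same by (simp add: same_except_def)
      then show ?thesis using zero(2) that by simp
    qed
    moreover have "f' 6 = i" "f' 1 = fst \<tau> 1" using same \<tau>(3) by (simp_all add: same_except_def)
    ultimately show "fst \<rho> 6 = i \<and> fst \<rho> 1 = fst \<tau> 1 \<and> parse_inv (Suc i) ((fst \<rho>)(6 := Suc i), snd \<rho>)"
      unfolding parse_inv_def \<rho> fst_conv snd_conv using f' m' Suc
      by (intro conjI allI impI) (simp_all, auto)
  qed (assumption | fact)+
qed

lemma runs_parse:
  assumes W: "8 * N + 4 \<le> W" and x: "\<forall>x\<in>set xs. x \<le> W"
  shows "runs xs W parse_code init_state
    (com_weight (Seq (Assign 1 (Inp (Num 0))) (Assign 2 (Num 1))) + (k * (N * tree_weight + 10) + 10))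
    (\<lambda>\<rho>. fst \<rho> 1 = k \<and> parse_inv k \<rho>)"
  unfolding parse_code_def
proof (rule runs_Seq)
  let ?c = "Seq (Assign 1 (Inp (Num 0))) (Assign 2 (Num 1))"
  let ?\<sigma> = "((\<lambda>_. 0)(1 := k, 2 := 1), \<lambda>_ _. 0) :: state"
  have sem: "sem xs ?c init_state = ?\<sigma>" by (simp add: init_state_def xs)
  show "runs xs W ?c init_state (com_weight ?c) (\<lambda>\<tau>. \<tau> = ?\<sigma>)"
  proof (rule runs_block)
    show "bounded_state xs W init_state" using x by (simp add: bounded_state_def init_state_def)
    have "k \<le> W" using k_le_N W by simp
    then show "bounded_state xs W (sem xs ?c init_state)"
      unfolding sem using x W by (simp add: bounded_state_def)
    show "sem xs ?c init_state = ?\<sigma>" by (rule sem)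
  qed simp
  fix \<tau> assume \<tau>: "bounded_state xs W \<tau>" "\<tau> = ?\<sigma>"
  show "runs xs W (For 6 1 tree_code) \<tau> (k * (N * tree_weight + 10) + 10) (\<lambda>\<rho>. fst \<rho> 1 = k \<and> parse_inv k \<rho>)"
  proof (rule runs_For[where I = parse_inv])
    show "parse_inv 0 ((fst \<tau>)(6 := 0), snd \<tau>)"
      using \<tau>(2) by (simp add: parse_inv_def ptr_def off_def edge_off_def pos_off_def)
    fix j \<rho> assume "j < k" "fst \<rho> 6 = j" "fst \<rho> 1 = k" "bounded_state xs W \<rho>" "parse_inv j \<rho>"
    then show "runs xs W tree_code \<rho> (N * tree_weight)
        (\<lambda>\<rho>. fst \<rho> 6 = j \<and> fst \<rho> 1 = k \<and> parse_inv (Suc j) ((fst \<rho>)(6 := Suc j), snd \<rho>))"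
      using parse_inv_step[of j \<rho>] W by simp
  qed (use \<tau> in simp_all)
qed

end

section \<open>Block minima\<close>

text \<open>For a loop without counter: the number of rounds \<open>n\<close> is known to the proof,
  and the test only has to agree with it.\<close>

lemma runs_While:
  assumes "bounded_state xs V \<sigma>" "I 0 \<sigma>"
    and step: "\<And>j \<tau>. j < n \<Longrightarrow> bounded_state xs V \<tau> \<Longrightarrow> I j \<tau> \<Longrightarrow> val xs \<tau> e \<noteq> 0 \<and> runs xs V c \<tau> T (I (Suc j))"
    and stop: "\<And>\<tau>. I n \<tau> \<Longrightarrow> val xs \<tau> e = 0"
  shows "runs xs V (While e c) \<sigma> (Suc n * (T + 1 + expr_weight e)) (I n)"
proof -
  have "runs xs V (While e c) \<tau> (Suc (n - j) * (T + 1 + expr_weight e)) (I n)"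
    if "j \<le> n" "bounded_state xs V \<tau>" "I j \<tau>" for j \<tau>
    using that
  proof (induction "n - j" arbitrary: j \<tau>)
    case 0
    then have "j = n" by simp
    have "1 + cost xs \<tau> e \<le> (1 + expr_weight e) * bits (V + 2)"
      using cost_le[OF 0(3), of e] bits_pos[of "V + 2"] by (simp add: add_mult_distrib)
    also have "\<dots> \<le> (Suc (n - j) * (T + 1 + expr_weight e)) * bits (V + 2)"
      by (intro mult_le_mono1) simp
    finally have "1 + cost xs \<tau> e \<le> (Suc (n - j) * (T + 1 + expr_weight e)) * bits (V + 2)" .
    moreover have "exec xs (While e c) \<tau> (1 + cost xs \<tau> e) \<tau>"
      using stop 0(4) \<open>j = n\<close> by (intro exec.WhileFalse) simp
    ultimately show ?case using 0 \<open>j = n\<close> unfolding runs_def by blast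
  next
    case (Suc d)
    then have "j < n" by simp
    from step[OF this Suc.prems(2,3)] obtain t1 \<rho> where 1: "val xs \<tau> e \<noteq> 0" "exec xs c \<tau> t1 \<rho>"
      "t1 \<le> T * bits (V + 2)" "bounded_state xs V \<rho>" "I (Suc j) \<rho>" unfolding runs_def by blast
    have "runs xs V (While e c) \<rho> (Suc (n - Suc j) * (T + 1 + expr_weight e)) (I n)"
      using Suc.hyps 1 \<open>j < n\<close> by (intro Suc.hyps(1)) auto
    then obtain t2 \<pi> where 2: "exec xs (While e c) \<rho> t2 \<pi>" "bounded_state xs V \<pi>" "I n \<pi>"
      "t2 \<le> Suc (n - Suc j) * (T + 1 + expr_weight e) * bits (V + 2)" unfolding runs_def by blast
    have "Suc (n - j) = Suc (Suc (n - Suc j))" using \<open>j < n\<close> by simp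
    then have "Suc (n - j) * (T + 1 + expr_weight e) * bits (V + 2) =
      T * bits (V + 2) + bits (V + 2) + expr_weight e * bits (V + 2) +
      Suc (n - Suc j) * (T + 1 + expr_weight e) * bits (V + 2)"
      by (simp only: mult_Suc add_mult_distrib mult_1)
    moreover have "1 \<le> bits (V + 2)" by (rule bits_pos)
    ultimately have "1 + cost xs \<tau> e + t1 + t2 \<le> Suc (n - j) * (T + 1 + expr_weight e) * bits (V + 2)"
      using cost_le[OF Suc.prems(2), of e] 1(3) 2(4) by linarith
    then show ?case using exec.WhileTrue[OF 1(1,2) 2(1)] 2(2,3) unfolding runs_def by blast
  qed
  from this[of 0 \<sigma>] show ?thesis using assms(1,2) by simp
qed

text \<open>Positions stay below \<open>m\<close>, but weights reach \<open>2 * m\<close>. With the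
  factor 2 both are less than \<open>2 ^ levels m\<close>, so one number of block sizes serves for
  comparing positions and for comparing weights.\<close>

definition levels :: "nat \<Rightarrow> nat" where "levels m = floorlog 2 (2 * m)"

lemma levels_upper: "2 * m < 2 ^ levels m"
  unfolding levels_def by (rule less_power_floorlog)

lemma levels_lower: "l < levels m \<Longrightarrow> 2 ^ l \<le> 2 * m"
proof -
  assume l: "l < levels m"
  then have "0 < 2 * m" by (cases m) (simp_all add: levels_def floorlog_def)
  then have "2 ^ (levels m - 1) \<le> 2 * m" using floorlog_bounds[of "2 * m" 2] by (simp add: levels_def)
  moreover have "(2::nat) ^ l \<le> 2 ^ (levels m - 1)" using l by (intro power_increasing) auto
  ultimately show ?thesis by linarith
qed

definition pre_min :: "(nat \<Rightarrow> nat) \<Rightarrow> nat \<Rightarrow> nat \<Rightarrow> nat" where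
  "pre_min H l p = Min (H ` {p div 2 ^ l * 2 ^ l..p})"

definition suf_min :: "(nat \<Rightarrow> nat) \<Rightarrow> nat \<Rightarrow> nat \<Rightarrow> nat" where
  "suf_min H l p = Min (H ` {p..p div 2 ^ l * 2 ^ l + (2 ^ l - 1)})"

lemma pre_min_rec:
  "pre_min H l p = (if p mod 2 ^ l = 0 then H p else min (pre_min H l (p - 1)) (H p))"
proof (cases "p mod 2 ^ l = 0")
  case True
  then have "p div 2 ^ l * 2 ^ l = p" using div_mult_mod_eq[of p "2 ^ l"] by simp
  then show ?thesis using True by (simp add: pre_min_def)
next
  case False
  then obtain q where q: "p = Suc q" by (cases p) auto
  have div: "q div 2 ^ l = p div 2 ^ l"
    using False q div_Suc[of q "2 ^ l"] by simp
  have le: "q div 2 ^ l * 2 ^ l \<le> q" by simp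
  then have "{p div 2 ^ l * 2 ^ l..p} = insert p {q div 2 ^ l * 2 ^ l..q}"
    using div q by (auto simp: le_Suc_eq)
  then have "pre_min H l p = Min (insert (H p) (H ` {q div 2 ^ l * 2 ^ l..q}))"
    by (simp add: pre_min_def)
  also have "\<dots> = min (H p) (pre_min H l q)"
    unfolding pre_min_def using le by (intro Min_insert) auto
  finally show ?thesis using False q by (simp add: min.commute)
qed

lemma suf_min_rec:
  "suf_min H l p = (if Suc p mod 2 ^ l = 0 then H p else min (suf_min H l (Suc p)) (H p))"
proof -
  have pos: "(0::nat) < 2 ^ l" by simp
  have le: "p \<le> p div 2 ^ l * 2 ^ l + (2 ^ l - 1)"
    using div_mult_mod_eq[of p "2 ^ l"] mod_less_divisor[OF pos, of p] by linarith
  show ?thesis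
  proof (cases "Suc p mod 2 ^ l = 0")
    case True
    have "p mod 2 ^ l = 2 ^ l - 1"
      using True mod_Suc[of p "2 ^ l"] by (auto split: if_splits)
    then have "p div 2 ^ l * 2 ^ l + (2 ^ l - 1) = p" using div_mult_mod_eq[of p "2 ^ l"] by simp
    then show ?thesis using True by (simp add: suf_min_def)
  next
    case False
    then have div: "Suc p div 2 ^ l = p div 2 ^ l" using div_Suc[of p "2 ^ l"] by simp
    have le': "Suc p \<le> Suc p div 2 ^ l * 2 ^ l + (2 ^ l - 1)"
      using div_mult_mod_eq[of "Suc p" "2 ^ l"] mod_less_divisor[OF pos, of "Suc p"] by linarith
    have "{p..p div 2 ^ l * 2 ^ l + (2 ^ l - 1)} = insert p {Suc p..Suc p div 2 ^ l * 2 ^ l + (2 ^ l - 1)}"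
      using div le by auto
    then have "suf_min H l p = Min (insert (H p) (H ` {Suc p..Suc p div 2 ^ l * 2 ^ l + (2 ^ l - 1)}))"
      by (simp add: suf_min_def)
    also have "\<dots> = min (H p) (suf_min H l (Suc p))"
      unfolding suf_min_def using le' by (intro Min_insert) auto
    finally show ?thesis using False by (simp add: min.commute)
  qed
qed

text \<open>Applied to the first position behind all tours, where the height is zero.\<close>

lemma suf_min_0:
  assumes "H p = 0"
  shows "suf_min H l p = 0"
proof -
  have pos: "(0::nat) < 2 ^ l" by simp
  have "p \<le> p div 2 ^ l * 2 ^ l + (2 ^ l - 1)"
    using div_mult_mod_eq[of p "2 ^ l"] mod_less_divisor[OF pos, of p] by linarith
  then have "0 \<in> H ` {p..p div 2 ^ l * 2 ^ l + (2 ^ l - 1)}" using assms by (intro image_eqI[of _ _ p]) auto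
  then have "Min (H ` {p..p div 2 ^ l * 2 ^ l + (2 ^ l - 1)}) \<le> 0" by (intro Min_le) auto
  then show ?thesis by (simp add: suf_min_def)
qed

definition cell_addr :: "nat \<Rightarrow> nat \<Rightarrow> nat \<Rightarrow> nat \<Rightarrow> nat" where
  "cell_addr B p l s = (p * B + l) * 2 + s"

lemma cell_addr_eq_iff:
  assumes "l < B" "l' < B" "s < 2" "s' < 2"
  shows "cell_addr B p l s = cell_addr B p' l' s' \<longleftrightarrow> p = p' \<and> l = l' \<and> s = s'"
proof
  assume "cell_addr B p l s = cell_addr B p' l' s'"
  then have *: "(p * B + l) * 2 + s = (p' * B + l') * 2 + s'" by (simp add: cell_addr_def)
  have "s = s'" "p * B + l = p' * B + l'" using * assms(3,4) by presburger+
  moreover have "(p * B + l) div B = p" "(p' * B + l') div B = p'" "(p * B + l) mod B = l" "(p' * B + l') mod B = l'"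
    using assms(1,2) by simp_all
  ultimately show "p = p' \<and> l = l' \<and> s = s'" by metis
qed simp

definition pow_code :: com where
  "pow_code = block [Store 5 (Reg 17) (Reg 18), Assign 18 (Mul (Num 2) (Reg 18)), Assign 17 (Add (Reg 17) (Num 1))]"

definition cell_expr :: "expr \<Rightarrow> nat \<Rightarrow> expr" where
  "cell_expr e s = Add (Mul (Add (Mul e (Reg 17)) (Reg 30)) (Num 2)) (Num s)"

text \<open>One round extends a prefix minimum at the ascending position in register 9 and a suffix
  minimum at the descending position in register 27. With truncated subtraction,
  \<open>a - (a - b)\<close> is the minimum of \<open>a\<close> and \<open>b\<close>.\<close>

definition table_code :: com where
  "table_code = block
    [Cond (Mod (Reg 9) (Arr 5 (Reg 30)))
       (Store 6 (cell_expr (Reg 9) 1)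
         (Sub (Arr 6 (cell_expr (Sub (Reg 9) (Num 1)) 1)) (Sub (Arr 6 (cell_expr (Sub (Reg 9) (Num 1)) 1)) (Arr 3 (Reg 9)))))
       (Store 6 (cell_expr (Reg 9) 1) (Arr 3 (Reg 9))),
     Assign 27 (Sub (Sub (Reg 5) (Num 1)) (Reg 9)),
     Cond (Mod (Add (Reg 27) (Num 1)) (Arr 5 (Reg 30)))
       (Store 6 (cell_expr (Reg 27) 0)
         (Sub (Arr 6 (cell_expr (Add (Reg 27) (Num 1)) 0)) (Sub (Arr 6 (cell_expr (Add (Reg 27) (Num 1)) 0)) (Arr 3 (Reg 27)))))
       (Store 6 (cell_expr (Reg 27) 0) (Arr 3 (Reg 27)))]"

definition power_code :: com where
  "power_code = Assign 19 (Mul (Reg 19) (Mul (Num 4) (Mul (Reg 17) (Reg 17))))"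

definition prep_code :: com where
  "prep_code =
     Seq (Seq (Assign 17 (Num 0)) (Assign 18 (Num 1)))
    (Seq (While (Sub (Add (Mul (Num 2) (Reg 5)) (Num 1)) (Reg 18)) pow_code)
    (Seq (For 30 17 (For 9 5 table_code))
    (Seq (Assign 19 (Num 1))
    (Seq (For 9 1 power_code)
         (block [Assign 20 (Inp (Reg 2)), Assign 36 (Add (Reg 2) (Num 1))])))))"

text \<open>By \<open>levels_lower\<close> the test succeeds in each of the first
  \<open>levels m\<close> rounds, and by \<open>levels_upper\<close> it fails afterwards, so
  doubling finds the logarithm.\<close>

lemma runs_pow:
  assumes "bounded_state xs W \<sigma>" "fst \<sigma> 5 = m" "fst \<sigma> 17 = 0" "fst \<sigma> 18 = 1" "4 * m + 2 + levels m \<le> W"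
  shows "runs xs W (While (Sub (Add (Mul (Num 2) (Reg 5)) (Num 1)) (Reg 18)) pow_code) \<sigma>
    (Suc (levels m) * (com_weight pow_code + 1 + expr_weight (Sub (Add (Mul (Num 2) (Reg 5)) (Num 1)) (Reg 18))))
    (\<lambda>\<tau>. same_except {17, 18} {5} \<sigma> \<tau> \<and> fst \<tau> 17 = levels m \<and> fst \<tau> 18 = 2 ^ levels m \<and> (\<forall>l<levels m. snd \<tau> 5 l = 2 ^ l))"
proof (rule runs_While[where I = "\<lambda>j \<tau>. same_except {17, 18} {5} \<sigma> \<tau> \<and> fst \<tau> 17 = j \<and>
    fst \<tau> 18 = 2 ^ j \<and> (\<forall>l<j. snd \<tau> 5 l = 2 ^ l)"])
  fix j \<tau> assume j: "j < levels m" "bounded_state xs W \<tau>"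
    and I: "same_except {17, 18} {5} \<sigma> \<tau> \<and> fst \<tau> 17 = j \<and> fst \<tau> 18 = 2 ^ j \<and> (\<forall>l<j. snd \<tau> 5 l = 2 ^ l)"
  obtain f A where \<tau>: "\<tau> = (f, A)" by fastforce
  have f: "same_except {17, 18} {5} \<sigma> (f, A)" "f 17 = j" "f 18 = 2 ^ j" "\<forall>l<j. A 5 l = 2 ^ l" "f 5 = m"
    using I \<tau> assms(2) by (auto simp: same_except_def)
  have le: "2 ^ j \<le> 2 * m" by (rule levels_lower[OF j(1)])
  have sem: "sem xs pow_code \<tau> = (f(18 := 2 * 2 ^ j, 17 := j + 1), A(5 := (A 5)(j := 2 ^ j)))"
    using \<tau> f by (simp add: pow_code_def)
  show "val xs \<tau> (Sub (Add (Mul (Num 2) (Reg 5)) (Num 1)) (Reg 18)) \<noteq> 0 \<and>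
    runs xs W pow_code \<tau> (com_weight pow_code) (\<lambda>\<tau>. same_except {17, 18} {5} \<sigma> \<tau> \<and> fst \<tau> 17 = Suc j \<and>
      fst \<tau> 18 = 2 ^ Suc j \<and> (\<forall>l<Suc j. snd \<tau> 5 l = 2 ^ l))"
  proof
    show "val xs \<tau> (Sub (Add (Mul (Num 2) (Reg 5)) (Num 1)) (Reg 18)) \<noteq> 0" using \<tau> f le by simp
    show "runs xs W pow_code \<tau> (com_weight pow_code) (\<lambda>\<tau>. same_except {17, 18} {5} \<sigma> \<tau> \<and> fst \<tau> 17 = Suc j \<and>
      fst \<tau> 18 = 2 ^ Suc j \<and> (\<forall>l<Suc j. snd \<tau> 5 l = 2 ^ l))"
    proof (rule runs_block)
      show "loop_free pow_code" by (simp add: pow_code_def)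
      show "bounded_state xs W (sem xs pow_code \<tau>)" unfolding sem
        using j \<tau> le assms(5) by (intro bounded_state_arr bounded_state_reg) auto
      show "same_except {17, 18} {5} \<sigma> (sem xs pow_code \<tau>) \<and> fst (sem xs pow_code \<tau>) 17 = Suc j \<and>
        fst (sem xs pow_code \<tau>) 18 = 2 ^ Suc j \<and> (\<forall>l<Suc j. snd (sem xs pow_code \<tau>) 5 l = 2 ^ l)"
        unfolding sem using f by (auto simp: same_except_def less_Suc_eq)
    qed (rule j)
  qed
qed (use assms levels_upper[of m] in \<open>auto simp: same_except_def\<close>)

lemma runs_table:
  assumes b: "bounded_state xs W \<sigma>" and f: "fst \<sigma> 5 = m" "fst \<sigma> 17 = B"
    and pow: "\<forall>l<B. snd \<sigma> 5 l = 2 ^ l" and H: "snd \<sigma> 3 = H" "H m = 0" and zero: "snd \<sigma> 6 = (\<lambda>_. 0)"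
  shows "runs xs W (For 30 17 (For 9 5 table_code)) \<sigma> (B * ((m * (com_weight table_code + 10) + 10) + 10) + 10)
    (\<lambda>\<tau>. same_except {9, 27, 30} {6} \<sigma> \<tau> \<and>
       (\<forall>p<m. \<forall>l<B. snd \<tau> 6 (cell_addr B p l 0) = suf_min H l p \<and> snd \<tau> 6 (cell_addr B p l 1) = pre_min H l p))"
proof -
  let ?tab = "\<lambda>l A6. (\<forall>p<m. A6 (cell_addr B p l 0) = suf_min H l p \<and> A6 (cell_addr B p l 1) = pre_min H l p)"
  let ?I = "\<lambda>j \<tau>. same_except {9, 27, 30} {6} \<sigma> \<tau> \<and> (\<forall>l<j. ?tab l (snd \<tau> 6)) \<and> (\<forall>x\<ge>2 * (m * B). snd \<tau> 6 x = 0)"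
  have "runs xs W (For 30 17 (For 9 5 table_code)) \<sigma> (B * ((m * (com_weight table_code + 10) + 10) + 10) + 10)
    (\<lambda>\<rho>. fst \<rho> 17 = B \<and> ?I B \<rho>)"
  proof (rule runs_For[where I = ?I])
    show "?I 0 ((fst \<sigma>)(30 := 0), snd \<sigma>)" using zero by (simp add: same_except_def)
  next
    fix l \<tau> assume l: "l < B" "fst \<tau> 30 = l" "fst \<tau> 17 = B" "bounded_state xs W \<tau>" "?I l \<tau>"
    let ?J = "\<lambda>c \<rho>. same_except {9, 27, 30} {6} \<sigma> \<rho> \<and> fst \<rho> 30 = l \<and> (\<forall>l'<l. ?tab l' (snd \<rho> 6)) \<and>
      (\<forall>p<c. snd \<rho> 6 (cell_addr B p l 1) = pre_min H l p) \<and>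
      (\<forall>p<m. m - c \<le> p \<longrightarrow> snd \<rho> 6 (cell_addr B p l 0) = suf_min H l p) \<and> (\<forall>x\<ge>2 * (m * B). snd \<rho> 6 x = 0)"
    have "runs xs W (For 9 5 table_code) \<tau> (m * (com_weight table_code + 10) + 10) (\<lambda>\<rho>. fst \<rho> 5 = m \<and> ?J m \<rho>)"
    proof (rule runs_For[where I = ?J])
      show "fst \<tau> 5 = m" using l(5) f by (auto simp: same_except_def)
      show "?J 0 ((fst \<tau>)(9 := 0), snd \<tau>)" using l by (auto simp: same_except_def)
    next
      fix c \<rho> assume c: "c < m" "fst \<rho> 9 = c" "fst \<rho> 5 = m" "bounded_state xs W \<rho>" "?J c \<rho>"
      obtain g A where \<rho>: "\<rho> = (g, A)" by fastforce
      have same: "same_except {9, 27, 30} {6} \<sigma> (g, A)" and g30: "g 30 = l"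
        and low: "\<forall>l'<l. ?tab l' (A 6)" and pre: "\<forall>p<c. A 6 (cell_addr B p l 1) = pre_min H l p"
        and suf: "\<forall>p<m. m - c \<le> p \<longrightarrow> A 6 (cell_addr B p l 0) = suf_min H l p"
        and high: "\<forall>x\<ge>2 * (m * B). A 6 x = 0"
        using c(5)[unfolded \<rho> fst_conv snd_conv] by - (elim conjE, assumption)+
      have g: "g 9 = c" "g 5 = m" "g 17 = B" "A 3 = H" "A 5 l = 2 ^ l"
        using c(2,3) same \<rho> f H pow l(1) by (auto simp: same_except_def)
      define p where "p = m - 1 - c"
      define P where "P = pre_min H l c"
      define S where "S = suf_min H l p"
      have p: "p < m" "Suc p = m - c" using c(1) by (auto simp: p_def)
      have P: "P = (if c mod 2 ^ l = 0 then H c else min (A 6 (cell_addr B (c - 1) l 1)) (H c))"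
      proof (cases "c mod 2 ^ l = 0")
        case True
        then show ?thesis using pre_min_rec[of H l c] by (simp add: P_def)
      next
        case False
        then have "c - 1 < c" by (cases c) auto
        then show ?thesis using pre_min_rec[of H l c] pre by (simp add: P_def)
      qed
      have S: "S = (if Suc p mod 2 ^ l = 0 then H p else min (A 6 (cell_addr B (Suc p) l 0)) (H p))"
      proof -
        have "A 6 (cell_addr B (Suc p) l 0) = suf_min H l (Suc p)"
        proof (cases "Suc p < m")
          case True
          then show ?thesis using suf p by simp
        next
          case False
          then have "Suc p = m" using p by simp
          \<comment> \<open>The row behind the last position is never written. Its initial zeros are
            the correct suffix minima there because \<open>H m = 0\<close>.\<close>
          moreover have "A 6 (cell_addr B m l 0) = 0" using high by (simp add: cell_addr_def)
          ultimately show ?thesis using suf_min_0[of H m l] H(2) by simp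
        qed
        then show ?thesis using suf_min_rec[of H l p] by (simp add: S_def)
      qed
      have min_sub: "a - (a - b) = min a b" for a b :: nat by simp
      have ne: "cell_addr B q l 0 \<noteq> cell_addr B c l 1" for q
        using cell_addr_eq_iff[OF l(1) l(1), of 0 1 q c] by simp
      define A6 where "A6 = (A 6)(cell_addr B c l 1 := P, cell_addr B p l 0 := S)"
      have sem: "sem xs table_code \<rho> = (g(27 := p), A(6 := A6))"
      proof -
        have c1: "val xs (g', A') (cell_expr e s) = cell_addr B (val xs (g', A') e) l s"
          if "g' 17 = B" "g' 30 = l" for g' A' e s
          using that by (simp add: cell_expr_def cell_addr_def)
        have s1: "sem xs (Cond (Mod (Reg 9) (Arr 5 (Reg 30)))
           (Store 6 (cell_expr (Reg 9) 1)
             (Sub (Arr 6 (cell_expr (Sub (Reg 9) (Num 1)) 1)) (Sub (Arr 6 (cell_expr (Sub (Reg 9) (Num 1)) 1)) (Arr 3 (Reg 9)))))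
           (Store 6 (cell_expr (Reg 9) 1) (Arr 3 (Reg 9)))) (g, A) = (g, A(6 := (A 6)(cell_addr B c l 1 := P)))"
          using g g30 P c1[of g A] by (simp add: min_sub)
        have s2: "sem xs (Cond (Mod (Add (Reg 27) (Num 1)) (Arr 5 (Reg 30)))
           (Store 6 (cell_expr (Reg 27) 0)
             (Sub (Arr 6 (cell_expr (Add (Reg 27) (Num 1)) 0)) (Sub (Arr 6 (cell_expr (Add (Reg 27) (Num 1)) 0)) (Arr 3 (Reg 27)))))
           (Store 6 (cell_expr (Reg 27) 0) (Arr 3 (Reg 27)))) (g(27 := p), A(6 := (A 6)(cell_addr B c l 1 := P))) =
           (g(27 := p), A(6 := A6))"
          using g g30 S c1[of "g(27 := p)" "A(6 := (A 6)(cell_addr B c l 1 := P))"] ne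
          by (simp add: min_sub A6_def)
        show ?thesis unfolding table_code_def block.simps sem.simps(4) \<rho> s1
          using s2 g by (simp add: p_def)
      qed
      have HW: "H x \<le> W" for x using b H by (auto simp: bounded_state_def)
      have minW: "P \<le> W" "S \<le> W"
        using P S HW[of c] HW[of p] by (auto simp: min_def split: if_splits)
      show "runs xs W table_code \<rho> (com_weight table_code)
        (\<lambda>\<rho>. fst \<rho> 9 = c \<and> fst \<rho> 5 = m \<and> ?J (Suc c) ((fst \<rho>)(9 := Suc c), snd \<rho>))"
      proof (rule runs_block)
        show "loop_free table_code" by (simp add: table_code_def)
        show "bounded_state xs W (sem xs table_code \<rho>)" unfolding sem
        proof -
          have "bounded_state xs W (g, A)" using c(4) \<rho> by simp
          moreover have "m \<le> W" using b f by (auto simp: bounded_state_def)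
          ultimately show "bounded_state xs W (g(27 := p), A(6 := A6))"
            using minW p(1) unfolding bounded_state_def A6_def by auto
        qed
        have 1: "?tab l' A6" if "l' < l" for l'
          using low that cell_addr_eq_iff[of l' B l] l(1) by (simp add: A6_def)
        have 2: "A6 (cell_addr B q l 1) = pre_min H l q" if "q < Suc c" for q
          using pre that cell_addr_eq_iff[OF l(1) l(1), of 1 1 q c] ne[of p] cell_addr_eq_iff[OF l(1) l(1), of 1 0 q p]
          by (auto simp: A6_def P_def less_Suc_eq)
        have 3: "A6 (cell_addr B q l 0) = suf_min H l q" if "q < m" "m - Suc c \<le> q" for q
        proof (cases "q = p")
          case True
          then show ?thesis by (simp add: A6_def S_def)
        next
          case False
          then have "m - c \<le> q" using that p by simp
          then show ?thesis using suf that False ne[of q] cell_addr_eq_iff[OF l(1) l(1), of 0 0 q p] by (simp add: A6_def)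
        qed
        have 4: "A6 x = 0" if "x \<ge> 2 * (m * B)" for x
        proof -
          have small: "cell_addr B q l s < 2 * (m * B)" if "q < m" "s < 2" for q s
          proof -
            have "Suc q * B \<le> m * B" using that(1) by (intro mult_le_mono1) simp
            then show ?thesis using l(1) that(2) by (simp add: cell_addr_def)
          qed
          show ?thesis using high that small[OF c(1), of 1] small[OF p(1), of 0] by (auto simp: A6_def)
        qed
        have "same_except {9, 27, 30} {6} \<sigma> (g(27 := p, 9 := Suc c), A(6 := A6))"
          using same by (simp add: same_except_def)
        moreover have "(g(27 := p)) 9 = c" "(g(27 := p)) 5 = m" "(g(27 := p, 9 := Suc c)) 30 = l" using g g30 by simp_all
        ultimately show "fst (sem xs table_code \<rho>) 9 = c \<and> fst (sem xs table_code \<rho>) 5 = m \<and>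
          ?J (Suc c) ((fst (sem xs table_code \<rho>))(9 := Suc c), snd (sem xs table_code \<rho>))"
          unfolding sem fst_conv snd_conv fun_upd_same using 1 2 3 4 by (intro conjI allI impI) blast+
      qed (rule c)
    qed (use l in simp_all)
    then show "runs xs W (For 9 5 table_code) \<tau> (m * (com_weight table_code + 10) + 10)
      (\<lambda>\<rho>. fst \<rho> 30 = l \<and> fst \<rho> 17 = B \<and> ?I (Suc l) ((fst \<rho>)(30 := Suc l), snd \<rho>))"
      by (rule runs_mono) (use f in \<open>auto simp: same_except_def less_Suc_eq\<close>)
  qed (use assms in simp_all)
  then show ?thesis by (rule runs_mono) auto
qed

definition (in forest) B :: nat where "B = levels (pos_off k)"
text \<open>Per tree there are two tags, two sides, \<open>B\<close> block sizes for positions and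
  \<open>B\<close> for weights. For \<open>+\<close> the last choice has no effect, but a common
  numbering spares a second program.\<close>

definition (in forest) J :: nat where "J = (4 * (B * B)) ^ k"

definition (in forest) tables :: "state \<Rightarrow> bool" where
  "tables \<tau> \<longleftrightarrow> fst \<tau> 1 = k \<and> fst \<tau> 5 = pos_off k \<and> fst \<tau> 17 = B \<and> fst \<tau> 18 = 2 ^ B \<and> fst \<tau> 19 = J \<and>
     (\<forall>j<k. snd \<tau> 4 j = off j) \<and> (\<forall>j<k. placed j (snd \<tau> 2) (snd \<tau> 3)) \<and> (\<forall>q. snd \<tau> 3 q \<le> q) \<and>
     (\<forall>l<B. snd \<tau> 5 l = 2 ^ l) \<and>
     (\<forall>p<pos_off k. \<forall>l<B. snd \<tau> 6 (cell_addr B p l 0) = suf_min (snd \<tau> 3) l p \<and>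
        snd \<tau> 6 (cell_addr B p l 1) = pre_min (snd \<tau> 3) l p)"

lemma runs_power:
  assumes "bounded_state xs W \<sigma>" "fst \<sigma> 1 = n" "fst \<sigma> 17 = b" "fst \<sigma> 19 = 1" "(4 * (b * b)) ^ n \<le> W" "b \<ge> 1"
  shows "runs xs W (For 9 1 power_code) \<sigma> (n * (com_weight power_code + 10) + 10)
    (\<lambda>\<tau>. same_except {9, 19} {} \<sigma> \<tau> \<and> fst \<tau> 19 = (4 * (b * b)) ^ n)"
proof -
  let ?I = "\<lambda>j \<tau>. same_except {9, 19} {} \<sigma> \<tau> \<and> fst \<tau> 19 = (4 * (b * b)) ^ j"
  have "runs xs W (For 9 1 power_code) \<sigma> (n * (com_weight power_code + 10) + 10) (\<lambda>\<rho>. fst \<rho> 1 = n \<and> ?I n \<rho>)"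
  proof (rule runs_For[where I = ?I])
    show "?I 0 ((fst \<sigma>)(9 := 0), snd \<sigma>)" using assms by (simp add: same_except_def)
    fix j \<tau> assume j: "j < n" "fst \<tau> 9 = j" "fst \<tau> 1 = n" "bounded_state xs W \<tau>" "?I j \<tau>"
    obtain f A where \<tau>: "\<tau> = (f, A)" by fastforce
    have f17: "f 17 = b" using j(5) assms(3) \<tau> by (simp add: same_except_def)
    have sem: "sem xs power_code \<tau> = (f(19 := (4 * (b * b)) ^ Suc j), A)"
      using j(5) f17 \<tau> by (simp add: power_code_def mult.commute)
    have "(4 * (b * b)) ^ Suc j \<le> (4 * (b * b)) ^ n"
      using j(1) assms(6) by (intro power_increasing) auto
    then have le: "(4 * (b * b)) ^ Suc j \<le> W" using assms(5) by simp
    show "runs xs W power_code \<tau> (com_weight power_code)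
      (\<lambda>\<rho>. fst \<rho> 9 = j \<and> fst \<rho> 1 = n \<and> ?I (Suc j) ((fst \<rho>)(9 := Suc j), snd \<rho>))"
    proof (rule runs_block)
      show "loop_free power_code" by (simp add: power_code_def)
      show "bounded_state xs W (sem xs power_code \<tau>)" unfolding sem
        using j(4) \<tau> le by (intro bounded_state_reg) auto
      show "fst (sem xs power_code \<tau>) 9 = j \<and> fst (sem xs power_code \<tau>) 1 = n \<and>
        ?I (Suc j) ((fst (sem xs power_code \<tau>))(9 := Suc j), snd (sem xs power_code \<tau>))"
        unfolding sem using j \<tau> by (simp add: same_except_def)
    qed (rule j)
  qed (use assms in simp_all)
  then show ?thesis by (rule runs_mono) auto
qed

definition prep_weight :: nat where
  "prep_weight = com_weight (Seq (Assign 17 (Num 0)) (Assign 18 (Num 1))) +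
     2 * (com_weight pow_code + 1 + expr_weight (Sub (Add (Mul (Num 2) (Reg 5)) (Num 1)) (Reg 18))) +
     (com_weight table_code + 40) + com_weight (Assign 19 (Num 1)) + (com_weight power_code + 20) +
     com_weight (block [Assign 20 (Inp (Reg 2)), Assign 36 (Add (Reg 2) (Num 1))])"

lemma (in forest) runs_prep:
  assumes b: "bounded_state xs W \<sigma>" and k: "fst \<sigma> 1 = k" and inv: "parse_inv k \<sigma>" and kpos: "k > 0"
    and W: "J \<le> W" "30 * N + 5 + B \<le> W" and rest: "rest \<noteq> []"
  shows "runs xs W prep_code \<sigma> ((k + B * pos_off k) * prep_weight)
    (\<lambda>\<tau>. tables \<tau> \<and> fst \<tau> 2 = ptr k \<and> fst \<tau> 20 = hd rest \<and> fst \<tau> 36 = ptr k + 1 \<and> snd \<tau> 7 = (\<lambda>_. 0))"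
    (is "runs _ _ _ _ _ ?Q")
proof -
  have Npos: "N > 0" using k_le_N kpos by linarith
  have mpos: "pos_off k > 0" using pos_off_ge[of k] Npos by simp
  have Bpos: "B \<ge> 1"
    using mpos levels_upper[of "pos_off k"] by (cases B) (auto simp: B_def)
  have mW: "4 * pos_off k + 2 + levels (pos_off k) \<le> W"
    using pos_off_le[of k] W(2) by (simp add: B_def)
  have two: "(2::nat) ^ B \<le> 4 * pos_off k"
  proof -
    have "2 ^ (B - 1) \<le> 2 * pos_off k" using Bpos by (intro levels_lower) (simp add: B_def)
    then show ?thesis using Bpos by (cases B) auto
  qed
  have p: "fst \<sigma> 2 = ptr k" "fst \<sigma> 5 = pos_off k"
    and offs: "\<forall>j<k. snd \<sigma> 4 j = off j"
    and tabs: "\<forall>j<k. placed j (snd \<sigma> 2) (snd \<sigma> 3)"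
    and ht: "\<forall>q. snd \<sigma> 3 q \<le> q" "\<forall>q\<ge>pos_off k. snd \<sigma> 3 q = 0"
    and zero: "\<forall>a. a \<notin> {0..4} \<longrightarrow> snd \<sigma> a = (\<lambda>_. 0)"
    using inv unfolding parse_inv_def by - (elim conjE, assumption)+
  have xptr: "ptr k < length xs" "xs ! ptr k = hd rest"
  proof -
    have d: "drop (ptr k) xs = rest" using xs_drop[of k] length_gs by simp
    then show "ptr k < length xs" using rest by (metis drop_all linorder_not_less)
    then show "xs ! ptr k = hd rest" using d by (metis hd_drop_conv_nth)
  qed
  obtain f A where \<sigma>: "\<sigma> = (f, A)" by fastforce
  have 1: "runs xs W (Seq (Assign 17 (Num 0)) (Assign 18 (Num 1))) \<sigma>
    (com_weight (Seq (Assign 17 (Num 0)) (Assign 18 (Num 1)))) (\<lambda>\<tau>. \<tau> = (f(17 := 0, 18 := 1), A))"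
  proof (rule runs_block)
    have sem: "sem xs (Seq (Assign 17 (Num 0)) (Assign 18 (Num 1))) \<sigma> = (f(17 := 0, 18 := 1), A)" using \<sigma> by simp
    show "sem xs (Seq (Assign 17 (Num 0)) (Assign 18 (Num 1))) \<sigma> = (f(17 := 0, 18 := 1), A)" by (rule sem)
    show "bounded_state xs W (sem xs (Seq (Assign 17 (Num 0)) (Assign 18 (Num 1))) \<sigma>)"
      unfolding sem using b \<sigma> W(2) by (intro bounded_state_reg) auto
  qed (use b in simp_all)
  let ?T = "com_weight (Seq (Assign 17 (Num 0)) (Assign 18 (Num 1))) +
    (Suc B * (com_weight pow_code + 1 + expr_weight (Sub (Add (Mul (Num 2) (Reg 5)) (Num 1)) (Reg 18))) +
    ((B * ((pos_off k * (com_weight table_code + 10) + 10) + 10) + 10) + (com_weight (Assign 19 (Num 1)) +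
    ((k * (com_weight power_code + 10) + 10) +
     com_weight (block [Assign 20 (Inp (Reg 2)), Assign 36 (Add (Reg 2) (Num 1))])))))"
  have "runs xs W prep_code \<sigma> ?T ?Q"
    unfolding prep_code_def
  proof (rule runs_Seq[OF 1], goal_cases)
    case (1 \<tau>1)
    have t1: "fst \<tau>1 5 = pos_off k" "fst \<tau>1 17 = 0" "fst \<tau>1 18 = 1" using 1(2) p \<sigma> by simp_all
    show ?case
    proof (rule runs_Seq[OF runs_pow[OF 1(1) t1 mW, folded B_def]], goal_cases)
      case (1 \<tau>2)
      have same2: "same_except {17, 18} {5} \<sigma> \<tau>2"
        using 1(2) \<open>\<tau>1 = _\<close> \<sigma> by (auto simp: same_except_def)
      have t2: "fst \<tau>2 5 = pos_off k" "fst \<tau>2 17 = B" "\<forall>l<B. snd \<tau>2 5 l = 2 ^ l" "snd \<tau>2 3 = snd \<sigma> 3"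
        "snd \<sigma> 3 (pos_off k) = 0" "snd \<tau>2 6 = (\<lambda>_. 0)" "fst \<tau>2 18 = 2 ^ B"
        using 1(2) same2 p ht zero by (auto simp: same_except_def)
      show ?case
      proof (rule runs_Seq[OF runs_table[OF 1(1) t2(1-6)]], goal_cases)
        case (1 \<tau>3)
        obtain f3 A3 where \<tau>3: "\<tau>3 = (f3, A3)" by fastforce
        have same3: "same_except {9, 17, 18, 27, 30} {5, 6} \<sigma> (f3, A3)"
          "f3 17 = B" "f3 18 = 2 ^ B" "\<forall>l<B. A3 5 l = 2 ^ l"
          using 1(2) same2 t2 \<tau>3 by (auto simp: same_except_def)
        have tab3: "\<forall>p<pos_off k. \<forall>l<B. A3 6 (cell_addr B p l 0) = suf_min (snd \<sigma> 3) l p \<and>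
          A3 6 (cell_addr B p l 1) = pre_min (snd \<sigma> 3) l p"
          using 1(2) \<tau>3 by simp
        have 2: "runs xs W (Assign 19 (Num 1)) \<tau>3 (com_weight (Assign 19 (Num 1))) (\<lambda>\<tau>. \<tau> = (f3(19 := 1), A3))"
          using 1(1) \<tau>3 W(2) bounded_state_reg[of xs W f3 A3 1 19] by (intro runs_block) auto
        show ?case
        proof (rule runs_Seq[OF 2], goal_cases)
          case (1 \<tau>4)
          have t4: "fst \<tau>4 1 = k" "fst \<tau>4 17 = B" "fst \<tau>4 19 = 1" using 1(2) same3 k by (simp_all add: same_except_def)
          show ?case
          proof (rule runs_Seq[OF runs_power[OF 1(1) t4 W(1)[unfolded J_def] Bpos, folded J_def]], goal_cases)
            case (1 \<tau>5)
            obtain f5 A5 where \<tau>5: "\<tau>5 = (f5, A5)" by fastforce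
            have same5: "same_except {9, 17, 18, 19, 27, 30} {5, 6} \<sigma> (f5, A5)"
              "f5 17 = B" "f5 18 = 2 ^ B" "f5 19 = J" "A5 = A3"
              using 1(2) \<open>\<tau>4 = _\<close> same3 \<tau>5 by (auto simp: same_except_def)
            have f5: "f5 2 = ptr k" "f5 1 = k" "f5 5 = pos_off k" using same5(1) p k by (simp_all add: same_except_def)
            let ?c = "block [Assign 20 (Inp (Reg 2)), Assign 36 (Add (Reg 2) (Num 1))]"
            have sem: "sem xs ?c \<tau>5 = (f5(20 := hd rest, 36 := ptr k + 1), A5)"
              using \<tau>5 f5 xptr by simp
            have xW: "hd rest \<le> W" using b xptr by (metis bounded_state_def nth_mem)
            have pW: "ptr k + 1 \<le> W" using ptr_le[of k] W(2) by simp
            have same_arr: "A5 2 = snd \<sigma> 2" "A5 3 = snd \<sigma> 3" "A5 4 = snd \<sigma> 4" "A5 7 = snd \<sigma> 7"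
              using same5(1) by (simp_all add: same_except_def)
            show ?case
            proof (rule runs_block)
              show "bounded_state xs W (sem xs ?c \<tau>5)" unfolding sem
                using 1(1) \<tau>5 xW pW by (intro bounded_state_reg) auto
              show "?Q (sem xs ?c \<tau>5)" unfolding sem tables_def fst_conv snd_conv same_arr
                using f5 same5(2-5) same3(4) tab3 offs tabs ht zero by simp
            qed (use 1 in simp_all)
          qed
        qed
      qed
    qed
  qed
  then show ?thesis
  proof (rule runs_mono)
    let ?n = "k + B * pos_off k"
    have mB: "B \<le> B * pos_off k" using mpos by simp
    have le: "x \<le> ?n * x" for x using kpos by (cases "?n") auto
    let ?w = "com_weight pow_code + 1 + expr_weight (Sub (Add (Mul (Num 2) (Reg 5)) (Num 1)) (Reg 18))"
    have "Suc B \<le> 2 * ?n" using mB kpos unfolding distrib_left by linarith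
    then have "Suc B * ?w \<le> (2 * ?n) * ?w" by (rule mult_le_mono1)
    moreover have "B * ((pos_off k * (com_weight table_code + 10) + 10) + 10) + 10 \<le> ?n * (com_weight table_code + 40)"
    proof -
      have "B * ((pos_off k * (com_weight table_code + 10) + 10) + 10) = B * pos_off k * (com_weight table_code + 10) + B * 20"
        by (simp add: algebra_simps)
      also have "\<dots> \<le> ?n * (com_weight table_code + 10) + ?n * 20"
      proof (intro add_mono mult_le_mono1)
        show "B * pos_off k \<le> ?n" by simp
        show "B \<le> ?n" using mB by linarith
      qed
      finally have "B * ((pos_off k * (com_weight table_code + 10) + 10) + 10) \<le> ?n * (com_weight table_code + 10) + ?n * 20" .
      then show ?thesis using le[of 10] by (simp only: add_mult_distrib2)
    qed
    moreover have "k * (com_weight power_code + 10) + 10 \<le> ?n * (com_weight power_code + 20)"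
    proof -
      have "k * (com_weight power_code + 10) \<le> ?n * (com_weight power_code + 10)" by (intro mult_le_mono1) simp
      then show ?thesis using le[of 10] by (simp only: add_mult_distrib2)
    qed
    moreover have "2 * ?n * ?w = ?n * (2 * ?w)" by (simp only: ac_simps)
    ultimately show "?T \<le> ?n * prep_weight"
      unfolding prep_weight_def add_mult_distrib2[of ?n]
      using le[of "com_weight (Seq (Assign 17 (Num 0)) (Assign 18 (Num 1)))"] le[of "com_weight (Assign 19 (Num 1))"]
        le[of "com_weight (block [Assign 20 (Inp (Reg 2)), Assign 36 (Add (Reg 2) (Num 1))])"]
      by linarith
  qed
qed

section \<open>Matching data and query points\<close>

text \<open>Halve both numbers as long as the halves differ; the last pair of different quotients
  consists of consecutive numbers.\<close>

lemma div_successor: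
  fixes a b :: nat
  assumes "a < b" "b < 2 ^ B"
  shows "\<exists>l<B. b div 2 ^ l = a div 2 ^ l + 1"
  using assms
proof (induction B arbitrary: a b)
  case 0
  then show ?case by simp
next
  case (Suc B)
  show ?case
  proof (cases "a div 2 < b div 2")
    case True
    have "b div 2 < 2 ^ B" using Suc.prems(2) by auto
    then obtain l where "l < B" "b div 2 div 2 ^ l = a div 2 div 2 ^ l + 1"
      using Suc.IH[OF True] by blast
    then show ?thesis by (intro exI[of _ "Suc l"]) (simp add: div_mult2_eq)
  next
    case False
    then have "b = a + 1" using Suc.prems(1) by presburger
    then show ?thesis by (intro exI[of _ 0]) simp
  qed
qed

definition side_min :: "(nat \<Rightarrow> nat) \<Rightarrow> nat \<Rightarrow> nat \<Rightarrow> nat \<Rightarrow> nat" where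
  "side_min H s l p = (if s = 0 then suf_min H l p else pre_min H l p)"

text \<open>A point on the left names the block to its right, a point on the right names its own
  block. Equal names therefore mean adjacent blocks in the correct order.\<close>

definition cell :: "nat \<Rightarrow> nat \<Rightarrow> nat \<Rightarrow> nat" where
  "cell s l p = p div 2 ^ l + (1 - s)"

text \<open>The shift by \<open>m\<close> makes the subtraction exact: block minima are at most
  \<open>H p\<close>, and \<open>H p \<le> m\<close> wherever this is used. For \<open>t = 0\<close>
  this point contributes the block minimum, for \<open>t = 1\<close> its partner does.\<close>

definition weight :: "(nat \<Rightarrow> nat) \<Rightarrow> nat \<Rightarrow> nat \<Rightarrow> nat \<Rightarrow> nat \<Rightarrow> nat \<Rightarrow> nat" where
  "weight H m t s l p = H p + m - 2 * (side_min H s l p * (1 - t))"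

lemma suf_min_le: "suf_min H l p \<le> H p"
proof -
  have pos: "(0::nat) < 2 ^ l" by simp
  have "p \<le> p div 2 ^ l * 2 ^ l + (2 ^ l - 1)"
    using div_mult_mod_eq[of p "2 ^ l"] mod_less_divisor[OF pos, of p] by linarith
  then show ?thesis unfolding suf_min_def by (intro Min_le) auto
qed

lemma pre_min_le: "pre_min H l p \<le> H p"
  unfolding pre_min_def by (intro Min_le) auto

lemma side_min_le: "side_min H s l p \<le> H p"
  using suf_min_le pre_min_le by (simp add: side_min_def)

lemma weight_le: "H p \<le> m \<Longrightarrow> weight H m t s l p \<le> 2 * m"
  by (simp add: weight_def)

lemma height_dist_commute: "height_dist H a b = height_dist H b a"
  by (simp add: height_dist_def min.commute max.commute add.commute)

lemma height_dist_adjacent_blocks: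
  assumes "q div 2 ^ l = p div 2 ^ l + 1"
  shows "height_dist H p q = H p + H q - 2 * min (suf_min H l p) (pre_min H l q)"
proof -
  let ?w = "2 ^ l :: nat"
  have w: "0 < ?w" by simp
  let ?e = "p div ?w * ?w + (?w - 1)"
  have p: "p \<le> ?e" using div_mult_mod_eq[of p ?w] mod_less_divisor[OF w, of p] by linarith
  have q: "q div ?w * ?w \<le> q" by simp
  have e: "q div ?w * ?w = Suc ?e" unfolding assms using w by (simp add: algebra_simps)
  then have "p < q" using p q by linarith
  have "{p..q} = {p..?e} \<union> {q div ?w * ?w..q}" using p q e by auto
  then have "Min (H ` {p..q}) = Min (H ` {p..?e} \<union> H ` {q div ?w * ?w..q})" by (simp add: image_Un)
  also have "\<dots> = min (suf_min H l p) (pre_min H l q)"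
    unfolding suf_min_def pre_min_def using p q by (intro Min_Un) auto
  finally show ?thesis using \<open>p < q\<close> by (simp add: height_dist_def)
qed

lemma weight_match:
  assumes "s < 2" "t < 2" "cell s l p = cell (1 - s) l q" "H p \<le> m" "H q \<le> m"
  shows "weight H m t s l p + weight H m (1 - t) (1 - s) l q =
    H p + H q + 2 * m - 2 * (if t = 0 then side_min H s l p else side_min H (1 - s) l q)"
    and "height_dist H p q = H p + H q - 2 * min (side_min H s l p) (side_min H (1 - s) l q)"
proof -
  have "side_min H s l p \<le> m" "side_min H (1 - s) l q \<le> m"
    using side_min_le assms(4,5) le_trans by blast+
  then show "weight H m t s l p + weight H m (1 - t) (1 - s) l q =
    H p + H q + 2 * m - 2 * (if t = 0 then side_min H s l p else side_min H (1 - s) l q)"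
    using assms(2) side_min_le[of H s l p] side_min_le[of H "1 - s" l q] assms(4,5)
    by (auto simp: weight_def less_2_cases_iff)
  show "height_dist H p q = H p + H q - 2 * min (side_min H s l p) (side_min H (1 - s) l q)"
  proof (cases "s = 0")
    case True
    then have "q div 2 ^ l = p div 2 ^ l + 1" using assms(3) by (simp add: cell_def)
    then show ?thesis using True height_dist_adjacent_blocks[of q l p H] by (simp add: side_min_def)
  next
    case False
    then have "p div 2 ^ l = q div 2 ^ l + 1" using assms(1,3) by (simp add: cell_def less_2_cases_iff)
    then show ?thesis using False assms(1) height_dist_adjacent_blocks[of p l q H] height_dist_commute[of H p q]
      by (simp add: side_min_def min.commute less_2_cases_iff)
  qed
qed

text \<open>Subtracting either of the two minima takes away at least twice the lesser one. A wrong
  tag thus underestimates and cannot spoil a maximum.\<close>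

lemma weight_match_le:
  assumes "s < 2" "t < 2" "cell s l p = cell (1 - s) l q" "H p \<le> m" "H q \<le> m"
  shows "weight H m t s l p + weight H m (1 - t) (1 - s) l q \<le> height_dist H p q + 2 * m"
  using weight_match[where H = H and m = m, OF assms] side_min_le[of H s l p] side_min_le[of H "1 - s" l q]
  by (auto simp: min_def)

lemma weight_match_ex:
  assumes "p \<noteq> q" "p < 2 ^ B" "q < 2 ^ B" "H p \<le> m" "H q \<le> m"
  shows "\<exists>s<2. \<exists>t<2. \<exists>l<B. cell s l p = cell (1 - s) l q \<and>
    weight H m t s l p + weight H m (1 - t) (1 - s) l q = height_dist H p q + 2 * m"
proof -
  obtain s l where sl: "s < 2" "l < B" "cell s l p = cell (1 - s) l q"
  proof (cases "p < q")
    case True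
    then obtain l where "l < B" "q div 2 ^ l = p div 2 ^ l + 1" using div_successor assms(3) by blast
    then show thesis using that[of 0 l] by (simp add: cell_def)
  next
    case False
    then have "q < p" using assms(1) by simp
    then obtain l where "l < B" "p div 2 ^ l = q div 2 ^ l + 1" using div_successor assms(2) by blast
    then show thesis using that[of 1 l] by (simp add: cell_def)
  qed
  define t :: nat where "t = (if side_min H s l p \<le> side_min H (1 - s) l q then 0 else 1)"
  have "t < 2" by (simp add: t_def)
  from weight_match[where H = H and m = m, OF sl(1) this sl(3) assms(4,5)]
  have "weight H m t s l p + weight H m (1 - t) (1 - s) l q = height_dist H p q + 2 * m"
    using side_min_le[of H s l p] side_min_le[of H "1 - s" l q] by (auto simp: t_def min_def)
  then show ?thesis using sl \<open>t < 2\<close> by blast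
qed

text \<open>
  The number \<open>r\<close> encodes the choices for one coordinate: \<open>tag r\<close> says which of the two points
  accounts for the minimal height, \<open>side r\<close> whether the data point lies to the right, \<open>lev B r\<close> is
  the size of the adjacent blocks, and \<open>lev2 B r\<close> does the same for comparing two numbers.
\<close>

definition tag :: "nat \<Rightarrow> nat" where "tag r = r mod 2"
definition side :: "nat \<Rightarrow> nat" where "side r = r div 2 mod 2"
definition lev :: "nat \<Rightarrow> nat \<Rightarrow> nat" where "lev B r = r div 2 div 2 mod B"
definition lev2 :: "nat \<Rightarrow> nat \<Rightarrow> nat" where "lev2 B r = r div 2 div 2 div B mod B"
definition shift :: "nat \<Rightarrow> nat \<Rightarrow> nat" where "shift B r = r div 2 div 2 div B div B"

lemma choices_surj:
  assumes "t < 2" "s < 2" "l < B" "l2 < B"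
  shows "\<exists>r<4 * (B * B). tag r = t \<and> side r = s \<and> lev B r = l \<and> lev2 B r = l2"
proof -
  define r where "r = t + 2 * (s + 2 * (l + B * l2))"
  have "l + B * l2 < B * B"
  proof -
    have "l + B * l2 < B * Suc l2" using assms(3) by simp
    also have "\<dots> \<le> B * B" using assms(4) by (intro mult_le_mono2) simp
    finally show ?thesis .
  qed
  moreover have "t + 2 * (s + 2 * y) < 4 * z" if "y < z" for y z using that assms(1,2) by presburger
  ultimately have "r < 4 * (B * B)" unfolding r_def by blast
  have bit: "(u + 2 * x) div 2 = x \<and> (u + 2 * x) mod 2 = u" if "u < 2" for u x :: nat
    using that by presburger
  have "r div 2 = s + 2 * (l + B * l2)" "r mod 2 = t" using bit[OF assms(1)] by (simp_all only: r_def)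
  moreover have "(s + 2 * (l + B * l2)) div 2 = l + B * l2" "(s + 2 * (l + B * l2)) mod 2 = s"
    using bit[OF assms(2), of "l + B * l2"] by (simp_all only:)
  ultimately show ?thesis using assms(3,4) \<open>r < _\<close> by (intro exI[of _ r]) (simp add: tag_def side_def lev_def lev2_def)
qed

text \<open>Choices made independently for the coordinates combine into a single number, so one loop
  over \<open>j\<close> visits every combination.\<close>

lemma digits_surj:
  assumes "R > 0" "\<And>i. i < n \<Longrightarrow> r i < R"
  shows "\<exists>j<R ^ n. \<forall>i<n. j div R ^ i mod R = (r i :: nat)"
  using assms(2)
proof (induction n arbitrary: r)
  case 0
  then show ?case by simp
next
  case (Suc n)
  from Suc.IH[of "\<lambda>i. r (Suc i)"] Suc.prems obtain j where
    j: "j < R ^ n" "\<forall>i<n. j div R ^ i mod R = r (Suc i)" by auto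
  have r0: "r 0 < R" using Suc.prems by simp
  have "r 0 + R * j < R ^ Suc n"
  proof -
    have "r 0 + R * j < R * Suc j" using r0 by simp
    also have "\<dots> \<le> R * R ^ n" using j(1) by (intro mult_le_mono2) simp
    finally show ?thesis by simp
  qed
  moreover have "(r 0 + R * j) div R ^ i mod R = r i" if "i < Suc n" for i
  proof (cases i)
    case 0
    then show ?thesis using r0 by simp
  next
    case (Suc i')
    then have "(r 0 + R * j) div R ^ i = j div R ^ i'" using r0 assms(1) by (simp add: div_mult2_eq)
    then show ?thesis using j(2) Suc that by simp
  qed
  ultimately show ?case by blast
qed

text \<open>The program strips digits from \<open>j\<close> without reducing the rest, so each
  coordinate sees its own digit followed by all later ones. The four readers depend on the lowest
  digit alone.\<close>

lemma tag_mod: "tag (x mod (4 * (B * B))) = tag x"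
  and side_mod: "side (x mod (4 * (B * B))) = side x"
  and lev_mod: "lev B (x mod (4 * (B * B))) = lev B x"
  and lev2_mod: "lev2 B (x mod (4 * (B * B))) = lev2 B x"
proof -
  have 4: "4 * (B * B) = 2 * (2 * (B * B))" by simp
  have h: "x mod (2 * y) div 2 = x div 2 mod y" "x mod (2 * y) mod 2 = x mod 2" for x y :: nat
    by (simp_all add: mod_mult2_eq mod_mod_cancel)
  have h3: "x mod (B * B) div B = x div B mod B" "x mod (B * B) mod B = x mod B" for x
    by (cases "B = 0"; simp add: mod_mult2_eq)+
  show "tag (x mod (4 * (B * B))) = tag x" "side (x mod (4 * (B * B))) = side x"
    "lev B (x mod (4 * (B * B))) = lev B x" "lev2 B (x mod (4 * (B * B))) = lev2 B x"
    unfolding tag_def side_def lev_def lev2_def 4 h h3 by simp_all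
qed

primrec rem :: "nat \<Rightarrow> nat \<Rightarrow> nat \<Rightarrow> nat" where
  "rem B j 0 = j"
| "rem B j (Suc i) = shift B (rem B j i)"

lemma rem_eq: "rem B j i = j div (4 * (B * B)) ^ i"
proof (induction i)
  case (Suc i)
  have "shift B x = x div (4 * (B * B))" for x
    by (simp add: shift_def div_mult2_eq[symmetric] mult.assoc[symmetric])
  then show ?case using Suc by (simp add: div_mult2_eq[symmetric] mult.commute)
qed simp

text \<open>
  \<open>b = 0\<close> for a data point and \<open>b = 1\<close> for a query, which uses the complementary tag and side.
  The second cell matters only for \<open>min\<close>: the two match iff the data weight \<open>a\<close> and the query weight
  \<open>b\<close> satisfy \<open>a > thr + 2 * m - b - 1\<close> at this level.
\<close>

definition coord_weight :: "(nat \<Rightarrow> nat) \<Rightarrow> nat \<Rightarrow> nat \<Rightarrow> nat \<Rightarrow> nat \<Rightarrow> nat \<Rightarrow> nat" where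
  "coord_weight H m B b r p = (if b = 0 then weight H m (tag r) (side r) (lev B r) p
     else weight H m (1 - tag r) (1 - side r) (lev B r) p)"

definition coord_cell :: "nat \<Rightarrow> nat \<Rightarrow> nat \<Rightarrow> nat \<Rightarrow> nat" where
  "coord_cell B b r p = (if b = 0 then cell (side r) (lev B r) p else cell (1 - side r) (lev B r) p)"

definition coord_cell2 :: "bool \<Rightarrow> (nat \<Rightarrow> nat) \<Rightarrow> nat \<Rightarrow> nat \<Rightarrow> nat \<Rightarrow> nat \<Rightarrow> nat \<Rightarrow> nat \<Rightarrow> nat" where
  "coord_cell2 mm H m B thr b r p = (if \<not> mm then 0
     else if b = 0 then coord_weight H m B b r p div 2 ^ lev2 B r
     else (thr + 2 * m - coord_weight H m B b r p - 1) div 2 ^ lev2 B r + 1)"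

lemma coord_weight_le: "H p \<le> m \<Longrightarrow> coord_weight H m B b r p \<le> 2 * m"
  by (simp add: coord_weight_def weight_le)

lemma coord_sound_plus:
  assumes "coord_cell B 0 r p = coord_cell B 1 r q" "H p \<le> m" "H q \<le> m"
  shows "coord_weight H m B 0 r p + coord_weight H m B 1 r q \<le> height_dist H p q + 2 * m"
  using weight_match_le[of "side r" "tag r" "lev B r" p q H m] assms
  by (simp add: coord_weight_def coord_cell_def side_def tag_def)

lemma coord_complete_plus:
  assumes "p \<noteq> q" "p < 2 ^ B" "q < 2 ^ B" "H p \<le> m" "H q \<le> m"
  shows "\<exists>r<4 * (B * B). coord_cell B 0 r p = coord_cell B 1 r q \<and>
    coord_weight H m B 0 r p + coord_weight H m B 1 r q = height_dist H p q + 2 * m"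
proof -
  obtain s t l where stl: "s < 2" "t < 2" "l < B" "cell s l p = cell (1 - s) l q"
    "weight H m t s l p + weight H m (1 - t) (1 - s) l q = height_dist H p q + 2 * m"
    using weight_match_ex[OF assms] by blast
  obtain r where "r < 4 * (B * B)" "tag r = t" "side r = s" "lev B r = l"
    using choices_surj[OF stl(2,1,3,3)] by blast
  then show ?thesis using stl by (intro exI[of _ r]) (simp add: coord_weight_def coord_cell_def)
qed

text \<open>With matching positions, the weights \<open>a\<close> and \<open>b\<close> satisfy
  \<open>a + b \<le> d + 2 * m\<close> for the distance \<open>d\<close>, with equality for a
  suitable choice. So \<open>d \<ge> thr\<close> holds iff \<open>a + b \<ge> thr + 2 * m\<close>
  for some choice, that is, \<open>a > thr + 2 * m - b - 1\<close>, and \<open>div_successor\<close>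
  turns this strict inequality into an equality of cells.\<close>

lemma coord_min:
  assumes "p \<noteq> q" "p < 2 ^ B" "q < 2 ^ B" "H p \<le> m" "H q \<le> m" "2 * m < 2 ^ B" "thr \<ge> 1"
  shows "thr \<le> height_dist H p q \<longleftrightarrow> (\<exists>r<4 * (B * B). coord_cell B 0 r p = coord_cell B 1 r q \<and>
    coord_cell2 True H m B thr 0 r p = coord_cell2 True H m B thr 1 r q)"
proof
  assume thr: "thr \<le> height_dist H p q"
  obtain s t l where stl: "s < 2" "t < 2" "l < B" "cell s l p = cell (1 - s) l q"
    "weight H m t s l p + weight H m (1 - t) (1 - s) l q = height_dist H p q + 2 * m"
    using weight_match_ex[OF assms(1-5)] by blast
  let ?a = "weight H m t s l p" and ?b = "weight H m (1 - t) (1 - s) l q"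
  have "?a \<le> 2 * m" using weight_le assms(4) by blast
  then have "?a < 2 ^ B" using assms(6) by linarith
  \<comment> \<open>No truncation takes place on the left because \<open>thr \<ge> 1\<close> and
    \<open>b \<le> 2 * m\<close>; with \<open>thr = 0\<close> the claim could fail.\<close>
  moreover have "thr + 2 * m - b - 1 < a" if "a + b = height_dist H p q + 2 * m" "b \<le> 2 * m" for a b
    using that thr assms(7) by linarith
  from this[OF stl(5) weight_le[of H q m, OF assms(5)]] have "thr + 2 * m - ?b - 1 < ?a" .
  ultimately obtain l2 where l2: "l2 < B" "?a div 2 ^ l2 = (thr + 2 * m - ?b - 1) div 2 ^ l2 + 1"
    using div_successor by blast
  obtain r where "r < 4 * (B * B)" "tag r = t" "side r = s" "lev B r = l" "lev2 B r = l2"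
    using choices_surj[OF stl(2,1,3) l2(1)] by blast
  then show "\<exists>r<4 * (B * B). coord_cell B 0 r p = coord_cell B 1 r q \<and>
    coord_cell2 True H m B thr 0 r p = coord_cell2 True H m B thr 1 r q"
    using stl l2 by (intro exI[of _ r]) (simp add: coord_weight_def coord_cell_def coord_cell2_def)
next
  assume "\<exists>r<4 * (B * B). coord_cell B 0 r p = coord_cell B 1 r q \<and>
    coord_cell2 True H m B thr 0 r p = coord_cell2 True H m B thr 1 r q"
  then obtain r where r: "coord_cell B 0 r p = coord_cell B 1 r q"
    "coord_cell2 True H m B thr 0 r p = coord_cell2 True H m B thr 1 r q" by blast
  let ?a = "coord_weight H m B 0 r p" and ?b = "coord_weight H m B 1 r q"
  have "\<not> ?a \<le> thr + 2 * m - ?b - 1"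
  proof
    assume "?a \<le> thr + 2 * m - ?b - 1"
    then have "?a div 2 ^ lev2 B r \<le> (thr + 2 * m - ?b - 1) div 2 ^ lev2 B r" by (rule div_le_mono)
    then show False using r(2) by (simp add: coord_cell2_def)
  qed
  then have "thr + 2 * m \<le> ?a + ?b" by linarith
  also have "\<dots> \<le> height_dist H p q + 2 * m" by (rule coord_sound_plus[OF r(1) assms(4,5)])
  finally show "thr \<le> height_dist H p q" by simp
qed

section \<open>Dictionary keys as numerals to the base \<open>K\<close>\<close>

primrec key :: "bool \<Rightarrow> (nat \<Rightarrow> nat) \<Rightarrow> nat \<Rightarrow> nat \<Rightarrow> nat \<Rightarrow> nat \<Rightarrow> nat \<Rightarrow> (nat \<Rightarrow> nat) \<Rightarrow> nat \<Rightarrow> nat \<Rightarrow> nat" where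
  "key mm H m B K thr b ps j 0 = j"
| "key mm H m B K thr b ps j (Suc i) = (key mm H m B K thr b ps j i * K +
     coord_cell B b (rem B j i) (ps i)) * K + coord_cell2 mm H m B thr b (rem B j i) (ps i)"

definition key_weight :: "bool \<Rightarrow> (nat \<Rightarrow> nat) \<Rightarrow> nat \<Rightarrow> nat \<Rightarrow> nat \<Rightarrow> (nat \<Rightarrow> nat) \<Rightarrow> nat \<Rightarrow> nat \<Rightarrow> nat" where
  "key_weight mm H m B b ps j n = (if mm then 0 else \<Sum>i<n. coord_weight H m B b (rem B j i) (ps i))"

text \<open>All digits are below \<open>K\<close>, so the numeral determines them. Its leading part
  is the combination \<open>j\<close>, which forces data and query to have made the same
  choices.\<close>

lemma key_eq_iff:
  assumes "\<And>i. i < n \<Longrightarrow> coord_cell B b (rem B j i) (ps i) < K \<and> coord_cell2 mm H m B thr b (rem B j i) (ps i) < K"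
    and "\<And>i. i < n \<Longrightarrow> coord_cell B b' (rem B j' i) (ps' i) < K \<and> coord_cell2 mm H m B thr' b' (rem B j' i) (ps' i) < K"
  shows "key mm H m B K thr b ps j n = key mm H m B K thr' b' ps' j' n \<longleftrightarrow> j = j' \<and>
    (\<forall>i<n. coord_cell B b (rem B j i) (ps i) = coord_cell B b' (rem B j' i) (ps' i) \<and>
       coord_cell2 mm H m B thr b (rem B j i) (ps i) = coord_cell2 mm H m B thr' b' (rem B j' i) (ps' i))"
  using assms
proof (induction n)
  case (Suc n)
  have split: "(x * K + c) * K + d = (x' * K + c') * K + d' \<longleftrightarrow> x = x' \<and> c = c' \<and> d = d'"
    if "c < K" "d < K" "c' < K" "d' < K" for x c d x' c' d'
  proof
    assume eq: "(x * K + c) * K + d = (x' * K + c') * K + d'"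
    have "((x * K + c) * K + d) div K = x * K + c" "((x' * K + c') * K + d') div K = x' * K + c'"
      "((x * K + c) * K + d) mod K = d" "((x' * K + c') * K + d') mod K = d'" using that by simp_all
    then have "x * K + c = x' * K + c'" "d = d'" using eq by metis+
    moreover have "(x * K + c) div K = x" "(x' * K + c') div K = x'" "(x * K + c) mod K = c" "(x' * K + c') mod K = c'"
      using that by simp_all
    ultimately show "x = x' \<and> c = c' \<and> d = d'" by metis
  qed simp
  have IH: "key mm H m B K thr b ps j n = key mm H m B K thr' b' ps' j' n \<longleftrightarrow> j = j' \<and>
    (\<forall>i<n. coord_cell B b (rem B j i) (ps i) = coord_cell B b' (rem B j' i) (ps' i) \<and>
       coord_cell2 mm H m B thr b (rem B j i) (ps i) = coord_cell2 mm H m B thr' b' (rem B j' i) (ps' i))"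
    using Suc.prems by (intro Suc.IH) (simp_all only: less_Suc_eq simp_thms)
  show ?case
    unfolding key.simps using Suc.prems(1)[of n] Suc.prems(2)[of n]
    by (subst split) (auto simp only: IH less_Suc_eq simp_thms)
qed simp

lemma key_le:
  assumes "\<And>i. i < n \<Longrightarrow> coord_cell B b (rem B j i) (ps i) < K \<and> coord_cell2 mm H m B thr b (rem B j i) (ps i) < K"
    and "j < J"
  shows "key mm H m B K thr b ps j n < J * (K * K) ^ n"
  using assms(1)
proof (induction n)
  case 0
  then show ?case using assms(2) by simp
next
  case (Suc n)
  have IH: "key mm H m B K thr b ps j n < J * (K * K) ^ n"
    using Suc.prems by (intro Suc.IH) simp
  have c: "coord_cell B b (rem B j n) (ps n) < K" "coord_cell2 mm H m B thr b (rem B j n) (ps n) < K"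
    using Suc.prems[of n] by simp_all
  have step: "x * K + c < y * K" if "c < K" "x < y" for x y c
  proof -
    have "x * K + c < Suc x * K" using that(1) by simp
    also have "\<dots> \<le> y * K" using that(2) by (intro mult_le_mono1) simp
    finally show ?thesis .
  qed
  show ?case using step[OF c(2) step[OF c(1) IH]] by (simp add: mult.assoc mult.commute mult.left_commute)
qed

text \<open>The parameters \<open>mm\<close> and \<open>b\<close> select the program text and are
  not read at run time. Register 26 is consumed digit by digit, and the key is extended by Horner's
  rule, with the base \<open>4 * 2 ^ B\<close> recovered from register 18.\<close>

definition coord_code :: "bool \<Rightarrow> nat \<Rightarrow> com" where
  "coord_code mm b = block
    [Assign 27 (Add (Arr 2 (Add (Arr 4 (Reg 23)) (Inp (if b = 0 then Add (Reg 36) (Reg 23) else Reg 23)))) (Num b)),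
     Assign 28 (if b = 0 then Mod (Reg 26) (Num 2) else Sub (Num 1) (Mod (Reg 26) (Num 2))),
     Assign 26 (Div (Reg 26) (Num 2)),
     Assign 29 (if b = 0 then Mod (Reg 26) (Num 2) else Sub (Num 1) (Mod (Reg 26) (Num 2))),
     Assign 26 (Div (Reg 26) (Num 2)),
     Assign 30 (Mod (Reg 26) (Reg 17)),
     Assign 26 (Div (Reg 26) (Reg 17)),
     Assign 31 (Mod (Reg 26) (Reg 17)),
     Assign 26 (Div (Reg 26) (Reg 17)),
     Assign 32 (Sub (Add (Arr 3 (Reg 27)) (Reg 5)) (Mul (Num 2) (Mul
       (Arr 6 (Add (Mul (Add (Mul (Reg 27) (Reg 17)) (Reg 30)) (Num 2)) (Reg 29))) (Sub (Num 1) (Reg 28))))),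
     Assign 24 (Add (Mul (Add (Mul (Reg 24) (Mul (Num 4) (Reg 18)))
         (Add (Div (Reg 27) (Arr 5 (Reg 30))) (Sub (Num 1) (Reg 29)))) (Mul (Num 4) (Reg 18)))
       (if \<not> mm then Num 0 else if b = 0 then Div (Reg 32) (Arr 5 (Reg 31))
        else Add (Div (Sub (Sub (Add (Reg 33) (Mul (Num 2) (Reg 5))) (Reg 32)) (Num 1)) (Arr 5 (Reg 31))) (Num 1))),
     Assign 25 (if mm then Reg 25 else Add (Reg 25) (Reg 32))]"

lemma loop_free_coord: "loop_free (coord_code mm b)"
  by (simp add: coord_code_def)

context forest
begin

abbreviation P_end :: nat where "P_end \<equiv> pos_off k"

text \<open>Large enough for every digit: \<open>2 * P_end\<close> and the thresholds are at most
  \<open>2 ^ B\<close>, and the second cell of a query can exceed their sum by one.\<close>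

definition K :: nat where "K = 4 * 2 ^ B"

lemma tables_same_except:
  assumes "tables \<sigma>" "same_except R {7} \<sigma> \<tau>" "R \<subseteq> {0} \<union> {20..37}"
  shows "tables \<tau>"
proof -
  have "fst \<tau> r = fst \<sigma> r" if "r \<notin> {0} \<union> {20..37}" for r
    using assms(2,3) that unfolding same_except_def by (meson subsetD)
  then have "fst \<tau> 1 = fst \<sigma> 1" "fst \<tau> 5 = fst \<sigma> 5" "fst \<tau> 17 = fst \<sigma> 17" "fst \<tau> 18 = fst \<sigma> 18"
    "fst \<tau> 19 = fst \<sigma> 19" by simp_all
  moreover have "snd \<tau> a = snd \<sigma> a" if "a \<noteq> 7" for a
    using assms(2) that unfolding same_except_def by simp
  then have "snd \<tau> 2 = snd \<sigma> 2" "snd \<tau> 3 = snd \<sigma> 3" "snd \<tau> 4 = snd \<sigma> 4" "snd \<tau> 5 = snd \<sigma> 5"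
    "snd \<tau> 6 = snd \<sigma> 6" by simp_all
  ultimately have "tables \<tau> = tables \<sigma>" unfolding tables_def by (simp only:)
  then show ?thesis using assms(1) by (rule iffD2)
qed

lemma same_except_mono: "same_except R A \<sigma> \<tau> \<Longrightarrow> R \<subseteq> R' \<Longrightarrow> A \<subseteq> A' \<Longrightarrow> same_except R' A' \<sigma> \<tau>"
  by (auto simp: same_except_def)

lemma P_end_less: "2 * P_end < 2 ^ B"
  unfolding B_def by (rule levels_upper)

lemma coord_cells_less:
  assumes "p < P_end" "\<And>q. H q \<le> q" "thr \<le> 2 ^ B"
  shows "coord_cell B b r p < K \<and> coord_cell2 mm H P_end B thr b r p < K"
proof -
  define E where "E = (2::nat) ^ B"
  have E: "2 * P_end < E" "thr \<le> E" "K = 4 * E"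
    unfolding E_def K_def by (rule P_end_less, rule assms(3), rule refl)
  have div_less: "x div y + z < K" if "x + z < K" for x y z
  proof -
    have "x div y + z \<le> x + z" by (intro add_right_mono div_le_dividend)
    then show ?thesis using that by (rule le_less_trans)
  qed
  have "p + z < K" if "z \<le> 1" for z
    using that assms(1) E by linarith
  then have cell: "cell s l p < K" for l s unfolding cell_def by (intro div_less) simp
  have 1: "coord_cell B b r p < K" unfolding coord_cell_def by (split if_split) (intro conjI impI cell)
  have w: "coord_weight H P_end B b r p \<le> 2 * P_end"
    using assms(1,2) by (intro coord_weight_le) (meson le_trans less_imp_le)
  have "coord_weight H P_end B b r p + 0 < K" using w E by linarith
  from div_less[OF this] have 2: "coord_weight H P_end B b r p div x + 0 < K" for x .
  have 3: "(thr + 2 * P_end - y - 1) div x + 1 < K" for x y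
  proof (rule div_less)
    have "thr + 2 * P_end - y - 1 \<le> thr + 2 * P_end" by simp
    then show "(thr + 2 * P_end - y - 1) + 1 < K" using E by linarith
  qed
  have 0: "0 < K" by (simp add: K_def)
  have "coord_cell2 mm H P_end B thr b r p < K"
    unfolding coord_cell2_def by (split if_split)+ (intro conjI impI 0 2[unfolded add_0_right] 3)
  then show ?thesis using 1 by blast
qed

text \<open>Room for all keys, for a sum of \<open>k\<close> weights increased by one, and for the
  base.\<close>

definition big :: "nat \<Rightarrow> bool" where
  "big w \<longleftrightarrow> J * (K * K) ^ k \<le> w \<and> 2 * P_end * k + 1 \<le> w \<and> K \<le> w"

text \<open>For \<open>b = 0\<close> the input is the global one and the tuple starts at the index
  in register 36; for \<open>b = 1\<close> the input is the query tuple itself. Adding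
  \<open>b\<close> to the position moves a query to the second copy.\<close>

lemma runs_coords:
  assumes t: "tables \<sigma>" and bd: "bounded_state ys W \<sigma>" and b: "b < 2" and W: "big W"
    and j: "fst \<sigma> 24 = j" "fst \<sigma> 25 = 0" "fst \<sigma> 26 = j" "j < J" and thr: "fst \<sigma> 33 = thr" "thr \<le> 2 ^ B"
    and ps: "\<And>i. i < k \<Longrightarrow> ps i < P_end"
    and inp: "\<And>i. i < k \<Longrightarrow> (if b = 0 then fst \<sigma> 36 else 0) + i < length ys \<and>
      snd \<sigma> 2 (off i + ys ! ((if b = 0 then fst \<sigma> 36 else 0) + i)) + b = ps i"
  shows "runs ys W (For 23 1 (coord_code mm b)) \<sigma> (k * (com_weight (coord_code mm b) + 10) + 10)
    (\<lambda>\<tau>. same_except {23..32} {} \<sigma> \<tau> \<and> fst \<tau> 24 = key mm (snd \<sigma> 3) P_end B K thr b ps j k \<and>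
       fst \<tau> 25 = key_weight mm (snd \<sigma> 3) P_end B b ps j k)"
proof -
  define H where "H = snd \<sigma> 3"
  have regs: "fst \<sigma> 1 = k" "fst \<sigma> 5 = P_end" "fst \<sigma> 17 = B" "fst \<sigma> 18 = 2 ^ B"
    and offs: "\<forall>j<k. snd \<sigma> 4 j = off j" and Hle': "\<forall>q. H q \<le> q" and pow: "\<forall>l<B. snd \<sigma> 5 l = 2 ^ l"
    and tab: "\<forall>p<P_end. \<forall>l<B. snd \<sigma> 6 (cell_addr B p l 0) = suf_min H l p \<and> snd \<sigma> 6 (cell_addr B p l 1) = pre_min H l p"
    using t unfolding tables_def H_def by - (elim conjE, assumption)+
  have Hle: "H q \<le> q" for q using Hle' by blast
  have bigW: "J * (K * K) ^ k \<le> W" "2 * P_end * k + 1 \<le> W" "K \<le> W"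
    using W unfolding big_def by - (elim conjE, assumption)+
  let ?I = "\<lambda>i \<tau>. same_except {23..32} {} \<sigma> \<tau> \<and> fst \<tau> 24 = key mm H P_end B K thr b ps j i \<and>
       fst \<tau> 25 = key_weight mm H P_end B b ps j i \<and> fst \<tau> 26 = rem B j i"
  have "runs ys W (For 23 1 (coord_code mm b)) \<sigma> (k * (com_weight (coord_code mm b) + 10) + 10)
    (\<lambda>\<rho>. fst \<rho> 1 = k \<and> ?I k \<rho>)"
  proof (rule runs_For[where I = ?I])
    show "?I 0 ((fst \<sigma>)(23 := 0), snd \<sigma>)" using j by (simp add: same_except_def key_weight_def)
  next
    fix i \<tau> assume i: "i < k" "fst \<tau> 23 = i" "fst \<tau> 1 = k" "bounded_state ys W \<tau>" "?I i \<tau>"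
    obtain f A where \<tau>: "\<tau> = (f, A)" by fastforce
    have same: "same_except {23..32} {} \<sigma> (f, A)" and f24: "f 24 = key mm H P_end B K thr b ps j i"
      and f25: "f 25 = key_weight mm H P_end B b ps j i" and f26: "f 26 = rem B j i"
      using i(5) \<tau> by simp_all
    have A: "A = snd \<sigma>" using same by (simp add: same_except_def fun_eq_iff)
    have f: "f 5 = P_end" "f 17 = B" "f 18 = 2 ^ B" "f 33 = thr" "f 36 = fst \<sigma> 36" "f 23 = i"
      using same regs thr i(2) \<tau> by (simp_all add: same_except_def)
    define r where "r = rem B j i"
    have Bpos: "B > 0" using P_end_less ps[OF i(1)] by (cases B) auto
    define s where "s = (if b = 0 then side r else 1 - side r)"
    define tg where "tg = (if b = 0 then tag r else 1 - tag r)"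
    have s2: "s < 2" "tg < 2" by (auto simp: s_def tg_def side_def tag_def)
    have lev: "lev B r < B" "lev2 B r < B" using Bpos by (simp_all add: lev_def lev2_def)
    have sm: "A 6 (cell_addr B (ps i) (lev B r) s) = side_min H s (lev B r) (ps i)"
      using tab ps[OF i(1)] lev s2(1) by (auto simp: A side_min_def less_2_cases_iff)
    have w: "coord_weight H P_end B b r (ps i) = H (ps i) + P_end - 2 * (A 6 (cell_addr B (ps i) (lev B r) s) * (1 - tg))"
      unfolding sm by (simp add: coord_weight_def weight_def s_def tg_def)
    have c: "coord_cell B b r (ps i) = ps i div 2 ^ lev B r + (1 - s)"
      by (simp add: coord_cell_def cell_def s_def)
    have powA: "A 5 (lev B r) = 2 ^ lev B r" "A 5 (lev2 B r) = 2 ^ lev2 B r" using pow lev by (simp_all add: A)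
    define w' where "w' = coord_weight H P_end B b r (ps i)"
    define key' where "key' = key mm H P_end B K thr b ps j (Suc i)"
    define kw where "kw = key_weight mm H P_end B b ps j (Suc i)"
    define f' where "f' = f(27 := ps i, 28 := tg, 29 := s, 30 := lev B r, 31 := lev2 B r, 26 := shift B r, 32 := w', 24 := key', 25 := kw)"
    have p: "A 2 (A 4 i + (if b = 0 then (if f 36 + i < length ys then ys ! (f 36 + i) else 0) else (if i < length ys then ys ! i else 0))) + b = ps i"
      using inp[OF i(1)] offs i(1) f(5) b by (auto simp: A less_2_cases_iff)
    have addr: "(ps i * B + lev B r) * 2 + s = cell_addr B (ps i) (lev B r) s" by (simp add: cell_addr_def)
    have key': "key' = (f 24 * (4 * 2 ^ B) + (ps i div 2 ^ lev B r + (1 - s))) * (4 * 2 ^ B) + coord_cell2 mm H P_end B thr b r (ps i)"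
      using c by (simp add: key'_def f24 K_def r_def)
    have c2: "coord_cell2 mm H P_end B thr b r (ps i) = (if \<not> mm then 0 else if b = 0 then w' div 2 ^ lev2 B r
      else (thr + 2 * P_end - w' - 1) div 2 ^ lev2 B r + 1)"
      by (simp add: coord_cell2_def w'_def)
    have kw: "kw = (if mm then f 25 else f 25 + w')" by (simp add: kw_def f25 key_weight_def w'_def r_def)
    define g where "g = f(27 := ps i, 28 := tg, 29 := s, 30 := lev B r, 31 := lev2 B r, 26 := shift B r)"
    have sem: "sem ys (coord_code mm b) \<tau> = (f', A)"
    proof -
      have v27: "val ys (f, A) (Add (Arr 2 (Add (Arr 4 (Reg 23)) (Inp (if b = 0 then Add (Reg 36) (Reg 23) else Reg 23)))) (Num b)) = ps i"
      proof -
        have "val ys (f, A) (Add (Arr 2 (Add (Arr 4 (Reg 23)) (Inp (if b = 0 then Add (Reg 36) (Reg 23) else Reg 23)))) (Num b)) =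
          A 2 (A 4 (f 23) + (if b = 0 then (if f 36 + f 23 < length ys then ys ! (f 36 + f 23) else 0)
            else (if f 23 < length ys then ys ! f 23 else 0))) + b"
          by (cases "b = 0") simp_all
        then show ?thesis unfolding f(6) p .
      qed
      have v28: "val ys (f(27 := ps i), A) (if b = 0 then Mod (Reg 26) (Num 2) else Sub (Num 1) (Mod (Reg 26) (Num 2))) = tg"
        by (simp add: tg_def tag_def f26 r_def)
      have v29: "val ys (f(27 := ps i, 28 := tg, 26 := r div 2), A) (if b = 0 then Mod (Reg 26) (Num 2) else Sub (Num 1) (Mod (Reg 26) (Num 2))) = s"
        by (simp add: s_def side_def)
      have v32: "val ys (g, A) (Sub (Add (Arr 3 (Reg 27)) (Reg 5)) (Mul (Num 2) (Mul
         (Arr 6 (Add (Mul (Add (Mul (Reg 27) (Reg 17)) (Reg 30)) (Num 2)) (Reg 29))) (Sub (Num 1) (Reg 28))))) = w'"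
      proof -
        have "val ys (g, A) (Sub (Add (Arr 3 (Reg 27)) (Reg 5)) (Mul (Num 2) (Mul
         (Arr 6 (Add (Mul (Add (Mul (Reg 27) (Reg 17)) (Reg 30)) (Num 2)) (Reg 29))) (Sub (Num 1) (Reg 28))))) =
          A 3 (ps i) + f 5 - 2 * (A 6 ((ps i * f 17 + lev B r) * 2 + s) * (1 - tg))"
          by (simp add: g_def)
        also have "\<dots> = w'" unfolding f addr w'_def w unfolding A H_def ..
        finally show ?thesis .
      qed
      have v24: "val ys (g(32 := w'), A) (Add (Mul (Add (Mul (Reg 24) (Mul (Num 4) (Reg 18)))
         (Add (Div (Reg 27) (Arr 5 (Reg 30))) (Sub (Num 1) (Reg 29)))) (Mul (Num 4) (Reg 18)))
         (if \<not> mm then Num 0 else if b = 0 then Div (Reg 32) (Arr 5 (Reg 31))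
          else Add (Div (Sub (Sub (Add (Reg 33) (Mul (Num 2) (Reg 5))) (Reg 32)) (Num 1)) (Arr 5 (Reg 31))) (Num 1))) = key'"
      proof -
        have "val ys (g(32 := w'), A) (Add (Mul (Add (Mul (Reg 24) (Mul (Num 4) (Reg 18)))
         (Add (Div (Reg 27) (Arr 5 (Reg 30))) (Sub (Num 1) (Reg 29)))) (Mul (Num 4) (Reg 18)))
         (if \<not> mm then Num 0 else if b = 0 then Div (Reg 32) (Arr 5 (Reg 31))
          else Add (Div (Sub (Sub (Add (Reg 33) (Mul (Num 2) (Reg 5))) (Reg 32)) (Num 1)) (Arr 5 (Reg 31))) (Num 1))) =
          (f 24 * (4 * f 18) + (ps i div A 5 (lev B r) + (1 - s))) * (4 * f 18) +
          (if \<not> mm then 0 else if b = 0 then w' div A 5 (lev2 B r)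
            else (f 33 + 2 * f 5 - w' - 1) div A 5 (lev2 B r) + 1)"
          by (cases mm; cases "b = 0") (simp_all add: g_def)
        then show ?thesis unfolding key' c2 f powA .
      qed
      have v25: "val ys (g(32 := w', 24 := key'), A) (if mm then Reg 25 else Add (Reg 25) (Reg 32)) = kw"
        unfolding kw by (simp add: g_def)
      have g: "f(27 := ps i, 28 := tg, 26 := r div 2, 29 := s, 26 := r div 2 div 2, 30 := r div 2 div 2 mod B,
          26 := r div 2 div 2 div B, 31 := r div 2 div 2 div B mod B, 26 := r div 2 div 2 div B div B) = g"
        by (rule ext) (simp add: g_def lev_def lev2_def shift_def)
      have f'g: "f' = g(32 := w', 24 := key', 25 := kw)" by (simp add: f'_def g_def)
      have regs': "val ys (f(27 := ps i, 28 := tg), A) (Div (Reg 26) (Num 2)) = r div 2"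
        "val ys (f(27 := ps i, 28 := tg, 26 := r div 2, 29 := s), A) (Div (Reg 26) (Num 2)) = r div 2 div 2"
        "val ys (f(27 := ps i, 28 := tg, 26 := r div 2, 29 := s, 26 := r div 2 div 2), A) (Mod (Reg 26) (Reg 17)) = r div 2 div 2 mod B"
        "val ys (f(27 := ps i, 28 := tg, 26 := r div 2, 29 := s, 26 := r div 2 div 2, 30 := r div 2 div 2 mod B), A)
          (Div (Reg 26) (Reg 17)) = r div 2 div 2 div B"
        "val ys (f(27 := ps i, 28 := tg, 26 := r div 2, 29 := s, 26 := r div 2 div 2, 30 := r div 2 div 2 mod B,
          26 := r div 2 div 2 div B), A) (Mod (Reg 26) (Reg 17)) = r div 2 div 2 div B mod B"
        "val ys (f(27 := ps i, 28 := tg, 26 := r div 2, 29 := s, 26 := r div 2 div 2, 30 := r div 2 div 2 mod B,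
          26 := r div 2 div 2 div B, 31 := r div 2 div 2 div B mod B), A) (Div (Reg 26) (Reg 17)) = r div 2 div 2 div B div B"
        using f f26 by (simp_all add: r_def)
      show ?thesis
        unfolding coord_code_def block.simps sem.simps \<tau> fst_conv snd_conv v27 v28 regs' v29 g v32 v24 v25 f'g ..
    qed
    have cells: "coord_cell B b (rem B j i') (ps i') < K \<and> coord_cell2 mm H P_end B thr b (rem B j i') (ps i') < K"
      if "i' < k" for i'
      using coord_cells_less[OF ps[OF that] Hle thr(2)] .
    have keyW: "key' \<le> W"
    proof -
      have "key' < J * (K * K) ^ Suc i" unfolding key'_def using cells i(1) j(4) by (intro key_le) auto
      also have "\<dots> \<le> J * (K * K) ^ k"
        using i(1) by (intro mult_le_mono2 power_increasing) (auto simp: K_def)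
      finally show ?thesis using bigW(1) by (rule less_imp_le[THEN le_trans])
    qed
    have Hm: "H (ps i') \<le> P_end" if "i' < k" for i' using Hle[of "ps i'"] ps[OF that] by simp
    have kwW: "kw \<le> W"
    proof -
      have "(\<Sum>i'<Suc i. coord_weight H P_end B b (rem B j i') (ps i')) \<le> (\<Sum>i'<Suc i. 2 * P_end)"
      proof (rule sum_mono)
        fix i' assume "i' \<in> {..<Suc i}"
        then have "i' < k" using i(1) by simp
        then have "H (ps i') \<le> P_end" by (rule Hm)
        then show "coord_weight H P_end B b (rem B j i') (ps i') \<le> 2 * P_end" by (rule coord_weight_le)
      qed
      also have "\<dots> = Suc i * (2 * P_end)" by (simp only: sum_constant card_lessThan of_nat_id)
      also have "\<dots> \<le> k * (2 * P_end)" using i(1) by (intro mult_le_mono1 Suc_leI)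
      also have "\<dots> = 2 * P_end * k" by (simp only: ac_simps)
      also have "\<dots> \<le> W" using bigW(2) by (rule Suc_leD[unfolded Suc_eq_plus1])
      finally show ?thesis unfolding kw_def key_weight_def by (cases mm) (simp_all only: if_True if_False le0)
    qed
    have w'W: "w' \<le> W"
    proof -
      have "w' \<le> 2 * P_end" unfolding w'_def using Hm[OF i(1)] by (rule coord_weight_le)
      moreover have "2 * P_end \<le> K" using P_end_less unfolding K_def by (rule less_imp_le[THEN le_trans]) simp
      ultimately show ?thesis using bigW(3) by (meson le_trans)
    qed
    have bfA: "bounded_state ys W (f, A)" using i(4) \<tau> by simp
    have small: "B \<le> W" "P_end \<le> W" "1 \<le> W"
      using bounded_stateD(1)[OF bfA, of 17] bounded_stateD(1)[OF bfA, of 5] bigW(2) unfolding f by (blast, blast, linarith)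
    have rW: "r \<le> W" using bfA f26 by (metis bounded_stateD(1) r_def)
    show "runs ys W (coord_code mm b) \<tau> (com_weight (coord_code mm b))
      (\<lambda>\<rho>. fst \<rho> 23 = i \<and> fst \<rho> 1 = k \<and> ?I (Suc i) ((fst \<rho>)(23 := Suc i), snd \<rho>))"
    proof (rule runs_block)
      show "loop_free (coord_code mm b)" by (rule loop_free_coord)
      have "ps i \<le> W" "tg \<le> W" "s \<le> W" "lev B r \<le> W" "lev2 B r \<le> W"
        using ps[OF i(1)] s2 lev small by linarith+
      moreover have "shift B r \<le> W"
      proof -
        have "shift B r \<le> r" unfolding shift_def by (meson div_le_dividend le_trans)
        then show ?thesis using rW by simp
      qed
      ultimately show "bounded_state ys W (sem ys (coord_code mm b) \<tau>)"
        unfolding sem f'_def using bfA keyW kwW w'W by (intro bounded_state_reg) auto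
      have 1: "same_except {23..32} {} \<sigma> (f'(23 := Suc i), A)"
        using same by (simp add: same_except_def f'_def)
      have 2: "(f'(23 := Suc i)) 26 = rem B j (Suc i)" by (simp add: f'_def r_def)
      have 3: "(f'(23 := Suc i)) 24 = key'" "(f'(23 := Suc i)) 25 = kw" by (simp_all add: f'_def)
      have 4: "f' 23 = i" "f' 1 = k" using i(2,3) \<tau> by (simp_all add: f'_def)
      show "fst (sem ys (coord_code mm b) \<tau>) 23 = i \<and> fst (sem ys (coord_code mm b) \<tau>) 1 = k \<and>
        ?I (Suc i) ((fst (sem ys (coord_code mm b) \<tau>))(23 := Suc i), snd (sem ys (coord_code mm b) \<tau>))"
        unfolding sem fst_conv snd_conv
        by (rule conjI[OF 4(1) conjI[OF 4(2) conjI[OF 1 conjI[OF 3(1)[unfolded key'_def] conjI[OF 3(2)[unfolded kw_def] 2]]]]])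
    qed (rule i)
  qed (use regs bd in simp_all)
  then show ?thesis unfolding H_def by (rule runs_mono) blast+
qed

end

text \<open>Weights are stored increased by one, so the initial content zero means that a key is
  absent. The two conditions together make an entry the greatest weight among the elements with that
  key.\<close>

definition dict_ok :: "('s \<Rightarrow> nat) \<Rightarrow> ('s \<Rightarrow> nat) \<Rightarrow> 's set \<Rightarrow> (nat \<Rightarrow> nat) \<Rightarrow> bool" where
  "dict_ok \<kappa> w S D \<longleftrightarrow> (\<forall>s\<in>S. w s + 1 \<le> D (\<kappa> s)) \<and> (\<forall>x. D x = 0 \<or> (\<exists>s\<in>S. x = \<kappa> s \<and> D x = w s + 1))"

lemma dict_ok_empty: "dict_ok \<kappa> w {} (\<lambda>_. 0)"
  by (simp add: dict_ok_def)

lemma dict_ok_nonzero: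
  assumes "dict_ok \<kappa> w S D" "D x \<noteq> 0"
  obtains s where "s \<in> S" "x = \<kappa> s" "D x = w s + 1"
proof -
  have "D x = 0 \<or> (\<exists>s\<in>S. x = \<kappa> s \<and> D x = w s + 1)"
    using assms(1) unfolding dict_ok_def by (rule conjunct2[THEN spec])
  then have "\<exists>s\<in>S. x = \<kappa> s \<and> D x = w s + 1"
  proof
    assume "D x = 0"
    with assms(2) show ?thesis by (rule notE)
  qed
  then show thesis by (elim bexE conjE) (rule that)
qed

lemma dict_ok_le: "dict_ok \<kappa> w S D \<Longrightarrow> s \<in> S \<Longrightarrow> w s + 1 \<le> D (\<kappa> s)"
  unfolding dict_ok_def by (elim conjE) (erule (1) bspec)

lemma dict_ok_insert:
  assumes "dict_ok \<kappa> w S D"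
  shows "dict_ok \<kappa> w (insert s S) (D(\<kappa> s := max (D (\<kappa> s)) (w s + 1)))"
proof -
  let ?D = "D(\<kappa> s := max (D (\<kappa> s)) (w s + 1))"
  have "w s' + 1 \<le> ?D (\<kappa> s')" if "s' \<in> insert s S" for s'
    using that assms unfolding dict_ok_def by (cases "s' = s") (auto simp: le_max_iff_disj)
  moreover have "?D x = 0 \<or> (\<exists>s'\<in>insert s S. x = \<kappa> s' \<and> ?D x = w s' + 1)" for x
  proof (cases "x = \<kappa> s")
    case True
    show ?thesis
    proof (cases "D (\<kappa> s) \<le> w s + 1")
      case True
      then show ?thesis using \<open>x = \<kappa> s\<close> by (auto simp: max_def)
    next
      case False
      then obtain s' where "s' \<in> S" "\<kappa> s = \<kappa> s'" "D (\<kappa> s) = w s' + 1"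
        using assms unfolding dict_ok_def by (metis le0)
      then show ?thesis using \<open>x = \<kappa> s\<close> False by (intro disjI2 bexI[of _ s']) (auto simp: max_def)
    qed
  next
    case False
    then show ?thesis using assms unfolding dict_ok_def by auto
  qed
  ultimately show ?thesis unfolding dict_ok_def by blast
qed

lemma key_weight_le:
  assumes "\<And>i. i < l \<Longrightarrow> H (ps i) \<le> m"
  shows "key_weight mm H m B b ps j l \<le> 2 * m * l"
proof -
  have "(\<Sum>i<l. coord_weight H m B b (rem B j i) (ps i)) \<le> (\<Sum>i<l. 2 * m)"
  proof (rule sum_mono)
    fix i assume "i \<in> {..<l}"
    then have "H (ps i) \<le> m" using assms by blast
    then show "coord_weight H m B b (rem B j i) (ps i) \<le> 2 * m" by (rule coord_weight_le)
  qed
  also have "\<dots> = 2 * m * l" by simp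
  finally show ?thesis by (simp add: key_weight_def)
qed

lemma coord_mod:
  assumes "x mod (4 * (B * B)) = r"
  shows "coord_cell B b x p = coord_cell B b r p" "coord_weight H m B b x p = coord_weight H m B b r p"
    "coord_cell2 mm H m B thr b x p = coord_cell2 mm H m B thr b r p"
  unfolding assms[symmetric] coord_cell2_def coord_cell_def coord_weight_def tag_mod side_mod lev_mod lev2_mod
  by (rule refl)+

context forest
begin

section \<open>Correctness of the dictionary test\<close>

definition data_pos :: "(nat \<Rightarrow> nat) \<Rightarrow> nat list \<Rightarrow> nat \<Rightarrow> nat" where
  "data_pos pos s i = pos (off i + s ! i)"

definition query_pos :: "(nat \<Rightarrow> nat) \<Rightarrow> nat list \<Rightarrow> nat \<Rightarrow> nat" where
  "query_pos pos v i = pos (off i + v ! i) + 1"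

definition data_key :: "bool \<Rightarrow> (nat \<Rightarrow> nat) \<Rightarrow> (nat \<Rightarrow> nat) \<Rightarrow> nat list \<times> nat \<Rightarrow> nat" where
  "data_key mm H pos = (\<lambda>(s, j). key mm H P_end B K 0 0 (data_pos pos s) j k)"

definition data_weight :: "bool \<Rightarrow> (nat \<Rightarrow> nat) \<Rightarrow> (nat \<Rightarrow> nat) \<Rightarrow> nat list \<times> nat \<Rightarrow> nat" where
  "data_weight mm H pos = (\<lambda>(s, j). key_weight mm H P_end B 0 (data_pos pos s) j k)"

definition query_key :: "bool \<Rightarrow> (nat \<Rightarrow> nat) \<Rightarrow> (nat \<Rightarrow> nat) \<Rightarrow> nat list \<Rightarrow> nat \<Rightarrow> nat \<Rightarrow> nat" where
  "query_key mm H pos v thr j = key mm H P_end B K thr 1 (query_pos pos v) j k"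

definition query_weight :: "bool \<Rightarrow> (nat \<Rightarrow> nat) \<Rightarrow> (nat \<Rightarrow> nat) \<Rightarrow> nat list \<Rightarrow> nat \<Rightarrow> nat" where
  "query_weight mm H pos v j = key_weight mm H P_end B 1 (query_pos pos v) j k"

definition tuple :: "nat list \<Rightarrow> bool" where
  "tuple s \<longleftrightarrow> length s = k \<and> (\<forall>i<k. s ! i < n i)"

definition passes :: "bool \<Rightarrow> nat \<Rightarrow> nat list \<Rightarrow> nat list \<Rightarrow> bool" where
  "passes mm thr s v \<longleftrightarrow> (if mm then \<forall>i<k. thr \<le> graph_dist (Ts ! i) (s ! i) (v ! i)
     else thr \<le> (\<Sum>i<k. graph_dist (Ts ! i) (s ! i) (v ! i)))"

text \<open>Each coordinate contributes a shift of \<open>2 * P_end\<close>, and the entry is one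
  too large, so a nonzero truncated difference means that the unshifted sum reaches
  \<open>thr\<close>. For \<open>min\<close> the threshold is already in the key, and any entry is a
  success.\<close>

definition accepts :: "bool \<Rightarrow> (nat \<Rightarrow> nat) \<Rightarrow> (nat \<Rightarrow> nat) \<Rightarrow> (nat \<Rightarrow> nat) \<Rightarrow> nat list \<Rightarrow> nat \<Rightarrow> nat \<Rightarrow> bool" where
  "accepts mm H pos D v thr j \<longleftrightarrow>
     D (query_key mm H pos v thr j) + query_weight mm H pos v j - (if mm then 0 else thr + 2 * (k * P_end)) \<noteq> 0"

context
  fixes H pos :: "nat \<Rightarrow> nat"
  assumes placed: "\<forall>j<k. placed j pos H" and H_le: "\<forall>q. H q \<le> q"
begin

lemma pos_less: "i < k \<Longrightarrow> u < n i \<Longrightarrow> pos (off i + u) + 1 < P_end"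
proof -
  assume "i < k" "u < n i"
  then have "pos (off i + u) + 1 < pos_off (Suc i)" using placed unfolding placed_def by blast
  also have "\<dots> \<le> P_end" using \<open>i < k\<close> by (intro pos_off_mono) simp
  finally show ?thesis .
qed

lemma data_pos_less: "tuple s \<Longrightarrow> i < k \<Longrightarrow> data_pos pos s i < P_end"
  unfolding data_pos_def tuple_def using pos_less[of i "s ! i"] by simp

lemma query_pos_less: "tuple v \<Longrightarrow> i < k \<Longrightarrow> query_pos pos v i < P_end"
  unfolding query_pos_def tuple_def using pos_less[of i "v ! i"] by simp

lemma H_bound: "p < P_end \<Longrightarrow> H p \<le> P_end"
  using H_le[rule_format, of p] by simp

lemma P_end_bound: "p < P_end \<Longrightarrow> p < 2 ^ B"
  using P_end_less by (rule le_less_trans[rotated]) simp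

lemma pair_dist:
  assumes "tuple s" "tuple v" "i < k"
  shows "data_pos pos s i \<noteq> query_pos pos v i"
    and "height_dist H (data_pos pos s i) (query_pos pos v i) = graph_dist (Ts ! i) (s ! i) (v ! i)"
  using placed assms unfolding placed_def tuple_def data_pos_def query_pos_def by blast+

lemma key_match:
  assumes "tuple s" "tuple v" "thr \<le> 2 ^ B"
  shows "data_key mm H pos (s, j) = query_key mm H pos v thr j' \<longleftrightarrow> j = j' \<and>
    (\<forall>i<k. coord_cell B 0 (rem B j i) (data_pos pos s i) = coord_cell B 1 (rem B j' i) (query_pos pos v i) \<and>
       coord_cell2 mm H P_end B 0 0 (rem B j i) (data_pos pos s i) =
       coord_cell2 mm H P_end B thr 1 (rem B j' i) (query_pos pos v i))"
  unfolding data_key_def query_key_def prod.case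
proof (rule key_eq_iff)
  fix i assume i: "i < k"
  have H: "\<And>q. H q \<le> q" using H_le by blast
  show "coord_cell B 0 (rem B j i) (data_pos pos s i) < K \<and>
      coord_cell2 mm H P_end B 0 0 (rem B j i) (data_pos pos s i) < K"
    using data_pos_less[OF assms(1) i] H by (rule coord_cells_less) simp
  show "coord_cell B 1 (rem B j' i) (query_pos pos v i) < K \<and>
      coord_cell2 mm H P_end B thr 1 (rem B j' i) (query_pos pos v i) < K"
    using query_pos_less[OF assms(2) i] H assms(3) by (rule coord_cells_less)
qed

text \<open>The second hypothesis lets a property of the digit \<open>r\<close> pass to the
  unreduced remainder that the program really sees.\<close>

lemma choose_digits:
  assumes "\<And>i. i < k \<Longrightarrow> \<exists>r<4 * (B * B). Q i r" "\<And>i r x. Q i r \<Longrightarrow> x mod (4 * (B * B)) = r \<Longrightarrow> Q i x" "k > 0"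
  shows "\<exists>j<J. \<forall>i<k. Q i (rem B j i)"
proof -
  obtain r where r: "\<And>i. i < k \<Longrightarrow> r i < 4 * (B * B) \<and> Q i (r i)" using assms(1) by metis
  have "4 * (B * B) > 0" using r[OF assms(3)] by (cases "4 * (B * B)") auto
  then obtain j where j: "j < (4 * (B * B)) ^ k" "\<forall>i<k. j div (4 * (B * B)) ^ i mod (4 * (B * B)) = r i"
    using digits_surj[of "4 * (B * B)" k r] r by blast
  have "Q i (rem B j i)" if "i < k" for i
    using assms(2)[of i "r i" "rem B j i"] r[OF that] j(2) that by (simp add: rem_eq)
  then show ?thesis using j(1) unfolding J_def by blast
qed

text \<open>An entry under the query key comes from a tuple that matches in every coordinate, so its
  sum of weights is a lower bound for the true sum. Conversely, a tuple that passes admits a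
  combination that is exact in all coordinates for \<open>+\<close>, and that matches both cells for
  \<open>min\<close>.\<close>

lemma check_iff:
  assumes D: "dict_ok (data_key mm H pos) (data_weight mm H pos) (S \<times> {..<J}) D"
    and S: "\<And>s. s \<in> S \<Longrightarrow> tuple s" and v: "tuple v" and thr: "1 \<le> thr" "thr \<le> 2 ^ B" and kpos: "k > 0"
  shows "(\<exists>j<J. accepts mm H pos D v thr j) \<longleftrightarrow> (\<exists>s\<in>S. passes mm thr s v)"
proof
  assume "\<exists>j<J. accepts mm H pos D v thr j"
  then obtain j where j: "j < J" "accepts mm H pos D v thr j" by blast
  let ?q = "query_key mm H pos v thr j"
  have wq: "query_weight mm H pos v j \<le> 2 * P_end * k"
    unfolding query_weight_def using query_pos_less[OF v] H_bound by (intro key_weight_le) blast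
  \<comment> \<open>Without an entry, the query weight alone would have to exceed the shift, which
    it cannot.\<close>
  have "D ?q \<noteq> 0"
  proof
    assume D0: "D ?q = 0"
    have acc: "query_weight mm H pos v j - (if mm then 0 else thr + 2 * (k * P_end)) \<noteq> 0"
      using j(2) unfolding accepts_def D0 add_0 .
    have "2 * P_end * k = 2 * (k * P_end)" by (simp only: ac_simps)
    then have wq': "query_weight mm H pos v j \<le> thr + 2 * (k * P_end)" using wq by linarith
    show False
    proof (cases mm)
      case True
      then have "query_weight mm H pos v j = 0" by (simp add: query_weight_def key_weight_def)
      then show False using acc by simp
    next
      case False
      then show False using acc wq' by (simp only: if_False diff_is_0_eq)
    qed
  qed
  with D obtain sj where sj: "sj \<in> S \<times> {..<J}" "?q = data_key mm H pos sj" "D ?q = data_weight mm H pos sj + 1"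
    by (rule dict_ok_nonzero)
  obtain s j' where "sj = (s, j')" by (cases sj)
  with sj have s: "s \<in> S" "?q = data_key mm H pos (s, j')" "D ?q = data_weight mm H pos (s, j') + 1"
    by simp_all
  have ts: "tuple s" by (rule S[OF s(1)])
  note km = s(2)[symmetric, unfolded key_match[OF ts v thr(2)]]
  have jj: "j' = j" by (rule conjunct1[OF km])
  have cells: "\<forall>i<k. coord_cell B 0 (rem B j i) (data_pos pos s i) = coord_cell B 1 (rem B j i) (query_pos pos v i) \<and>
       coord_cell2 mm H P_end B 0 0 (rem B j i) (data_pos pos s i) =
       coord_cell2 mm H P_end B thr 1 (rem B j i) (query_pos pos v i)"
    by (rule conjunct2[OF km, unfolded jj])
  have "passes mm thr s v"
  proof (cases mm)
    case True
    have "thr \<le> graph_dist (Ts ! i) (s ! i) (v ! i)" if i: "i < k" for i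
    proof -
      let ?x = "rem B j i"
      have p: "data_pos pos s i < P_end" "query_pos pos v i < P_end"
        using data_pos_less[OF ts i] query_pos_less[OF v i] .
      let ?r = "?x mod (4 * (B * B))"
      have "B > 0" using P_end_less p(1) by (cases B) auto
      then have "?r < 4 * (B * B)" by simp
      moreover have "coord_cell B 0 ?r (data_pos pos s i) = coord_cell B 1 ?r (query_pos pos v i)"
        unfolding coord_mod(1)[OF refl, of B _ ?x, symmetric] using cells i by blast
      moreover have "coord_cell2 True H P_end B thr 0 ?r (data_pos pos s i) = coord_cell2 True H P_end B thr 1 ?r (query_pos pos v i)"
      proof -
        \<comment> \<open>Data keys were built with threshold 0, before any query was known; on the
          data side the cell does not depend on the threshold.\<close>
        have "coord_cell2 True H P_end B thr 0 ?x (data_pos pos s i) = coord_cell2 True H P_end B 0 0 ?x (data_pos pos s i)"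
          by (simp add: coord_cell2_def)
        also have "\<dots> = coord_cell2 True H P_end B thr 1 ?x (query_pos pos v i)" by (rule conjunct2[OF cells[rule_format, OF i], unfolded eqTrueI[OF True]])
        finally show ?thesis unfolding coord_mod(3)[OF refl, of _ _ _ _ _ _ ?x] .
      qed
      ultimately have "thr \<le> height_dist H (data_pos pos s i) (query_pos pos v i)"
        using coord_min[OF pair_dist(1)[OF ts v i] P_end_bound[OF p(1)] P_end_bound[OF p(2)] H_bound[OF p(1)] H_bound[OF p(2)]
            P_end_less thr(1)] by blast
      then show ?thesis using pair_dist(2)[OF ts v i] by simp
    qed
    then show ?thesis using True by (simp add: passes_def)
  next
    case False
    have "data_weight mm H pos (s, j) + query_weight mm H pos v j =
      (\<Sum>i<k. coord_weight H P_end B 0 (rem B j i) (data_pos pos s i) + coord_weight H P_end B 1 (rem B j i) (query_pos pos v i))"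
      using False by (simp add: data_weight_def query_weight_def key_weight_def sum.distrib)
    also have "\<dots> \<le> (\<Sum>i<k. graph_dist (Ts ! i) (s ! i) (v ! i) + 2 * P_end)"
    proof (rule sum_mono)
      fix i assume "i \<in> {..<k}"
      then have i: "i < k" by simp
      have "coord_cell B 0 (rem B j i) (data_pos pos s i) = coord_cell B 1 (rem B j i) (query_pos pos v i)"
        using cells i by blast
      from coord_sound_plus[OF this H_bound[OF data_pos_less[OF ts i]] H_bound[OF query_pos_less[OF v i]]]
      show "coord_weight H P_end B 0 (rem B j i) (data_pos pos s i) + coord_weight H P_end B 1 (rem B j i) (query_pos pos v i)
        \<le> graph_dist (Ts ! i) (s ! i) (v ! i) + 2 * P_end"
        unfolding pair_dist(2)[OF ts v i] .
    qed
    also have "\<dots> = (\<Sum>i<k. graph_dist (Ts ! i) (s ! i) (v ! i)) + 2 * (k * P_end)"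
      by (simp add: sum.distrib)
    finally have "data_weight mm H pos (s, j) + query_weight mm H pos v j \<le>
      (\<Sum>i<k. graph_dist (Ts ! i) (s ! i) (v ! i)) + 2 * (k * P_end)" .
    moreover have "data_weight mm H pos (s, j) + 1 + query_weight mm H pos v j > thr + 2 * (k * P_end)"
      using j(2) False unfolding accepts_def s(3) jj by simp
    ultimately have "thr \<le> (\<Sum>i<k. graph_dist (Ts ! i) (s ! i) (v ! i))" by linarith
    then show ?thesis using False unfolding passes_def by simp
  qed
  then show "\<exists>s\<in>S. passes mm thr s v" using s(1) by blast
next
  assume "\<exists>s\<in>S. passes mm thr s v"
  then obtain s where s: "s \<in> S" "passes mm thr s v" by blast
  have ts: "tuple s" by (rule S[OF s(1)])
  let ?c = "\<lambda>i r. coord_cell B 0 r (data_pos pos s i) = coord_cell B 1 r (query_pos pos v i)"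
  let ?c2 = "\<lambda>i r. coord_cell2 mm H P_end B thr 0 r (data_pos pos s i) = coord_cell2 mm H P_end B thr 1 r (query_pos pos v i)"
  let ?w = "\<lambda>i r. coord_weight H P_end B 0 r (data_pos pos s i) + coord_weight H P_end B 1 r (query_pos pos v i) =
      graph_dist (Ts ! i) (s ! i) (v ! i) + 2 * P_end"
  have "\<exists>j<J. \<forall>i<k. ?c i (rem B j i) \<and> ?c2 i (rem B j i) \<and> (\<not> mm \<longrightarrow> ?w i (rem B j i))"
  proof (rule choose_digits)
    fix i assume i: "i < k"
    have p: "data_pos pos s i < P_end" "query_pos pos v i < P_end"
      using data_pos_less[OF ts i] query_pos_less[OF v i] .
    note facts = pair_dist(1)[OF ts v i] P_end_bound[OF p(1)] P_end_bound[OF p(2)] H_bound[OF p(1)] H_bound[OF p(2)]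
    show "\<exists>r<4 * (B * B). ?c i r \<and> ?c2 i r \<and> (\<not> mm \<longrightarrow> ?w i r)"
    proof (cases mm)
      case True
      then have "thr \<le> height_dist H (data_pos pos s i) (query_pos pos v i)"
        using s(2) i unfolding pair_dist(2)[OF ts v i] passes_def by simp
      then show ?thesis using coord_min[OF facts P_end_less thr(1)] True by simp
    next
      case False
      then show ?thesis using coord_complete_plus[OF facts] unfolding pair_dist(2)[OF ts v i]
        by (simp add: coord_cell2_def)
    qed
  next
    fix i r x assume r: "?c i r \<and> ?c2 i r \<and> (\<not> mm \<longrightarrow> ?w i r)" and x: "x mod (4 * (B * B)) = r"
    then show "?c i x \<and> ?c2 i x \<and> (\<not> mm \<longrightarrow> ?w i x)" unfolding coord_mod[OF x] by blast
  qed (rule kpos)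
  then obtain j where j: "j < J" "\<forall>i<k. ?c i (rem B j i) \<and> ?c2 i (rem B j i) \<and> (\<not> mm \<longrightarrow> ?w i (rem B j i))" by blast
  have eq: "data_key mm H pos (s, j) = query_key mm H pos v thr j"
    unfolding key_match[OF ts v thr(2)]
  proof (intro conjI allI impI refl)
    fix i assume "i < k"
    then show "?c i (rem B j i)" using j(2) by blast
    have "coord_cell2 mm H P_end B 0 0 (rem B j i) (data_pos pos s i) = coord_cell2 mm H P_end B thr 0 (rem B j i) (data_pos pos s i)"
      by (simp add: coord_cell2_def)
    then show "coord_cell2 mm H P_end B 0 0 (rem B j i) (data_pos pos s i) = coord_cell2 mm H P_end B thr 1 (rem B j i) (query_pos pos v i)"
      using j(2) \<open>i < k\<close> by simp
  qed
  have D1: "data_weight mm H pos (s, j) + 1 \<le> D (query_key mm H pos v thr j)"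
    unfolding eq[symmetric] using s(1) j(1) by (intro dict_ok_le[OF D]) simp
  have "accepts mm H pos D v thr j"
  proof (cases mm)
    case True
    then show ?thesis using D1 unfolding accepts_def by simp
  next
    case False
    have "data_weight mm H pos (s, j) + query_weight mm H pos v j =
      (\<Sum>i<k. coord_weight H P_end B 0 (rem B j i) (data_pos pos s i) + coord_weight H P_end B 1 (rem B j i) (query_pos pos v i))"
      using False by (simp add: data_weight_def query_weight_def key_weight_def sum.distrib)
    also have "\<dots> = (\<Sum>i<k. graph_dist (Ts ! i) (s ! i) (v ! i) + 2 * P_end)"
      using j(2) False by (intro sum.cong) auto
    also have "\<dots> = (\<Sum>i<k. graph_dist (Ts ! i) (s ! i) (v ! i)) + 2 * (k * P_end)"
      by (simp add: sum.distrib)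
    finally have "thr + 2 * (k * P_end) \<le> data_weight mm H pos (s, j) + query_weight mm H pos v j"
      using s(2) False by (simp add: passes_def)
    then show ?thesis using D1 False unfolding accepts_def by simp
  qed
  then show "\<exists>j<J. accepts mm H pos D v thr j" using j(1) by blast
qed

end

end

section \<open>Insertion and query\<close>

text \<open>The entry \<open>a\<close> becomes \<open>a + (w + 1 - a)\<close>, the maximum of
  \<open>a\<close> and \<open>w + 1\<close> by truncated subtraction.\<close>

definition insert_item :: "bool \<Rightarrow> com" where
  "insert_item mm =
     Seq (block [Assign 24 (Reg 22), Assign 25 (Num 0), Assign 26 (Reg 22), Assign 33 (Num 0)])
    (Seq (For 23 1 (coord_code mm 0))
         (Store 7 (Reg 24) (Add (Arr 7 (Reg 24)) (Sub (Add (Reg 25) (Num 1)) (Arr 7 (Reg 24))))))"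

definition insert_code :: "bool \<Rightarrow> com" where
  "insert_code mm = For 21 20 (Seq (For 22 19 (insert_item mm)) (Assign 36 (Add (Reg 36) (Reg 1))))"

definition query_item :: "bool \<Rightarrow> com" where
  "query_item mm =
     Seq (block [Assign 24 (Reg 22), Assign 25 (Num 0), Assign 26 (Reg 22)])
    (Seq (For 23 1 (coord_code mm 1))
         (Cond (Sub (Add (Arr 7 (Reg 24)) (Reg 25))
             (if mm then Num 0 else Add (Reg 33) (Mul (Num 2) (Mul (Reg 1) (Reg 5)))))
           (Assign 35 (Num 1)) Skip))"

definition query_round :: "bool \<Rightarrow> com" where
  "query_round mm =
     Seq (block [Assign 34 (Div (Reg 34) (Num 2)), Assign 33 (Add (Reg 0) (Reg 34)), Assign 35 (Num 0)])
    (Seq (For 22 19 (query_item mm)) (Cond (Reg 35) (Assign 0 (Reg 33)) Skip))"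

text \<open>A binary search from above: register 34 starts at \<open>2 ^ B\<close>, beyond every
  eccentricity, and is halved at the beginning of each of the \<open>B\<close> rounds.\<close>

definition query_code :: "bool \<Rightarrow> com" where
  "query_code mm = Seq (block [Assign 0 (Num 0), Assign 34 (Reg 18)]) (For 37 17 (query_round mm))"

lemma same_except_reg: "same_except R A \<sigma> (f, M) \<Longrightarrow> r \<in> R \<Longrightarrow> same_except R A \<sigma> (f(r := x), M)"
  unfolding same_except_def by auto

lemma same_except_arr: "same_except R A \<sigma> (f, M) \<Longrightarrow> a \<in> A \<Longrightarrow> same_except R A \<sigma> (f, M(a := x))"
  unfolding same_except_def by auto

lemma same_except_compose:
  "same_except R A \<rho> \<sigma> \<Longrightarrow> same_except R' A' \<sigma> \<tau> \<Longrightarrow> same_except (R \<union> R') (A \<union> A') \<rho> \<tau>"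
  unfolding same_except_def by auto

context forest
begin

definition item_weight :: "bool \<Rightarrow> nat" where
  "item_weight mm = com_weight (block [Assign 24 (Reg 22), Assign 25 (Num 0), Assign 26 (Reg 22), Assign 33 (Num 0)]) +
    (k * (com_weight (coord_code mm 0) + 10) + 10 +
     com_weight (Store 7 (Reg 24) (Add (Arr 7 (Reg 24)) (Sub (Add (Reg 25) (Num 1)) (Arr 7 (Reg 24))))))"

lemma tablesD:
  assumes "tables \<sigma>"
  shows "fst \<sigma> 1 = k" "fst \<sigma> 5 = P_end" "fst \<sigma> 17 = B" "fst \<sigma> 18 = 2 ^ B" "fst \<sigma> 19 = J"
    "\<forall>j<k. placed j (snd \<sigma> 2) (snd \<sigma> 3)" "\<forall>q. snd \<sigma> 3 q \<le> q"
  using assms unfolding tables_def by - (elim conjE, assumption)+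

lemma bigD:
  assumes "big w"
  shows "J * (K * K) ^ k \<le> w" "2 * P_end * k + 1 \<le> w" "K \<le> w"
  using assms unfolding big_def by - (elim conjE, assumption)+

lemma runs_insert_item:
  assumes t: "tables \<sigma>" and bd: "bounded_state ys W \<sigma>" and W: "big W"
    and j: "fst \<sigma> 22 = j" "j < J" and s: "tuple s"
    and inp: "\<And>i. i < k \<Longrightarrow> fst \<sigma> 36 + i < length ys \<and> ys ! (fst \<sigma> 36 + i) = s ! i"
  shows "runs ys W (insert_item mm) \<sigma> (item_weight mm)
    (\<lambda>\<tau>. same_except {23..33} {7} \<sigma> \<tau> \<and> snd \<tau> 7 = (snd \<sigma> 7)(data_key mm (snd \<sigma> 3) (snd \<sigma> 2) (s, j) :=
       max (snd \<sigma> 7 (data_key mm (snd \<sigma> 3) (snd \<sigma> 2) (s, j))) (data_weight mm (snd \<sigma> 3) (snd \<sigma> 2) (s, j) + 1)))"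
    (is "runs _ _ _ _ _ ?Q")
proof -
  define H where "H = snd \<sigma> 3"
  define pos where "pos = snd \<sigma> 2"
  define \<kappa> where "\<kappa> = data_key mm H pos (s, j)"
  define w where "w = data_weight mm H pos (s, j)"
  have pl: "\<forall>j<k. placed j pos H" "\<forall>q. H q \<le> q" using tablesD(6,7)[OF t] unfolding pos_def H_def .
  obtain f A where \<sigma>: "\<sigma> = (f, A)" by fastforce
  let ?c = "block [Assign 24 (Reg 22), Assign 25 (Num 0), Assign 26 (Reg 22), Assign 33 (Num 0)]"
  let ?\<sigma>1 = "(f(24 := j, 25 := 0, 26 := j, 33 := 0), A)"
  have jW: "j \<le> W" using bounded_stateD(1)[of ys W f A 22] bd \<sigma> j(1) by simp
  have 1: "runs ys W ?c \<sigma> (com_weight ?c) (\<lambda>\<tau>. \<tau> = ?\<sigma>1)"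
  proof (rule runs_block)
    have sem: "sem ys ?c \<sigma> = ?\<sigma>1" using \<sigma> j(1) by simp
    show "sem ys ?c \<sigma> = ?\<sigma>1" by (rule sem)
    show "bounded_state ys W (sem ys ?c \<sigma>)" unfolding sem
      using bd \<sigma> jW by (intro bounded_state_reg) auto
  qed (use bd in simp_all)
  have s1: "same_except {23..33} {7} \<sigma> ?\<sigma>1" using \<sigma> by (simp add: same_except_def)
  have t1: "tables ?\<sigma>1" by (rule tables_same_except[OF t s1]) auto
  show ?thesis unfolding insert_item_def item_weight_def
  proof (rule runs_Seq[OF 1], goal_cases)
    case (1 \<tau>1)
    have \<tau>1: "\<tau>1 = ?\<sigma>1" by (rule 1(2))
    have ps: "data_pos pos s i < P_end" if "i < k" for i by (rule data_pos_less[OF pl s that])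
    have "runs ys W (For 23 1 (coord_code mm 0)) \<tau>1 (k * (com_weight (coord_code mm 0) + 10) + 10)
      (\<lambda>\<tau>. same_except {23..32} {} \<tau>1 \<tau> \<and> fst \<tau> 24 = key mm (snd \<tau>1 3) P_end B K 0 0 (data_pos pos s) j k \<and>
         fst \<tau> 25 = key_weight mm (snd \<tau>1 3) P_end B 0 (data_pos pos s) j k)"
    proof (rule runs_coords)
      show "tables \<tau>1" using t1 \<tau>1 by simp
      show "fst \<tau>1 24 = j" "fst \<tau>1 25 = 0" "fst \<tau>1 26 = j" "fst \<tau>1 33 = 0" using \<tau>1 by simp_all
      show "(if (0::nat) = 0 then fst \<tau>1 36 else 0) + i < length ys \<and>
        snd \<tau>1 2 (off i + ys ! ((if (0::nat) = 0 then fst \<tau>1 36 else 0) + i)) + 0 = data_pos pos s i" if "i < k" for i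
        using inp[OF that] \<sigma> \<tau>1 by (simp add: data_pos_def pos_def)
    qed (use 1(1) W j(2) ps in auto)
    then show ?case
    proof (rule runs_Seq, goal_cases)
      case (1 \<tau>2)
      obtain f2 A2 where \<tau>2: "\<tau>2 = (f2, A2)" by fastforce
      have same: "same_except {23..32} {} \<tau>1 (f2, A2)" using 1(2) \<tau>2 by simp
      have A2: "A2 = A" using same \<tau>1 by (simp add: same_except_def fun_eq_iff)
      have f2: "f2 24 = \<kappa>" "f2 25 = w"
        using 1(2) unfolding \<kappa>_def w_def data_key_def data_weight_def H_def \<tau>2 \<tau>1 \<sigma> by simp_all
      let ?st = "Store 7 (Reg 24) (Add (Arr 7 (Reg 24)) (Sub (Add (Reg 25) (Num 1)) (Arr 7 (Reg 24))))"
      have max: "a + (w + 1 - a) = max a (w + 1)" for a :: nat by simp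
      have sem: "sem ys ?st \<tau>2 = (f2, A2(7 := (A2 7)(\<kappa> := max (A2 7 \<kappa>) (w + 1))))"
        unfolding \<tau>2 using f2 max by simp
      have wW: "w + 1 \<le> W"
      proof -
        have "w \<le> 2 * P_end * k" unfolding w_def data_weight_def prod.case
          using H_bound[OF pl] ps by (intro key_weight_le) blast
        then show ?thesis using bigD(2)[OF W] by linarith
      qed
      show ?case
      proof (rule runs_block)
        have bfA: "bounded_state ys W (f2, A2)" using 1(1) \<tau>2 by simp
        then have "max (A2 7 \<kappa>) (w + 1) \<le> W" using bounded_stateD(2)[OF bfA] wW by simp
        then show "bounded_state ys W (sem ys ?st \<tau>2)" unfolding sem using bfA by (intro bounded_state_arr)
        have "same_except {23..33} {7} \<sigma> (f2, A2(7 := (A2 7)(\<kappa> := max (A2 7 \<kappa>) (w + 1))))"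
        proof (rule same_except_arr)
          have "same_except ({23..33} \<union> {23..32}) ({7} \<union> {}) \<sigma> (f2, A2)"
            by (rule same_except_compose[OF s1 same[unfolded \<tau>1]])
          then show "same_except {23..33} {7} \<sigma> (f2, A2)" by (rule same_except_mono) auto
        qed simp
        moreover have "(A2(7 := (A2 7)(\<kappa> := max (A2 7 \<kappa>) (w + 1)))) 7 = (A 7)(\<kappa> := max (A 7 \<kappa>) (w + 1))"
          using A2 by simp
        ultimately show "?Q (sem ys ?st \<tau>2)"
          unfolding sem H_def[symmetric] pos_def[symmetric] \<kappa>_def[symmetric] w_def[symmetric] fst_conv snd_conv
          using \<sigma> by simp
      qed (use 1 in simp_all)
    qed
  qed
qed

text \<open>During the inner loop the dictionary describes all combinations of the earlier tuples
  and the first ones of the current tuple, so every step adds a single pair of tuple and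
  combination.\<close>

lemma runs_insert:
  assumes t: "tables \<sigma>" and bd: "bounded_state xs W \<sigma>" and W: "big W" "base + (length ss + 1) * k \<le> W"
    and base: "fst \<sigma> 36 = base" "fst \<sigma> 20 = length ss" and D: "snd \<sigma> 7 = (\<lambda>_. 0)"
    and ss: "\<And>c. c < length ss \<Longrightarrow> tuple (ss ! c)"
    and inp: "\<And>c i. c < length ss \<Longrightarrow> i < k \<Longrightarrow> base + c * k + i < length xs \<and> xs ! (base + c * k + i) = ss ! c ! i"
  shows "runs xs W (insert_code mm) \<sigma> (length ss * (J * (item_weight mm + 10) + 10 + com_weight (Assign 36 (Add (Reg 36) (Reg 1))) + 10) + 10)
    (\<lambda>\<tau>. same_except {21..36} {7} \<sigma> \<tau> \<and>
      dict_ok (data_key mm (snd \<sigma> 3) (snd \<sigma> 2)) (data_weight mm (snd \<sigma> 3) (snd \<sigma> 2)) (set ss \<times> {..<J}) (snd \<tau> 7))"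
proof -
  define \<kappa> where "\<kappa> = data_key mm (snd \<sigma> 3) (snd \<sigma> 2)"
  define w where "w = data_weight mm (snd \<sigma> 3) (snd \<sigma> 2)"
  let ?I = "\<lambda>c \<tau>. same_except {21..36} {7} \<sigma> \<tau> \<and> fst \<tau> 36 = base + c * k \<and> dict_ok \<kappa> w (set (take c ss) \<times> {..<J}) (snd \<tau> 7)"
  have "runs xs W (insert_code mm) \<sigma> (length ss * (J * (item_weight mm + 10) + 10 + com_weight (Assign 36 (Add (Reg 36) (Reg 1))) + 10) + 10)
    (\<lambda>\<rho>. fst \<rho> 20 = length ss \<and> ?I (length ss) \<rho>)"
    unfolding insert_code_def
  proof (rule runs_For[where I = ?I])
    show "?I 0 ((fst \<sigma>)(21 := 0), snd \<sigma>)"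
      using base D dict_ok_empty[of \<kappa> w] by (simp add: same_except_def)
  next
    fix c \<tau> assume c: "c < length ss" "fst \<tau> 21 = c" "fst \<tau> 20 = length ss" "bounded_state xs W \<tau>" "?I c \<tau>"
    define s where "s = ss ! c"
    have same: "same_except {21..36} {7} \<sigma> \<tau>" and b36: "fst \<tau> 36 = base + c * k"
      and dict: "dict_ok \<kappa> w (set (take c ss) \<times> {..<J}) (snd \<tau> 7)"
      using c(5) by - (elim conjE, assumption)+
    have tt: "tables \<tau>" by (rule tables_same_except[OF t same]) auto
    have arr: "snd \<tau> 3 = snd \<sigma> 3" "snd \<tau> 2 = snd \<sigma> 2" using same by (simp_all add: same_except_def)
    let ?J = "\<lambda>j \<rho>. same_except {22..33} {7} \<tau> \<rho> \<and> dict_ok \<kappa> w (set (take c ss) \<times> {..<J} \<union> {s} \<times> {..<j}) (snd \<rho> 7)"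
    have inner: "runs xs W (For 22 19 (insert_item mm)) \<tau> (J * (item_weight mm + 10) + 10) (\<lambda>\<rho>. fst \<rho> 19 = J \<and> ?J J \<rho>)"
    proof (rule runs_For[where I = ?J])
      show "fst \<tau> 19 = J" by (rule tablesD(5)[OF tt])
      show "?J 0 ((fst \<tau>)(22 := 0), snd \<tau>)" using dict by (simp add: same_except_def)
    next
      fix j \<rho> assume j: "j < J" "fst \<rho> 22 = j" "fst \<rho> 19 = J" "bounded_state xs W \<rho>" "?J j \<rho>"
      have same': "same_except {22..33} {7} \<tau> \<rho>"
        and dict': "dict_ok \<kappa> w (set (take c ss) \<times> {..<J} \<union> {s} \<times> {..<j}) (snd \<rho> 7)"
        using j(5) by - (elim conjE, assumption)+
      have tr: "tables \<rho>" by (rule tables_same_except[OF tt same']) auto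
      have arr': "snd \<rho> 3 = snd \<sigma> 3" "snd \<rho> 2 = snd \<sigma> 2" using same' arr by (simp_all add: same_except_def)
      have r36: "fst \<rho> 36 = base + c * k" using same' b36 by (simp add: same_except_def)
      have inp': "fst \<rho> 36 + i < length xs \<and> xs ! (fst \<rho> 36 + i) = s ! i" if "i < k" for i
        unfolding r36 s_def by (rule inp[OF c(1) that])
      have "runs xs W (insert_item mm) \<rho> (item_weight mm)
        (\<lambda>\<tau>. same_except {23..33} {7} \<rho> \<tau> \<and> snd \<tau> 7 = (snd \<rho> 7)(\<kappa> (s, j) := max (snd \<rho> 7 (\<kappa> (s, j))) (w (s, j) + 1)))"
        using runs_insert_item[OF tr j(4) W(1) j(2) j(1) ss[OF c(1), folded s_def] inp'] unfolding arr' \<kappa>_def w_def .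
      then show "runs xs W (insert_item mm) \<rho> (item_weight mm)
        (\<lambda>\<rho>. fst \<rho> 22 = j \<and> fst \<rho> 19 = J \<and> ?J (Suc j) ((fst \<rho>)(22 := Suc j), snd \<rho>))"
      proof (rule runs_mono)
        fix \<pi> assume \<pi>: "same_except {23..33} {7} \<rho> \<pi> \<and> snd \<pi> 7 = (snd \<rho> 7)(\<kappa> (s, j) := max (snd \<rho> 7 (\<kappa> (s, j))) (w (s, j) + 1))"
        have "insert (s, j) (set (take c ss) \<times> {..<J} \<union> {s} \<times> {..<j}) = set (take c ss) \<times> {..<J} \<union> {s} \<times> {..<Suc j}"
          by (auto simp: less_Suc_eq)
        then have "dict_ok \<kappa> w (set (take c ss) \<times> {..<J} \<union> {s} \<times> {..<Suc j}) (snd \<pi> 7)"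
          using dict_ok_insert[OF dict', of "(s, j)"] \<pi> by simp
        moreover have "same_except {22..33} {7} \<tau> ((fst \<pi>)(22 := Suc j), snd \<pi>)"
          using \<pi> same' by (auto simp: same_except_def)
        moreover have "fst \<pi> 22 = j" "fst \<pi> 19 = J" using \<pi> j(2,3) by (auto simp: same_except_def)
        ultimately show "fst \<pi> 22 = j \<and> fst \<pi> 19 = J \<and> ?J (Suc j) ((fst \<pi>)(22 := Suc j), snd \<pi>)" by simp
      qed simp
    qed (use c in simp_all)
    show "runs xs W (Seq (For 22 19 (insert_item mm)) (Assign 36 (Add (Reg 36) (Reg 1)))) \<tau>
      (J * (item_weight mm + 10) + 10 + com_weight (Assign 36 (Add (Reg 36) (Reg 1))))
      (\<lambda>\<rho>. fst \<rho> 21 = c \<and> fst \<rho> 20 = length ss \<and> ?I (Suc c) ((fst \<rho>)(21 := Suc c), snd \<rho>))"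
    proof (rule runs_Seq[OF inner])
      fix \<rho> assume \<rho>: "bounded_state xs W \<rho>" "fst \<rho> 19 = J \<and> ?J J \<rho>"
      obtain g A where g: "\<rho> = (g, A)" by fastforce
      have same': "same_except {22..33} {7} \<tau> (g, A)"
        and dict': "dict_ok \<kappa> w (set (take c ss) \<times> {..<J} \<union> {s} \<times> {..<J}) (A 7)" using \<rho>(2) g by simp_all
      have eq: "g r = fst \<tau> r" if "r \<notin> {22..33}" for r
        using same' that unfolding same_except_def by simp
      have g36: "g 36 = base + c * k" "g 1 = k" "g 21 = c" "g 20 = length ss"
        using eq[of 36] eq[of 1] eq[of 21] eq[of 20] b36 tablesD(1)[OF tt] c(2,3) by simp_all
      have step: "g 36 + g 1 = base + Suc c * k" unfolding g36 by simp
      have sem: "sem xs (Assign 36 (Add (Reg 36) (Reg 1))) \<rho> = (g(36 := base + Suc c * k), A)"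
        unfolding g step[symmetric] by simp
      have le: "base + Suc c * k \<le> W"
      proof -
        have "Suc c * k \<le> (length ss + 1) * k" using c(1) by (intro mult_le_mono1) simp
        then show ?thesis using W(2) by linarith
      qed
      show "runs xs W (Assign 36 (Add (Reg 36) (Reg 1))) \<rho> (com_weight (Assign 36 (Add (Reg 36) (Reg 1))))
        (\<lambda>\<rho>. fst \<rho> 21 = c \<and> fst \<rho> 20 = length ss \<and> ?I (Suc c) ((fst \<rho>)(21 := Suc c), snd \<rho>))"
      proof (rule runs_block)
        show "bounded_state xs W (sem xs (Assign 36 (Add (Reg 36) (Reg 1))) \<rho>)"
          unfolding sem using \<rho>(1) g le by (intro bounded_state_reg) simp_all
        have "set (take (Suc c) ss) \<times> {..<J} = set (take c ss) \<times> {..<J} \<union> {s} \<times> {..<J}"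
          using c(1) by (auto simp: take_Suc_conv_app_nth s_def)
        moreover have "same_except {21..36} {7} \<sigma> (g(36 := base + Suc c * k, 21 := Suc c), A)"
          using same same' by (auto simp: same_except_def)
        ultimately show "fst (sem xs (Assign 36 (Add (Reg 36) (Reg 1))) \<rho>) 21 = c \<and>
          fst (sem xs (Assign 36 (Add (Reg 36) (Reg 1))) \<rho>) 20 = length ss \<and>
          ?I (Suc c) ((fst (sem xs (Assign 36 (Add (Reg 36) (Reg 1))) \<rho>))(21 := Suc c), snd (sem xs (Assign 36 (Add (Reg 36) (Reg 1))) \<rho>))"
          unfolding sem using dict' g36 by simp
      qed (use \<rho> in simp_all)
    qed
  qed (use base bd in simp_all)
  then show ?thesis unfolding \<kappa>_def w_def by (rule runs_mono) simp_all
qed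

definition query_weight_bound :: "bool \<Rightarrow> nat" where
  "query_weight_bound mm = com_weight (block [Assign 24 (Reg 22), Assign 25 (Num 0), Assign 26 (Reg 22)]) +
    (k * (com_weight (coord_code mm 1) + 10) + 10 +
     com_weight (Cond (Sub (Add (Arr 7 (Reg 24)) (Reg 25))
             (if mm then Num 0 else Add (Reg 33) (Mul (Num 2) (Mul (Reg 1) (Reg 5)))))
           (Assign 35 (Num 1)) Skip))"

lemma runs_query_item:
  assumes t: "tables \<sigma>" and bd: "bounded_state v W \<sigma>" and W: "big W"
    and j: "fst \<sigma> 22 = j" "j < J" and v: "tuple v" and thr: "fst \<sigma> 33 = thr" "thr \<le> 2 ^ B"
  shows "runs v W (query_item mm) \<sigma> (query_weight_bound mm)
    (\<lambda>\<tau>. same_except ({23..32} \<union> {35}) {} \<sigma> \<tau> \<and>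
      fst \<tau> 35 = (if accepts mm (snd \<sigma> 3) (snd \<sigma> 2) (snd \<sigma> 7) v thr j then 1 else fst \<sigma> 35))"
    (is "runs _ _ _ _ _ ?Q")
proof -
  define H where "H = snd \<sigma> 3"
  define pos where "pos = snd \<sigma> 2"
  define \<kappa> where "\<kappa> = query_key mm H pos v thr j"
  define w where "w = query_weight mm H pos v j"
  have pl: "\<forall>j<k. placed j pos H" "\<forall>q. H q \<le> q" using tablesD(6,7)[OF t] unfolding pos_def H_def .
  obtain f A where \<sigma>: "\<sigma> = (f, A)" by fastforce
  let ?c = "block [Assign 24 (Reg 22), Assign 25 (Num 0), Assign 26 (Reg 22)]"
  let ?\<sigma>1 = "(f(24 := j, 25 := 0, 26 := j), A)"
  have jW: "j \<le> W" using bounded_stateD(1)[of v W f A 22] bd \<sigma> j(1) by simp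
  have 1: "runs v W ?c \<sigma> (com_weight ?c) (\<lambda>\<tau>. \<tau> = ?\<sigma>1)"
  proof (rule runs_block)
    have sem: "sem v ?c \<sigma> = ?\<sigma>1" using \<sigma> j(1) by simp
    show "sem v ?c \<sigma> = ?\<sigma>1" by (rule sem)
    show "bounded_state v W (sem v ?c \<sigma>)" unfolding sem
      using bd \<sigma> jW by (intro bounded_state_reg) auto
  qed (use bd in simp_all)
  have s1: "same_except {23..32} {7} \<sigma> ?\<sigma>1" using \<sigma> by (simp add: same_except_def)
  have t1: "tables ?\<sigma>1" by (rule tables_same_except[OF t s1]) auto
  show ?thesis unfolding query_item_def query_weight_bound_def
  proof (rule runs_Seq[OF 1], goal_cases)
    case (1 \<tau>1)
    have \<tau>1: "\<tau>1 = ?\<sigma>1" by (rule 1(2))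
    have ps: "query_pos pos v i < P_end" if "i < k" for i by (rule query_pos_less[OF pl v that])
    have "runs v W (For 23 1 (coord_code mm 1)) \<tau>1 (k * (com_weight (coord_code mm 1) + 10) + 10)
      (\<lambda>\<tau>. same_except {23..32} {} \<tau>1 \<tau> \<and> fst \<tau> 24 = key mm (snd \<tau>1 3) P_end B K thr 1 (query_pos pos v) j k \<and>
         fst \<tau> 25 = key_weight mm (snd \<tau>1 3) P_end B 1 (query_pos pos v) j k)"
    proof (rule runs_coords)
      show "tables \<tau>1" using t1 \<tau>1 by simp
      show "fst \<tau>1 24 = j" "fst \<tau>1 25 = 0" "fst \<tau>1 26 = j" "fst \<tau>1 33 = thr" using \<tau>1 thr(1) \<sigma> by simp_all
      show "(if (1::nat) = 0 then fst \<tau>1 36 else 0) + i < length v \<and>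
        snd \<tau>1 2 (off i + v ! ((if (1::nat) = 0 then fst \<tau>1 36 else 0) + i)) + 1 = query_pos pos v i" if "i < k" for i
        using v that \<sigma> \<tau>1 by (simp add: query_pos_def pos_def tuple_def)
    qed (use 1(1) W j(2) thr(2) ps in auto)
    then show ?case
    proof (rule runs_Seq, goal_cases)
      case (1 \<tau>2)
      obtain f2 A2 where \<tau>2: "\<tau>2 = (f2, A2)" by fastforce
      have same: "same_except {23..32} {} \<tau>1 (f2, A2)" using 1(2) \<tau>2 by simp
      have A2: "A2 = A" using same \<tau>1 by (simp add: same_except_def fun_eq_iff)
      have f2: "f2 24 = \<kappa>" "f2 25 = w"
        using 1(2) unfolding \<kappa>_def w_def query_key_def query_weight_def H_def \<tau>2 \<tau>1 \<sigma> by simp_all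
      have f2': "f2 33 = thr" "f2 1 = k" "f2 5 = P_end" "f2 35 = f 35"
        using same \<tau>1 thr(1) \<sigma> tablesD(1,2)[OF t] by (simp_all add: same_except_def)
      let ?e = "Sub (Add (Arr 7 (Reg 24)) (Reg 25)) (if mm then Num 0 else Add (Reg 33) (Mul (Num 2) (Mul (Reg 1) (Reg 5))))"
      let ?a = "accepts mm H pos (A 7) v thr j"
      have val: "val v \<tau>2 ?e \<noteq> 0 \<longleftrightarrow> ?a"
      proof -
        have "val v \<tau>2 ?e = A2 7 (f2 24) + f2 25 - (if mm then 0 else f2 33 + 2 * (f2 1 * f2 5))"
          unfolding \<tau>2 by (cases mm) simp_all
        also have "\<dots> = A 7 \<kappa> + w - (if mm then 0 else thr + 2 * (k * P_end))" unfolding f2 f2' A2 ..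
        finally show ?thesis unfolding accepts_def \<kappa>_def w_def by (rule arg_cong)
      qed
      define y where "y = (if ?a then 1 else f2 35)"
      have sem: "sem v (Cond ?e (Assign 35 (Num 1)) Skip) \<tau>2 = (f2(35 := y), A2)"
      proof (cases ?a)
        case True
        then show ?thesis unfolding sem.simps if_P[OF iffD2[OF val True]] by (simp add: \<tau>2 y_def)
      next
        case False
        then have "\<not> val v \<tau>2 ?e \<noteq> 0" using val by blast
        then show ?thesis unfolding sem.simps if_not_P[OF \<open>\<not> val v \<tau>2 ?e \<noteq> 0\<close>] using False by (simp add: \<tau>2 y_def)
      qed
      show ?case
      proof (rule runs_block)
        have bfA: "bounded_state v W (f2, A2)" using 1(1) \<tau>2 by simp
        have "1 \<le> W" using bigD(2)[OF W] by linarith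
        then have "y \<le> W" unfolding y_def using bounded_stateD(1)[OF bfA, of 35] by simp
        then show "bounded_state v W (sem v (Cond ?e (Assign 35 (Num 1)) Skip) \<tau>2)"
          unfolding sem using bfA by (intro bounded_state_reg)
        have 5: "same_except ({23..32} \<union> {35}) {} \<sigma> (f2(35 := y), A2)"
          using same \<tau>1 \<sigma> by (simp add: same_except_def)
        have 6: "(f2(35 := y)) 35 = (if ?a then 1 else f 35)" by (simp add: y_def f2')
        show "?Q (sem v (Cond ?e (Assign 35 (Num 1)) Skip) \<tau>2)"
          unfolding sem using 5 6 unfolding H_def pos_def \<sigma> fst_conv snd_conv by (rule conjI)
      qed (use 1 in simp_all)
    qed
  qed
qed

definition round_weight :: "bool \<Rightarrow> nat" where
  "round_weight mm = com_weight (block [Assign 34 (Div (Reg 34) (Num 2)), Assign 33 (Add (Reg 0) (Reg 34)), Assign 35 (Num 0)]) +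
    (J * (query_weight_bound mm + 10) + 10 + com_weight (Cond (Reg 35) (Assign 0 (Reg 33)) Skip))"

lemma runs_query_round:
  assumes t: "tables \<sigma>" and bd: "bounded_state v W \<sigma>" and W: "big W" and v: "tuple v"
    and h: "fst \<sigma> 34 = 2 * h" "fst \<sigma> 0 = r" "r + h \<le> 2 ^ B"
  shows "runs v W (query_round mm) \<sigma> (round_weight mm)
    (\<lambda>\<tau>. same_except ({0} \<union> {22..35}) {} \<sigma> \<tau> \<and> fst \<tau> 34 = h \<and>
      fst \<tau> 0 = (if \<exists>j<J. accepts mm (snd \<sigma> 3) (snd \<sigma> 2) (snd \<sigma> 7) v (r + h) j then r + h else r))"
    (is "runs _ _ _ _ _ ?Q")
proof -
  obtain f A where \<sigma>: "\<sigma> = (f, A)" by fastforce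
  let ?acc = "accepts mm (A 3) (A 2) (A 7) v (r + h)"
  let ?c = "block [Assign 34 (Div (Reg 34) (Num 2)), Assign 33 (Add (Reg 0) (Reg 34)), Assign 35 (Num 0)]"
  let ?\<sigma>1 = "(f(34 := h, 33 := r + h, 35 := 0), A)"
  have "2 ^ B \<le> W" using bigD(3)[OF W] unfolding K_def by simp
  then have rW: "r + h \<le> W" "h \<le> W" using h(3) by linarith+
  have 1: "runs v W ?c \<sigma> (com_weight ?c) (\<lambda>\<tau>. \<tau> = ?\<sigma>1)"
  proof (rule runs_block)
    have sem: "sem v ?c \<sigma> = ?\<sigma>1" using \<sigma> h(1,2) by simp
    show "sem v ?c \<sigma> = ?\<sigma>1" by (rule sem)
    show "bounded_state v W (sem v ?c \<sigma>)" unfolding sem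
      using bd \<sigma> rW by (intro bounded_state_reg) auto
  qed (use bd in simp_all)
  have s1: "same_except {33..35} {7} \<sigma> ?\<sigma>1" using \<sigma> by (simp add: same_except_def)
  have t1: "tables ?\<sigma>1" by (rule tables_same_except[OF t s1]) auto
  show ?thesis unfolding query_round_def round_weight_def
  proof (rule runs_Seq[OF 1], goal_cases)
    case (1 \<tau>1)
    have \<tau>1: "\<tau>1 = ?\<sigma>1" by (rule 1(2))
    let ?I = "\<lambda>j \<tau>. same_except ({22..32} \<union> {35}) {} \<tau>1 \<tau> \<and> fst \<tau> 35 = (if \<exists>j'<j. ?acc j' then 1 else 0)"
    have "runs v W (For 22 19 (query_item mm)) \<tau>1 (J * (query_weight_bound mm + 10) + 10) (\<lambda>\<rho>. fst \<rho> 19 = J \<and> ?I J \<rho>)"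
    proof (rule runs_For[where I = ?I])
      show "fst \<tau>1 19 = J" using tablesD(5)[OF t1] \<tau>1 by simp
      show "?I 0 ((fst \<tau>1)(22 := 0), snd \<tau>1)" using \<tau>1 by (simp add: same_except_def)
    next
      fix j \<tau> assume j: "j < J" "fst \<tau> 22 = j" "fst \<tau> 19 = J" "bounded_state v W \<tau>" "?I j \<tau>"
      have same: "same_except ({22..32} \<union> {35}) {} \<tau>1 \<tau>" and f35: "fst \<tau> 35 = (if \<exists>j'<j. ?acc j' then 1 else 0)"
        using j(5) by - (elim conjE, assumption)+
      have same7: "same_except ({22..32} \<union> {35}) {7} \<tau>1 \<tau>" by (rule same_except_mono[OF same]) auto
      have t2: "tables \<tau>" by (rule tables_same_except[OF _ same7]) (use t1 \<tau>1 in auto)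
      have A: "snd \<tau> = A" using same \<tau>1 by (simp add: same_except_def fun_eq_iff)
      have f33: "fst \<tau> 33 = r + h" using same \<tau>1 by (simp add: same_except_def)
      from runs_query_item[OF t2 j(4) W j(2,1) v f33 h(3)]
      show "runs v W (query_item mm) \<tau> (query_weight_bound mm)
        (\<lambda>\<rho>. fst \<rho> 22 = j \<and> fst \<rho> 19 = J \<and> ?I (Suc j) ((fst \<rho>)(22 := Suc j), snd \<rho>))"
      proof (rule runs_mono)
        fix \<pi> assume \<pi>: "same_except ({23..32} \<union> {35}) {} \<tau> \<pi> \<and>
          fst \<pi> 35 = (if accepts mm (snd \<tau> 3) (snd \<tau> 2) (snd \<tau> 7) v (r + h) j then 1 else fst \<tau> 35)"
        have "(\<exists>j'<Suc j. ?acc j') \<longleftrightarrow> (\<exists>j'<j. ?acc j') \<or> ?acc j" by (auto simp: less_Suc_eq)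
        then have "fst \<pi> 35 = (if \<exists>j'<Suc j. ?acc j' then 1 else 0)"
          using \<pi> f35 unfolding A by (auto split: if_splits)
        moreover have "same_except ({22..32} \<union> {35}) {} \<tau>1 ((fst \<pi>)(22 := Suc j), snd \<pi>)"
          using \<pi> same by (auto simp: same_except_def)
        moreover have "fst \<pi> 22 = j" "fst \<pi> 19 = J" using \<pi> j(2,3) by (auto simp: same_except_def)
        ultimately show "fst \<pi> 22 = j \<and> fst \<pi> 19 = J \<and> ?I (Suc j) ((fst \<pi>)(22 := Suc j), snd \<pi>)" by simp
      qed simp
    qed (use 1 in simp_all)
    then show ?case
    proof (rule runs_Seq, goal_cases)
      case (1 \<tau>2)
      obtain f2 A2 where \<tau>2: "\<tau>2 = (f2, A2)" by fastforce
      have same: "same_except ({22..32} \<union> {35}) {} \<tau>1 (f2, A2)"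
        and f35: "f2 35 = (if \<exists>j'<J. ?acc j' then 1 else 0)" using 1(2) \<tau>2 by simp_all
      have f2: "f2 33 = r + h" "f2 34 = h" "f2 0 = r" using same \<tau>1 h(2) \<sigma> by (simp_all add: same_except_def)
      define b where "b = (\<exists>j<J. ?acc j)"
      have f35': "f2 35 = (if b then 1 else 0)" unfolding b_def by (rule f35)
      define y where "y = (if b then r + h else r)"
      have sem: "sem v (Cond (Reg 35) (Assign 0 (Reg 33)) Skip) \<tau>2 = (f2(0 := y), A2)"
      proof (cases b)
        case True
        have eq: "f2 35 = 1" "y = f2 33" using True f35' f2 unfolding y_def by simp_all
        show ?thesis unfolding \<tau>2 eq(2) using eq(1) by simp
      next
        case False
        have eq: "f2 35 = 0" "y = f2 0" using False f35' f2 unfolding y_def by simp_all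
        show ?thesis unfolding \<tau>2 eq(2) using eq(1) by simp
      qed
      show ?case
      proof (rule runs_block)
        have "y \<le> W" unfolding y_def using rW by simp
        then show "bounded_state v W (sem v (Cond (Reg 35) (Assign 0 (Reg 33)) Skip) \<tau>2)"
          unfolding sem using 1(1) \<tau>2 by (intro bounded_state_reg) simp_all
        have 5: "same_except ({0} \<union> {22..35}) {} \<sigma> (f2(0 := y), A2)"
        proof (rule same_except_reg)
          have s1': "same_except {33..35} {} \<sigma> ?\<sigma>1" using \<sigma> by (simp add: same_except_def)
          have "same_except ({33..35} \<union> ({22..32} \<union> {35})) ({} \<union> {}) \<sigma> (f2, A2)"
            by (rule same_except_compose[OF s1' same[unfolded \<tau>1]])
          then show "same_except ({0} \<union> {22..35}) {} \<sigma> (f2, A2)" by (rule same_except_mono) auto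
        qed simp
        have 6: "(f2(0 := y)) 34 = h" "(f2(0 := y)) 0 = (if \<exists>j<J. ?acc j then r + h else r)"
          using f2(2) unfolding y_def b_def by simp_all
        show "?Q (sem v (Cond (Reg 35) (Assign 0 (Reg 33)) Skip) \<tau>2)"
          unfolding sem using 5 6 unfolding \<sigma> fst_conv snd_conv by (intro conjI)
      qed (use 1 in simp_all)
    qed
  qed
qed

text \<open>The invariant confines \<open>e\<close> to the interval of length
  \<open>2 ^ (B - x)\<close> that starts at register 0. No array is among the changed parts of
  memory, which is what later queries rely on. For an empty \<open>S\<close> only the time bound and
  this frame condition remain.\<close>

lemma runs_query:
  assumes t: "tables \<sigma>" and bd: "bounded_state v W \<sigma>" and W: "big W" and v: "tuple v" and kpos: "k > 0"
    and D: "dict_ok (data_key mm (snd \<sigma> 3) (snd \<sigma> 2)) (data_weight mm (snd \<sigma> 3) (snd \<sigma> 2)) (S \<times> {..<J}) (snd \<sigma> 7)"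
    and S: "\<And>s. s \<in> S \<Longrightarrow> tuple s"
    and e: "S \<noteq> {} \<Longrightarrow> e < 2 ^ B" "\<And>thr. S \<noteq> {} \<Longrightarrow> thr \<le> e \<longleftrightarrow> (\<exists>s\<in>S. passes mm thr s v)"
  shows "runs v W (query_code mm) \<sigma>
    (com_weight (block [Assign 0 (Num 0), Assign 34 (Reg 18)]) + (B * (round_weight mm + 10) + 10))
    (\<lambda>\<tau>. same_except ({0} \<union> {22..37}) {} \<sigma> \<tau> \<and> (S \<noteq> {} \<longrightarrow> fst \<tau> 0 = e))"
proof -
  obtain f A where \<sigma>: "\<sigma> = (f, A)" by fastforce
  let ?c = "block [Assign 0 (Num 0), Assign 34 (Reg 18)]"
  let ?\<sigma>1 = "(f(0 := 0, 34 := 2 ^ B), A)"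
  have "2 ^ B \<le> W" using bigD(3)[OF W] unfolding K_def by simp
  have 1: "runs v W ?c \<sigma> (com_weight ?c) (\<lambda>\<tau>. \<tau> = ?\<sigma>1)"
  proof (rule runs_block)
    have sem: "sem v ?c \<sigma> = ?\<sigma>1" using \<sigma> tablesD(4)[OF t] by simp
    show "sem v ?c \<sigma> = ?\<sigma>1" by (rule sem)
    show "bounded_state v W (sem v ?c \<sigma>)" unfolding sem
      using bd \<sigma> \<open>2 ^ B \<le> W\<close> by (intro bounded_state_reg) auto
  qed (use bd in simp_all)
  let ?I = "\<lambda>x \<tau>. same_except ({0} \<union> {22..37}) {} \<sigma> \<tau> \<and> fst \<tau> 34 = 2 ^ (B - x) \<and>
    fst \<tau> 0 + 2 ^ (B - x) \<le> 2 ^ B \<and> (S \<noteq> {} \<longrightarrow> fst \<tau> 0 \<le> e \<and> e < fst \<tau> 0 + 2 ^ (B - x))"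
  show ?thesis unfolding query_code_def
  proof (rule runs_Seq[OF 1], goal_cases)
    case (1 \<tau>1)
    have \<tau>1: "\<tau>1 = ?\<sigma>1" by (rule 1(2))
    have "runs v W (For 37 17 (query_round mm)) \<tau>1 (B * (round_weight mm + 10) + 10) (\<lambda>\<rho>. fst \<rho> 17 = B \<and> ?I B \<rho>)"
    proof (rule runs_For[where I = ?I])
      show "fst \<tau>1 17 = B" using tablesD(3)[OF t] \<tau>1 \<sigma> by simp
      show "?I 0 ((fst \<tau>1)(37 := 0), snd \<tau>1)" using \<tau>1 \<sigma> e(1) by (simp add: same_except_def)
    next
      fix x \<tau> assume x: "x < B" "fst \<tau> 37 = x" "fst \<tau> 17 = B" "bounded_state v W \<tau>" "?I x \<tau>"
      define h where "h = (2::nat) ^ (B - Suc x)"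
      define r where "r = fst \<tau> 0"
      have pw: "(2::nat) ^ (B - x) = 2 * h"
        using x(1) by (simp add: h_def Suc_diff_Suc[symmetric] flip: power_Suc)
      have same: "same_except ({0} \<union> {22..37}) {} \<sigma> \<tau>" and b: "fst \<tau> 34 = 2 * h" "r + 2 * h \<le> 2 ^ B"
        and re: "S \<noteq> {} \<longrightarrow> r \<le> e \<and> e < r + 2 * h"
        using x(5) unfolding pw r_def by - (elim conjE, assumption)+
      have same7: "same_except ({0} \<union> {22..37}) {7} \<sigma> \<tau>" by (rule same_except_mono[OF same]) auto
      have t2: "tables \<tau>" by (rule tables_same_except[OF t same7]) auto
      have A: "snd \<tau> = A" using same \<sigma> by (simp add: same_except_def fun_eq_iff)
      have bpos: "h \<ge> 1" by (simp add: h_def)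
      have le: "r + h \<le> 2 ^ B" "1 \<le> r + h" using b(2) bpos by linarith+
      have pl: "\<forall>j<k. placed j (A 2) (A 3)" "\<forall>q. A 3 q \<le> q" using tablesD(6,7)[OF t] unfolding \<sigma> snd_conv .
      have D': "dict_ok (data_key mm (A 3) (A 2)) (data_weight mm (A 3) (A 2)) (S \<times> {..<J}) (A 7)"
        using D unfolding \<sigma> snd_conv .
      have acc: "(\<exists>j<J. accepts mm (A 3) (A 2) (A 7) v (r + h) j) \<longleftrightarrow> (\<exists>s\<in>S. passes mm (r + h) s v)"
        by (rule check_iff[OF pl D' S v le(2,1) kpos])
      from runs_query_round[OF t2 x(4) W v b(1) r_def[symmetric] le(1)]
      show "runs v W (query_round mm) \<tau> (round_weight mm)
        (\<lambda>\<rho>. fst \<rho> 37 = x \<and> fst \<rho> 17 = B \<and> ?I (Suc x) ((fst \<rho>)(37 := Suc x), snd \<rho>))"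
      proof (rule runs_mono)
        fix \<pi> assume \<pi>: "same_except ({0} \<union> {22..35}) {} \<tau> \<pi> \<and> fst \<pi> 34 = h \<and>
          fst \<pi> 0 = (if \<exists>j<J. accepts mm (snd \<tau> 3) (snd \<tau> 2) (snd \<tau> 7) v (r + h) j then r + h else r)"
        then have \<pi>0: "fst \<pi> 0 = (if \<exists>s\<in>S. passes mm (r + h) s v then r + h else r)"
          and \<pi>': "same_except ({0} \<union> {22..35}) {} \<tau> \<pi>" "fst \<pi> 34 = h" unfolding A acc by blast+
        have 1: "fst \<pi> 0 + h \<le> 2 ^ B" using \<pi>0 b(2) by (simp split: if_splits)
        have 2: "S \<noteq> {} \<longrightarrow> fst \<pi> 0 \<le> e \<and> e < fst \<pi> 0 + h"
        proof
          assume S: "S \<noteq> {}"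
          show "fst \<pi> 0 \<le> e \<and> e < fst \<pi> 0 + h"
          proof (cases "r + h \<le> e")
            case True
            then have "fst \<pi> 0 = r + h" using \<pi>0 e(2)[OF S, of "r + h"] by simp
            then show ?thesis using True re S by simp
          next
            case False
            then have "fst \<pi> 0 = r" using \<pi>0 e(2)[OF S, of "r + h"] by simp
            then show ?thesis using False re S by simp
          qed
        qed
        have 3: "same_except ({0} \<union> {22..37}) {} \<sigma> ((fst \<pi>)(37 := Suc x), snd \<pi>)"
          using \<pi>'(1) same by (auto simp: same_except_def)
        have 4: "fst \<pi> 37 = x" "fst \<pi> 17 = B" using \<pi>'(1) x(2,3) by (auto simp: same_except_def)
        show "fst \<pi> 37 = x \<and> fst \<pi> 17 = B \<and> ?I (Suc x) ((fst \<pi>)(37 := Suc x), snd \<pi>)"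
          using 1 2 3 4 \<pi>'(2) unfolding h_def[symmetric] by (intro conjI; (elim conjE)?; simp)
      qed simp
    qed (use 1 in simp_all)
    then show ?case by (rule runs_mono) auto
  qed
qed

end

section \<open>Asymptotics\<close>

text \<open>A real upper bound for \<open>scale\<close>, the integral measure of
  \<open>log n\<close> used in the time bounds.\<close>

definition size_growth :: "nat \<Rightarrow> real" where
  "size_growth n = 2 * log 2 (real n) + 22"

text \<open>The binary logarithm of \<open>k ^ 2 * (k ^ 2) ^ (2 * k + 2)\<close>.\<close>

definition tree_exponent :: "nat \<Rightarrow> real" where
  "tree_exponent k = (4 * real k + 6) * log 2 (real k)"

text \<open>Chosen so that, with \<open>g = size_growth n\<close>, the power of \<open>n\<close>
  with this exponent equals \<open>g powr (2 * sqrt g + 2)\<close> for \<open>n > 1\<close>. It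
  vanishes asymptotically since \<open>sqrt (log n) * log (log n)\<close> is small against
  \<open>log n\<close>.\<close>

definition size_exponent :: "nat \<Rightarrow> real" where
  "size_exponent n = (2 * sqrt (size_growth n) + 2) * log 2 (size_growth n) / log 2 (real n)"

lemma tree_exponent_bigo: "tree_exponent \<in> O(\<lambda>k. real k * log 2 (real k))"
  unfolding tree_exponent_def by real_asymp

lemma size_exponent_smallo: "size_exponent \<in> o(\<lambda>_. 1)"
  unfolding size_exponent_def size_growth_def by real_asymp

text \<open>If \<open>g \<le> k ^ 2\<close>, replacing \<open>g\<close> by \<open>k ^ 2\<close>
  leaves a power of \<open>k\<close> alone. Otherwise \<open>k \<le> sqrt g\<close>, so the exponent
  \<open>2 * k + 2\<close> is at most \<open>2 * sqrt g + 2\<close>, and a bound in \<open>n\<close>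
  alone results.\<close>

lemma power_growth_le:
  assumes "k \<ge> 1" "n \<ge> 1"
  shows "real k ^ 2 * size_growth n ^ (2 * k + 2)
    \<le> 22 powr (2 * sqrt 22 + 2) * 2 powr tree_exponent k * real n powr size_exponent n"
proof -
  define g where "g = size_growth n"
  have g: "g \<ge> 22" unfolding g_def size_growth_def using assms(2) by simp
  have g0: "0 \<le> g" using g by linarith
  have lk: "0 \<le> log 2 (real k)" using assms(1) by simp
  have k2: "real k ^ 2 = 2 powr (2 * log 2 (real k))"
    using assms(1) by (simp add: powr_mult_base mult.commute[of 2] powr_powr[symmetric] powr_numeral)
  have e0: "size_exponent n \<ge> 0"
    unfolding size_exponent_def g_def[symmetric] using g assms(2) by (intro divide_nonneg_nonneg mult_nonneg_nonneg) auto
  have one: "1 \<le> real n powr size_exponent n" using e0 assms(2) by (intro ge_one_powr_ge_zero) auto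
  define e :: real where "e = 2 * sqrt 22 + 2"
  have e: "e \<ge> 0" unfolding e_def by (intro add_nonneg_nonneg mult_nonneg_nonneg real_sqrt_ge_zero) linarith+
  have C: "(1::real) \<le> 22 powr e" using e by (intro ge_one_powr_ge_zero) linarith+
  show ?thesis
  proof (cases "g \<le> real k ^ 2")
    case True
    have ex: "2 * (2 * k + 2) = 4 * k + 4" by simp
    have "g ^ (2 * k + 2) \<le> (real k ^ 2) ^ (2 * k + 2)" by (rule power_mono[OF True g0])
    also have "\<dots> = real k ^ (4 * k + 4)" using ex power_mult[of "real k" 2 "2 * k + 2"] by (simp only:)
    also have "\<dots> = real k powr real (4 * k + 4)" using assms(1) by (intro powr_realpow[symmetric]) simp
    also have "\<dots> = (2 powr log 2 (real k)) powr (4 * real k + 4)" using assms(1) by simp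
    also have "\<dots> = 2 powr ((4 * real k + 4) * log 2 (real k))"
      unfolding powr_powr by (simp only: mult.commute)
    finally have "real k ^ 2 * g ^ (2 * k + 2) \<le> real k ^ 2 * 2 powr ((4 * real k + 4) * log 2 (real k))"
      by (intro mult_left_mono) auto
    also have "\<dots> = 2 powr tree_exponent k"
      unfolding k2 tree_exponent_def by (simp add: powr_add[symmetric] algebra_simps)
    also have "\<dots> \<le> 22 powr e * 2 powr tree_exponent k * real n powr size_exponent n"
    proof -
      have "1 * 2 powr tree_exponent k \<le> 22 powr e * 2 powr tree_exponent k"
        using C by (intro mult_right_mono) auto
      moreover have "22 powr e * 2 powr tree_exponent k * 1
        \<le> 22 powr e * 2 powr tree_exponent k * real n powr size_exponent n"
        using one by (intro mult_left_mono) auto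
      ultimately show ?thesis by linarith
    qed
    finally show ?thesis unfolding g_def e_def .
  next
    case False
    then have "real k \<le> sqrt g" by (intro real_le_rsqrt) linarith
    have gpos: "0 < g" using g by linarith
    have le: "2 * real k + 2 \<le> 2 * sqrt g + 2" using \<open>real k \<le> sqrt g\<close> by linarith
    have "g ^ (2 * k + 2) = g powr real (2 * k + 2)" by (rule powr_realpow[OF gpos, symmetric])
    also have "\<dots> = g powr (2 * real k + 2)" by (simp only: of_nat_add of_nat_mult of_nat_numeral)
    also have "\<dots> \<le> g powr (2 * sqrt g + 2)"
      using g by (intro powr_mono le) linarith
    also have "\<dots> \<le> 22 powr e * real n powr size_exponent n"
    \<comment> \<open>Here \<open>log 2 n\<close> is zero and the quotient in
      \<open>size_exponent\<close> is zero by convention, so the power of \<open>n\<close> is just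
      1. The constant in front is the value of \<open>g powr (2 * sqrt g + 2)\<close> at
      \<open>g = 22\<close>.\<close>
    proof (cases "n = 1")
      case True
      have "g = 22" unfolding g_def size_growth_def True by simp
      then show ?thesis unfolding True e_def by simp
    next
      case n: False
      then have ln: "log 2 (real n) > 0" using assms(2) by simp
      have "real n powr size_exponent n = (2 powr log 2 (real n)) powr size_exponent n" using assms(2) by simp
      also have "\<dots> = 2 powr ((2 * sqrt g + 2) * log 2 g)"
        unfolding powr_powr size_exponent_def g_def[symmetric] using ln by simp
      also have "\<dots> = (2 powr log 2 g) powr (2 * sqrt g + 2)" unfolding powr_powr by (simp only: mult.commute)
      also have "\<dots> = g powr (2 * sqrt g + 2)" using g by simp
      finally have eq: "real n powr size_exponent n = g powr (2 * sqrt g + 2)" .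
      have "1 * g powr (2 * sqrt g + 2) \<le> 22 powr e * g powr (2 * sqrt g + 2)"
        using C by (intro mult_right_mono) auto
      then show ?thesis unfolding eq by simp
    qed
    finally have 1: "g ^ (2 * k + 2) \<le> 22 powr e * real n powr size_exponent n" .
    have "2 * log 2 (real k) \<le> tree_exponent k"
      unfolding tree_exponent_def using lk by (intro mult_right_mono) auto
    then have "real k ^ 2 \<le> 2 powr tree_exponent k" unfolding k2 by simp
    then have "real k ^ 2 * g ^ (2 * k + 2) \<le> 2 powr tree_exponent k * (22 powr e * real n powr size_exponent n)"
      using 1 g by (intro mult_mono) auto
    then show ?thesis unfolding g_def e_def by (simp only: mult_ac)
  qed
qed

section \<open>The data structure\<close>

lemma list_all2_mem_listset: "v \<in> listset As \<longleftrightarrow> list_all2 (\<in>) v As"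
proof (induction As arbitrary: v)
  case (Cons A As)
  then show ?case by (cases v) (auto simp: set_Cons_def)
qed simp

lemma concat_nth_uniform:
  assumes "\<And>s. s \<in> set ss \<Longrightarrow> length s = k" "c < length ss" "i < k"
  shows "c * k + i < length (concat ss) \<and> concat ss ! (c * k + i) = ss ! c ! i"
  using assms
proof (induction ss arbitrary: c)
  case (Cons s ss)
  have s: "length s = k" using Cons.prems(1) by simp
  show ?case
  proof (cases c)
    case 0
    then show ?thesis using s Cons.prems(3) by (simp add: nth_append)
  next
    case (Suc c')
    have "c' * k + i < length (concat ss) \<and> concat ss ! (c' * k + i) = ss ! c' ! i"
      by (rule Cons.IH) (use Cons.prems Suc in auto)
    then show ?thesis using s Suc by (simp add: nth_append add.assoc)
  qed
qed simp

lemma le_bigop_min: "ys \<noteq> [] \<Longrightarrow> thr \<le> bigop min ys \<longleftrightarrow> (\<forall>x\<in>set ys. thr \<le> x)" for thr :: nat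
  by (induction "min :: nat \<Rightarrow> nat \<Rightarrow> nat" ys rule: bigop.induct) auto

lemma bigop_plus: "ys \<noteq> [] \<Longrightarrow> bigop (+) ys = sum_list ys" for ys :: "nat list"
  by (induction "(+) :: nat \<Rightarrow> nat \<Rightarrow> nat" ys rule: bigop.induct) auto

text \<open>\<open>G\<close> stands for a logarithm and \<open>H\<close> for a bound on the number
  of combinations. The dominating products are \<open>B * P\<close> for the tables and
  \<open>m * J * k\<close> for the insertions.\<close>

lemma prep_time_le:
  fixes a0 a1 a2 a3 c1 pw tw k n N m B P J G H :: nat
  assumes "1 \<le> k" "1 \<le> n" "N \<le> n" "m \<le> n" "P \<le> 6 * n" "B \<le> G" "J \<le> H" "1 \<le> G" "1 \<le> H"
  shows "a0 + (k * (N * tw + 10) + 10) +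
      ((k + B * P) * pw + (m * (J * ((a1 + (k * (a2 + 10) + 10 + a3)) + 10) + 10 + c1 + 10) + 10))
    \<le> (a0 + tw + 7 * pw + a1 + a2 + a3 + c1 + 80) * (n * k * (G * H))"
proof -
  define M where "M = n * k * (G * H)"
  have M1: "1 \<le> M" using assms unfolding M_def by simp
  have GH: "1 \<le> G * H" using assms by simp
  have "k * N \<le> n * k * 1" using assms(3) by simp
  also have "\<dots> \<le> M" unfolding M_def using GH by (rule mult_le_mono2)
  finally have kN: "k * N \<le> M" .
  have "1 * k * 1 \<le> M" unfolding M_def using assms(2) GH by (intro mult_le_mono) simp_all
  then have kM: "k \<le> M" by simp
  have "m * 1 * 1 \<le> M" unfolding M_def using assms(1,4) GH by (intro mult_le_mono)
  then have mM: "m \<le> M" by simp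
  have mJk: "m * J * k \<le> M"
  proof -
    have "m * k * (1 * J) \<le> M" unfolding M_def using assms by (intro mult_le_mono) simp_all
    then show ?thesis by (simp only: mult_ac mult_1)
  qed
  have "m * J * 1 \<le> m * J * k" using assms(1) by (rule mult_le_mono2)
  then have mJ: "m * J \<le> M" unfolding mult_1_right using mJk by (rule le_trans)
  have BP: "B * P \<le> 6 * M"
  proof -
    have "B * P \<le> G * (6 * n)" using assms(5,6) by (intro mult_le_mono)
    also have "\<dots> = 6 * (n * 1 * (G * 1))" by simp
    also have "\<dots> \<le> 6 * M" unfolding M_def using assms(1,9) by (intro mult_le_mono) simp_all
    finally show ?thesis .
  qed
  have "a0 + (k * (N * tw + 10) + 10) +
      ((k + B * P) * pw + (m * (J * ((a1 + (k * (a2 + 10) + 10 + a3)) + 10) + 10 + c1 + 10) + 10))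
    = a0 * 1 + tw * (k * N) + 10 * k + 20 * 1 + pw * k + pw * (B * P) + (a1 + a3 + 20) * (m * J) + (a2 + 10) * (m * J * k)
      + (c1 + 20) * m" by (simp add: algebra_simps)
  also have "\<dots> \<le> a0 * M + tw * M + 10 * M + 20 * M + pw * M + pw * (6 * M) + (a1 + a3 + 20) * M + (a2 + 10) * M + (c1 + 20) * M"
    using M1 kN kM mM mJk mJ BP by (intro add_mono mult_le_mono2)
  also have "\<dots> = (a0 + tw + 7 * pw + a1 + a2 + a3 + c1 + 80) * M" by (simp add: algebra_simps)
  finally show ?thesis unfolding M_def .
qed

lemma query_time_le:
  fixes b0 b1 b2 b3 b4 b5 k B J G H :: nat
  assumes "1 \<le> k" "B \<le> G" "J \<le> H" "1 \<le> G" "1 \<le> H"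
  shows "b0 + (B * ((b1 + (J * ((b3 + (k * (b4 + 10) + 10 + b5)) + 10) + 10 + b2)) + 10) + 10)
    \<le> (b0 + b1 + b2 + b3 + b4 + b5 + 60) * (k * (G * H))"
proof -
  define M where "M = k * (G * H)"
  have M1: "1 \<le> M" using assms unfolding M_def by simp
  have BJk: "B * J * k \<le> M"
  proof -
    have "k * (B * J) \<le> M" unfolding M_def using assms by (intro mult_le_mono) simp_all
    then show ?thesis by (simp only: mult_ac)
  qed
  have "B * J * 1 \<le> B * J * k" using assms(1) by (rule mult_le_mono2)
  then have BJ: "B * J \<le> M" unfolding mult_1_right using BJk by (rule le_trans)
  have "1 * (B * 1) \<le> M" unfolding M_def using assms by (intro mult_le_mono)
  then have BM: "B \<le> M" by simp
  have "b0 + (B * ((b1 + (J * ((b3 + (k * (b4 + 10) + 10 + b5)) + 10) + 10 + b2)) + 10) + 10)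
    = (b0 + 10) * 1 + (b1 + b2 + 20) * B + (b3 + b5 + 20) * (B * J) + (b4 + 10) * (B * J * k)" by (simp add: algebra_simps)
  also have "\<dots> \<le> (b0 + 10) * M + (b1 + b2 + 20) * M + (b3 + b5 + 20) * M + (b4 + 10) * M"
    using M1 BM BJ BJk by (intro add_mono mult_le_mono2)
  also have "\<dots> = (b0 + b1 + b2 + b3 + b4 + b5 + 60) * M" by (simp add: algebra_simps)
  finally show ?thesis unfolding M_def .
qed

context forest
begin

section \<open>Eccentricities as thresholds; the word size\<close>

lemma tuples_iff: "v \<in> tuples Ts \<longleftrightarrow> tuple v"
proof -
  have "v ! i \<in> Defs.verts (Ts ! i) \<longleftrightarrow> v ! i < n i" if "i < k" for i
    using verts[OF that] unfolding n_def by (metis lessThan_iff)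
  then show ?thesis unfolding tuples_def list_all2_mem_listset tuple_def list_all2_conv_all_nth by auto
qed

lemma n_le_N: "i < k \<Longrightarrow> n i \<le> N"
  unfolding off_def by (intro member_le_sum) auto

lemma N_less_power: "N < 2 ^ B"
proof -
  have "2 * N \<le> P_end" by (rule pos_off_ge) simp
  then have "N \<le> 2 * P_end" by simp
  then show ?thesis using P_end_less by (rule le_less_trans)
qed

text \<open>The program can only test thresholds. Knowing for every \<open>thr\<close> whether it is
  at most the maximum determines the maximum, and the second claim fixes where the search may
  start.\<close>

lemma eccentricity:
  assumes S: "finite S" "S \<noteq> {}" "\<And>s. s \<in> S \<Longrightarrow> tuple s" and v: "tuple v" and k: "k > 0"
    and odot: "odot = (if mm then min else (+))"
  shows "thr \<le> eccentricity odot Ts S v \<longleftrightarrow> (\<exists>s\<in>S. passes mm thr s v)" (is ?max)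
    and "eccentricity odot Ts S v < 2 ^ B"
proof -
  define d where "d s i = graph_dist (Ts ! i) (s ! i) (v ! i)" for s i
  define a where "a s = bigop odot (map (d s) [0..<k])" for s
  have a: "thr \<le> a s \<longleftrightarrow> passes mm thr s v" for thr s
  proof -
    have ne: "map (d s) [0..<k] \<noteq> []" using k by simp
    show ?thesis
  proof (cases mm)
    case True
    have o: "odot = min" using odot True by simp
    have "thr \<le> a s \<longleftrightarrow> (\<forall>i<k. thr \<le> d s i)" unfolding a_def o le_bigop_min[OF ne] by auto
    then show ?thesis unfolding passes_def d_def if_P[OF True] .
  next
    case False
    have o: "odot = (+)" using odot False by simp
    have "a s = (\<Sum>i<k. d s i)" unfolding a_def o bigop_plus[OF ne]
      by (simp add: interv_sum_list_conv_sum_set_nat atLeast0LessThan)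
    then show ?thesis unfolding passes_def if_not_P[OF False] d_def by (rule ssubst) (rule refl)
  qed
  qed
  have E: "eccentricity odot Ts S v = Max (a ` S)"
    unfolding eccentricity_def a_def d_def by (rule arg_cong[where f = Max]) (auto simp: image_iff)
  have max: "thr \<le> eccentricity odot Ts S v \<longleftrightarrow> (\<exists>s\<in>S. passes mm thr s v)" for thr
    unfolding E a[symmetric] using S(1,2) by (subst Max_ge_iff) auto
  then show ?max .
  \<comment> \<open>The equivalence at the threshold \<open>eccentricity odot Ts S v\<close> itself
    yields a tuple that attains it. As each distance is less than the size of its tree, both
    operations stay within \<open>N\<close>.\<close>
  obtain s where s: "s \<in> S" "passes mm (eccentricity odot Ts S v) s v" using max by blast
  have less: "d s i < n i" if "i < k" for i
    unfolding d_def using listed_tree.graph_dist_less[OF listed[OF that]] S(3)[OF s(1)] v that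
    unfolding tuple_def by blast
  have "eccentricity odot Ts S v \<le> N"
  proof (cases mm)
    case True
    have "\<forall>i<k. eccentricity odot Ts S v \<le> d s i" using s(2) unfolding passes_def d_def if_P[OF True] .
    then have "eccentricity odot Ts S v \<le> d s 0" using k by blast
    also have "d s 0 \<le> N" using less[OF k] n_le_N[OF k] by (metis less_imp_le order_trans)
    finally show ?thesis .
  next
    case False
    have "eccentricity odot Ts S v \<le> (\<Sum>i<k. d s i)" using s(2) unfolding passes_def d_def if_not_P[OF False] .
    also have "\<dots> \<le> N" unfolding off_def using less by (intro sum_mono less_imp_le) blast
    finally show ?thesis .
  qed
  then show "eccentricity odot Ts S v < 2 ^ B" using N_less_power by (rule le_less_trans)
qed

text \<open>Keys need \<open>K ^ (4 * k)\<close>: \<open>J\<close> contributes at most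
  \<open>K ^ (2 * k)\<close>, the \<open>2 * k\<close> digits the same again. Two more factors
  \<open>K\<close> together with \<open>m + 100\<close> absorb positions, sums of weights and input
  pointers.\<close>

definition word :: "nat \<Rightarrow> nat" where "word m = K ^ (4 * k + 2) * (m + 100)"

lemma word_bounds:
  assumes "k > 0"
  shows "8 * N + 4 \<le> word m" "J \<le> word m" "30 * N + 5 + B \<le> word m" "big (word m)"
    "ptr k + 1 + (m + 1) * k \<le> word m" "N \<le> word m" "m \<le> word m"
proof -
  have K4: "4 \<le> K" unfolding K_def by simp
  have "4 * (2 * P_end) \<le> K" unfolding K_def using P_end_less by (intro mult_le_mono2 less_imp_le)
  then have P: "8 * P_end \<le> K" by simp
  have "2 * N \<le> P_end" by (rule pos_off_ge) simp
  then have N: "16 * N \<le> K" using P by linarith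
  have "B \<le> 2 ^ B" by (rule less_imp_le[OF less_exp])
  then have BK: "4 * B \<le> K" unfolding K_def by (rule mult_le_mono2)
  have k: "k \<le> N" by (rule k_le_N)
  have K2: "K * K * (m + 100) \<le> word m"
  proof -
    have "K ^ 2 \<le> K ^ (4 * k + 2)" using K4 by (intro power_increasing) simp_all
    then show ?thesis unfolding word_def power2_eq_square by (rule mult_le_mono1)
  qed
  have KK: "4 * K \<le> K * K" using K4 by (rule mult_le_mono1)
  have "4 * K * (m + 100) \<le> K * K * (m + 100)" using KK by (rule mult_le_mono1)
  then have K1: "4 * K * (m + 100) \<le> word m" using K2 by (rule le_trans)
  have "400 * K = 4 * K * 100" by simp
  also have "\<dots> \<le> 4 * K * (m + 100)" by (rule mult_le_mono2) simp
  finally have K100: "400 * K \<le> word m" using K1 by (rule le_trans)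
  show "8 * N + 4 \<le> word m" "30 * N + 5 + B \<le> word m" "N \<le> word m"
    using N K4 BK K100 by linarith+
  have "1 * (m + 100) \<le> 4 * K * (m + 100)" using K4 by (intro mult_le_mono1) simp
  also note K1
  finally show "m \<le> word m" by simp
  have JK: "J \<le> (K * K) ^ k"
  proof -
    have "4 * (B * B) \<le> (4 * B) * (4 * B)" by simp
    also have "\<dots> \<le> K * K" using BK by (intro mult_le_mono)
    finally show ?thesis unfolding J_def by (rule power_mono) simp
  qed
  have big1: "J * (K * K) ^ k \<le> word m"
  proof -
    have "J * (K * K) ^ k \<le> (K * K) ^ k * (K * K) ^ k" using JK by (rule mult_le_mono1)
    also have "\<dots> = (K ^ 4) ^ k" by (simp only: power4_eq_xxxx power_mult_distrib mult.assoc)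
    also have "\<dots> = K ^ (4 * k)" by (rule power_mult[symmetric])
    also have "\<dots> \<le> K ^ (4 * k + 2)" using K4 by (intro power_increasing) linarith+
    finally have "J * (K * K) ^ k * 1 \<le> K ^ (4 * k + 2) * (m + 100)" by (rule mult_le_mono) linarith
    then show ?thesis unfolding word_def mult_1_right .
  qed
  have K1': "1 \<le> K" using K4 by linarith
  have "1 * 1 \<le> K * K" by (rule mult_le_mono[OF K1' K1'])
  then have KK1: "1 \<le> K * K" unfolding mult_1_right .
  then have "1 \<le> (K * K) ^ k" by (rule one_le_power)
  then have "J * 1 \<le> J * (K * K) ^ k" by (rule mult_le_mono2)
  then show "J \<le> word m" unfolding mult_1_right using big1 by (rule le_trans)
  have PK: "2 * P_end \<le> K" using P by linarith
  have kK: "k \<le> K" using k N by linarith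
  have "2 * P_end * k + 1 \<le> K * K + K * K" using KK1 by (intro add_mono mult_le_mono[OF PK kK])
  also have "\<dots> = K * K * 2" by simp
  also have "\<dots> \<le> K * K * (m + 100)" by (rule mult_le_mono2) simp
  also note K2
  finally have big2: "2 * P_end * k + 1 \<le> word m" .
  have "K \<le> word m" using K100 by linarith
  with big1 big2 show "big (word m)" unfolding big_def by (intro conjI)
  have "(m + 1) * k \<le> (m + 1) * K" by (rule mult_le_mono2[OF kK])
  moreover have "ptr k \<le> 1 + 2 * N" by (rule ptr_le) simp
  moreover have "4 * K * (m + 100) = 4 * ((m + 1) * K) + 396 * K" by (simp add: algebra_simps)
  ultimately show "ptr k + 1 + (m + 1) * k \<le> word m" using K1 N K4 by linarith
qed

text \<open>The factor 2 comes from \<open>J = (2 * B) ^ (2 * k)\<close>, where \<open>B\<close> is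
  at most the bit length of \<open>N + m\<close> plus 4.\<close>

definition scale :: "nat \<Rightarrow> nat" where "scale m = 2 * floorlog 2 (N + m) + 20"

text \<open>\<open>K\<close> is two to the power \<open>B + 2\<close>, so the word size has a bit
  length of order \<open>k\<close> times the logarithm of the input size. The word length costs only
  one factor \<open>scale m\<close> and one factor \<open>k\<close>, although keys are exponentially
  large in \<open>k\<close>.\<close>

lemma scale_bounds:
  assumes "k > 0"
  shows "B \<le> scale m" "J \<le> scale m ^ (2 * k)" "bits (word m + 2) \<le> 7 * (k * scale m)" "P_end \<le> 6 * (N + m)"
proof -
  define L where "L = floorlog 2 (N + m)"
  have L: "N + m < 2 ^ L" unfolding L_def by (rule less_power_floorlog)
  have P6: "P_end \<le> 6 * N" by (rule pos_off_le)
  also have "6 * N \<le> 6 * (N + m)" by (intro mult_le_mono2 le_add1)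
  finally show "P_end \<le> 6 * (N + m)" .
  define p where "p = P_end"
  define E where "E = (2::nat) ^ L"
  have LE: "N + m < E" unfolding E_def by (rule L)
  have p: "p \<le> 6 * N" unfolding p_def by (rule P6)
  have "B < L + 5"
  proof (cases "B = 0")
    case False
    have "2 ^ (B - 1) \<le> 2 * P_end" using False unfolding B_def by (intro levels_lower) simp
    also have "2 * P_end < 16 * E" unfolding p_def[symmetric] using p LE by linarith
    also have "16 * E = 2 ^ 4 * 2 ^ L" unfolding E_def by simp
    finally have "(2::nat) ^ (B - 1) < 2 ^ (4 + L)" unfolding power_add .
    then have "B - 1 < 4 + L" by (rule power_less_imp_less_exp[rotated]) simp
    then show ?thesis by simp
  qed simp
  then have B: "B \<le> L + 4" by simp
  have sL: "scale m = 2 * L + 20" unfolding scale_def L_def ..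
  show "B \<le> scale m" using B sL by simp
  have "4 * (B * B) = (2 * B) ^ 2" by (simp add: power2_eq_square)
  then have "J = ((2 * B) ^ 2) ^ k" unfolding J_def by (rule arg_cong)
  also have "\<dots> = (2 * B) ^ (2 * k)" by (rule power_mult[symmetric])
  also have "\<dots> \<le> scale m ^ (2 * k)"
  proof (rule power_mono)
    show "2 * B \<le> scale m" using B unfolding sL by linarith
  qed simp
  finally show "J \<le> scale m ^ (2 * k)" .
  have K: "K = 2 ^ (B + 2)" unfolding K_def by simp
  define X where "X = (B + 2) * (4 * k + 2) + (L + 7)"
  have m: "m + 100 \<le> 2 ^ (L + 7)"
  proof -
    have "m + 100 \<le> E * 128" using LE by linarith
    also have "\<dots> = 2 ^ (L + 7)" unfolding E_def power_add by simp
    finally show ?thesis .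
  qed
  have "word m \<le> 2 ^ ((B + 2) * (4 * k + 2)) * 2 ^ (L + 7)"
    unfolding word_def K power_mult[symmetric] by (rule mult_le_mono2[OF m])
  then have w: "word m \<le> 2 ^ X" unfolding X_def power_add .
  have "word m + 2 < 2 ^ (X + 2)"
  proof -
    define F where "F = (2::nat) ^ X"
    have "1 \<le> F" "word m \<le> F" unfolding F_def using w by simp_all
    then have "word m + 2 < F * 4" by linarith
    also have "\<dots> = 2 ^ (X + 2)" unfolding F_def power_add by simp
    finally show ?thesis .
  qed
  then have "bits (word m + 2) \<le> Suc (X + 2)" by (rule bits_less_power)
  also have "Suc (X + 2) = (B + 2) * (4 * k + 2) + (L + 10) * 1" unfolding X_def by simp
  also have "\<dots> \<le> (L + 10) * (6 * k) + (L + 10) * k"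
  proof (rule add_mono[OF mult_le_mono mult_le_mono2])
    show "B + 2 \<le> L + 10" using B by simp
    have gen: "0 < q \<Longrightarrow> 1 \<le> q \<and> 4 * q + 2 \<le> 6 * q" for q :: nat by simp
    show "1 \<le> k" "4 * k + 2 \<le> 6 * k" using gen[OF assms] by (rule conjunct1, rule conjunct2)
  qed
  also have "\<dots> = 7 * (k * (L + 10))" by (simp add: algebra_simps)
  also have "\<dots> \<le> 7 * (k * scale m)" unfolding sL by (intro mult_le_mono2) simp
  finally show "bits (word m + 2) \<le> 7 * (k * scale m)" .
qed

lemma input_bound:
  assumes "x \<in> set (concat gs)"
  shows "x \<le> N"
proof -
  obtain g where "g \<in> set gs" "x \<in> set g" using assms by auto
  then obtain i where i: "i < k" "x \<in> set (gs ! i)" by (metis in_set_conv_nth length_gs)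
  have "x \<le> n i"
  proof -
    consider "x = n i" | "x = length (es i)" | u v where "(u, v) \<in> set (es i)" "x = u \<or> x = v"
      using i(2) unfolding gs_nth[OF i(1)] n_def by auto
    then show ?thesis
    proof cases
      case 2
      then show ?thesis using length_es_less[OF i(1)] by simp
    next
      case (3 u v)
      have "{u, v} \<in> edges (Ts ! i)" unfolding set_es[OF i(1), symmetric] using 3(1) by force
      then have "{u, v} \<subseteq> {..<n i}"
        using tree[OF i(1)] verts[OF i(1)] unfolding tree_def simple_graph_def n_def by metis
      then show ?thesis using 3(2) by auto
    qed simp
  qed
  then show ?thesis using n_le_N[OF i(1)] by (rule le_trans)
qed

end

definition build_code :: "bool \<Rightarrow> com" where
  "build_code mm = Seq parse_code (Seq prep_code (insert_code mm))"

definition build_const :: "bool \<Rightarrow> nat" where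
  "build_const mm = com_weight (Seq (Assign 1 (Inp (Num 0))) (Assign 2 (Num 1))) + tree_weight + 7 * prep_weight +
     com_weight (block [Assign 24 (Reg 22), Assign 25 (Num 0), Assign 26 (Reg 22), Assign 33 (Num 0)]) +
     com_weight (coord_code mm 0) +
     com_weight (Store 7 (Reg 24) (Add (Arr 7 (Reg 24)) (Sub (Add (Reg 25) (Num 1)) (Arr 7 (Reg 24))))) +
     com_weight (Assign 36 (Add (Reg 36) (Reg 1))) + 80"

definition query_const :: "bool \<Rightarrow> nat" where
  "query_const mm = com_weight (block [Assign 0 (Num 0), Assign 34 (Reg 18)]) +
     com_weight (block [Assign 34 (Div (Reg 34) (Num 2)), Assign 33 (Add (Reg 0) (Reg 34)), Assign 35 (Num 0)]) +
     com_weight (Cond (Reg 35) (Assign 0 (Reg 33)) Skip) +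
     com_weight (block [Assign 24 (Reg 22), Assign 25 (Num 0), Assign 26 (Reg 22)]) +
     com_weight (coord_code mm 1) +
     com_weight (Cond (Sub (Add (Arr 7 (Reg 24)) (Reg 25))
             (if mm then Num 0 else Add (Reg 33) (Mul (Num 2) (Mul (Reg 1) (Reg 5)))))
           (Assign 35 (Num 1)) Skip) + 60"

lemma ds_solves_mono:
  assumes "ds_solves P Q xs V ok p q" "p \<le> p'" "q \<le> q'"
  shows "ds_solves P Q xs V ok p' q'"
  using assms unfolding ds_solves_def by (meson order_trans)

lemma floorlog_le_log:
  assumes "1 \<le> n"
  shows "real (floorlog 2 n) \<le> log 2 (real n) + 1"
proof -
  have "0 \<le> log 2 (real n)" using assms by simp
  then have "real (nat \<lfloor>log 2 (real n)\<rfloor>) \<le> log 2 (real n)" by (rule of_nat_floor)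
  then show ?thesis using assms by (simp add: floorlog_def)
qed

context forest
begin

text \<open>What a query must find and must leave behind. All data are taken from the state itself,
  so the invariant makes no reference to the run that built it.\<close>

definition ds_inv :: "bool \<Rightarrow> nat list set \<Rightarrow> state \<Rightarrow> bool" where
  "ds_inv mm S \<sigma> \<longleftrightarrow> tables \<sigma> \<and>
     dict_ok (data_key mm (snd \<sigma> 3) (snd \<sigma> 2)) (data_weight mm (snd \<sigma> 3) (snd \<sigma> 2)) (S \<times> {..<J}) (snd \<sigma> 7)"

definition build_time :: "bool \<Rightarrow> nat \<Rightarrow> nat" where
  "build_time mm m = com_weight (Seq (Assign 1 (Inp (Num 0))) (Assign 2 (Num 1))) + (k * (N * tree_weight + 10) + 10) +
     ((k + B * P_end) * prep_weight +
      (m * (J * (item_weight mm + 10) + 10 + com_weight (Assign 36 (Add (Reg 36) (Reg 1))) + 10) + 10))"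

definition query_time :: "bool \<Rightarrow> nat" where
  "query_time mm = com_weight (block [Assign 0 (Num 0), Assign 34 (Reg 18)]) + (B * (round_weight mm + 10) + 10)"

lemma runs_build:
  assumes kpos: "k > 0" and rest: "rest = length ss # concat ss" and W: "W = word (length ss)"
    and ss: "\<And>s. s \<in> set ss \<Longrightarrow> tuple s"
  shows "runs xs W (build_code mm) init_state (build_time mm (length ss)) (ds_inv mm (set ss))"
proof -
  note w = word_bounds[OF kpos, of "length ss", folded W]
  have x: "\<forall>x\<in>set xs. x \<le> W"
  proof
    fix x assume "x \<in> set xs"
    then consider "x = k" | "x \<in> set (concat gs)" | "x = length ss" | s where "s \<in> set ss" "x \<in> set s"
      unfolding xs rest by auto
    then show "x \<le> W"
    proof cases
      case 1
      then show ?thesis using k_le_N w(6) by (metis le_trans)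
    next
      case 2
      then show ?thesis using input_bound[OF 2] w(6) by (metis le_trans)
    next
      case 3
      then show ?thesis using w(7) by (rule ssubst)
    next
      case (4 s)
      then obtain i where i: "i < k" "x = s ! i" using ss[OF 4(1)] unfolding tuple_def by (metis in_set_conv_nth)
      then have "x < n i" using ss[OF 4(1)] unfolding tuple_def by blast
      then show ?thesis using n_le_N[OF i(1)] w(6) by (metis le_trans less_imp_le)
    qed
  qed
  have d: "drop (ptr k) xs = rest" using xs_drop[of k] length_gs by simp
  have inp: "ptr k + 1 + c * k + i < length xs \<and> xs ! (ptr k + 1 + c * k + i) = ss ! c ! i"
    if ci: "c < length ss" "i < k" for c i
  proof -
    define q where "q = c * k + i"
    have "c * k + i < length (concat ss) \<and> concat ss ! (c * k + i) = ss ! c ! i"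
      by (rule concat_nth_uniform[OF _ ci]) (use ss in \<open>auto simp: tuple_def\<close>)
    then have q: "q < length (concat ss)" "concat ss ! q = ss ! c ! i" unfolding q_def by blast+
    have "length rest = length xs - ptr k" unfolding d[symmetric] by (rule length_drop)
    moreover have "Suc q < length rest" unfolding rest using q(1) by (simp del: length_concat)
    ultimately have less: "ptr k + Suc q < length xs" by linarith
    have "xs ! (ptr k + Suc q) = drop (ptr k) xs ! Suc q" using less by (intro nth_drop[symmetric]) linarith
    also have "\<dots> = ss ! c ! i" unfolding d rest using q(2) by simp
    finally have "xs ! (ptr k + Suc q) = ss ! c ! i" .
    moreover have "ptr k + 1 + c * k + i = ptr k + Suc q" unfolding q_def by simp
    ultimately show ?thesis using less by (simp only: simp_thms)
  qed
  show ?thesis unfolding build_code_def build_time_def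
  proof (rule runs_Seq[OF runs_parse[OF w(1) x]], goal_cases)
    case (1 \<tau>1)
    have \<tau>1: "fst \<tau>1 1 = k" "parse_inv k \<tau>1" using 1(2) by - (elim conjE, assumption)+
    have ne: "rest \<noteq> []" unfolding rest by simp
    show ?case
    proof (rule runs_Seq[OF runs_prep[OF 1(1) \<tau>1 kpos w(2,3) ne]], goal_cases)
      case (1 \<tau>2)
      have \<tau>2: "tables \<tau>2" "fst \<tau>2 20 = hd rest" "fst \<tau>2 36 = ptr k + 1" "snd \<tau>2 7 = (\<lambda>_. 0)"
        using 1(2) by - (elim conjE, assumption)+
      have len: "fst \<tau>2 20 = length ss" unfolding \<tau>2(2) rest list.sel ..
      have "runs xs W (insert_code mm) \<tau>2
        (length ss * (J * (item_weight mm + 10) + 10 + com_weight (Assign 36 (Add (Reg 36) (Reg 1))) + 10) + 10)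
        (\<lambda>\<tau>. same_except {21..36} {7} \<tau>2 \<tau> \<and>
          dict_ok (data_key mm (snd \<tau>2 3) (snd \<tau>2 2)) (data_weight mm (snd \<tau>2 3) (snd \<tau>2 2)) (set ss \<times> {..<J}) (snd \<tau> 7))"
      proof (rule runs_insert[OF \<tau>2(1) 1(1) w(4,5) \<tau>2(3) len \<tau>2(4)])
        show "tuple (ss ! c)" if "c < length ss" for c by (rule ss[OF nth_mem[OF that]])
        show "ptr k + 1 + c * k + i < length xs \<and> xs ! (ptr k + 1 + c * k + i) = ss ! c ! i"
          if "c < length ss" "i < k" for c i by (rule inp[OF that])
      qed
      then show ?case
      proof (rule runs_mono[OF _ order_refl], goal_cases)
        case (1 \<tau>3)
        have same: "same_except {21..36} {7} \<tau>2 \<tau>3"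
          and dict: "dict_ok (data_key mm (snd \<tau>2 3) (snd \<tau>2 2)) (data_weight mm (snd \<tau>2 3) (snd \<tau>2 2))
            (set ss \<times> {..<J}) (snd \<tau>3 7)"
          using 1(2) by - (elim conjE, assumption)+
        have "tables \<tau>3" by (rule tables_same_except[OF \<tau>2(1) same]) auto
        moreover have arr: "snd \<tau>2 3 = snd \<tau>3 3" "snd \<tau>2 2 = snd \<tau>3 2" using same by (simp_all add: same_except_def)
        ultimately show ?case unfolding ds_inv_def using dict[unfolded arr] by (intro conjI)
      qed
    qed
  qed
qed

text \<open>The bound on the start state is stated for the empty input because every query comes
  with an input word of its own; only the memory is carried over.\<close>

lemma runs_query_inv:
  assumes kpos: "k > 0" and W: "W = word (length ss)" and ss: "\<And>s. s \<in> set ss \<Longrightarrow> tuple s"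
    and odot: "odot = (if mm then min else (+))"
    and inv: "ds_inv mm (set ss) \<sigma>" "bounded_state [] W \<sigma>" and v: "tuple v"
  shows "runs v W (query_code mm) \<sigma> (query_time mm)
    (\<lambda>\<tau>. ds_inv mm (set ss) \<tau> \<and> (set ss \<noteq> {} \<longrightarrow> result \<tau> = eccentricity odot Ts (set ss) v))"
proof -
  note w = word_bounds[OF kpos, of "length ss", folded W]
  have t: "tables \<sigma>" and D: "dict_ok (data_key mm (snd \<sigma> 3) (snd \<sigma> 2)) (data_weight mm (snd \<sigma> 3) (snd \<sigma> 2))
      (set ss \<times> {..<J}) (snd \<sigma> 7)"
    using inv(1) unfolding ds_inv_def by - (elim conjE, assumption)+
  have "x \<le> W" if "x \<in> set v" for x
  proof -
    obtain i where i: "i < k" "x = v ! i" using v \<open>x \<in> set v\<close> unfolding tuple_def by (metis in_set_conv_nth)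
    then have "x < n i" using v unfolding tuple_def by blast
    then show ?thesis using n_le_N[OF i(1)] w(6) by (metis le_trans less_imp_le)
  qed
  then have bd: "bounded_state v W \<sigma>" using inv(2) unfolding bounded_state_def by blast
  have "runs v W (query_code mm) \<sigma> (query_time mm)
    (\<lambda>\<tau>. same_except ({0} \<union> {22..37}) {} \<sigma> \<tau> \<and> (set ss \<noteq> {} \<longrightarrow> fst \<tau> 0 = eccentricity odot Ts (set ss) v))"
    unfolding query_time_def
  proof (rule runs_query[OF t bd w(4) v kpos D])
    show "tuple s" if "s \<in> set ss" for s by (rule ss[OF that])
    show "eccentricity odot Ts (set ss) v < 2 ^ B" if "set ss \<noteq> {}"
      by (rule eccentricity(2)[OF finite_set that ss v kpos odot])
    show "thr \<le> eccentricity odot Ts (set ss) v \<longleftrightarrow> (\<exists>s\<in>set ss. passes mm thr s v)" if "set ss \<noteq> {}" for thr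
      by (rule eccentricity(1)[OF finite_set that ss v kpos odot])
  qed
  then show ?thesis
  proof (rule runs_mono[OF _ order_refl], goal_cases)
    case (1 \<tau>)
    have same: "same_except ({0} \<union> {22..37}) {} \<sigma> \<tau>"
      and res: "set ss \<noteq> {} \<longrightarrow> fst \<tau> 0 = eccentricity odot Ts (set ss) v"
      using 1(2) by - (elim conjE, assumption)+
    have same7: "same_except ({0} \<union> {22..37}) {7} \<sigma> \<tau>" by (rule same_except_mono[OF same]) auto
    have "tables \<tau>" by (rule tables_same_except[OF t same7]) auto
    moreover have arr: "snd \<sigma> 3 = snd \<tau> 3" "snd \<sigma> 2 = snd \<tau> 2" "snd \<sigma> 7 = snd \<tau> 7"
      using same by (simp_all add: same_except_def)
    ultimately have "ds_inv mm (set ss) \<tau>" unfolding ds_inv_def using D[unfolded arr] by (intro conjI)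
    then show ?case using res unfolding result_def by (intro conjI)
  qed
qed

text \<open>Reachable states are given by arbitrary runs, whereas the triples assert the existence
  of one run. Determinism identifies the two, and the invariant then follows by induction over the
  sequence of queries.\<close>

lemma solves:
  assumes kpos: "k > 0" and rest: "rest = length ss # concat ss" and W: "W = word (length ss)"
    and ss: "\<And>s. s \<in> set ss \<Longrightarrow> tuple s" and odot: "odot = (if mm then min else (+))"
  shows "ds_solves (build_code mm) (query_code mm) xs (tuples Ts)
    (\<lambda>v a. set ss \<noteq> {} \<longrightarrow> a = eccentricity odot Ts (set ss) v)
    (real (build_time mm (length ss) * bits (W + 2))) (real (query_time mm * bits (W + 2)))"
proof -
  obtain t0 \<sigma>0 where build: "exec xs (build_code mm) init_state t0 \<sigma>0"
      "t0 \<le> build_time mm (length ss) * bits (W + 2)" "bounded_state xs W \<sigma>0" "ds_inv mm (set ss) \<sigma>0"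
    using runs_build[OF kpos rest W ss, of mm] unfolding runs_def by blast
  note query = runs_query_inv[OF kpos W ss odot]
  have inv: "ds_inv mm (set ss) \<sigma> \<and> bounded_state [] W \<sigma>"
    if "ds_state (build_code mm) (query_code mm) xs (tuples Ts) \<sigma>" for \<sigma>
    using that
  proof induction
    case (built t \<sigma>)
    have "\<sigma> = \<sigma>0" using exec_deterministic[OF built build(1)] by blast
    then show ?case using build(3,4) unfolding bounded_state_def by simp
  next
    case (queried \<sigma> v t \<sigma>')
    have v: "tuple v" using queried.hyps(2) unfolding tuples_iff .
    obtain t1 \<sigma>1 where "exec v (query_code mm) \<sigma> t1 \<sigma>1" "bounded_state v W \<sigma>1" "ds_inv mm (set ss) \<sigma>1"
      using query[OF _ conjunct1[OF queried.IH] conjunct2[OF queried.IH] v] unfolding runs_def by blast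
    moreover have "\<sigma>' = \<sigma>1" using exec_deterministic[OF queried.hyps(3) calculation(1)] by blast
    ultimately show ?case unfolding bounded_state_def by simp
  qed
  show ?thesis unfolding ds_solves_def
  proof (intro conjI allI impI)
    show "\<exists>t \<sigma>. exec xs (build_code mm) init_state t \<sigma> \<and> real t \<le> real (build_time mm (length ss) * bits (W + 2))"
      using build(1,2) of_nat_le_iff by blast
  next
    fix \<sigma> v assume "ds_state (build_code mm) (query_code mm) xs (tuples Ts) \<sigma>" "v \<in> tuples Ts"
    then show "\<exists>t \<sigma>'. exec v (query_code mm) \<sigma> t \<sigma>' \<and> real t \<le> real (query_time mm * bits (W + 2)) \<and>
        (set ss \<noteq> {} \<longrightarrow> result \<sigma>' = eccentricity odot Ts (set ss) v)"
      using query[OF _ conjunct1[OF inv] conjunct2[OF inv]] unfolding tuples_iff runs_def of_nat_le_iff by blast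
  qed
qed

text \<open>Of the exponent \<open>2 * k + 2\<close>, the part \<open>2 * k\<close> counts
  combinations, one factor comes from the block sizes or the rounds of the search, and one from the
  word length. One factor \<open>k\<close> is the loop over coordinates, the other again the word
  length.\<close>

lemma cost_bounds:
  assumes kpos: "k > 0"
  shows "build_time mm m * bits (word m + 2) \<le> 7 * build_const mm * ((N + m) * (k ^ 2 * scale m ^ (2 * k + 2)))"
    and "query_time mm * bits (word m + 2) \<le> 7 * query_const mm * (k ^ 2 * scale m ^ (2 * k + 2))"
proof -
  define G where "G = scale m"
  define H where "H = G ^ (2 * k)"
  note sb = scale_bounds[OF kpos, of m, folded G_def, folded H_def]
  have k1: "1 \<le> k" using kpos by (rule Suc_leI[THEN ord_eq_le_trans[OF One_nat_def]])
  have n1: "1 \<le> N + m" using k1 k_le_N by (rule le_trans[THEN trans_le_add1])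
  have G1: "1 \<le> G" unfolding G_def scale_def by simp
  have H1: "1 \<le> H" unfolding H_def using G1 by (rule one_le_power)
  have pw: "G ^ (2 * k + 2) = H * (G * G)" unfolding H_def power_add power2_eq_square ..
  have "build_time mm m \<le> build_const mm * ((N + m) * k * (G * H))"
    unfolding build_time_def build_const_def item_weight_def
    by (rule prep_time_le[OF k1 n1 le_add1 le_add2 sb(4,1,2) G1 H1])
  then have "build_time mm m * bits (word m + 2) \<le> build_const mm * ((N + m) * k * (G * H)) * (7 * (k * G))"
    using sb(3) by (rule mult_le_mono)
  also have "\<dots> = 7 * build_const mm * ((N + m) * (k ^ 2 * (H * (G * G))))"
    by (simp only: power2_eq_square mult_ac)
  finally show "build_time mm m * bits (word m + 2) \<le> 7 * build_const mm * ((N + m) * (k ^ 2 * scale m ^ (2 * k + 2)))"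
    unfolding G_def[symmetric] pw .
  have "query_time mm \<le> query_const mm * (k * (G * H))"
    unfolding query_time_def query_const_def round_weight_def query_weight_bound_def
    by (rule query_time_le[OF k1 sb(1,2) G1 H1])
  then have "query_time mm * bits (word m + 2) \<le> query_const mm * (k * (G * H)) * (7 * (k * G))"
    using sb(3) by (rule mult_le_mono)
  also have "\<dots> = 7 * query_const mm * (k ^ 2 * (H * (G * G)))"
    by (simp only: power2_eq_square mult_ac)
  finally show "query_time mm * bits (word m + 2) \<le> 7 * query_const mm * (k ^ 2 * scale m ^ (2 * k + 2))"
    unfolding G_def[symmetric] pw .
qed

lemma scale_le_growth:
  assumes "k > 0"
  shows "real (scale m) \<le> size_growth (N + m)"
proof -
  have "1 \<le> k" using assms by (rule Suc_leI[THEN ord_eq_le_trans[OF One_nat_def]])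
  then have "1 \<le> N + m" using k_le_N by (rule le_trans[THEN trans_le_add1])
  then have "real (floorlog 2 (N + m)) \<le> log 2 (real (N + m)) + 1" by (rule floorlog_le_log)
  moreover have "real (scale m) = 2 * real (floorlog 2 (N + m)) + 20"
    unfolding scale_def of_nat_add of_nat_mult of_nat_numeral ..
  ultimately show ?thesis unfolding size_growth_def by linarith
qed

end

text \<open>The encoding hides the edge lists behind one existential quantifier per tree; a choice
  function gathers them so that they can become parameters of the locale.\<close>

lemma forest_of_encoding:
  assumes "encodes_input xs Ts S" "\<forall>T\<in>set Ts. tree T \<and> verts T = {..<card (verts T)}"
  obtains gs es ss where "forest Ts gs es xs (length ss # concat ss)" "set ss = S" "distinct ss"
proof -
  obtain gs ss where gs: "list_all2 encodes_graph gs Ts" and ss: "distinct ss" "set ss = S"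
    and xs: "xs = length Ts # concat gs @ length ss # concat ss"
    using assms(1) unfolding encodes_input_def by blast
  have "\<forall>i. \<exists>e. i < length Ts \<longrightarrow> distinct (map (\<lambda>(u, v). {u, v}) e) \<and>
      set (map (\<lambda>(u, v). {u, v}) e) = edges (Ts ! i) \<and>
      gs ! i = card (verts (Ts ! i)) # length e # concat (map (\<lambda>(u, v). [u, v]) e)"
    using gs unfolding list_all2_conv_all_nth encodes_graph_def by metis
  then obtain es where es: "\<forall>i. i < length Ts \<longrightarrow> distinct (map (\<lambda>(u, v). {u, v}) (es i)) \<and>
      set (map (\<lambda>(u, v). {u, v}) (es i)) = edges (Ts ! i) \<and>
      gs ! i = card (verts (Ts ! i)) # length (es i) # concat (map (\<lambda>(u, v). [u, v]) (es i))"
    unfolding choice_iff by blast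
  have "forest Ts gs es xs (length ss # concat ss)"
  proof
    show "length gs = length Ts" by (rule list_all2_lengthD[OF gs])
    show "tree (Ts ! i)" "verts (Ts ! i) = {..<card (verts (Ts ! i))}" if "i < length Ts" for i
      using assms(2) nth_mem[OF that] by blast+
    show "distinct (map (\<lambda>(u, v). {u, v}) (es i))" "set (map (\<lambda>(u, v). {u, v}) (es i)) = edges (Ts ! i)"
      "gs ! i = card (verts (Ts ! i)) # length (es i) # concat (map (\<lambda>(u, v). [u, v]) (es i))"
      if "i < length Ts" for i
      using es[rule_format, OF that] by - (elim conjE, assumption)+
    show "xs = length Ts # concat gs @ length ss # concat ss" by (rule xs)
  qed
  then show ?thesis using ss by (intro that)
qed

theorem theorem5:
  fixes odot :: "nat \<Rightarrow> nat \<Rightarrow> nat"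
  assumes "odot \<in> {min, (+)}"
  shows "\<exists>(P :: com) (Q :: com) (C :: real) (C' :: real)
      (f :: nat \<Rightarrow> real) (f' :: nat \<Rightarrow> real) (\<epsilon> :: nat \<Rightarrow> real) (\<epsilon>' :: nat \<Rightarrow> real).
    f \<in> O(\<lambda>k. real k * log 2 (real k)) \<and> f' \<in> O(\<lambda>k. real k * log 2 (real k)) \<and>
    \<epsilon> \<in> o(\<lambda>_. 1) \<and> \<epsilon>' \<in> o(\<lambda>_. 1) \<and>
    (\<forall>(Ts :: nat graph list) (S :: nat list set) (xs :: nat list) (k :: nat) (N :: nat).
      Ts \<noteq> [] \<longrightarrow>
      (\<forall>T\<in>set Ts. tree T \<and> verts T = {..<card (verts T)}) \<longrightarrow>
      S \<subseteq> tuples Ts \<longrightarrow>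
      encodes_input xs Ts S \<longrightarrow>
      k = length Ts \<longrightarrow>
      N = (\<Sum>i<k. card (verts (Ts ! i))) \<longrightarrow>
      ds_solves P Q xs (tuples Ts)
        (\<lambda>v a. S \<noteq> {} \<longrightarrow> a = eccentricity odot Ts S v)
        (C * 2 powr f k * real (N + card S) powr (1 + \<epsilon> (N + card S)))
        (C' * 2 powr f' k * real (N + card S) powr \<epsilon>' (N + card S)))"
proof -
  \<comment> \<open>The operation is built into the program text, so each of the two problems has
    its own pair of programs.\<close>
  define mm where "mm = (odot = min)"
  have odot: "odot = (if mm then min else (+))" using assms unfolding mm_def by auto
  define C0 :: real where "C0 = 22 powr (2 * sqrt 22 + 2)"
  define C where "C = real (7 * build_const mm) * C0"
  define C' where "C' = real (7 * query_const mm) * C0"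
  have main: "ds_solves (build_code mm) (query_code mm) xs (tuples Ts)
        (\<lambda>v a. S \<noteq> {} \<longrightarrow> a = eccentricity odot Ts S v)
        (C * 2 powr tree_exponent k * real (N + card S) powr (1 + size_exponent (N + card S)))
        (C' * 2 powr tree_exponent k * real (N + card S) powr size_exponent (N + card S))"
    if ne: "Ts \<noteq> []" and trees: "\<forall>T\<in>set Ts. tree T \<and> verts T = {..<card (verts T)}"
      and sub: "S \<subseteq> tuples Ts" and enc: "encodes_input xs Ts S"
      and k: "k = length Ts" and N: "N = (\<Sum>i<k. card (verts (Ts ! i)))"
    for Ts :: "nat graph list" and S xs k N
  proof -
    obtain gs es ss where F: "forest Ts gs es xs (length ss # concat ss)" and ss: "set ss = S" "distinct ss"
      using forest_of_encoding[OF enc trees] by blast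
    \<comment> \<open>The word size parameter of the locale is fixed only now, when the number of
      tuples is available.\<close>
    interpret F: forest Ts gs es xs "length ss # concat ss" "forest.word Ts (length ss)" by (rule F)
    define m where "m = length ss"
    have m: "card S = m" unfolding m_def using distinct_card[OF ss(2)] unfolding ss(1) .
    have kpos: "length Ts > 0" using ne by simp
    have k1: "1 \<le> k" unfolding k using kpos by (rule Suc_leI[THEN ord_eq_le_trans[OF One_nat_def]])
    have N': "N = F.off (length Ts)" unfolding N k F.off_def F.n_def ..
    have tup: "F.tuple s" if "s \<in> set ss" for s
      using that sub unfolding ss(1) F.tuples_iff[symmetric] by (rule rev_subsetD)
    define n where "n = N + card S"
    have n: "F.off (length Ts) + m = n" unfolding n_def N' m ..
    have n1: "1 \<le> n" unfolding n_def N' using k1[unfolded k] F.k_le_N by (rule le_trans[THEN trans_le_add1])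
    define X where "X = k ^ 2 * F.scale m ^ (2 * k + 2)"
    have "real X = real k ^ 2 * real (F.scale m) ^ (2 * k + 2)"
      unfolding X_def of_nat_mult of_nat_power ..
    also have "\<dots> \<le> real k ^ 2 * size_growth n ^ (2 * k + 2)"
      using F.scale_le_growth[OF kpos, of m] unfolding n
      by (intro mult_left_mono power_mono) simp_all
    also have "\<dots> \<le> C0 * 2 powr tree_exponent k * real n powr size_exponent n"
      unfolding C0_def by (rule power_growth_le[OF k1 n1])
    finally have X: "real X \<le> C0 * 2 powr tree_exponent k * real n powr size_exponent n" .
    show ?thesis
    proof (rule ds_solves_mono[OF F.solves[OF kpos refl refl tup odot, unfolded ss(1), folded m_def]])
      have "real (F.build_time mm m * bits (F.word m + 2)) \<le> real (7 * build_const mm * (n * X))"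
        using F.cost_bounds(1)[OF kpos, of mm m] unfolding n X_def k of_nat_le_iff .
      also have "\<dots> = real (7 * build_const mm) * (real n * real X)" unfolding of_nat_mult ..
      also have "\<dots> \<le> real (7 * build_const mm) * (real n * (C0 * 2 powr tree_exponent k * real n powr size_exponent n))"
        by (intro mult_left_mono X of_nat_0_le_iff)
      also have "\<dots> = C * 2 powr tree_exponent k * (real n * real n powr size_exponent n)"
        unfolding C_def by (simp only: mult_ac)
      also have "real n * real n powr size_exponent n = real n powr (1 + size_exponent n)"
        using n1 by (simp add: powr_add)
      finally show "real (F.build_time mm m * bits (F.word m + 2))
        \<le> C * 2 powr tree_exponent k * real (N + card S) powr (1 + size_exponent (N + card S))"
        unfolding n_def .
      have "real (F.query_time mm * bits (F.word m + 2)) \<le> real (7 * query_const mm * X)"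
        using F.cost_bounds(2)[OF kpos, of mm m] unfolding X_def k of_nat_le_iff .
      also have "\<dots> = real (7 * query_const mm) * real X" unfolding of_nat_mult ..
      also have "\<dots> \<le> real (7 * query_const mm) * (C0 * 2 powr tree_exponent k * real n powr size_exponent n)"
        by (intro mult_left_mono X of_nat_0_le_iff)
      also have "\<dots> = C' * 2 powr tree_exponent k * real n powr size_exponent n"
        unfolding C'_def by (simp only: mult_ac)
      finally show "real (F.query_time mm * bits (F.word m + 2))
        \<le> C' * 2 powr tree_exponent k * real (N + card S) powr size_exponent (N + card S)"
        unfolding n_def .
    qed
  qed
  show ?thesis
    by (intro exI conjI allI impI, rule tree_exponent_bigo, rule tree_exponent_bigo,
        rule size_exponent_smallo, rule size_exponent_smallo) (rule main)
qed

end
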